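(* Let $\gamma>0$ and let $\Lambda$, $P$ define a stochastic energy exchange model as in the context, such that for every $\mathcal{E}>0$ and $N\ge 2$ the measure $\nu^{\gamma}_{\mathcal{E},N}$ is reversible for its generator $\mathcal{L}$. Assume there exist constants $\tilde C>0$ and $m\ge 0$ such that $$\lambda(\mathcal{E},2)\ \ge\ \tilde C\,\mathcal{E}^m\qquad\text{for all }\mathcal{E}>0.$$ Then there exists a constant $C>0$ depending only on $m$ and $\gamma$ such that $$\lambda(\mathcal{E},N)\ \ge\ C\,\frac{\tilde C\,\mathcal{E}^m}{N^2}\qquad\text{for all }\mathcal{E}>0\text{ and all }N\ge 2.$$
   Context: Fix $\gamma>0$. Let $\nu^{\gamma}(dx)=x^{\gamma-1}e^{-x}\Gamma(\gamma)^{-1}dx$ on $(0,\infty)$. For an integer $N\ge2$ and $\mathcal{E}>0$ let $\mathcal{S}_{\mathcal{E},N}=\{x\in(0,\infty)^N:\frac1N\sum_{i=1}^N x_i=\mathcal{E}\}$ and let $\nu_{\mathcal{E},N}=\nu^{\gamma}_{\mathcal{E},N}$ be the conditional law on $\mathcal{S}_{\mathcal{E},N}$ of the product measure $(\nu^\gamma)^{\otimes N}$ given $\sum_i x_i=N\mathcal{E}$. For $i\ne j$ and $\alpha\in[0,1]$, $T_{i,j,\alpha}x$ is the configuration with $(T_{i,j,\alpha}x)_i=\alpha(x_i+x_j)$, $(T_{i,j,\alpha}x)_j=(1-\alpha)(x_i+x_j)$, and all other coordinates unchanged. A stochastic energy exchange model is given by a continuous rate function $\Lambda:(0,\infty)^2\to[0,\infty)$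 and a continuous map $P$ from $(0,\infty)^2$ to probability measures on $[0,1]$; its generator on $\mathcal{S}_{\mathcal{E},N}$ is $\mathcal{L}f(x)=\sum_{i=1}^{N-1}\Lambda(x_i,x_{i+1})\int P(x_i,x_{i+1},d\alpha)[f(T_{i,i+1,\alpha}x)-f(x)]$. Its Dirichlet form is $\mathcal{D}_{\mathcal{E},N}(f)=\frac12\sum_{i=1}^{N-1}\int\nu_{\mathcal{E},N}(dx)\Lambda(x_i,x_{i+1})\int P(x_i,x_{i+1},d\alpha)[f(T_{i,i+1,\alpha}x)-f(x)]^2$, and its spectral gap is $\lambda(\mathcal{E},N)=\inf\{\mathcal{D}_{\mathcal{E},N}(f)/E_{\nu_{\mathcal{E},N}}[f^2]:\ f\in L^2(\nu_{\mathcal{E},N}),\ E_{\nu_{\mathcal{E},N}}[f]=0,\ f\neq0\}$. *)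

theory Defs
  imports "HOL-Probability.Probability"
begin

definition cfg :: "nat \<Rightarrow> (nat \<Rightarrow> real) measure" where
  "cfg N = PiM {..<N} (\<lambda>_. lborel)"

definition Tx :: "nat \<Rightarrow> nat \<Rightarrow> real \<Rightarrow> (nat \<Rightarrow> real) \<Rightarrow> (nat \<Rightarrow> real)" where
  "Tx i j \<alpha> x = x(i := \<alpha> * (x i + x j), j := (1 - \<alpha>) * (x i + x j))"

text \<open>Conditional law of the product of Gamma(gamma) laws given sum x_i = N*E:
  the first N-1 coordinates have the conditional density
  prod_{i<N-1} g(x_i) * g(N E - sum_{i<N-1} x_i) (normalised), g the Gamma(gamma) density;
  the last coordinate is N E minus the others. Constant factors cancel in the normalisation.\<close>

definition cond_dens :: "real \<Rightarrow> real \<Rightarrow> nat \<Rightarrow> (nat \<Rightarrow> real) \<Rightarrow> real" where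
  "cond_dens \<gamma> E N y =
     (if (\<forall>i<N-1. 0 < y i) \<and> (\<Sum>i<N-1. y i) < real N * E
      then (\<Prod>i<N-1. y i powr (\<gamma> - 1) * exp (- y i))
           * ((real N * E - (\<Sum>i<N-1. y i)) powr (\<gamma> - 1) * exp (- (real N * E - (\<Sum>i<N-1. y i))))
      else 0)"

definition embed_cfg :: "real \<Rightarrow> nat \<Rightarrow> (nat \<Rightarrow> real) \<Rightarrow> (nat \<Rightarrow> real)" where
  "embed_cfg E N y = restrict (\<lambda>i. if i < N - 1 then y i else real N * E - (\<Sum>k<N-1. y k)) {..<N}"

definition nu :: "real \<Rightarrow> real \<Rightarrow> nat \<Rightarrow> (nat \<Rightarrow> real) measure" where
  "nu \<gamma> E N =
     (let M = PiM {..<N-1} (\<lambda>_. lborel);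
          Z = (\<integral>\<^sup>+ y. ennreal (cond_dens \<gamma> E N y) \<partial>M)
      in distr (density M (\<lambda>y. ennreal (cond_dens \<gamma> E N y) / Z)) (cfg N) (embed_cfg E N))"

definition energy_exchange_model ::
  "(real \<Rightarrow> real \<Rightarrow> real) \<Rightarrow> (real \<Rightarrow> real \<Rightarrow> real measure) \<Rightarrow> bool" where
  "energy_exchange_model \<Lambda> P \<longleftrightarrow>
     continuous_on ({0<..} \<times> {0<..}) (\<lambda>(a, b). \<Lambda> a b) \<and>
     (\<forall>a>0. \<forall>b>0. 0 \<le> \<Lambda> a b) \<and>
     (\<forall>a>0. \<forall>b>0. prob_space (P a b) \<and> sets (P a b) = sets borel \<and> measure (P a b) {0..1} = 1) \<and>
     (\<forall>g :: real \<Rightarrow> real. continuous_on UNIV g \<and> bounded (range g) \<longrightarrow>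
        continuous_on ({0<..} \<times> {0<..}) (\<lambda>(a, b). \<integral>\<alpha>. g \<alpha> \<partial>(P a b)))"

text \<open>Reversibility of nu for the generator: the jump kernel
  nu(dx) sum_i Lambda(x_i,x_{i+1}) P(x_i,x_{i+1},d alpha) delta_{T_{i,i+1,alpha} x}(dy) is symmetric.\<close>

definition reversible ::
  "(real \<Rightarrow> real \<Rightarrow> real) \<Rightarrow> (real \<Rightarrow> real \<Rightarrow> real measure) \<Rightarrow> real \<Rightarrow> real \<Rightarrow> nat \<Rightarrow> bool" where
  "reversible \<Lambda> P \<gamma> E N \<longleftrightarrow>
     (\<forall>A \<in> sets (cfg N). \<forall>B \<in> sets (cfg N).
        (\<Sum>i<N-1. \<integral>\<^sup>+ x. ennreal (\<Lambda> (x i) (x (Suc i))) *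
            (\<integral>\<^sup>+ \<alpha>. indicator A x * indicator B (Tx i (Suc i) \<alpha> x) \<partial>(P (x i) (x (Suc i)))) \<partial>(nu \<gamma> E N))
      = (\<Sum>i<N-1. \<integral>\<^sup>+ x. ennreal (\<Lambda> (x i) (x (Suc i))) *
            (\<integral>\<^sup>+ \<alpha>. indicator B x * indicator A (Tx i (Suc i) \<alpha> x) \<partial>(P (x i) (x (Suc i)))) \<partial>(nu \<gamma> E N)))"

definition dirichlet ::
  "(real \<Rightarrow> real \<Rightarrow> real) \<Rightarrow> (real \<Rightarrow> real \<Rightarrow> real measure) \<Rightarrow> real \<Rightarrow> real \<Rightarrow> nat
     \<Rightarrow> ((nat \<Rightarrow> real) \<Rightarrow> real) \<Rightarrow> ennreal" where
  "dirichlet \<Lambda> P \<gamma> E N f =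
     (1/2) * (\<Sum>i<N-1. \<integral>\<^sup>+ x. ennreal (\<Lambda> (x i) (x (Suc i))) *
        (\<integral>\<^sup>+ \<alpha>. ennreal ((f (Tx i (Suc i) \<alpha> x) - f x)\<^sup>2) \<partial>(P (x i) (x (Suc i)))) \<partial>(nu \<gamma> E N))"

definition spectral_gap ::
  "(real \<Rightarrow> real \<Rightarrow> real) \<Rightarrow> (real \<Rightarrow> real \<Rightarrow> real measure) \<Rightarrow> real \<Rightarrow> real \<Rightarrow> nat \<Rightarrow> ennreal" where
  "spectral_gap \<Lambda> P \<gamma> E N =
     (INF f \<in> {f. f \<in> borel_measurable (cfg N) \<and> integrable (nu \<gamma> E N) (\<lambda>x. (f x)\<^sup>2)
                 \<and> (\<integral>x. f x \<partial>(nu \<gamma> E N)) = 0 \<and> (\<integral>x. (f x)\<^sup>2 \<partial>(nu \<gamma> E N)) > 0}.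
        dirichlet \<Lambda> P \<gamma> E N f / ennreal (\<integral>x. (f x)\<^sup>2 \<partial>(nu \<gamma> E N)))"

end

theory Submission imports Defs begin

text \<open>The gap for two sites, applied to each bond conditionally on its energy, bounds the Dirichlet form
  below by the sum over nearest neighbours \<open>i, j\<close> of the energies in which the pair is resampled by the
  Beta law \<open>(\<gamma>, \<gamma>)\<close> at rate \<open>(x\<^sub>i + x\<^sub>j)\<^sup>m\<close>. A long-range exchange is realised by carrying the
  larger energy to its partner along adjacent swaps, resampling, and carrying it back; the carried energy
  keeps all rates on the way comparable. This costs a factor \<open>N\<^sup>3\<close> against the sum over all pairs, and
  it remains to show that the mean-field form has a gap of order \<open>N\<close>.

  Without weights, the average of all resampling operators contracts Lipschitz constants, which for a
  self-adjoint operator yields a spectral gap. A third site \<open>k\<close> acts as a catalyst: an exchange of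
  \<open>i, j\<close> at rate \<open>x\<^sub>k\<^sup>m\<close> is a composition of exchanges within the triple at the true rates. For
  \<open>m = 0\<close> or \<open>m \<ge> 1\<close>, and for bounded \<open>N\<close>, the sum of \<open>x\<^sub>k\<^sup>m\<close> is at least of order \<open>N\<close>, which
  suffices. For \<open>0 < m < 1\<close> this fails when the energy concentrates on few sites; there the Lyapunov function
  \<open>3 - (1/N) \<Sum> (x\<^sub>k/E)\<^bsup>1-m\<^esup>\<close> controls \<open>f\<^sup>2\<close> up to \<open>(1/N) \<Sum> min 1 (x\<^sub>k/E) f\<^sup>2\<close>, and the latter is
  bounded by averages that leave out the site \<open>k\<close> and use it as the catalyst.\<close>

section \<open>Symmetric Beta laws\<close>

text \<open>The obstacle is that the rate of a pair vanishes with its energy and has no uniform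
  lower bound; so each comparison keeps a site of known energy inside the pair that moves. The
  exponent 1 - m in the Lyapunov function is forced by scaling: a pair of energy s is resampled at
  rate s^m and changes the sum of the x_k^(1-m) by a multiple of s^(1-m). The drift of a bond is
  thus homogeneous of degree one and comparable with the conserved total energy. It has the right
  sign for very unequal pairs, where resampling spreads the energy; for comparable energies it may
  have the wrong one, and the capped weights measure that error. The passage from Lipschitz
  contraction to L2 tolerates any prefactor: the norms of the iterates of a self-adjoint operator
  are log-convex, so their decay rate already bounds the first step. Constants that depend on N and
  E, such as the diameter of the simplex, therefore never enter the gap.\<close>

definition sym_beta :: "real \<Rightarrow> real measure" where
  "sym_beta g = density lborel
     (\<lambda>a. ennreal (indicator {0<..<1} a * (a powr (g - 1) * (1 - a) powr (g - 1)) / Beta g g))"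

lemma sets_sym_beta [simp, measurable_cong]: "sets (sym_beta g) = sets borel"
  and space_sym_beta [simp]: "space (sym_beta g) = UNIV"
  by (auto simp: sym_beta_def)

lemma Beta_pos: "(g::real) > 0 \<Longrightarrow> Beta g g > 0"
  by (simp add: Beta_def Gamma_real_pos)

lemma nn_integral_sym_beta:
  assumes [measurable]: "F \<in> borel_measurable borel"
  shows "(\<integral>\<^sup>+a. F a \<partial>sym_beta g) =
    (\<integral>\<^sup>+a. ennreal (indicator {0<..<1} a * (a powr (g - 1) * (1 - a) powr (g - 1)) / Beta g g) * F a \<partial>lborel)"
  unfolding sym_beta_def by (subst nn_integral_density) auto

lemma prob_space_sym_beta:
  assumes g: "g > 0"
  shows "prob_space (sym_beta g)"
proof
  let ?w = "\<lambda>a::real. a powr (g - 1) * (1 - a) powr (g - 1)"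
  have "(?w has_integral Beta g g) {0<..<1}"
    using has_integral_Beta_real[OF g g] by (simp add: has_integral_Icc_iff_Ioo)
  then have "((\<lambda>a. indicator {0<..<1} a * ?w a) has_integral Beta g g) UNIV"
    by (subst (asm) has_integral_restrict_UNIV[symmetric])
       (erule has_integral_eq[rotated], auto simp: indicator_def)
  then have "((\<lambda>a. indicator {0<..<1} a * ?w a / Beta g g) has_integral 1) UNIV"
    using has_integral_divide[of _ "Beta g g" UNIV "Beta g g"] Beta_pos[OF g] by fastforce
  then have "(\<integral>\<^sup>+a. ennreal (indicator {0<..<1} a * ?w a / Beta g g) \<partial>lborel) = ennreal 1"
    using Beta_pos[OF g]
    by (intro nn_integral_has_integral_lborel) (auto simp: divide_nonneg_pos)
  then show "emeasure (sym_beta g) (space (sym_beta g)) = 1"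
    unfolding sym_beta_def by (simp add: emeasure_density)
qed

lemma AE_sym_beta: "AE a in sym_beta g. 0 < a \<and> a < 1"
  unfolding sym_beta_def by (subst AE_density) (auto simp: indicator_def)

lemma nn_integral_sym_beta_flip:
  assumes [measurable]: "F \<in> borel_measurable borel"
  shows "(\<integral>\<^sup>+a. F (1 - a) \<partial>sym_beta g) = (\<integral>\<^sup>+a. F a \<partial>sym_beta g)"
proof -
  let ?w = "\<lambda>a::real. ennreal (indicator {0<..<1} a * (a powr (g - 1) * (1 - a) powr (g - 1)) / Beta g g)"
  have "(\<integral>\<^sup>+a. F a \<partial>sym_beta g) = (\<integral>\<^sup>+a. ?w a * F a \<partial>lborel)"
    by (simp add: nn_integral_sym_beta)
  also have "\<dots> = (\<integral>\<^sup>+a. ?w (1 - a) * F (1 - a) \<partial>lborel)"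
    by (subst nn_integral_real_affine[where c="-1" and t=1]) auto
  also have "\<dots> = (\<integral>\<^sup>+a. ?w a * F (1 - a) \<partial>lborel)"
    by (intro nn_integral_cong) (auto simp: indicator_def mult_ac)
  finally show ?thesis by (simp add: nn_integral_sym_beta)
qed

text \<open>Substitute y = c a: the two powers are homogeneous of total degree 2 g - 2, and dy
  contributes one more factor c. The law of the fraction a is the same for every c, which is why one
  fixed Beta law can resample pairs of any energy.\<close>

lemma nn_integral_slice:
  assumes g: "g > 0" and c: "c > 0" and [measurable]: "F \<in> borel_measurable borel"
  shows "(\<integral>\<^sup>+y. ennreal (indicator {0<..<c} y * (y powr (g - 1) * (c - y) powr (g - 1))) * F y \<partial>lborel)
       = ennreal (c powr (2 * g - 1) * Beta g g) * (\<integral>\<^sup>+a. F (a * c) \<partial>sym_beta g)"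
proof -
  let ?w = "\<lambda>a::real. ennreal (indicator {0<..<1} a * (a powr (g - 1) * (1 - a) powr (g - 1)) / Beta g g)"
  have eq: "ennreal \<bar>c\<bar> * (ennreal (indicator {0<..<c} (0 + c * a) * ((0 + c * a) powr (g - 1) * (c - (0 + c * a)) powr (g - 1))) * F (0 + c * a))
     = ennreal (c powr (2 * g - 1) * Beta g g) * (?w a * F (a * c))" for a
  proof (cases "0 < a \<and> a < 1")
    case True
    have "c * ((c * a) powr (g - 1) * (c - c * a) powr (g - 1)) =
      c powr (2 * g - 1) * (a powr (g - 1) * (1 - a) powr (g - 1))"
    proof -
      have "c - c * a = c * (1 - a)" by (simp add: algebra_simps)
      moreover have "c powr (2 * g - 1) = c * (c powr (g - 1) * c powr (g - 1))"
      proof -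
        have "c * (c powr (g - 1) * c powr (g - 1)) = c powr 1 * (c powr (g - 1) * c powr (g - 1))"
          using c by simp
        also have "\<dots> = c powr (1 + ((g - 1) + (g - 1)))" by (simp only: powr_add)
        finally show ?thesis by (simp add: algebra_simps)
      qed
      ultimately show ?thesis using True c by (simp add: powr_mult mult_ac)
    qed
    moreover have "0 < c * a" "c * a < c" using True c by auto
    ultimately show ?thesis using True c Beta_pos[OF g]
      by (simp add: mult.assoc[symmetric] ennreal_mult[symmetric] mult.commute[of a c]) 
  next
    case False
    then have "\<not> (0 < c * a \<and> c * a < c)" using c by (auto simp: zero_less_mult_iff)
    then have "indicator {0<..<c} (0 + c * a) = (0::real)" by (auto simp: indicator_def)
    moreover have "indicator {0<..<1} a = (0::real)" using False by (auto simp: indicator_def)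
    ultimately show ?thesis by (simp only:) simp
  qed
  have "(\<integral>\<^sup>+y. ennreal (indicator {0<..<c} y * (y powr (g - 1) * (c - y) powr (g - 1))) * F y \<partial>lborel)
      = (\<integral>\<^sup>+a. ennreal (c powr (2 * g - 1) * Beta g g) * (?w a * F (a * c)) \<partial>lborel)"
    using c by (subst nn_integral_real_affine[where c=c and t=0])
      (simp_all only: eq[symmetric] nn_integral_cmult[symmetric], auto simp: nn_integral_cmult)
  also have "\<dots> = ennreal (c powr (2 * g - 1) * Beta g g) * (\<integral>\<^sup>+a. F (a * c) \<partial>sym_beta g)"
    by (simp add: nn_integral_cmult nn_integral_sym_beta)
  finally show ?thesis .
qed

section \<open>Exchange moves and invariance under resampling\<close>

lemma sets_cfg [measurable_cong]: "sets (cfg N) = sets (PiM {..<N} (\<lambda>_. borel))"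
  unfolding cfg_def by (intro sets_PiM_cong) auto

lemma space_cfg: "space (cfg N) = extensional {..<N}"
  by (auto simp: cfg_def space_PiM PiE_def)

lemma measurable_cfg_component [measurable (raw)]:
  assumes "i < N"
  shows "(\<lambda>x. x i) \<in> borel_measurable (cfg N)"
  unfolding measurable_cong_sets[OF sets_cfg refl]
  using assms by (intro measurable_component_singleton) simp

lemma measurable_cfg_component' [measurable_dest]:
  assumes "h \<in> M \<rightarrow>\<^sub>M cfg N" "g \<in> L \<rightarrow>\<^sub>M M" "i < N"
  shows "(\<lambda>x. h (g x) i) \<in> borel_measurable L"
  using measurable_compose[OF measurable_compose[OF assms(2,1)] measurable_cfg_component[OF assms(3)]] .

lemma measurable_cfg_upd [measurable (raw)]:
  assumes [measurable]: "h \<in> M \<rightarrow>\<^sub>M cfg N" "g \<in> borel_measurable M" and i: "i < N"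
  shows "(\<lambda>x. (h x)(i := g x)) \<in> M \<rightarrow>\<^sub>M cfg N"
proof -
  have "(\<lambda>x. (h x)(i := g x)) \<in> M \<rightarrow>\<^sub>M PiM {..<N} (\<lambda>_. borel)"
  proof (rule measurable_PiM_single')
    show "(\<lambda>x. ((h x)(i := g x)) k) \<in> borel_measurable M" if "k \<in> {..<N}" for k
      using that by (cases "k = i") auto
    have "h x \<in> space (cfg N)" if "x \<in> space M" for x
      using measurable_space[OF assms(1) that] .
    then show "(\<lambda>x. (h x)(i := g x)) \<in> space M \<rightarrow> ({..<N} \<rightarrow>\<^sub>E space borel)"
      using i by (force simp: space_cfg PiE_def extensional_def)
  qed
  then show ?thesis by (simp add: measurable_cong_sets[OF refl sets_cfg])
qed

lemma measurable_Tx [measurable (raw)]: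
  assumes "h \<in> M \<rightarrow>\<^sub>M cfg N" "g \<in> borel_measurable M" and "i < N" "j < N"
  shows "(\<lambda>x. Tx i j (g x) (h x)) \<in> M \<rightarrow>\<^sub>M cfg N"
  using assms unfolding Tx_def by measurable

definition swap_cfg :: "nat \<Rightarrow> nat \<Rightarrow> (nat \<Rightarrow> real) \<Rightarrow> nat \<Rightarrow> real" where
  "swap_cfg i j x = x(i := x j, j := x i)"

lemma measurable_swap_cfg [measurable (raw)]:
  assumes "h \<in> M \<rightarrow>\<^sub>M cfg N" and "i < N" "j < N"
  shows "(\<lambda>x. swap_cfg i j (h x)) \<in> M \<rightarrow>\<^sub>M cfg N"
  using assms unfolding swap_cfg_def by measurable

lemma measurable_embed:
  assumes "N \<ge> 2"
  shows "embed_cfg E N \<in> PiM {..<N-1} (\<lambda>_. lborel) \<rightarrow>\<^sub>M cfg N"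
proof -
  have [measurable]: "(\<lambda>y. y k) \<in> borel_measurable (PiM {..<N-1} (\<lambda>_. lborel))" if "k < N - 1" for k
    using measurable_component_singleton[of k "{..<N-1}" "\<lambda>_. lborel::real measure"] that by simp
  note * = this
  have "(\<lambda>y. \<Sum>i<N-1. y i) \<in> borel_measurable (PiM {..<N-1} (\<lambda>_. lborel))"
    by (rule borel_measurable_sum) (simp del: One_nat_def add: *)
  then have "(\<lambda>y. real N * E - (\<Sum>i<N-1. y i)) \<in> borel_measurable (PiM {..<N-1} (\<lambda>_. lborel))"
    by (rule borel_measurable_diff[rotated]) simp
  then have "embed_cfg E N \<in> PiM {..<N-1} (\<lambda>_. lborel) \<rightarrow>\<^sub>M PiM {..<N} (\<lambda>_. borel)"
    unfolding embed_cfg_def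
    using * by (intro measurable_restrict) (case_tac "i < N - 1"; simp del: One_nat_def)
  then show ?thesis by (simp add: measurable_cong_sets[OF refl sets_cfg])
qed

lemma measurable_cond_dens:
  "cond_dens g E N \<in> borel_measurable (PiM {..<N-1} (\<lambda>_. lborel))"
proof -
  have [measurable]: "(\<lambda>y. y k) \<in> borel_measurable (PiM {..<N-1} (\<lambda>_. lborel))" if "k < N - 1" for k
    using measurable_component_singleton[of k "{..<N-1}" "\<lambda>_. lborel::real measure"] that by simp
  have "(\<lambda>y. \<Sum>i<N-1. y i) \<in> borel_measurable (PiM {..<N-1} (\<lambda>_. lborel))"
    by measurable
  moreover have "(\<lambda>y. \<Prod>i<N-1. y i powr (g - 1) * exp (- y i)) \<in> borel_measurable (PiM {..<N-1} (\<lambda>_. lborel))"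
    by measurable
  moreover have "Measurable.pred (PiM {..<N-1} (\<lambda>_. lborel)) (\<lambda>y::nat\<Rightarrow>real. \<forall>i<N-1. 0 < y i)"
  proof -
    have "Measurable.pred (PiM {..<N-1} (\<lambda>_. lborel)) (\<lambda>y::nat\<Rightarrow>real. \<forall>i\<in>{..<N-1}. 0 < y i)"
      by measurable
    then show ?thesis by (simp add: Ball_def)
  qed
  ultimately show ?thesis unfolding cond_dens_def[abs_def] by measurable
qed

section \<open>Algebra of the exchange moves\<close>

text \<open>An exchange sees its two sites only through their sum. That it forgets earlier exchanges
  and swaps of the same pair, as in \<open>Tx_Tx\<close> and \<open>Tx_swap_cfg\<close>, comes from
  this.\<close>

lemma Tx_same_sum: "x i + x j = y i + y j \<Longrightarrow> (\<And>k. k \<noteq> i \<Longrightarrow> k \<noteq> j \<Longrightarrow> x k = y k) \<Longrightarrow> Tx i j a x = Tx i j a y"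
  by (auto simp: Tx_def)

lemma Tx_pair_sum: "i \<noteq> j \<Longrightarrow> Tx i j a x i + Tx i j a x j = x i + x j"
  by (simp add: Tx_def algebra_simps)

lemma Tx_Tx [simp]: "i \<noteq> j \<Longrightarrow> Tx i j a (Tx i j b x) = Tx i j a x"
  by (rule Tx_same_sum) (auto simp: Tx_pair_sum, auto simp: Tx_def)

lemma Tx_swap_cfg [simp]: "i \<noteq> j \<Longrightarrow> Tx i j a (swap_cfg i j x) = Tx i j a x"
  by (rule Tx_same_sum) (auto simp: swap_cfg_def)

lemma swap_cfg_Tx: "i \<noteq> j \<Longrightarrow> swap_cfg i j (Tx i j a x) = Tx i j (1 - a) x"
  by (auto simp: Tx_def swap_cfg_def fun_eq_iff algebra_simps)

lemma Tx_commute: "i \<noteq> j \<Longrightarrow> Tx j i a x = Tx i j (1 - a) x"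
  by (auto simp: Tx_def fun_eq_iff algebra_simps)

text \<open>Relabels the partner \<open>j\<close> as \<open>l\<close>. This reduces an arbitrary
  pair to one that contains the last site, to which the coordinates in the definition of
  \<open>nu\<close> are adapted.\<close>

lemma Tx_conj: "i \<noteq> j \<Longrightarrow> i \<noteq> l \<Longrightarrow> j \<noteq> l \<Longrightarrow> Tx i j a x = swap_cfg j l (Tx i l a (swap_cfg j l x))"
  by (auto simp: Tx_def swap_cfg_def fun_eq_iff)

lemma Tx_space: "i < N \<Longrightarrow> j < N \<Longrightarrow> x \<in> space (cfg N) \<Longrightarrow> Tx i j a x \<in> space (cfg N)"
  by (auto simp: Tx_def space_cfg extensional_def)

lemma Tx_sum:
  assumes "i \<in> A" "j \<in> A" "i \<noteq> j" "finite A"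
  shows "(\<Sum>k\<in>A. Tx i j a x k) = (\<Sum>k\<in>A. x k)"
proof -
  have A: "A = insert i (insert j (A - {i, j}))" using assms by auto
  show ?thesis
    by (subst (1 2) A) (use assms in \<open>auto simp: Tx_def algebra_simps intro!: sum.cong\<close>)
qed

section \<open>Invariance of the conditional law under resampling and swaps\<close>

locale energy_simplex =
  fixes \<gamma> E :: real and N :: nat
  assumes gam: "\<gamma> > 0" and Epos: "E > 0" and N2: "N \<ge> 2"
begin

abbreviation "\<nu> \<equiv> nu \<gamma> E N"
abbreviation "\<beta> \<equiv> sym_beta \<gamma>"

sublocale beta: prob_space \<beta> by (rule prob_space_sym_beta[OF gam])

lemma sets_nu [simp, measurable_cong]: "sets \<nu> = sets (cfg N)"
  and space_nu [simp]: "space \<nu> = space (cfg N)"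
  by (auto simp: nu_def Let_def)

abbreviation "base \<equiv> PiM {..<N-1} (\<lambda>_. lborel :: real measure)"

definition "Z = (\<integral>\<^sup>+ y. ennreal (cond_dens \<gamma> E N y) \<partial>base)"

lemma dens_measurable: "(\<lambda>y. ennreal (cond_dens \<gamma> E N y) / Z) \<in> borel_measurable base"
  by (intro borel_measurable_divide_ennreal measurable_compose[OF measurable_cond_dens measurable_ennreal] borel_measurable_const)

lemma nn_integral_nu:
  assumes [measurable]: "F \<in> borel_measurable (cfg N)"
  shows "(\<integral>\<^sup>+x. F x \<partial>\<nu>) = (\<integral>\<^sup>+y. ennreal (cond_dens \<gamma> E N y) / Z * F (embed_cfg E N y) \<partial>base)"
proof -
  have measurable_sets_eq_dens: "embed_cfg E N \<in> density base (\<lambda>y. ennreal (cond_dens \<gamma> E N y) / Z) \<rightarrow>\<^sub>M cfg N"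
    using measurable_embed[OF N2] by simp
  have FE: "(\<lambda>y. F (embed_cfg E N y)) \<in> borel_measurable base"
    using measurable_compose[OF measurable_embed[OF N2] assms] .
  show ?thesis unfolding nu_def Let_def Z_def[symmetric]
    by (subst nn_integral_distr[OF measurable_sets_eq_dens], simp, subst nn_integral_density[OF dens_measurable FE]) (rule refl)
qed

text \<open>In \<open>ennreal\<close>, \<open>Z / Z\<close> is 1, or 0 when \<open>Z\<close> is 0 or
  infinite. Hence no normalising constant has to be computed for general \<open>N\<close>: a mass of
  at most one suffices, and the massless case is split off where a division by the mass
  occurs.\<close>

lemma emeasure_nu_le: "emeasure \<nu> (space \<nu>) \<le> 1"
proof -
  note [measurable] = measurable_cond_dens
  have meas: "(\<lambda>y. ennreal (cond_dens \<gamma> E N y)) \<in> borel_measurable base"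
    by (rule measurable_compose[OF measurable_cond_dens measurable_ennreal])
  have "emeasure \<nu> (space \<nu>) = (\<integral>\<^sup>+x. 1 \<partial>\<nu>)" by simp
  also have "\<dots> = (\<integral>\<^sup>+y. ennreal (cond_dens \<gamma> E N y) / Z \<partial>base)"
    by (subst nn_integral_nu) auto
  also have "\<dots> = Z / Z" unfolding Z_def by (rule nn_integral_divide[OF meas])
  also have "\<dots> \<le> 1"
  proof (cases "Z = 0 \<or> Z = top")
    case True then show ?thesis by (auto simp: divide_ennreal_def)
  next
    case False then show ?thesis by (simp add: less_top[symmetric])
  qed
  finally show ?thesis .
qed

sublocale fin: finite_measure \<nu>
  using emeasure_nu_le by (intro finite_measureI) (auto simp: top_unique)

lemma AE_nu: "AE x in \<nu>. (\<forall>i<N. 0 < x i) \<and> (\<Sum>i<N. x i) = real N * E"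
proof -
  note [measurable] = measurable_cond_dens measurable_embed[OF N2]
  have N: "{..<N} = insert (N-1) {..<N-1}" using N2 by auto
  have *: "(\<forall>i<N. 0 < embed_cfg E N y i) \<and> (\<Sum>i<N. embed_cfg E N y i) = real N * E"
    if "cond_dens \<gamma> E N y \<noteq> 0" for y
  proof -
    have y: "(\<forall>i<N-1. 0 < y i) \<and> (\<Sum>i<N-1. y i) < real N * E"
      using that by (auto simp: cond_dens_def split: if_splits)
    have "(\<Sum>i<N. embed_cfg E N y i) = embed_cfg E N y (N-1) + (\<Sum>i<N-1. embed_cfg E N y i)"
      by (subst N) (simp)
    also have "(\<Sum>i<N-1. embed_cfg E N y i) = (\<Sum>i<N-1. y i)"
      by (intro sum.cong) (auto simp: embed_cfg_def)
    also have "embed_cfg E N y (N-1) = real N * E - (\<Sum>i<N-1. y i)"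
      using N2 by (simp add: embed_cfg_def)
    finally show ?thesis using y by (auto simp: embed_cfg_def)
  qed
  have pred: "Measurable.pred (cfg N) (\<lambda>x. (\<forall>i\<in>{..<N}. 0 < x i) \<and> (\<Sum>i<N. x i) = real N * E)"
    by measurable
  have "AE y in base. 0 < ennreal (cond_dens \<gamma> E N y) / Z \<longrightarrow> 
       (\<forall>i<N. 0 < embed_cfg E N y i) \<and> (\<Sum>i<N. embed_cfg E N y i) = real N * E"
    using * by (intro AE_I2) (metis ennreal_0 ennreal_zero_divide less_irrefl)
  then have "AE y in density base (\<lambda>y. ennreal (cond_dens \<gamma> E N y) / Z).
       (\<forall>i\<in>{..<N}. 0 < embed_cfg E N y i) \<and> (\<Sum>i<N. embed_cfg E N y i) = real N * E"
    by (subst AE_density[OF dens_measurable]) (simp add: Ball_def)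
  then have "AE x in \<nu>. (\<forall>i\<in>{..<N}. 0 < x i) \<and> (\<Sum>i<N. x i) = real N * E"
    unfolding nu_def Let_def Z_def[symmetric] using pred measurable_embed[OF N2]
    by (subst AE_distr_iff) (auto simp: pred_def)
  then show ?thesis by (simp add: Ball_def)
qed

text \<open>In the coordinates that define \<open>nu\<close> the last energy is determined by the
  others, so an exchange between \<open>i\<close> and the last site moves only the coordinate
  \<open>i\<close>. Integrating that coordinate first gives, on each fibre, a multiple of the Beta
  law of the fraction.\<close>

lemma resample_last:
  assumes [measurable]: "F \<in> borel_measurable (cfg N)" and i: "i < N - 1"
  shows "(\<integral>\<^sup>+x. (\<integral>\<^sup>+a. F (Tx i (N-1) a x) \<partial>\<beta>) \<partial>\<nu>) = (\<integral>\<^sup>+x. F x \<partial>\<nu>)"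
proof -
  note [measurable] = measurable_cond_dens measurable_embed[OF N2]
  interpret product_sigma_finite "\<lambda>_::nat. lborel :: real measure" by standard
  define J where "J = {..<N-1} - {i}"
  have J: "finite J" "i \<notin> J" "insert i J = {..<N-1}" using i by (auto simp: J_def)
  define F' where "F' x = (\<integral>\<^sup>+a. F (Tx i (N-1) a x) \<partial>\<beta>)" for x
  have [measurable]: "F' \<in> borel_measurable (cfg N)"
  proof -
    have "i < N" "N - 1 < N" using i by auto
    then show ?thesis unfolding F'_def by measurable
  qed
  have slice: "(\<integral>\<^sup>+y. ennreal (cond_dens \<gamma> E N (x(i := y))) / Z * F' (embed_cfg E N (x(i := y))) \<partial>lborel)
      = (\<integral>\<^sup>+y. ennreal (cond_dens \<gamma> E N (x(i := y))) / Z * F (embed_cfg E N (x(i := y))) \<partial>lborel)"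
    if x: "x \<in> space (PiM J (\<lambda>_. lborel :: real measure))" for x
  proof -
    \<comment> \<open>\<open>c\<close> is the energy left for the sites \<open>i\<close> and
      \<open>N-1\<close> together. \<open>K\<close> collects the part of the density that does not
      see the fraction; all exponentials multiply to a constant.\<close>
    define c where "c = real N * E - (\<Sum>k\<in>J. x k)"
    define K where "K = (if \<forall>k\<in>J. 0 < x k then (\<Prod>k\<in>J. x k powr (\<gamma> - 1)) * exp (- (real N * E)) else 0)"
    define X where "X y = embed_cfg E N (x(i := y))" for y
    have s: "(\<Sum>k<N-1. (x(i := y)) k) = y + (\<Sum>k\<in>J. x k)" for y
    proof -
      have "(\<Sum>k\<in>J. (x(i := y)) k) = (\<Sum>k\<in>J. x k)" using J by (intro sum.cong) auto
      then show ?thesis by (simp only: J(3)[symmetric] sum.insert[OF J(1,2)] fun_upd_same)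
    qed
    have dens: "cond_dens \<gamma> E N (x(i := y)) = K * (indicator {0<..<c} y * (y powr (\<gamma> - 1) * (c - y) powr (\<gamma> - 1)))" for y
    proof -
      have 1: "(\<forall>k<N-1. 0 < (x(i := y)) k) \<longleftrightarrow> 0 < y \<and> (\<forall>k\<in>J. 0 < x k)"
        using J(3) i by (auto simp: J_def)
      have 2: "(\<Prod>k<N-1. (x(i := y)) k powr (\<gamma> - 1) * exp (- (x(i := y)) k)) =
         y powr (\<gamma> - 1) * (\<Prod>k\<in>J. x k powr (\<gamma> - 1)) * exp (- (y + (\<Sum>k\<in>J. x k)))"
      proof -
        have "(\<Prod>k<N-1. (x(i := y)) k powr (\<gamma> - 1)) = y powr (\<gamma> - 1) * (\<Prod>k\<in>J. x k powr (\<gamma> - 1))"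
        proof -
          have "(\<Prod>k\<in>J. (x(i := y)) k powr (\<gamma> - 1)) = (\<Prod>k\<in>J. x k powr (\<gamma> - 1))"
            using J by (intro prod.cong) auto
          then show ?thesis by (simp only: J(3)[symmetric] prod.insert[OF J(1,2)] fun_upd_same)
        qed
        moreover have "(\<Prod>k<N-1. exp (- (x(i := y)) k)) = exp (- (y + (\<Sum>k\<in>J. x k)))"
          by (simp only: exp_sum[symmetric, OF finite_lessThan] sum_negf s)
        ultimately show ?thesis by (simp only: prod.distrib)
      qed
      have 3: "exp (- (y + (\<Sum>k\<in>J. x k))) * exp (- (real N * E - (y + (\<Sum>k\<in>J. x k)))) = exp (- (real N * E))"
        by (simp add: exp_add[symmetric])
      have 4: "real N * E - (y + (\<Sum>k\<in>J. x k)) = c - y" by (simp add: c_def)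
      have 5: "y + (\<Sum>k\<in>J. x k) < real N * E \<longleftrightarrow> y < c" by (auto simp: c_def)
      show ?thesis
      proof (cases "(0 < y \<and> y < c) \<and> (\<forall>k\<in>J. 0 < x k)")
        case True
        have "cond_dens \<gamma> E N (x(i := y)) = y powr (\<gamma> - 1) * (\<Prod>k\<in>J. x k powr (\<gamma> - 1)) * exp (- (y + (\<Sum>k\<in>J. x k)))
           * ((c - y) powr (\<gamma> - 1) * exp (- (real N * E - (y + (\<Sum>k\<in>J. x k)))))"
          unfolding cond_dens_def 1 2 s 5 4 using True by simp
        also have "\<dots> = y powr (\<gamma> - 1) * (\<Prod>k\<in>J. x k powr (\<gamma> - 1)) * (c - y) powr (\<gamma> - 1) *
            (exp (- (y + (\<Sum>k\<in>J. x k))) * exp (- (real N * E - (y + (\<Sum>k\<in>J. x k)))))"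
          by (simp only: mult_ac)
        finally show ?thesis using True unfolding 3 K_def by simp
      next
        case False
        then show ?thesis unfolding cond_dens_def 1 s 5 K_def by (auto simp: indicator_def)
      qed
    qed
    have Kpos: "K \<ge> 0" by (auto simp: K_def intro!: mult_nonneg_nonneg prod_nonneg)
    have X: "X y = (X 0)(i := y, N-1 := c - y)" for y
    proof (rule ext)
      fix k
      show "X y k = ((X 0)(i := y, N-1 := c - y)) k"
        using i less_le_trans[OF i diff_le_self] unfolding X_def embed_cfg_def s c_def
        by (cases "k = i"; cases "k < N - 1"; cases "k = N - 1"; simp add: restrict_def)
    qed
    have Xs: "X y \<in> space (cfg N)" for y by (auto simp: X_def space_cfg embed_cfg_def)
    have T: "Tx i (N-1) a (X y) = X (a * c)" for a y
    proof -
      have "Tx i (N-1) a ((X 0)(i := y, N-1 := c - y)) = (X 0)(i := a * c, N-1 := c - a * c)"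
        using i by (auto simp: Tx_def fun_eq_iff algebra_simps)
      then show ?thesis by (simp only: X[of y, symmetric] X[of "a * c", symmetric])
    qed
    have [measurable]: "X \<in> borel \<rightarrow>\<^sub>M cfg N"
    proof -
      have "i < N" "N - 1 < N" using i by auto
      moreover have "(\<lambda>y::real. X 0) \<in> borel \<rightarrow>\<^sub>M cfg N" using Xs by simp
      ultimately have "(\<lambda>y. (X 0)(i := y, N-1 := c - y)) \<in> borel \<rightarrow>\<^sub>M cfg N"
        by measurable
      then show ?thesis by (simp only: X[symmetric])
    qed
    show ?thesis
    proof (cases "c > 0")
      case True
      let ?w = "\<lambda>y. ennreal (indicator {0<..<c} y * (y powr (\<gamma> - 1) * (c - y) powr (\<gamma> - 1)))"
      \<comment> \<open>Applied both to \<open>F\<close> and to \<open>F'\<close>: the latter is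
        constant along the fibre, with value the Beta average of the former, so the two integrals
        agree.\<close>
      have gen: "(\<integral>\<^sup>+y. ennreal (cond_dens \<gamma> E N (x(i := y))) / Z * G (embed_cfg E N (x(i := y))) \<partial>lborel)
         = ennreal K / Z * (ennreal (c powr (2 * \<gamma> - 1) * Beta \<gamma> \<gamma>) * (\<integral>\<^sup>+a. G (X (a * c)) \<partial>\<beta>))"
        if [measurable]: "G \<in> borel_measurable (cfg N)" for G
      proof -
        have "(\<integral>\<^sup>+y. ennreal (cond_dens \<gamma> E N (x(i := y))) / Z * G (embed_cfg E N (x(i := y))) \<partial>lborel)
           = (\<integral>\<^sup>+y. ennreal K / Z * (?w y * G (X y)) \<partial>lborel)"
          unfolding dens X_def[symmetric]
          by (intro nn_integral_cong) (use Kpos in \<open>simp add: ennreal_mult divide_ennreal_def mult_ac\<close>)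
        also have "\<dots> = ennreal K / Z * (\<integral>\<^sup>+y. ?w y * G (X y) \<partial>lborel)"
          by (rule nn_integral_cmult) measurable
        finally show ?thesis by (subst (asm) nn_integral_slice[OF gam True]) auto
      qed
      show ?thesis
        by (subst (1 2) gen) (simp_all add: F'_def T[simplified] beta.emeasure_space_1[simplified])
    next
      case False
      then have "cond_dens \<gamma> E N (x(i := y)) = 0" for y unfolding dens by (auto simp: indicator_def)
      then show ?thesis by simp
    qed
  qed
  have red: "(\<integral>\<^sup>+x. G x \<partial>\<nu>) = (\<integral>\<^sup>+x. (\<integral>\<^sup>+y. ennreal (cond_dens \<gamma> E N (x(i := y))) / Z * G (embed_cfg E N (x(i := y))) \<partial>lborel) \<partial>(PiM J (\<lambda>_. lborel)))"
    if [measurable]: "G \<in> borel_measurable (cfg N)" for G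
  proof -
    have "(\<lambda>y. ennreal (cond_dens \<gamma> E N y) / Z * G (embed_cfg E N y)) \<in> borel_measurable base"
      by (intro borel_measurable_times_ennreal dens_measurable measurable_compose[OF measurable_embed[OF N2]] that)
    with J show ?thesis
      by (subst nn_integral_nu, simp, subst J(3)[symmetric], subst product_nn_integral_insert) auto
  qed
  show ?thesis unfolding F'_def[symmetric]
    by (subst (1 2) red) (auto intro!: nn_integral_cong slice)
qed

text \<open>After a resampling, a swap merely turns the fraction a into 1 - a, and the Beta law is
  symmetric. It is stated for a pair with known invariance because the swap with the last site is
  needed to reach the remaining pairs.\<close>

lemma swap_of_resample:
  assumes inv: "\<And>F. F \<in> borel_measurable (cfg N) \<Longrightarrow> (\<integral>\<^sup>+x. (\<integral>\<^sup>+a. F (Tx i j a x) \<partial>\<beta>) \<partial>\<nu>) = (\<integral>\<^sup>+x. F x \<partial>\<nu>)"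
    and ij: "i < N" "j < N" "i \<noteq> j" and [measurable]: "F \<in> borel_measurable (cfg N)"
  shows "(\<integral>\<^sup>+x. F (swap_cfg i j x) \<partial>\<nu>) = (\<integral>\<^sup>+x. F x \<partial>\<nu>)"
proof -
  have "(\<integral>\<^sup>+x. F (swap_cfg i j x) \<partial>\<nu>) = (\<integral>\<^sup>+x. (\<integral>\<^sup>+a. F (swap_cfg i j (Tx i j a x)) \<partial>\<beta>) \<partial>\<nu>)"
    using ij by (subst inv) auto
  also have "\<dots> = (\<integral>\<^sup>+x. (\<integral>\<^sup>+a. F (Tx i j a x) \<partial>\<beta>) \<partial>\<nu>)"
  proof (rule nn_integral_cong)
    fix x assume "x \<in> space \<nu>"
    then have [measurable]: "(\<lambda>a. x) \<in> borel \<rightarrow>\<^sub>M cfg N" by simp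
    have "(\<lambda>a. F (Tx i j a x)) \<in> borel_measurable borel" using ij by measurable
    from nn_integral_sym_beta_flip[OF this, of \<gamma>] ij
    show "(\<integral>\<^sup>+a. F (swap_cfg i j (Tx i j a x)) \<partial>\<beta>) = (\<integral>\<^sup>+a. F (Tx i j a x) \<partial>\<beta>)"
      by (simp add: swap_cfg_Tx)
  qed
  also have "\<dots> = (\<integral>\<^sup>+x. F x \<partial>\<nu>)" by (rule inv) simp
  finally show ?thesis .
qed

text \<open>A pair without the last site is conjugate, by the swap of \<open>j\<close> with the last
  site, to a pair that contains it.\<close>

theorem resample:
  assumes [measurable]: "F \<in> borel_measurable (cfg N)" and ij: "i < N" "j < N" "i \<noteq> j"
  shows "(\<integral>\<^sup>+x. (\<integral>\<^sup>+a. F (Tx i j a x) \<partial>\<beta>) \<partial>\<nu>) = (\<integral>\<^sup>+x. F x \<partial>\<nu>)"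
proof -
  let ?l = "N - 1"
  have l: "?l < N" using N2 by simp
  consider "j = ?l" | "i = ?l" | "i \<noteq> ?l" "j \<noteq> ?l" by blast
  then show ?thesis
  proof cases
    case 1
    then show ?thesis using resample_last[of F i] ij by simp
  next
    case 2
    have "(\<integral>\<^sup>+x. (\<integral>\<^sup>+a. F (Tx i j a x) \<partial>\<beta>) \<partial>\<nu>) = (\<integral>\<^sup>+x. (\<integral>\<^sup>+a. F (Tx j i a x) \<partial>\<beta>) \<partial>\<nu>)"
    proof (rule nn_integral_cong)
      fix x assume "x \<in> space \<nu>"
      then have [measurable]: "(\<lambda>a. x) \<in> borel \<rightarrow>\<^sub>M cfg N" by simp
      have "(\<lambda>a. F (Tx j i a x)) \<in> borel_measurable borel" using ij by measurable
      from nn_integral_sym_beta_flip[OF this, of \<gamma>] ij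
      show "(\<integral>\<^sup>+a. F (Tx i j a x) \<partial>\<beta>) = (\<integral>\<^sup>+a. F (Tx j i a x) \<partial>\<beta>)"
        by (simp add: Tx_commute[of j i])
    qed
    then show ?thesis using resample_last[of F j] ij 2 by simp
  next
    case 3
    have sw: "(\<integral>\<^sup>+x. G (swap_cfg j ?l x) \<partial>\<nu>) = (\<integral>\<^sup>+x. G x \<partial>\<nu>)" if "G \<in> borel_measurable (cfg N)" for G
      using 3 ij l that by (intro swap_of_resample resample_last) auto
    have "(\<integral>\<^sup>+x. (\<integral>\<^sup>+a. F (Tx i j a x) \<partial>\<beta>) \<partial>\<nu>)
        = (\<integral>\<^sup>+x. (\<integral>\<^sup>+a. F (swap_cfg j ?l (Tx i ?l a (swap_cfg j ?l x))) \<partial>\<beta>) \<partial>\<nu>)"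
      using 3 ij by (simp add: Tx_conj[of i j ?l])
    also have "\<dots> = (\<integral>\<^sup>+x. (\<integral>\<^sup>+a. F (swap_cfg j ?l (Tx i ?l a x)) \<partial>\<beta>) \<partial>\<nu>)"
      using ij l by (intro sw) measurable
    also have "\<dots> = (\<integral>\<^sup>+x. F (swap_cfg j ?l x) \<partial>\<nu>)"
      using ij l 3 by (intro resample_last) auto
    also have "\<dots> = (\<integral>\<^sup>+x. F x \<partial>\<nu>)" by (intro sw) simp
    finally show ?thesis .
  qed
qed

lemma swap:
  assumes "F \<in> borel_measurable (cfg N)" "i < N" "j < N" "i \<noteq> j"
  shows "(\<integral>\<^sup>+x. F (swap_cfg i j x) \<partial>\<nu>) = (\<integral>\<^sup>+x. F x \<partial>\<nu>)"
  using assms by (intro swap_of_resample resample) auto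

end

section \<open>From long-range to nearest-neighbour exchanges\<close>

lemma ennreal_sq2: "ennreal ((u - v)\<^sup>2) \<le> 2 * ennreal ((u - w)\<^sup>2) + 2 * ennreal ((w - v)\<^sup>2)"
proof -
  have "(u - v)\<^sup>2 \<le> 2 * (u - w)\<^sup>2 + 2 * (w - v)\<^sup>2"
    using sum_squares_ge_zero[of "(u - w) - (w - v)" 0] by (simp add: power2_eq_square algebra_simps)
  then have "ennreal ((u - v)\<^sup>2) \<le> ennreal (2 * (u - w)\<^sup>2 + 2 * (w - v)\<^sup>2)" by (rule ennreal_leI)
  also have "\<dots> = 2 * ennreal ((u - w)\<^sup>2) + 2 * ennreal ((w - v)\<^sup>2)"
    by (simp add: ennreal_plus ennreal_mult)
  finally show ?thesis .
qed

lemma ennreal_sq3: "ennreal ((u - v)\<^sup>2) \<le> 3 * (ennreal ((u - w)\<^sup>2) + ennreal ((w - z)\<^sup>2) + ennreal ((z - v)\<^sup>2))"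
proof -
  have "(u - v)\<^sup>2 \<le> 3 * ((u - w)\<^sup>2 + (w - z)\<^sup>2 + (z - v)\<^sup>2)"
  proof -
    have "0 \<le> ((u-w)-(w-z))\<^sup>2 + ((w-z)-(z-v))\<^sup>2 + ((u-w)-(z-v))\<^sup>2" by simp
    then show ?thesis by (simp add: power2_eq_square algebra_simps)
  qed
  then have "ennreal ((u - v)\<^sup>2) \<le> ennreal (3 * ((u - w)\<^sup>2 + (w - z)\<^sup>2 + (z - v)\<^sup>2))" by (rule ennreal_leI)
  also have "\<dots> = 3 * (ennreal ((u - w)\<^sup>2) + ennreal ((w - z)\<^sup>2) + ennreal ((z - v)\<^sup>2))"
    by (simp add: ennreal_plus ennreal_mult)
  finally show ?thesis .
qed

section \<open>Carrying energy along a path\<close>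

text \<open>For an injective path this permutes the energies: that of \<open>p 0\<close> travels to
  \<open>p n\<close>, and each energy met on the way moves back by one site.\<close>

primrec carry :: "(nat \<Rightarrow> nat) \<Rightarrow> nat \<Rightarrow> (nat \<Rightarrow> real) \<Rightarrow> nat \<Rightarrow> real" where
  "carry p 0 x = x"
| "carry p (Suc n) x = swap_cfg (p n) (p (Suc n)) (carry p n x)"

lemma carry_end: "carry p n x (p n) = x (p 0)"
  by (induction n) (auto simp: swap_cfg_def)

lemma carry_outside: "k \<notin> p ` {..n} \<Longrightarrow> carry p n x k = x k"
  by (induction n) (auto simp: swap_cfg_def atMost_Suc)

lemma carry_pos:
  assumes "\<forall>i<N. 0 < x i" "\<forall>k\<le>n. p k < N"
  shows "\<forall>i<N. 0 < carry p n x i"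
  using assms by (induction n) (auto simp: swap_cfg_def)

text \<open>An exchange with a site \<open>j\<close> off the path commutes with carrying, up to
  moving its first end from \<open>p 0\<close> to \<open>p n\<close>. With \<open>j\<close> the
  successor of \<open>p n\<close>, a long-range exchange becomes one between neighbours.\<close>

lemma carry_Tx:
  assumes "inj_on p {..n}" "j \<notin> p ` {..n}"
  shows "carry p n (Tx (p 0) j a x) = Tx (p n) j a (carry p n x)"
  using assms
proof (induction n)
  case (Suc n)
  have "inj_on p {..n}" using Suc.prems(1) by (rule inj_on_subset) auto
  moreover have "p n \<noteq> p (Suc n)" using Suc.prems(1) by (auto dest: inj_onD)
  ultimately have "carry p (Suc n) (Tx (p 0) j a x) = swap_cfg (p n) (p (Suc n)) (Tx (p n) j a (carry p n x))"
    using Suc by (simp add: atMost_Suc)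
  also have "\<dots> = Tx (p (Suc n)) j a (swap_cfg (p n) (p (Suc n)) (carry p n x))"
  proof -
    have *: "swap_cfg u v (Tx u j a y) = Tx v j a (swap_cfg u v y)" if "u \<noteq> v" "u \<noteq> j" "v \<noteq> j" for u v y
      using that by (auto simp: swap_cfg_def Tx_def fun_eq_iff)
    show ?thesis using \<open>p n \<noteq> p (Suc n)\<close> Suc.prems(2) by (intro *) auto
  qed
  finally show ?case by simp
qed simp

section \<open>Bond energies and the cost of swaps\<close>

context energy_simplex begin

lemma flip:
  assumes [measurable]: "F \<in> borel_measurable (cfg N)" and ij: "i < N" "j < N" "i \<noteq> j" and x: "x \<in> space (cfg N)"
  shows "(\<integral>\<^sup>+a. F (Tx j i a x) \<partial>\<beta>) = (\<integral>\<^sup>+a. F (Tx i j a x) \<partial>\<beta>)"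
proof -
  have [measurable]: "(\<lambda>a. x) \<in> borel \<rightarrow>\<^sub>M cfg N" using x by simp
  have "(\<lambda>a. F (Tx i j a x)) \<in> borel_measurable borel" using ij by measurable
  from nn_integral_sym_beta_flip[OF this, of \<gamma>] ij show ?thesis by (simp add: Tx_commute[of i j])
qed

text \<open>By stationarity \<open>x\<close> may be replaced by a resampled configuration, and the
  other exchange forgets that this was done. What remains are two independent samples from one
  fibre, on an equal footing.\<close>

lemma resample_pair:
  assumes [measurable]: "(\<lambda>(x, y). H x y) \<in> borel_measurable (cfg N \<Otimes>\<^sub>M cfg N)" and ij: "i < N" "j < N" "i \<noteq> j"
  shows "(\<integral>\<^sup>+x. (\<integral>\<^sup>+a. H x (Tx i j a x) \<partial>\<beta>) \<partial>\<nu>)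
    = (\<integral>\<^sup>+x. (\<integral>\<^sup>+b. (\<integral>\<^sup>+a. H (Tx i j b x) (Tx i j a x) \<partial>\<beta>) \<partial>\<beta>) \<partial>\<nu>)"
proof -
  have "(\<lambda>x. \<integral>\<^sup>+a. H x (Tx i j a x) \<partial>\<beta>) \<in> borel_measurable (cfg N)"
    using ij by measurable
  from resample[OF this ij] show ?thesis using ij by simp
qed

lemma reversible_pair:
  assumes [measurable]: "(\<lambda>(x, y). H x y) \<in> borel_measurable (cfg N \<Otimes>\<^sub>M cfg N)" and ij: "i < N" "j < N" "i \<noteq> j"
  shows "(\<integral>\<^sup>+x. (\<integral>\<^sup>+a. H x (Tx i j a x) \<partial>\<beta>) \<partial>\<nu>) = (\<integral>\<^sup>+x. (\<integral>\<^sup>+a. H (Tx i j a x) x \<partial>\<beta>) \<partial>\<nu>)"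
proof -
  interpret bb: pair_sigma_finite \<beta> \<beta> ..
  have H': "(\<lambda>(x, y). H y x) \<in> borel_measurable (cfg N \<Otimes>\<^sub>M cfg N)" by measurable
  have "(\<integral>\<^sup>+b. (\<integral>\<^sup>+a. H (Tx i j b x) (Tx i j a x) \<partial>\<beta>) \<partial>\<beta>) = (\<integral>\<^sup>+b. (\<integral>\<^sup>+a. H (Tx i j a x) (Tx i j b x) \<partial>\<beta>) \<partial>\<beta>)"
    if "x \<in> space \<nu>" for x
  proof (rule bb.Fubini')
    have x: "(\<lambda>p::real\<times>real. x) \<in> \<beta> \<Otimes>\<^sub>M \<beta> \<rightarrow>\<^sub>M cfg N" using that by simp
    have "(\<lambda>p. (Tx i j (snd p) x, Tx i j (fst p) x)) \<in> \<beta> \<Otimes>\<^sub>M \<beta> \<rightarrow>\<^sub>M cfg N \<Otimes>\<^sub>M cfg N"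
      using ij by (intro measurable_Pair measurable_Tx x) auto
    from measurable_compose[OF this assms(1)]
    show "(\<lambda>(x', y). H (Tx i j y x) (Tx i j x' x)) \<in> borel_measurable (\<beta> \<Otimes>\<^sub>M \<beta>)"
      by (simp add: case_prod_beta')
  qed
  then show ?thesis
    unfolding resample_pair[OF assms] resample_pair[OF H' ij] by (rule nn_integral_cong)
qed

text \<open>Twice the Dirichlet form of the process that resamples the pair at rate
  \<open>W\<close>.\<close>

definition jump :: "nat \<Rightarrow> nat \<Rightarrow> ((nat \<Rightarrow> real) \<Rightarrow> real) \<Rightarrow> ((nat \<Rightarrow> real) \<Rightarrow> ennreal) \<Rightarrow> ennreal" where
  "jump i j f W = (\<integral>\<^sup>+x. W x * (\<integral>\<^sup>+a. ennreal ((f (Tx i j a x) - f x)\<^sup>2) \<partial>\<beta>) \<partial>\<nu>)"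

definition pair_energy :: "real \<Rightarrow> ((nat \<Rightarrow> real) \<Rightarrow> real) \<Rightarrow> nat \<Rightarrow> nat \<Rightarrow> ennreal" where
  "pair_energy m f i j = jump i j f (\<lambda>x. ennreal ((x i + x j) powr m))"

lemma jump_eq:
  assumes [measurable]: "f \<in> borel_measurable (cfg N)" "W \<in> borel_measurable (cfg N)" and ij: "i < N" "j < N"
  shows "jump i j f W = (\<integral>\<^sup>+x. (\<integral>\<^sup>+a. W x * ennreal ((f (Tx i j a x) - f x)\<^sup>2) \<partial>\<beta>) \<partial>\<nu>)"
  unfolding jump_def
proof (rule nn_integral_cong)
  fix x assume "x \<in> space \<nu>"
  then have [measurable]: "(\<lambda>a. x) \<in> borel \<rightarrow>\<^sub>M cfg N" by simp
  show "W x * (\<integral>\<^sup>+a. ennreal ((f (Tx i j a x) - f x)\<^sup>2) \<partial>\<beta>) = (\<integral>\<^sup>+a. W x * ennreal ((f (Tx i j a x) - f x)\<^sup>2) \<partial>\<beta>)"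
    using ij by (subst nn_integral_cmult) auto
qed

lemma jump_mono:
  assumes "AE x in \<nu>. W x \<le> W' x"
  shows "jump i j f W \<le> jump i j f W'"
  unfolding jump_def
  by (rule nn_integral_mono_AE, use assms in eventually_elim) (rule mult_right_mono, auto)

lemma jump_cmult:
  assumes [measurable]: "f \<in> borel_measurable (cfg N)" "W \<in> borel_measurable (cfg N)" and ij: "i < N" "j < N"
  shows "jump i j f (\<lambda>x. c * W x) = c * jump i j f W"
  unfolding jump_def mult.assoc using ij by (subst nn_integral_cmult) auto

lemma jump_flip:
  assumes [measurable]: "f \<in> borel_measurable (cfg N)" and ij: "i < N" "j < N" "i \<noteq> j"
  shows "jump j i f W = jump i j f W"
  unfolding jump_def
proof (rule nn_integral_cong)
  fix x assume "x \<in> space \<nu>"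
  then have "(\<integral>\<^sup>+a. ennreal ((f (Tx j i a x) - f x)\<^sup>2) \<partial>\<beta>) = (\<integral>\<^sup>+a. ennreal ((f (Tx i j a x) - f x)\<^sup>2) \<partial>\<beta>)"
    using ij by (intro flip[where F="\<lambda>y. ennreal ((f y - f x)\<^sup>2)"]) auto
  then show "W x * (\<integral>\<^sup>+a. ennreal ((f (Tx j i a x) - f x)\<^sup>2) \<partial>\<beta>) = W x * (\<integral>\<^sup>+a. ennreal ((f (Tx i j a x) - f x)\<^sup>2) \<partial>\<beta>)"
    by simp
qed

lemma pair_energy_sym:
  assumes "f \<in> borel_measurable (cfg N)" "i < N" "j < N" "i \<noteq> j"
  shows "pair_energy m f j i = pair_energy m f i j"
  unfolding pair_energy_def using jump_flip[OF assms] by (simp add: add.commute)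

text \<open>Since an exchange does not see whether its pair was swapped before, \<open>x\<close> and
  its swap can both be compared with the random configuration \<open>Tx i j a x\<close>. The two
  comparisons cost the same, because swaps preserve \<open>nu\<close> and \<open>W\<close>; this
  gives 4 = 2 + 2.\<close>

lemma swap_energy:
  assumes [measurable]: "f \<in> borel_measurable (cfg N)" "W \<in> borel_measurable (cfg N)" and ij: "i < N" "j < N" "i \<noteq> j"
    and W: "\<And>x. W (swap_cfg i j x) = W x"
  shows "(\<integral>\<^sup>+x. W x * ennreal ((f (swap_cfg i j x) - f x)\<^sup>2) \<partial>\<nu>) \<le> 4 * jump i j f W"
proof -
  define G where "G x = W x * (\<integral>\<^sup>+a. ennreal ((f (Tx i j a x) - f x)\<^sup>2) \<partial>\<beta>)" for x
  have [measurable]: "G \<in> borel_measurable (cfg N)" unfolding G_def using ij by measurable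
  have "W x * ennreal ((f (swap_cfg i j x) - f x)\<^sup>2) \<le> 2 * G (swap_cfg i j x) + 2 * G x" if "x \<in> space \<nu>" for x
  proof -
    have [measurable]: "(\<lambda>a. x) \<in> borel \<rightarrow>\<^sub>M cfg N" "(\<lambda>a. swap_cfg i j x) \<in> borel \<rightarrow>\<^sub>M cfg N"
      using that measurable_space[OF measurable_swap_cfg[OF measurable_ident ij(1,2)]] by auto
    have "ennreal ((f (swap_cfg i j x) - f x)\<^sup>2) = (\<integral>\<^sup>+a. ennreal ((f (swap_cfg i j x) - f x)\<^sup>2) \<partial>\<beta>)"
      by (simp add: beta.emeasure_space_1[simplified])
    also have "\<dots> \<le> (\<integral>\<^sup>+a. 2 * ennreal ((f (Tx i j a (swap_cfg i j x)) - f (swap_cfg i j x))\<^sup>2)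
          + 2 * ennreal ((f (Tx i j a x) - f x)\<^sup>2) \<partial>\<beta>)"
    proof (rule nn_integral_mono)
      fix a
      show "ennreal ((f (swap_cfg i j x) - f x)\<^sup>2) \<le> 2 * ennreal ((f (Tx i j a (swap_cfg i j x)) - f (swap_cfg i j x))\<^sup>2)
          + 2 * ennreal ((f (Tx i j a x) - f x)\<^sup>2)"
        using ennreal_sq2[of "f (swap_cfg i j x)" "f x" "f (Tx i j a x)"] ij
        by (simp add: power2_commute[of "f (swap_cfg i j x)"])
    qed
    also have "\<dots> = 2 * (\<integral>\<^sup>+a. ennreal ((f (Tx i j a (swap_cfg i j x)) - f (swap_cfg i j x))\<^sup>2) \<partial>\<beta>)
          + 2 * (\<integral>\<^sup>+a. ennreal ((f (Tx i j a x) - f x)\<^sup>2) \<partial>\<beta>)"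
      using ij by (subst nn_integral_add, measurable, subst (1 2) nn_integral_cmult, measurable)
    finally have "W x * ennreal ((f (swap_cfg i j x) - f x)\<^sup>2) \<le> W x * \<dots>" by (rule mult_left_mono) simp
    then show ?thesis by (simp add: G_def W distrib_left mult_ac)
  qed
  then have "(\<integral>\<^sup>+x. W x * ennreal ((f (swap_cfg i j x) - f x)\<^sup>2) \<partial>\<nu>) \<le> (\<integral>\<^sup>+x. 2 * G (swap_cfg i j x) + 2 * G x \<partial>\<nu>)"
    by (rule nn_integral_mono)
  also have "\<dots> = 2 * (\<integral>\<^sup>+x. G (swap_cfg i j x) \<partial>\<nu>) + 2 * (\<integral>\<^sup>+x. G x \<partial>\<nu>)"
    using ij by (subst nn_integral_add, measurable, subst (1 2) nn_integral_cmult, measurable)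
  also have "(\<integral>\<^sup>+x. G (swap_cfg i j x) \<partial>\<nu>) = (\<integral>\<^sup>+x. G x \<partial>\<nu>)" using ij by (intro swap) auto
  also have "2 * (\<integral>\<^sup>+x. G x \<partial>\<nu>) + 2 * (\<integral>\<^sup>+x. G x \<partial>\<nu>) = 4 * jump i j f W"
    unfolding jump_def G_def by (simp add: distrib_right[symmetric])
  finally show ?thesis .
qed

lemma measurable_carry [measurable (raw)]:
  assumes "h \<in> M \<rightarrow>\<^sub>M cfg N" "\<forall>k\<le>n. p k < N"
  shows "(\<lambda>x. carry p n (h x)) \<in> M \<rightarrow>\<^sub>M cfg N"
  using assms by (induction n) auto

lemma carry_invariant:
  assumes "F \<in> borel_measurable (cfg N)" "\<forall>k\<le>n. p k < N" "inj_on p {..n}"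
  shows "(\<integral>\<^sup>+x. F (carry p n x) \<partial>\<nu>) = (\<integral>\<^sup>+x. F x \<partial>\<nu>)"
  using assms
proof (induction n arbitrary: F)
  case (Suc n)
  note [measurable] = Suc.prems(1)
  have 1: "p n < N" "p (Suc n) < N" "p n \<noteq> p (Suc n)" "inj_on p {..n}"
    using Suc.prems by (auto dest: inj_onD intro: inj_on_subset)
  have "(\<lambda>x. F (swap_cfg (p n) (p (Suc n)) x)) \<in> borel_measurable (cfg N)" using 1 by measurable
  from Suc.IH[OF this] swap[OF Suc.prems(1) 1(1-3)] Suc.prems(2) 1(4)
  show ?case by simp
qed simp

text \<open>Telescope over the swaps; Cauchy-Schwarz gives the factor \<open>n\<close>. At step
  \<open>k\<close> the carried energy sits at \<open>p k\<close>, so \<open>x (p 0) powr m\<close>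
  is at most the rate of the pair that is swapped there, and \<open>carry p k\<close> preserves
  \<open>nu\<close>.\<close>

lemma carry_energy:
  assumes m: "m \<ge> 0" and [measurable]: "f \<in> borel_measurable (cfg N)"
    and p: "\<forall>k\<le>n. p k < N" "inj_on p {..n}"
  shows "(\<integral>\<^sup>+x. ennreal (x (p 0) powr m) * ennreal ((f (carry p n x) - f x)\<^sup>2) \<partial>\<nu>)
     \<le> 4 * of_nat n * (\<Sum>k<n. pair_energy m f (p k) (p (Suc k)))"
proof -
  have p0: "p 0 < N" using p by simp
  define S where "S k x = ennreal ((x (p k) + x (p (Suc k))) powr m) * ennreal ((f (swap_cfg (p k) (p (Suc k)) x) - f x)\<^sup>2)" for k x
  have pk: "p k < N" "p (Suc k) < N" "p k \<noteq> p (Suc k)" "\<forall>l\<le>k. p l < N" "inj_on p {..k}" if "k < n" for k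
    using that p by (auto dest: inj_onD intro: inj_on_subset)
  have Sm: "S k \<in> borel_measurable (cfg N)" if "k < n" for k
    unfolding S_def using pk[OF that] by measurable
  have "AE x in \<nu>. ennreal (x (p 0) powr m) * ennreal ((f (carry p n x) - f x)\<^sup>2) \<le> of_nat n * (\<Sum>k<n. S k (carry p k x))"
    using AE_nu
  proof eventually_elim
    case (elim x)
    have "f (carry p n x) - f x = (\<Sum>k<n. f (carry p (Suc k) x) - f (carry p k x))"
      by (subst sum_lessThan_telescope) simp
    then have "(f (carry p n x) - f x)\<^sup>2 \<le> real n * (\<Sum>k<n. (f (carry p (Suc k) x) - f (carry p k x))\<^sup>2)"
      using sum_squared_le_sum_of_squares[of "\<lambda>k. f (carry p (Suc k) x) - f (carry p k x)" "{..<n}"]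
      by (simp add: mult.commute)
    then have "ennreal (x (p 0) powr m) * ennreal ((f (carry p n x) - f x)\<^sup>2) \<le>
      ennreal (x (p 0) powr m) * ennreal (real n * (\<Sum>k<n. (f (carry p (Suc k) x) - f (carry p k x))\<^sup>2))"
      by (intro mult_left_mono ennreal_leI) auto
    also have "\<dots> = of_nat n * (\<Sum>k<n. ennreal (x (p 0) powr m) * ennreal ((f (carry p (Suc k) x) - f (carry p k x))\<^sup>2))"
      by (simp add: ennreal_mult sum_nonneg sum_distrib_left ennreal_of_nat_eq_real_of_nat mult_ac flip: sum_ennreal)
    also have "\<dots> \<le> of_nat n * (\<Sum>k<n. S k (carry p k x))"
    proof (intro mult_left_mono sum_mono)
      fix k assume "k \<in> {..<n}" then have k: "k < n" by simp
      have "\<forall>i<N. 0 < carry p k x i" using elim pk(4)[OF k] by (intro carry_pos) auto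
      then have pos: "0 < carry p k x (p (Suc k))" using pk(2)[OF k] by blast
      have "0 < x (p 0)" using elim p0 by auto
      then have "x (p 0) powr m \<le> (carry p k x (p k) + carry p k x (p (Suc k))) powr m"
        using pos m by (intro powr_mono2) (auto simp: carry_end)
      then show "ennreal (x (p 0) powr m) * ennreal ((f (carry p (Suc k) x) - f (carry p k x))\<^sup>2) \<le> S k (carry p k x)"
        unfolding S_def by (auto intro!: mult_right_mono ennreal_leI)
    qed auto
    finally show ?case .
  qed
  then have "(\<integral>\<^sup>+x. ennreal (x (p 0) powr m) * ennreal ((f (carry p n x) - f x)\<^sup>2) \<partial>\<nu>)
     \<le> (\<integral>\<^sup>+x. of_nat n * (\<Sum>k<n. S k (carry p k x)) \<partial>\<nu>)"
    by (rule nn_integral_mono_AE)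
  also have "\<dots> = of_nat n * (\<Sum>k<n. (\<integral>\<^sup>+x. S k (carry p k x) \<partial>\<nu>))"
  proof -
    have M: "(\<lambda>x. S k (carry p k x)) \<in> borel_measurable \<nu>" if "k < n" for k
      using measurable_compose[OF measurable_carry[OF measurable_ident pk(4)[OF that]] Sm[OF that]]
      by simp
    have "(\<integral>\<^sup>+x. of_nat n * (\<Sum>k<n. S k (carry p k x)) \<partial>\<nu>) = of_nat n * (\<integral>\<^sup>+x. (\<Sum>k<n. S k (carry p k x)) \<partial>\<nu>)"
      by (rule nn_integral_cmult) (rule borel_measurable_sum, rule M, simp)
    also have "(\<integral>\<^sup>+x. (\<Sum>k<n. S k (carry p k x)) \<partial>\<nu>) = (\<Sum>k<n. (\<integral>\<^sup>+x. S k (carry p k x) \<partial>\<nu>))"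
      by (rule nn_integral_sum) (rule M, simp)
    finally show ?thesis .
  qed
  also have "\<dots> \<le> of_nat n * (\<Sum>k<n. 4 * pair_energy m f (p k) (p (Suc k)))"
  proof (intro mult_left_mono sum_mono)
    fix k assume "k \<in> {..<n}" then have k: "k < n" by simp
    have "(\<integral>\<^sup>+x. S k (carry p k x) \<partial>\<nu>) = (\<integral>\<^sup>+x. S k x \<partial>\<nu>)"
      using pk[OF k] Sm[OF k] by (intro carry_invariant) auto
    also have "\<dots> \<le> 4 * pair_energy m f (p k) (p (Suc k))"
      unfolding S_def pair_energy_def using pk[OF k] by (intro swap_energy) (auto simp: swap_cfg_def add.commute)
    finally show "(\<integral>\<^sup>+x. S k (carry p k x) \<partial>\<nu>) \<le> 4 * pair_energy m f (p k) (p (Suc k))" .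
  qed auto
  finally show ?thesis by (simp add: sum_distrib_left[symmetric] mult_ac)
qed

lemma Tx_measurable_fixed:
  assumes "x \<in> space (cfg N)" "i < N" "j < N"
  shows "(\<lambda>a. Tx i j a x) \<in> borel \<rightarrow>\<^sub>M cfg N"
  using assms by (intro measurable_Tx) auto

section \<open>Splitting a pair energy by its heavy end\<close>

lemma halves:
  assumes [measurable]: "F \<in> borel_measurable borel"
  defines "\<theta> \<equiv> \<lambda>a b. if (1/4 \<le> a \<and> 1/4 \<le> b) \<or> (a \<le> 3/4 \<and> b \<le> 3/4) then ennreal ((F a - F b)\<^sup>2) else 0"
  shows "emeasure \<beta> {1/4..3/4} * (\<integral>\<^sup>+b. (\<integral>\<^sup>+a. ennreal ((F a - F b)\<^sup>2) \<partial>\<beta>) \<partial>\<beta>)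
     \<le> 4 * (\<integral>\<^sup>+b. (\<integral>\<^sup>+a. \<theta> a b \<partial>\<beta>) \<partial>\<beta>)"
proof -
  have one: "(\<integral>\<^sup>+c. k \<partial>\<beta>) = k" for k :: ennreal
    using beta.emeasure_space_1 by simp
  have [measurable]: "(\<lambda>(a, b). \<theta> a b) \<in> borel_measurable (borel \<Otimes>\<^sub>M borel)"
    unfolding \<theta>_def by measurable
  have sym: "\<theta> a b = \<theta> b a" for a b
    by (auto simp: \<theta>_def power2_commute)
  have pt: "indicator {1/4..3/4} c * ennreal ((F a - F b)\<^sup>2) \<le> 2 * \<theta> a c + 2 * \<theta> c b" for a b c :: real
  proof (cases "c \<in> {1/4..3/4}")
    case True
    have "\<theta> a c = ennreal ((F a - F c)\<^sup>2)" "\<theta> c b = ennreal ((F c - F b)\<^sup>2)"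
      using True by (auto simp: \<theta>_def)
    then show ?thesis using True ennreal_sq2[of "F a" "F b" "F c"] by simp
  qed simp
  have "emeasure \<beta> {1/4..3/4} * (\<integral>\<^sup>+b. (\<integral>\<^sup>+a. ennreal ((F a - F b)\<^sup>2) \<partial>\<beta>) \<partial>\<beta>)
     = (\<integral>\<^sup>+c. (\<integral>\<^sup>+b. (\<integral>\<^sup>+a. indicator {1/4..3/4} c * ennreal ((F a - F b)\<^sup>2) \<partial>\<beta>) \<partial>\<beta>) \<partial>\<beta>)"
    by (simp add: nn_integral_cmult nn_integral_multc)
  also have "\<dots> \<le> (\<integral>\<^sup>+c. (\<integral>\<^sup>+b. (\<integral>\<^sup>+a. 2 * \<theta> a c + 2 * \<theta> c b \<partial>\<beta>) \<partial>\<beta>) \<partial>\<beta>)"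
    by (intro nn_integral_mono pt)
  also have "\<dots> = (\<integral>\<^sup>+c. 2 * (\<integral>\<^sup>+a. \<theta> a c \<partial>\<beta>) + 2 * (\<integral>\<^sup>+b. \<theta> c b \<partial>\<beta>) \<partial>\<beta>)"
    by (simp add: nn_integral_add nn_integral_cmult one beta.emeasure_space_1[simplified])
  also have "\<dots> = (\<integral>\<^sup>+c. 4 * (\<integral>\<^sup>+a. \<theta> a c \<partial>\<beta>) \<partial>\<beta>)"
  proof (rule nn_integral_cong)
    fix c
    show "2 * (\<integral>\<^sup>+a. \<theta> a c \<partial>\<beta>) + 2 * (\<integral>\<^sup>+b. \<theta> c b \<partial>\<beta>) = 4 * (\<integral>\<^sup>+a. \<theta> a c \<partial>\<beta>)"
      by (simp only: sym[of c] distrib_right[symmetric]) simp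
  qed
  also have "\<dots> = 4 * (\<integral>\<^sup>+b. (\<integral>\<^sup>+a. \<theta> a b \<partial>\<beta>) \<partial>\<beta>)"
    by (rule nn_integral_cmult) measurable
  finally show ?thesis .
qed

text \<open>The energy that gets transported must be a fixed fraction of \<open>x\<^sub>i + x\<^sub>j\<close>, so that each pair which
  it visits has weight comparable to \<open>(x\<^sub>i + x\<^sub>j)\<^sup>m\<close>. Every resampled pair is heavy at \<open>i\<close> or at \<open>j\<close>, and
  fractions in \<open>{1/4..3/4}\<close> are heavy at both ends.\<close>

definition heavy :: "nat \<Rightarrow> nat \<Rightarrow> (nat \<Rightarrow> real) \<Rightarrow> ennreal" where
  "heavy i j x = (if (x i + x j) / 4 \<le> x i then 1 else 0)"

lemma measurable_heavy [measurable]: "i < N \<Longrightarrow> j < N \<Longrightarrow> heavy i j \<in> borel_measurable (cfg N)"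
  unfolding heavy_def[abs_def] by measurable

definition heavy_energy :: "real \<Rightarrow> ((nat \<Rightarrow> real) \<Rightarrow> real) \<Rightarrow> nat \<Rightarrow> nat \<Rightarrow> ennreal" where
  "heavy_energy m f i j = (\<integral>\<^sup>+x. (\<integral>\<^sup>+a. ennreal ((x i + x j) powr m) * (heavy i j x * heavy i j (Tx i j a x))
      * ennreal ((f (Tx i j a x) - f x)\<^sup>2) \<partial>\<beta>) \<partial>\<nu>)"

lemma heavy_Tx: "0 < x i + x j \<Longrightarrow> i \<noteq> j \<Longrightarrow> heavy i j (Tx i j a x) = (if 1/4 \<le> a then 1 else 0)"
  using mult_le_cancel_right_pos[of "x i + x j" "1/4" a]
  by (simp add: heavy_def Tx_pair_sum) (simp add: Tx_def)

lemma heavy_Tx': 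
  assumes "0 < x i + x j" "i \<noteq> j"
  shows "heavy j i (Tx i j a x) = (if a \<le> 3/4 then 1 else 0)"
proof -
  have "Tx i j a x j = (1 - a) * (x i + x j)" by (simp add: Tx_def)
  moreover have "(x i + x j) / 4 \<le> (1 - a) * (x i + x j) \<longleftrightarrow> 1/4 \<le> 1 - a"
    using mult_le_cancel_right_pos[of "x i + x j" "1/4" "1 - a"] assms(1) by simp
  ultimately show ?thesis using Tx_pair_sum[OF assms(2), of a x]
    by (auto simp: heavy_def add.commute)
qed

lemma heavy_energy_pair:
  assumes [measurable]: "f \<in> borel_measurable (cfg N)" and ij: "i < N" "j < N" "i \<noteq> j"
  shows "heavy_energy m f i j = (\<integral>\<^sup>+x. (\<integral>\<^sup>+b. (\<integral>\<^sup>+a. ennreal ((x i + x j) powr m) * (heavy i j (Tx i j b x) * heavy i j (Tx i j a x))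
      * ennreal ((f (Tx i j a x) - f (Tx i j b x))\<^sup>2) \<partial>\<beta>) \<partial>\<beta>) \<partial>\<nu>)"
proof -
  have "heavy_energy m f i j = (\<integral>\<^sup>+x. (\<integral>\<^sup>+b. (\<integral>\<^sup>+a. ennreal ((Tx i j b x i + Tx i j b x j) powr m) * (heavy i j (Tx i j b x) * heavy i j (Tx i j a x))
      * ennreal ((f (Tx i j a x) - f (Tx i j b x))\<^sup>2) \<partial>\<beta>) \<partial>\<beta>) \<partial>\<nu>)"
    unfolding heavy_energy_def using ij
    by (intro resample_pair[where H="\<lambda>x y. ennreal ((x i + x j) powr m) * (heavy i j x * heavy i j y)
      * ennreal ((f y - f x)\<^sup>2)"]) measurable
  then show ?thesis using ij by (simp add: Tx_pair_sum)
qed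

text \<open>The fractions are still those of \<open>Tx i j\<close>, although the heavy end is
  \<open>j\<close>. Both heavy energies thus become integrals over the same two samples, and
  \<open>halves\<close> can compare their sum with the full pair energy.\<close>

lemma heavy_energy_pair':
  assumes [measurable]: "f \<in> borel_measurable (cfg N)" and ij: "i < N" "j < N" "i \<noteq> j"
  shows "heavy_energy m f j i = (\<integral>\<^sup>+x. (\<integral>\<^sup>+b. (\<integral>\<^sup>+a. ennreal ((x i + x j) powr m) * (heavy j i (Tx i j b x) * heavy j i (Tx i j a x))
      * ennreal ((f (Tx i j a x) - f (Tx i j b x))\<^sup>2) \<partial>\<beta>) \<partial>\<beta>) \<partial>\<nu>)"
proof -
  define H where "H x y = ennreal ((x i + x j) powr m) * (heavy j i x * heavy j i y) * ennreal ((f y - f x)\<^sup>2)" for x y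
  have H: "(\<lambda>(x, y). H x y) \<in> borel_measurable (cfg N \<Otimes>\<^sub>M cfg N)"
    unfolding H_def using ij by measurable
  have "heavy_energy m f j i = (\<integral>\<^sup>+x. (\<integral>\<^sup>+a. H x (Tx j i a x) \<partial>\<beta>) \<partial>\<nu>)"
    unfolding heavy_energy_def H_def by (simp add: add.commute)
  also have "\<dots> = (\<integral>\<^sup>+x. (\<integral>\<^sup>+a. H x (Tx i j a x) \<partial>\<beta>) \<partial>\<nu>)"
  proof (rule nn_integral_cong)
    fix x assume x: "x \<in> space \<nu>"
    have "(\<lambda>y. H x y) \<in> borel_measurable (cfg N)"
      using measurable_compose[OF measurable_Pair1' H] x by simp
    then show "(\<integral>\<^sup>+a. H x (Tx j i a x) \<partial>\<beta>) = (\<integral>\<^sup>+a. H x (Tx i j a x) \<partial>\<beta>)"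
      using ij x by (intro flip) auto
  qed
  also have "\<dots> = (\<integral>\<^sup>+x. (\<integral>\<^sup>+b. (\<integral>\<^sup>+a. H (Tx i j b x) (Tx i j a x) \<partial>\<beta>) \<partial>\<beta>) \<partial>\<nu>)"
    by (rule resample_pair[OF H ij])
  finally show ?thesis unfolding H_def using ij by (simp add: Tx_pair_sum)
qed

lemma pair_energy_halves:
  assumes f [measurable]: "f \<in> borel_measurable (cfg N)" and ij: "i < N" "j < N" "i \<noteq> j"
  shows "emeasure \<beta> {1/4..3/4} * pair_energy m f i j \<le> 4 * (heavy_energy m f i j + heavy_energy m f j i)"
proof -
  define W where "W x = ennreal ((x i + x j) powr m)" for x :: "nat \<Rightarrow> real"
  have [measurable]: "W \<in> borel_measurable (cfg N)" unfolding W_def[abs_def] using ij by measurable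
  define A where "A x = (\<integral>\<^sup>+b. (\<integral>\<^sup>+a. W x * (heavy i j (Tx i j b x) * heavy i j (Tx i j a x))
      * ennreal ((f (Tx i j a x) - f (Tx i j b x))\<^sup>2) \<partial>\<beta>) \<partial>\<beta>)" for x
  define B where "B x = (\<integral>\<^sup>+b. (\<integral>\<^sup>+a. W x * (heavy j i (Tx i j b x) * heavy j i (Tx i j a x))
      * ennreal ((f (Tx i j a x) - f (Tx i j b x))\<^sup>2) \<partial>\<beta>) \<partial>\<beta>)" for x
  define J where "J x = (\<integral>\<^sup>+b. (\<integral>\<^sup>+a. W x * ennreal ((f (Tx i j a x) - f (Tx i j b x))\<^sup>2) \<partial>\<beta>) \<partial>\<beta>)" for x
  have [measurable]: "A \<in> borel_measurable (cfg N)" "B \<in> borel_measurable (cfg N)" "J \<in> borel_measurable (cfg N)"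
    unfolding A_def[abs_def] B_def[abs_def] J_def[abs_def] using ij by measurable
  have "pair_energy m f i j = (\<integral>\<^sup>+x. (\<integral>\<^sup>+a. W x * ennreal ((f (Tx i j a x) - f x)\<^sup>2) \<partial>\<beta>) \<partial>\<nu>)"
    unfolding pair_energy_def W_def[symmetric] using ij by (intro jump_eq) auto
  also have "\<dots> = (\<integral>\<^sup>+x. (\<integral>\<^sup>+b. (\<integral>\<^sup>+a. W (Tx i j b x) * ennreal ((f (Tx i j a x) - f (Tx i j b x))\<^sup>2) \<partial>\<beta>) \<partial>\<beta>) \<partial>\<nu>)"
    using ij by (intro resample_pair[where H="\<lambda>x y. W x * ennreal ((f y - f x)\<^sup>2)"]) measurable
  also have "\<dots> = (\<integral>\<^sup>+x. J x \<partial>\<nu>)" unfolding J_def W_def using ij by (simp add: Tx_pair_sum)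
  finally have D: "pair_energy m f i j = (\<integral>\<^sup>+x. J x \<partial>\<nu>)" .
  have "AE x in \<nu>. emeasure \<beta> {1/4..3/4} * J x \<le> 4 * (A x + B x)"
    using AE_nu AE_space
  proof eventually_elim
    case (elim x)
    then have pos: "0 < x i + x j" and x: "x \<in> space (cfg N)" using ij by (auto intro: add_pos_pos)
    define F where "F a = f (Tx i j a x)" for a
    note [measurable] = Tx_measurable_fixed[OF x ij(1,2)]
    have [measurable]: "F \<in> borel_measurable borel" unfolding F_def by measurable
    define \<theta> where "\<theta> a b = (if (1/4 \<le> a \<and> 1/4 \<le> b) \<or> (a \<le> 3/4 \<and> b \<le> 3/4) then ennreal ((F a - F b)\<^sup>2) else 0)" for a b
    have [measurable]: "(\<lambda>(a, b). \<theta> a b) \<in> borel_measurable (borel \<Otimes>\<^sub>M borel)"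
      unfolding \<theta>_def by measurable
    have "emeasure \<beta> {1/4..3/4} * J x = W x * (emeasure \<beta> {1/4..3/4} * (\<integral>\<^sup>+b. (\<integral>\<^sup>+a. ennreal ((F a - F b)\<^sup>2) \<partial>\<beta>) \<partial>\<beta>))"
      unfolding J_def F_def[symmetric] by (simp add: nn_integral_cmult mult_ac)
    also have "\<dots> \<le> W x * (4 * (\<integral>\<^sup>+b. (\<integral>\<^sup>+a. \<theta> a b \<partial>\<beta>) \<partial>\<beta>))"
      unfolding \<theta>_def by (intro mult_left_mono halves) auto
    also have "\<dots> = 4 * (\<integral>\<^sup>+b. (\<integral>\<^sup>+a. W x * \<theta> a b \<partial>\<beta>) \<partial>\<beta>)"
      by (simp add: nn_integral_cmult mult_ac)
    also have "\<dots> \<le> 4 * (\<integral>\<^sup>+b. (\<integral>\<^sup>+a. W x * (heavy i j (Tx i j b x) * heavy i j (Tx i j a x))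
      * ennreal ((F a - F b)\<^sup>2) + W x * (heavy j i (Tx i j b x) * heavy j i (Tx i j a x))
      * ennreal ((F a - F b)\<^sup>2) \<partial>\<beta>) \<partial>\<beta>)"
      unfolding heavy_Tx[OF pos ij(3)] heavy_Tx'[OF pos ij(3)]
      by (intro mult_left_mono nn_integral_mono) (auto simp: \<theta>_def)
    also have "\<dots> = 4 * (A x + B x)"
      unfolding A_def B_def heavy_Tx[OF pos ij(3)] heavy_Tx'[OF pos ij(3)] F_def[symmetric]
      by (subst nn_integral_add[symmetric], measurable, subst nn_integral_add[symmetric]) auto
    finally show ?case .
  qed
  then have "(\<integral>\<^sup>+x. emeasure \<beta> {1/4..3/4} * J x \<partial>\<nu>) \<le> (\<integral>\<^sup>+x. 4 * (A x + B x) \<partial>\<nu>)"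
    by (rule nn_integral_mono_AE)
  then show ?thesis
    unfolding D heavy_energy_pair[OF f ij] heavy_energy_pair'[OF f ij] W_def[symmetric] A_def[symmetric] B_def[symmetric]
    by (simp add: nn_integral_cmult nn_integral_add)
qed

end

lemma AE_pos2: "(\<forall>i<N. 0 < (x::nat\<Rightarrow>real) i) \<Longrightarrow> i < N \<Longrightarrow> j < N \<Longrightarrow> 0 < x i + x j"
  by (auto intro: add_pos_pos)

context energy_simplex begin

text \<open>With \<open>c\<close> the carrying map and \<open>T\<close> the exchanged configuration,
  \<open>f T - f x\<close> is split at \<open>c T\<close> and \<open>c x\<close>. The outer
  differences are carrying costs; the middle one is an exchange of the neighbours \<open>p n\<close>
  and \<open>p (Suc n)\<close>. Heaviness at \<open>p 0\<close> is required before and after the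
  exchange because energy is carried in both configurations.\<close>

lemma heavy_energy_path:
  assumes m: "m \<ge> 0" and f [measurable]: "f \<in> borel_measurable (cfg N)"
    and p: "\<forall>k\<le>Suc n. p k < N" "inj_on p {..Suc n}"
  shows "heavy_energy m f (p 0) (p (Suc n)) \<le> ennreal (24 * 4 powr m) * of_nat (Suc n) * (\<Sum>k<Suc n. pair_energy m f (p k) (p (Suc k)))"
proof -
  let ?i = "p 0" and ?j = "p (Suc n)" and ?r = "p n"
  have ij: "?i < N" "?j < N" "?r < N" using p(1) by auto
  have ne: "?i \<noteq> ?j" "?r \<noteq> ?j" using p(2) by (auto dest: inj_onD)
  have jn: "?j \<notin> p ` {..n}"
  proof
    assume "?j \<in> p ` {..n}"
    then obtain k where "k \<le> n" "p (Suc n) = p k" by auto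
    then show False using inj_onD[OF p(2), of "Suc n" k] by simp
  qed
  have pn: "\<forall>k\<le>n. p k < N" "inj_on p {..n}" using p by (auto intro: inj_on_subset)
  define c where "c = carry p n"
  have cm: "c \<in> cfg N \<rightarrow>\<^sub>M cfg N" unfolding c_def using pn(1) by (intro measurable_carry) auto
  have [measurable]: "(\<lambda>x. f (c x)) \<in> borel_measurable (cfg N)" by (rule measurable_compose[OF cm f])
  have cT: "c (Tx ?i ?j a x) = Tx ?r ?j a (c x)" for a x
    unfolding c_def by (rule carry_Tx[OF pn(2) jn])
  define E1 where "E1 x = ennreal (4 powr m) * (ennreal (x ?i powr m) * ennreal ((f (c x) - f x)\<^sup>2))" for x
  have [measurable]: "E1 \<in> borel_measurable (cfg N)"
    unfolding E1_def[abs_def] using ij by measurable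
  define W where "W x = ennreal ((x ?i + x ?j) powr m)" for x :: "nat \<Rightarrow> real"
  define W' where "W' x = ennreal ((x ?r + x ?j) powr m)" for x :: "nat \<Rightarrow> real"
  have [measurable]: "W' \<in> borel_measurable (cfg N)" unfolding W'_def[abs_def] using ij by measurable
  define G where "G y = (\<integral>\<^sup>+a. W' y * ennreal ((f (Tx ?r ?j a y) - f y)\<^sup>2) \<partial>\<beta>)" for y
  have Gm [measurable]: "G \<in> borel_measurable (cfg N)" unfolding G_def[abs_def] using ij by measurable
  have IE1: "(\<integral>\<^sup>+x. E1 x \<partial>\<nu>) \<le> ennreal (4 powr m) * (4 * of_nat n * (\<Sum>k<n. pair_energy m f (p k) (p (Suc k))))"
  proof -
    have "(\<integral>\<^sup>+x. E1 x \<partial>\<nu>) = ennreal (4 powr m) * (\<integral>\<^sup>+x. ennreal (x ?i powr m) * ennreal ((f (c x) - f x)\<^sup>2) \<partial>\<nu>)"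
      unfolding E1_def using ij by (intro nn_integral_cmult) measurable
    then show ?thesis unfolding c_def
      using carry_energy[OF m f pn] by (auto intro!: mult_left_mono)
  qed
  have IG: "(\<integral>\<^sup>+x. G (c x) \<partial>\<nu>) = pair_energy m f ?r ?j"
  proof -
    have "(\<integral>\<^sup>+x. G (c x) \<partial>\<nu>) = (\<integral>\<^sup>+x. G x \<partial>\<nu>)"
      unfolding c_def by (rule carry_invariant[OF Gm pn])
    then show ?thesis
      unfolding pair_energy_def W'_def[symmetric] G_def using ij by (subst jump_eq) auto
  qed
  have "AE x in \<nu>. (\<integral>\<^sup>+a. W x * (heavy ?i ?j x * heavy ?i ?j (Tx ?i ?j a x)) * ennreal ((f (Tx ?i ?j a x) - f x)\<^sup>2) \<partial>\<beta>)
     \<le> (\<integral>\<^sup>+a. 3 * (E1 (Tx ?i ?j a x) + W' (c x) * ennreal ((f (Tx ?r ?j a (c x)) - f (c x))\<^sup>2) + E1 x) \<partial>\<beta>)"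
    using AE_nu AE_space
  proof eventually_elim
    case (elim x)
    have w: "0 < x ?i + x ?j" using elim ij by (auto intro: AE_pos2)
    \<comment> \<open>A heavy end holds at least a quarter of the energy of the pair; hence the
      factor \<open>4 powr m\<close>.\<close>
    have bnd: "W y * heavy ?i ?j y \<le> ennreal (4 powr m) * ennreal (y ?i powr m)" if "0 < y ?i + y ?j" for y
    proof (cases "(y ?i + y ?j) / 4 \<le> y ?i")
      case True
      then have "(y ?i + y ?j) powr m \<le> (4 * y ?i) powr m" using that m by (intro powr_mono2) auto
      also have "\<dots> = 4 powr m * y ?i powr m" using True that by (simp add: powr_mult)
      finally show ?thesis using True by (simp add: W_def heavy_def ennreal_mult[symmetric])
    qed (simp add: heavy_def)
    show ?case
    proof (rule nn_integral_mono)
      fix a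
      define T where "T = Tx ?i ?j a x"
      have WT: "W T = W x" unfolding W_def T_def using ne by (simp add: Tx_pair_sum)
      have W'c: "W' (c x) = W x"
        unfolding W'_def W_def c_def using carry_outside[OF jn, of x] by (simp add: carry_end)
      have b1: "W x * heavy ?i ?j x \<le> ennreal (4 powr m) * ennreal (x ?i powr m)" by (rule bnd[OF w])
      have b2: "W x * heavy ?i ?j T \<le> ennreal (4 powr m) * ennreal (T ?i powr m)"
        using bnd[of T] w ne unfolding WT[symmetric] by (simp add: T_def Tx_pair_sum)
      have h1: "heavy ?i ?j x \<le> 1" "heavy ?i ?j T \<le> 1" by (auto simp: heavy_def)
      let ?h = "heavy ?i ?j x * heavy ?i ?j T"
      have hx: "W x * ?h \<le> W x * heavy ?i ?j x" "W x * ?h \<le> W x * heavy ?i ?j T" "W x * ?h \<le> W x * 1"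
        using mult_left_mono[OF h1(2), of "heavy ?i ?j x"] mult_right_mono[OF h1(1), of "heavy ?i ?j T"]
          mult_left_mono[OF mult_mono[OF h1], of "W x"] by (auto intro!: mult_left_mono)
      have "W x * ?h * ennreal ((f T - f x)\<^sup>2) \<le> W x * ?h * (3 * (ennreal ((f T - f (c T))\<^sup>2) + ennreal ((f (c T) - f (c x))\<^sup>2) + ennreal ((f (c x) - f x)\<^sup>2)))"
        by (intro mult_left_mono ennreal_sq3) simp
      also have "\<dots> = 3 * (W x * ?h * ennreal ((f T - f (c T))\<^sup>2) + W x * ?h * ennreal ((f (c T) - f (c x))\<^sup>2) + W x * ?h * ennreal ((f (c x) - f x)\<^sup>2))"
        by (simp add: distrib_left mult_ac)
      also have "\<dots> \<le> 3 * (E1 T + W' (c x) * ennreal ((f (Tx ?r ?j a (c x)) - f (c x))\<^sup>2) + E1 x)"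
      proof (intro mult_left_mono add_mono)
        show "W x * ?h * ennreal ((f T - f (c T))\<^sup>2) \<le> E1 T"
          using mult_right_mono[OF order_trans[OF hx(2) b2], of "ennreal ((f T - f (c T))\<^sup>2)"]
          unfolding E1_def power2_commute[of "f T"] by (simp add: mult.assoc)
        show "W x * ?h * ennreal ((f (c x) - f x)\<^sup>2) \<le> E1 x"
          using mult_right_mono[OF order_trans[OF hx(1) b1], of "ennreal ((f (c x) - f x)\<^sup>2)"]
          unfolding E1_def by (simp add: mult.assoc)
        show "W x * ?h * ennreal ((f (c T) - f (c x))\<^sup>2) \<le> W' (c x) * ennreal ((f (Tx ?r ?j a (c x)) - f (c x))\<^sup>2)"
          unfolding W'c using hx(3) by (simp add: T_def cT mult_right_mono)
      qed simp
      finally show "W x * (heavy ?i ?j x * heavy ?i ?j (Tx ?i ?j a x)) * ennreal ((f (Tx ?i ?j a x) - f x)\<^sup>2)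
         \<le> 3 * (E1 (Tx ?i ?j a x) + W' (c x) * ennreal ((f (Tx ?r ?j a (c x)) - f (c x))\<^sup>2) + E1 x)"
        unfolding T_def .
    qed
  qed
  then have "heavy_energy m f ?i ?j \<le> (\<integral>\<^sup>+x. (\<integral>\<^sup>+a. 3 * (E1 (Tx ?i ?j a x) + W' (c x) * ennreal ((f (Tx ?r ?j a (c x)) - f (c x))\<^sup>2) + E1 x) \<partial>\<beta>) \<partial>\<nu>)"
    unfolding heavy_energy_def W_def[symmetric] by (rule nn_integral_mono_AE)
  also have "\<dots> = (\<integral>\<^sup>+x. 3 * ((\<integral>\<^sup>+a. E1 (Tx ?i ?j a x) \<partial>\<beta>) + G (c x) + E1 x) \<partial>\<nu>)"
  proof (rule nn_integral_cong)
    fix x assume "x \<in> space \<nu>"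
    then have x: "x \<in> space (cfg N)" "c x \<in> space (cfg N)" using measurable_space[OF cm] by auto
    note [measurable] = Tx_measurable_fixed[OF x(1) ij(1,2)] Tx_measurable_fixed[OF x(2) ij(3,2)]
    show "(\<integral>\<^sup>+a. 3 * (E1 (Tx ?i ?j a x) + W' (c x) * ennreal ((f (Tx ?r ?j a (c x)) - f (c x))\<^sup>2) + E1 x) \<partial>\<beta>)
      = 3 * ((\<integral>\<^sup>+a. E1 (Tx ?i ?j a x) \<partial>\<beta>) + G (c x) + E1 x)"
      unfolding G_def by (simp add: nn_integral_cmult nn_integral_add beta.emeasure_space_1[simplified])
  qed
  also have "\<dots> = 3 * ((\<integral>\<^sup>+x. (\<integral>\<^sup>+a. E1 (Tx ?i ?j a x) \<partial>\<beta>) \<partial>\<nu>) + (\<integral>\<^sup>+x. G (c x) \<partial>\<nu>) + (\<integral>\<^sup>+x. E1 x \<partial>\<nu>))"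
  proof -
    have [measurable]: "(\<lambda>x. \<integral>\<^sup>+a. E1 (Tx ?i ?j a x) \<partial>\<beta>) \<in> borel_measurable (cfg N)"
      using ij by measurable
    have [measurable]: "(\<lambda>x. G (c x)) \<in> borel_measurable (cfg N)" by (rule measurable_compose[OF cm Gm])
    show ?thesis by (simp add: nn_integral_cmult nn_integral_add)
  qed
  \<comment> \<open>Stationarity removes the exchange from the carrying cost that is evaluated at
    the exchanged configuration.\<close>
  also have "\<dots> = 3 * ((\<integral>\<^sup>+x. E1 x \<partial>\<nu>) + pair_energy m f ?r ?j + (\<integral>\<^sup>+x. E1 x \<partial>\<nu>))"
    unfolding IG using ij ne by (subst resample) auto
  also have "\<dots> \<le> 3 * (ennreal (4 powr m) * (4 * of_nat n * (\<Sum>k<n. pair_energy m f (p k) (p (Suc k))))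
     + ennreal (4 powr m) * pair_energy m f ?r ?j + ennreal (4 powr m) * (4 * of_nat n * (\<Sum>k<n. pair_energy m f (p k) (p (Suc k)))))"
  proof (intro mult_left_mono add_mono IE1)
    have "ennreal 1 \<le> ennreal (4 powr m)" using m by (intro ennreal_leI) (simp add: ge_one_powr_ge_zero)
    then show "pair_energy m f ?r ?j \<le> ennreal (4 powr m) * pair_energy m f ?r ?j"
      using mult_right_mono[of 1 "ennreal (4 powr m)" "pair_energy m f ?r ?j"] by simp
  qed auto
  \<comment> \<open>24 = 3 * (4 + 4): three differences, two of which are carrying costs with
    constant 4.\<close>
  also have "\<dots> = ennreal (4 powr m) * (24 * of_nat n * (\<Sum>k<n. pair_energy m f (p k) (p (Suc k))) + 3 * pair_energy m f ?r ?j)"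
  proof -
    have "3 * (e * (4 * a * S) + e * D + e * (4 * a * S)) = e * (24 * a * S + 3 * D)" for e a S D :: ennreal
    proof -
      have 1: "e * (4 * a * S) = 4 * (e * (a * S))" by (simp only: mult_ac)
      have 2: "4 * y + 4 * y = 8 * y" for y :: ennreal
        by (simp flip: distrib_right)
      have 3: "3 * (8 * y) = 24 * y" for y :: ennreal
        by (simp flip: mult.assoc)
      have "e * (4 * a * S) + e * D + e * (4 * a * S) = (4 * (e * (a * S)) + 4 * (e * (a * S))) + e * D"
        unfolding 1 by (simp only: add_ac)
      then show ?thesis unfolding 2 by (simp only: distrib_left 3) (simp only: mult_ac)
    qed
    then show ?thesis .
  qed
  also have "\<dots> \<le> ennreal (4 powr m) * (24 * of_nat (Suc n) * (\<Sum>k<Suc n. pair_energy m f (p k) (p (Suc k))))"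
  proof (rule mult_left_mono)
    let ?S = "\<Sum>k<n. pair_energy m f (p k) (p (Suc k))" and ?D = "pair_energy m f ?r ?j"
    have "24 * of_nat n * ?S + 3 * ?D \<le> 24 * of_nat (Suc n) * ?S + 24 * of_nat (Suc n) * ?D"
    proof (intro add_mono mult_right_mono)
      show "24 * of_nat n \<le> (24 * of_nat (Suc n) :: ennreal)" by (intro mult_left_mono) auto
      have "3 = (ennreal 3)" "24 * of_nat (Suc n) = ennreal (24 * real (Suc n))"
        by (simp_all add: ennreal_mult ennreal_of_nat_eq_real_of_nat del: of_nat_Suc)
      then show "3 \<le> (24 * of_nat (Suc n) :: ennreal)" by (simp only: ennreal_le_iff2) (simp add: ennreal_leI)
    qed auto
    then show "24 * of_nat n * ?S + 3 * ?D \<le> 24 * of_nat (Suc n) * (\<Sum>k<Suc n. pair_energy m f (p k) (p (Suc k)))"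
      by (simp add: distrib_left)
  qed simp
  also have "\<dots> = ennreal (24 * 4 powr m) * of_nat (Suc n) * (\<Sum>k<Suc n. pair_energy m f (p k) (p (Suc k)))"
  proof -
    have "ennreal (24 * 4 powr m) = 24 * ennreal (4 powr m)"
      using ennreal_mult'[of 24 "4 powr m"] by simp
    then show ?thesis by (simp only: mult_ac)
  qed
  finally show ?thesis .
qed

text \<open>One path runs up from \<open>i\<close> to \<open>j\<close> for the exchanges heavy at
  \<open>i\<close>, another down from \<open>j\<close> to \<open>i\<close> for those heavy at
  \<open>j\<close>. The constant is 192 = 4 * 2 * 24.\<close>

lemma pair_energy_path:
  assumes m: "m \<ge> 0" and f [measurable]: "f \<in> borel_measurable (cfg N)" and ij: "i < j" "j < N"
  shows "emeasure \<beta> {1/4..3/4} * pair_energy m f i j \<le> ennreal (192 * 4 powr m) * of_nat (j - i) * (\<Sum>k\<in>{i..<j}. pair_energy m f k (Suc k))"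
proof -
  obtain n where n: "j = i + Suc n" using ij(1) less_iff_Suc_add by auto
  let ?S = "\<Sum>k\<in>{i..<j}. pair_energy m f k (Suc k)"
  have S1: "(\<Sum>k<Suc n. pair_energy m f (i + k) (i + Suc k)) = ?S"
  proof -
    have "?S = (\<Sum>k=0..<Suc n. pair_energy m f (k + i) (Suc (k + i)))"
      unfolding n using sum.shift_bounds_nat_ivl[of "\<lambda>k. pair_energy m f k (Suc k)" 0 i "Suc n"] by (simp add: add.commute)
    then show ?thesis by (simp add: add.commute atLeast0LessThan)
  qed
  have S2: "(\<Sum>k<Suc n. pair_energy m f (j - k) (j - Suc k)) = ?S"
  proof -
    have "(\<Sum>k<Suc n. pair_energy m f (j - k) (j - Suc k)) = (\<Sum>k<Suc n. pair_energy m f (i + (n - k)) (i + Suc (n - k)))"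
    proof (rule sum.cong[OF refl])
      fix k assume "k \<in> {..<Suc n}"
      then have "j - k = i + Suc (n - k)" "j - Suc k = i + (n - k)" "i + Suc (n - k) < N" using n ij by auto
      then show "pair_energy m f (j - k) (j - Suc k) = pair_energy m f (i + (n - k)) (i + Suc (n - k))"
        using pair_energy_sym[OF f, of "i + (n - k)" "i + Suc (n - k)"] by simp
    qed
    also have "\<dots> = (\<Sum>k<Suc n. pair_energy m f (i + k) (i + Suc k))"
      using sum.nat_diff_reindex[of "\<lambda>k. pair_energy m f (i + k) (i + Suc k)" "Suc n"] by simp
    finally show ?thesis using S1 by simp
  qed
  have h1: "heavy_energy m f i j \<le> ennreal (24 * 4 powr m) * of_nat (j - i) * ?S"
  proof -
    have "heavy_energy m f (i + 0) (i + Suc n) \<le> ennreal (24 * 4 powr m) * of_nat (Suc n) * (\<Sum>k<Suc n. pair_energy m f (i + k) (i + Suc k))"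
      using n ij by (intro heavy_energy_path[OF m f]) (auto simp: inj_on_def)
    moreover have "j - i = Suc n" using n by simp
    ultimately show ?thesis unfolding S1 by (simp only: n add_0_right)
  qed
  have "inj_on (\<lambda>k. j - k) {..Suc n}" using n by (auto simp: inj_on_def)
  then have h2: "heavy_energy m f j i \<le> ennreal (24 * 4 powr m) * of_nat (j - i) * ?S"
  proof -
    assume inj: "inj_on (\<lambda>k. j - k) {..Suc n}"
    have "heavy_energy m f (j - 0) (j - Suc n) \<le> ennreal (24 * 4 powr m) * of_nat (Suc n) * (\<Sum>k<Suc n. pair_energy m f (j - k) (j - Suc k))"
      using n ij by (intro heavy_energy_path[OF m f] inj) auto
    moreover have "j - i = Suc n" "j - Suc n = i" using n by auto
    ultimately show ?thesis unfolding S2 by (simp only: diff_zero)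
  qed
  have "emeasure \<beta> {1/4..3/4} * pair_energy m f i j \<le> 4 * (heavy_energy m f i j + heavy_energy m f j i)"
    using ij by (intro pair_energy_halves) auto
  also have "\<dots> \<le> 4 * (ennreal (24 * 4 powr m) * of_nat (j - i) * ?S + ennreal (24 * 4 powr m) * of_nat (j - i) * ?S)"
    by (intro mult_left_mono add_mono h1 h2) simp
  also have "\<dots> = ennreal (192 * 4 powr m) * of_nat (j - i) * ?S"
  proof -
    have 1: "ennreal (192 * 4 powr m) = 8 * ennreal (24 * 4 powr m)"
      using ennreal_mult'[of 8 "24 * 4 powr m"] by simp
    have 2: "4 * (y + y) = 8 * y" for y :: ennreal
      by (simp add: distrib_left flip: distrib_right)
    show ?thesis unfolding 1 2 by (simp only: mult.assoc)
  qed
  finally show ?thesis .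
qed

end

section \<open>Catalyst sites\<close>

text \<open>Fractions in \<open>{1/8..1/4}\<close> handed to two of three sites leave at least half of the energy on
  the third one.\<close>

definition unif :: "real measure" where
  "unif = uniform_measure lborel {1/8..1/4}"

lemma sets_unif [simp, measurable_cong]: "sets unif = sets borel"
  and space_unif [simp]: "space unif = UNIV"
  by (simp_all add: unif_def)

lemma prob_space_unif: "prob_space unif"
  unfolding unif_def by (rule prob_space_uniform_measure) auto

lemma AE_unif: "AE a in unif. 1/8 \<le> a \<and> a \<le> 1/4"
  unfolding unif_def by (rule AE_uniform_measureI) auto

text \<open>The factor \<open>l\<close> converts fractions of a triple into fractions of a pair
  inside it: a fraction a of the energy s is the fraction \<open>a * l\<close> of a pair with energy
  s / l. In the catalyst argument that pair holds at least half of s, hence the range from 1 to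
  2.\<close>

definition unif_dom :: "real \<Rightarrow> real \<Rightarrow> bool" where
  "unif_dom g \<kappa> \<longleftrightarrow> (\<forall>l\<in>{1..2}. \<forall>H\<in>borel_measurable borel.
     (\<integral>\<^sup>+a. H (a * l) \<partial>unif) \<le> ennreal \<kappa> * (\<integral>\<^sup>+a. H a \<partial>sym_beta g))"

lemma unif_domD:
  "unif_dom g \<kappa> \<Longrightarrow> 1 \<le> l \<Longrightarrow> l \<le> 2 \<Longrightarrow> H \<in> borel_measurable borel \<Longrightarrow>
    (\<integral>\<^sup>+a. H (a * l) \<partial>unif) \<le> ennreal \<kappa> * (\<integral>\<^sup>+a. H a \<partial>sym_beta g)"
  unfolding unif_dom_def by auto

text \<open>The products \<open>a * l\<close> stay in [1/8, 1/2], where the Beta density has a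
  positive minimum \<open>c\<close>. The 8 is the density of \<open>unif\<close>; the Jacobian
  \<open>l\<close> is at least one, which goes in the right direction.\<close>

lemma unif_dom_exists:
  assumes g: "g > 0"
  shows "\<exists>\<kappa>>0. unif_dom g \<kappa>"
proof -
  let ?d = "\<lambda>a::real. a powr (g - 1) * (1 - a) powr (g - 1) / Beta g g"
  have "continuous_on {1/8..1/2} ?d"
    by (intro continuous_intros) (use Beta_pos[OF g] in auto)
  then obtain z where z: "z \<in> {1/8..1/2}" "\<And>a. a \<in> {1/8..1/2} \<Longrightarrow> ?d z \<le> ?d a"
    using continuous_attains_inf[of "{1/8..1/2::real}" ?d] by auto
  define c where "c = ?d z"
  have c: "c > 0" unfolding c_def using z(1) Beta_pos[OF g] by auto
  have "(\<integral>\<^sup>+a. H (a * l) \<partial>unif) \<le> ennreal (8 / c) * (\<integral>\<^sup>+a. H a \<partial>sym_beta g)"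
    if l: "1 \<le> l" "l \<le> 2" and [measurable]: "H \<in> borel_measurable borel" for l :: real and H
  proof -
    have "(\<integral>\<^sup>+a. H (a * l) \<partial>unif) = 8 * (\<integral>\<^sup>+a. H (a * l) * indicator {1/8..1/4} a \<partial>lborel)"
    proof -
      have "(\<integral>\<^sup>+a. H (a * l) \<partial>unif) = (\<integral>\<^sup>+a. H (a * l) * indicator {1/8..1/4} a \<partial>lborel) / emeasure lborel {1/8..1/4::real}"
        unfolding unif_def by (subst nn_integral_uniform_measure) auto
      moreover have "emeasure lborel {1/8..1/4::real} = ennreal (1/8)" by simp
      ultimately show ?thesis
        by (simp only: divide_ennreal_def inverse_ennreal) (simp add: inverse_ennreal mult.commute)
    qed
    also have "(\<integral>\<^sup>+a. H (a * l) * indicator {1/8..1/4} a \<partial>lborel)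
       \<le> ennreal \<bar>l\<bar> * (\<integral>\<^sup>+a. H (0 + l * a) * indicator {1/8..1/4} a \<partial>lborel)"
      using l mult_right_mono[of 1 "ennreal \<bar>l\<bar>" "(\<integral>\<^sup>+a. H (l * a) * indicator {1/8..1/4} a \<partial>lborel)"]
      by (simp add: mult.commute[of _ l] ennreal_leI[of 1, simplified])
    also have "\<dots> = ennreal \<bar>l\<bar> * (\<integral>\<^sup>+a. (\<lambda>u. H u * indicator {1/8..1/4} (u / l)) (0 + l * a) \<partial>lborel)"
      using l by simp
    also have "\<dots> = (\<integral>\<^sup>+u. H u * indicator {1/8..1/4} (u / l) \<partial>lborel)"
      using l by (intro nn_integral_real_affine[symmetric]) auto
    also have "\<dots> \<le> (\<integral>\<^sup>+u. ennreal (1 / c) * (ennreal (indicator {0<..<1} u * (u powr (g - 1) * (1 - u) powr (g - 1)) / Beta g g) * H u) \<partial>lborel)"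
    proof (rule nn_integral_mono)
      fix u :: real
      show "H u * indicator {1/8..1/4} (u / l) \<le> ennreal (1 / c) * (ennreal (indicator {0<..<1} u * (u powr (g - 1) * (1 - u) powr (g - 1)) / Beta g g) * H u)"
      proof (cases "u / l \<in> {1/8..1/4}")
        case True
        then have "l / 8 \<le> u" "u \<le> l / 4" using l by (auto simp: field_simps)
        then have u: "1/8 \<le> u" "u \<le> 1/2" using l by auto
        have "1 \<le> 1 / c * ?d u" 
        proof -
          have "c \<le> ?d u" using z(2)[of u] u unfolding c_def by simp
          then have "1 \<le> ?d u / c" using c by (subst pos_le_divide_eq) auto
          then show ?thesis by (simp add: mult.commute)
        qed
        then have "ennreal 1 \<le> ennreal (1 / c * ?d u)" by (rule ennreal_leI)
        also have "\<dots> = ennreal (1 / c) * ennreal (?d u)"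
          using c by (intro ennreal_mult') auto
        finally have "1 * H u \<le> ennreal (1 / c) * ennreal (?d u) * H u" by (intro mult_right_mono) auto
        then show ?thesis using True u by (simp add: mult.assoc)
      qed simp
    qed
    also have "\<dots> = ennreal (1 / c) * (\<integral>\<^sup>+a. H a \<partial>sym_beta g)"
      by (simp add: nn_integral_cmult nn_integral_sym_beta)
    finally have "(\<integral>\<^sup>+a. H (a * l) \<partial>unif) \<le> 8 * (ennreal (1 / c) * (\<integral>\<^sup>+a. H a \<partial>sym_beta g))"
      by (simp add: mult_left_mono)
    also have "\<dots> = ennreal (8 / c) * (\<integral>\<^sup>+a. H a \<partial>sym_beta g)"
    proof -
      have "8 * ennreal (1 / c) = ennreal (8 / c)"
        using c ennreal_mult'[of 8 "1 / c"] by simp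
      then show ?thesis by (simp add: mult.assoc[symmetric])
    qed
    finally show ?thesis .
  qed
  then show ?thesis using c unfolding unif_dom_def by (intro exI[of _ "8 / c"]) auto
qed

text \<open>The common random configuration of the catalyst argument. It depends on the three sites
  only through their total energy, so it is the same before and after an exchange of
  \<open>i\<close> and \<open>j\<close>.\<close>

definition split3 :: "nat \<Rightarrow> nat \<Rightarrow> nat \<Rightarrow> real \<Rightarrow> real \<Rightarrow> (nat \<Rightarrow> real) \<Rightarrow> nat \<Rightarrow> real" where
  "split3 i j k a b x = x(i := a * (x i + x j + x k), j := b * (x i + x j + x k), k := (1 - a - b) * (x i + x j + x k))"

lemma measurable_split3 [measurable (raw)]:
  assumes "h \<in> M \<rightarrow>\<^sub>M cfg N" "g \<in> borel_measurable M" "g' \<in> borel_measurable M" and "i < N" "j < N" "k < N"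
  shows "(\<lambda>x. split3 i j k (g x) (g' x) (h x)) \<in> M \<rightarrow>\<^sub>M cfg N"
  using assms unfolding split3_def by measurable

context energy_simplex begin

text \<open>If site \<open>k\<close> carries less than half of the energy of the three sites then already
  \<open>x\<^sub>k \<le> x\<^sub>i + x\<^sub>j\<close>. Otherwise the configurations before and after the exchange are both connected to
  a common random configuration by exchanges involving \<open>k\<close>, which have weight at least \<open>x\<^sub>k\<^sup>m\<close>.\<close>

lemma catalyst:
  assumes m: "m \<ge> 0" and \<kappa>: "unif_dom \<gamma> \<kappa>" "\<kappa> > 0" and f [measurable]: "f \<in> borel_measurable (cfg N)"
    and ijk: "i < N" "j < N" "k < N" "i \<noteq> j" "i \<noteq> k" "j \<noteq> k"
  shows "jump i j f (\<lambda>x. ennreal (x k powr m)) \<le>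
    pair_energy m f i j + ennreal (8 * \<kappa>) * pair_energy m f i k + ennreal (8 * \<kappa>\<^sup>2 * 2 powr m) * pair_energy m f j k"
proof -
  interpret U: prob_space unif by (rule prob_space_unif)
  define s where "s x = x i + x j + x k" for x :: "nat \<Rightarrow> real"
  \<comment> \<open>\<open>V\<close> and \<open>V'\<close> split the weight
    \<open>x k powr m\<close> by whether the catalyst holds at least half of the triple. An exchange
    of \<open>i\<close> and \<open>j\<close> changes neither \<open>s\<close> nor
    \<open>x k\<close>, so \<open>V\<close> is invariant under it.\<close>
  define V where "V x = (if s x / 2 \<le> x k then ennreal (x k powr m) else 0)" for x
  define V' where "V' x = (if s x / 2 \<le> x k then 0 else ennreal (x k powr m))" for x
  let ?z = "split3 i j k"
  have z_def: "?z a b x = x(i := a * s x, j := b * s x, k := (1 - a - b) * s x)" for a b x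
    by (simp add: split3_def s_def)
  \<comment> \<open>Halfway point: an exchange of \<open>i\<close> and \<open>k\<close> gives site
    \<open>i\<close> its final energy \<open>a * s x\<close>, and an exchange of \<open>j\<close>
    and \<open>k\<close> then leads on to \<open>?z a b x\<close>.\<close>
  define y where "y a x = Tx i k (a * (s x / (x i + x k))) x" for a x
  have [measurable]: "V \<in> borel_measurable (cfg N)" "V' \<in> borel_measurable (cfg N)" "s \<in> borel_measurable (cfg N)"
    unfolding V_def[abs_def] V'_def[abs_def] s_def[abs_def] using ijk by measurable
  have sT: "s (Tx i j a x) = s x" "Tx i j a x k = x k" for a x
    using ijk by (auto simp: s_def Tx_pair_sum) (auto simp: Tx_def)
  have VT: "V (Tx i j a x) = V x" for a x by (simp add: V_def sT)
  have zT: "?z a b (Tx i j c x) = ?z a b x" for a b c x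
    using ijk by (simp add: z_def sT fun_eq_iff) (auto simp: Tx_def)
  define \<Psi> where "\<Psi> x = V x * (\<integral>\<^sup>+a. (\<integral>\<^sup>+b. ennreal ((f (?z a b x) - f x)\<^sup>2) \<partial>unif) \<partial>unif)" for x
  have [measurable]: "\<Psi> \<in> borel_measurable (cfg N)"
    unfolding \<Psi>_def[abs_def] using ijk by measurable
  define G where "G w = (\<integral>\<^sup>+a. ennreal ((w j + w k) powr m) * ennreal ((f (Tx j k a w) - f w)\<^sup>2) \<partial>\<beta>)" for w
  have Gm [measurable]: "G \<in> borel_measurable (cfg N)" unfolding G_def[abs_def] using ijk by measurable
  have split: "jump i j f (\<lambda>x. ennreal (x k powr m)) = jump i j f V' + (\<integral>\<^sup>+x. (\<integral>\<^sup>+a. V x * ennreal ((f (Tx i j a x) - f x)\<^sup>2) \<partial>\<beta>) \<partial>\<nu>)"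
  proof -
    have "jump i j f (\<lambda>x. ennreal (x k powr m)) = jump i j f (\<lambda>x. V' x + V x)"
      unfolding jump_def by (intro nn_integral_cong) (simp add: V_def V'_def)
    also have "\<dots> = jump i j f V' + jump i j f V"
      unfolding jump_def distrib_right using ijk by (intro nn_integral_add) measurable
    also have "jump i j f V = (\<integral>\<^sup>+x. (\<integral>\<^sup>+a. V x * ennreal ((f (Tx i j a x) - f x)\<^sup>2) \<partial>\<beta>) \<partial>\<nu>)"
      using ijk by (intro jump_eq) auto
    finally show ?thesis .
  qed
  have light: "jump i j f V' \<le> pair_energy m f i j"
    unfolding pair_energy_def
  proof (rule jump_mono, use AE_nu in eventually_elim)
    case (elim x)
    then have p: "0 < x i" "0 < x j" "0 < x k" using ijk by auto
    show ?case
    proof (cases "s x / 2 \<le> x k")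
      case False
      then have "x k powr m \<le> (x i + x j) powr m" using p m by (intro powr_mono2) (auto simp: s_def)
      then show ?thesis using False by (simp add: V'_def ennreal_leI)
    qed (simp add: V'_def)
  qed
  \<comment> \<open>\<open>x\<close> and its exchanged configuration are compared with the same
    \<open>?z a b x\<close>. The two costs agree by stationarity, which gives 2 + 2.\<close>
  have heavy1: "(\<integral>\<^sup>+x. (\<integral>\<^sup>+a. V x * ennreal ((f (Tx i j a x) - f x)\<^sup>2) \<partial>\<beta>) \<partial>\<nu>) \<le> 4 * (\<integral>\<^sup>+x. \<Psi> x \<partial>\<nu>)"
  proof -
    have pt: "V x * ennreal ((f (Tx i j c x) - f x)\<^sup>2) \<le> 2 * \<Psi> (Tx i j c x) + 2 * \<Psi> x" if x: "x \<in> space (cfg N)" for c x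
    proof -
      let ?e = "\<lambda>w a b. ennreal ((f (?z a b w) - f w)\<^sup>2)"
      have Tc: "Tx i j c x \<in> space (cfg N)" by (rule Tx_space[OF ijk(1,2) x])
      have me: "(\<lambda>(a, b). ?z a b w) \<in> borel \<Otimes>\<^sub>M borel \<rightarrow>\<^sub>M cfg N" if "w \<in> space (cfg N)" for w
        unfolding case_prod_beta' using ijk that by (intro measurable_split3) auto
      note [measurable] = me[OF x] me[OF Tc]
      have "ennreal ((f (Tx i j c x) - f x)\<^sup>2) = (\<integral>\<^sup>+a. (\<integral>\<^sup>+b. ennreal ((f (Tx i j c x) - f x)\<^sup>2) \<partial>unif) \<partial>unif)"
        by (simp add: U.emeasure_space_1[simplified])
      also have "\<dots> \<le> (\<integral>\<^sup>+a. (\<integral>\<^sup>+b. 2 * ?e (Tx i j c x) a b + 2 * ?e x a b \<partial>unif) \<partial>unif)"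
      proof (intro nn_integral_mono)
        fix a b
        show "ennreal ((f (Tx i j c x) - f x)\<^sup>2) \<le> 2 * ?e (Tx i j c x) a b + 2 * ?e x a b"
          using ennreal_sq2[of "f (Tx i j c x)" "f x" "f (?z a b x)"]
          by (simp add: zT power2_commute[of "f (Tx i j c x)"])
      qed
      also have "\<dots> = 2 * (\<integral>\<^sup>+a. (\<integral>\<^sup>+b. ?e (Tx i j c x) a b \<partial>unif) \<partial>unif) + 2 * (\<integral>\<^sup>+a. (\<integral>\<^sup>+b. ?e x a b \<partial>unif) \<partial>unif)"
        by (simp add: nn_integral_add nn_integral_cmult)
      finally have "V x * ennreal ((f (Tx i j c x) - f x)\<^sup>2) \<le> V x * \<dots>" by (rule mult_left_mono) simp
      then show ?thesis by (simp add: \<Psi>_def VT distrib_left mult_ac)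
    qed
    have "(\<integral>\<^sup>+x. (\<integral>\<^sup>+a. V x * ennreal ((f (Tx i j a x) - f x)\<^sup>2) \<partial>\<beta>) \<partial>\<nu>) \<le> (\<integral>\<^sup>+x. (\<integral>\<^sup>+a. 2 * \<Psi> (Tx i j a x) + 2 * \<Psi> x \<partial>\<beta>) \<partial>\<nu>)"
      by (intro nn_integral_mono pt) simp
    also have "\<dots> = (\<integral>\<^sup>+x. 2 * (\<integral>\<^sup>+a. \<Psi> (Tx i j a x) \<partial>\<beta>) + 2 * \<Psi> x \<partial>\<nu>)"
    proof (rule nn_integral_cong)
      fix x assume "x \<in> space \<nu>"
      then have x: "x \<in> space (cfg N)" by simp
      note [measurable] = Tx_measurable_fixed[OF x ijk(1,2)]
      show "(\<integral>\<^sup>+a. 2 * \<Psi> (Tx i j a x) + 2 * \<Psi> x \<partial>\<beta>) = 2 * (\<integral>\<^sup>+a. \<Psi> (Tx i j a x) \<partial>\<beta>) + 2 * \<Psi> x"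
        by (simp add: nn_integral_cmult nn_integral_add beta.emeasure_space_1[simplified])
    qed
    also have "\<dots> = 2 * (\<integral>\<^sup>+x. (\<integral>\<^sup>+a. \<Psi> (Tx i j a x) \<partial>\<beta>) \<partial>\<nu>) + 2 * (\<integral>\<^sup>+x. \<Psi> x \<partial>\<nu>)"
    proof -
      have [measurable]: "(\<lambda>x. \<integral>\<^sup>+a. \<Psi> (Tx i j a x) \<partial>\<beta>) \<in> borel_measurable (cfg N)"
        using ijk by measurable
      show ?thesis by (simp add: nn_integral_cmult nn_integral_add)
    qed
    also have "\<dots> = 4 * (\<integral>\<^sup>+x. \<Psi> x \<partial>\<nu>)"
      using ijk by (subst resample) (auto simp: distrib_right[symmetric])
    finally show ?thesis .
  qed
  have heavy2: "AE x in \<nu>. \<Psi> x \<le> 2 * (ennreal (\<kappa>\<^sup>2 * 2 powr m) * (\<integral>\<^sup>+a. G (Tx i k a x) \<partial>\<beta>))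
      + 2 * (ennreal \<kappa> * (ennreal ((x i + x k) powr m) * (\<integral>\<^sup>+a. ennreal ((f (Tx i k a x) - f x)\<^sup>2) \<partial>\<beta>)))"
    using AE_nu AE_space
  proof eventually_elim
    case (elim x)
    then have x: "x \<in> space (cfg N)" and p: "0 < x i" "0 < x j" "0 < x k" using ijk by auto
    then have s: "0 < s x" by (auto simp: s_def)
    note [measurable] = Tx_measurable_fixed[OF x ijk(1,3)]
    show ?case
    proof (cases "s x / 2 \<le> x k")
      case False
      then show ?thesis by (simp add: \<Psi>_def V_def)
    next
      case True
      define l where "l = s x / (x i + x k)"
      have l: "1 \<le> l" "l \<le> 2" unfolding l_def using True p by (auto simp: s_def field_simps)
      have ya: "y a x = Tx i k (a * l) x" for a by (simp add: y_def l_def)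
      have lw: "l * (x i + x k) = s x" unfolding l_def using p by simp
      have yi: "y a x = x(i := a * s x, k := s x - x j - a * s x)" for a
      proof -
        have "(1 - a * l) * (x i + x k) = s x - x j - a * s x"
          by (simp add: left_diff_distrib mult.assoc lw) (simp add: s_def)
        then show ?thesis unfolding ya Tx_def by (simp add: mult.assoc lw)
      qed
      have yjk: "y a x j + y a x k = (1 - a) * s x" for a
        using ijk by (simp add: yi algebra_simps)
      \<comment> \<open>After the first exchange the sites \<open>j\<close> and \<open>k\<close>
        share the fraction 1 - a of the triple, so \<open>b\<close> has to be rescaled to b / (1 -
        a).\<close>
      have zy: "?z a b x = Tx j k (b * (1 / (1 - a))) (y a x)" if "1/8 \<le> a" "a \<le> 1/4" for a b
      proof -
        have "b * (1 / (1 - a)) * ((1 - a) * s x) = b * s x" using that by simp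
        moreover have "(1 - b * (1 / (1 - a))) * ((1 - a) * s x) = (1 - a - b) * s x"
          using that by (simp add: field_simps)
        ultimately show ?thesis using ijk
          unfolding Tx_def yjk z_def by (auto simp: yi fun_eq_iff)
      qed
      have ys: "y a x \<in> space (cfg N)" for a unfolding ya by (rule Tx_space[OF ijk(1,3) x])
      have Vx: "V x = ennreal (x k powr m)" using True by (simp add: V_def)
      let ?e1 = "\<lambda>a b. ennreal ((f (?z a b x) - f (y a x))\<^sup>2)"
      let ?e2 = "\<lambda>a. ennreal ((f (y a x) - f x)\<^sup>2)"
      have [measurable]: "(\<lambda>a. y a x) \<in> borel \<rightarrow>\<^sub>M cfg N" unfolding ya by measurable
      have [measurable]: "(\<lambda>(a, b). ?z a b x) \<in> borel \<Otimes>\<^sub>M borel \<rightarrow>\<^sub>M cfg N"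
        unfolding case_prod_beta' using ijk x by (intro measurable_split3) auto
      have "\<Psi> x \<le> V x * (\<integral>\<^sup>+a. (\<integral>\<^sup>+b. 2 * ?e1 a b + 2 * ?e2 a \<partial>unif) \<partial>unif)"
        unfolding \<Psi>_def by (intro mult_left_mono nn_integral_mono ennreal_sq2) simp
      also have "\<dots> = 2 * (V x * (\<integral>\<^sup>+a. (\<integral>\<^sup>+b. ?e1 a b \<partial>unif) \<partial>unif)) + 2 * (V x * (\<integral>\<^sup>+a. ?e2 a \<partial>unif))"
        by (simp add: nn_integral_add nn_integral_cmult U.emeasure_space_1[simplified] distrib_left mult_ac)
      also have "\<dots> \<le> 2 * (ennreal (\<kappa>\<^sup>2 * 2 powr m) * (\<integral>\<^sup>+a. G (Tx i k a x) \<partial>\<beta>))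
      + 2 * (ennreal \<kappa> * (ennreal ((x i + x k) powr m) * (\<integral>\<^sup>+a. ennreal ((f (Tx i k a x) - f x)\<^sup>2) \<partial>\<beta>)))"
      proof (intro add_mono mult_left_mono)
        have "(\<integral>\<^sup>+a. ?e2 a \<partial>unif) \<le> ennreal \<kappa> * (\<integral>\<^sup>+a. ennreal ((f (Tx i k a x) - f x)\<^sup>2) \<partial>\<beta>)"
          unfolding ya by (rule unif_domD[OF \<kappa>(1) l, of "\<lambda>a. ennreal ((f (Tx i k a x) - f x)\<^sup>2)"]) measurable
        moreover have "V x \<le> ennreal ((x i + x k) powr m)"
          unfolding Vx using p m by (intro ennreal_leI powr_mono2) auto
        ultimately have "V x * (\<integral>\<^sup>+a. ?e2 a \<partial>unif) \<le> ennreal ((x i + x k) powr m) * (ennreal \<kappa> * (\<integral>\<^sup>+a. ennreal ((f (Tx i k a x) - f x)\<^sup>2) \<partial>\<beta>))"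
          by (intro mult_mono) auto
        then show "V x * (\<integral>\<^sup>+a. ?e2 a \<partial>unif) \<le> ennreal \<kappa> * (ennreal ((x i + x k) powr m) * (\<integral>\<^sup>+a. ennreal ((f (Tx i k a x) - f x)\<^sup>2) \<partial>\<beta>))"
          by (simp add: mult_ac)
        have in1: "V x * (\<integral>\<^sup>+b. ?e1 a b \<partial>unif) \<le> ennreal (\<kappa> * 2 powr m) * G (y a x)" if a: "1/8 \<le> a" "a \<le> 1/4" for a
        proof -
          note [measurable] = Tx_measurable_fixed[OF ys[of a] ijk(2,3)]
          have "1 / (1 - a) \<in> {1..2}" using a by (auto simp: field_simps)
          then have "(\<integral>\<^sup>+b. ?e1 a b \<partial>unif) \<le> ennreal \<kappa> * (\<integral>\<^sup>+b. ennreal ((f (Tx j k b (y a x)) - f (y a x))\<^sup>2) \<partial>\<beta>)"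
            using \<kappa>(1)[unfolded unif_dom_def, rule_format, of "1 / (1 - a)" "\<lambda>b. ennreal ((f (Tx j k b (y a x)) - f (y a x))\<^sup>2)"]
            unfolding zy[OF a] by auto
          moreover have "V x \<le> ennreal (2 powr m * (y a x j + y a x k) powr m)"
          proof -
            \<comment> \<open>At the halfway point the pair \<open>j\<close>, \<open>k\<close> still
              holds at least half of \<open>s x\<close>, because \<open>a\<close> is at most 1/4;
              this costs the factor \<open>2 powr m\<close>.\<close>
            have "x k \<le> s x" using p by (simp add: s_def)
            also have "s x \<le> 2 * ((1 - a) * s x)" using a s by simp
            finally have "x k powr m \<le> (2 * ((1 - a) * s x)) powr m" using p m by (intro powr_mono2) auto
            also have "\<dots> = 2 powr m * ((1 - a) * s x) powr m" using a s by (simp add: powr_mult)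
            finally show ?thesis unfolding Vx yjk by (rule ennreal_leI)
          qed
          ultimately have "V x * (\<integral>\<^sup>+b. ?e1 a b \<partial>unif) \<le> ennreal (2 powr m * (y a x j + y a x k) powr m) *
              (ennreal \<kappa> * (\<integral>\<^sup>+b. ennreal ((f (Tx j k b (y a x)) - f (y a x))\<^sup>2) \<partial>\<beta>))"
            by (intro mult_mono) auto
          also have "\<dots> = ennreal (\<kappa> * 2 powr m) * G (y a x)"
            unfolding G_def using \<kappa>(2) by (simp add: nn_integral_cmult ennreal_mult mult_ac)
          finally show ?thesis .
        qed
        have "V x * (\<integral>\<^sup>+a. (\<integral>\<^sup>+b. ?e1 a b \<partial>unif) \<partial>unif) = (\<integral>\<^sup>+a. V x * (\<integral>\<^sup>+b. ?e1 a b \<partial>unif) \<partial>unif)"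
          by (simp add: nn_integral_cmult)
        also have "\<dots> \<le> (\<integral>\<^sup>+a. ennreal (\<kappa> * 2 powr m) * G (y a x) \<partial>unif)"
          by (rule nn_integral_mono_AE, use AE_unif in eventually_elim) (auto intro: in1)
        also have "\<dots> = ennreal (\<kappa> * 2 powr m) * (\<integral>\<^sup>+a. G (Tx i k (a * l) x) \<partial>unif)"
          unfolding ya by (simp add: nn_integral_cmult)
        also have "\<dots> \<le> ennreal (\<kappa> * 2 powr m) * (ennreal \<kappa> * (\<integral>\<^sup>+a. G (Tx i k a x) \<partial>\<beta>))"
          using unif_domD[OF \<kappa>(1) l, of "\<lambda>a. G (Tx i k a x)"] by (intro mult_left_mono) auto
        also have "\<dots> = ennreal (\<kappa>\<^sup>2 * 2 powr m) * (\<integral>\<^sup>+a. G (Tx i k a x) \<partial>\<beta>)"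
          using \<kappa>(2) by (simp add: ennreal_mult power2_eq_square mult_ac)
        finally show "V x * (\<integral>\<^sup>+a. (\<integral>\<^sup>+b. ?e1 a b \<partial>unif) \<partial>unif) \<le> ennreal (\<kappa>\<^sup>2 * 2 powr m) * (\<integral>\<^sup>+a. G (Tx i k a x) \<partial>\<beta>)" .
      qed auto
      finally show ?thesis .
    qed
  qed
  have "(\<integral>\<^sup>+x. \<Psi> x \<partial>\<nu>) \<le> 2 * (ennreal (\<kappa>\<^sup>2 * 2 powr m) * pair_energy m f j k) + 2 * (ennreal \<kappa> * pair_energy m f i k)"
  proof -
    have [measurable]: "(\<lambda>x. \<integral>\<^sup>+a. G (Tx i k a x) \<partial>\<beta>) \<in> borel_measurable (cfg N)"
      "(\<lambda>x. \<integral>\<^sup>+a. ennreal ((f (Tx i k a x) - f x)\<^sup>2) \<partial>\<beta>) \<in> borel_measurable (cfg N)"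
      "(\<lambda>x. ennreal ((x i + x k) powr m)) \<in> borel_measurable (cfg N)"
      using ijk by measurable
    have "(\<integral>\<^sup>+x. \<Psi> x \<partial>\<nu>) \<le> 2 * (ennreal (\<kappa>\<^sup>2 * 2 powr m) * (\<integral>\<^sup>+x. (\<integral>\<^sup>+a. G (Tx i k a x) \<partial>\<beta>) \<partial>\<nu>)) + 2 * (ennreal \<kappa> * pair_energy m f i k)"
      using nn_integral_mono_AE[OF heavy2] unfolding pair_energy_def jump_def
      by (simp add: nn_integral_add nn_integral_cmult)
    also have "(\<integral>\<^sup>+x. (\<integral>\<^sup>+a. G (Tx i k a x) \<partial>\<beta>) \<partial>\<nu>) = pair_energy m f j k"
    proof -
      have "(\<integral>\<^sup>+x. (\<integral>\<^sup>+a. G (Tx i k a x) \<partial>\<beta>) \<partial>\<nu>) = (\<integral>\<^sup>+x. G x \<partial>\<nu>)" using ijk by (intro resample) auto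
      then show ?thesis unfolding pair_energy_def G_def using ijk by (subst jump_eq) auto
    qed
    finally show ?thesis .
  qed
  then have "(\<integral>\<^sup>+x. (\<integral>\<^sup>+a. V x * ennreal ((f (Tx i j a x) - f x)\<^sup>2) \<partial>\<beta>) \<partial>\<nu>) \<le> 4 * (2 * (ennreal (\<kappa>\<^sup>2 * 2 powr m) * pair_energy m f j k) + 2 * (ennreal \<kappa> * pair_energy m f i k))"
    by (intro order_trans[OF heavy1] mult_left_mono) auto
  also have "\<dots> = ennreal (8 * \<kappa>) * pair_energy m f i k + ennreal (8 * \<kappa>\<^sup>2 * 2 powr m) * pair_energy m f j k"
    using \<kappa>(2) by (simp add: ennreal_mult distrib_left mult_ac)
  finally show ?thesis unfolding split using light by (simp add: add_mono add.assoc)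
qed

section \<open>Averages of resampling operators\<close>

text \<open>Bounded at every configuration and not just almost everywhere, because
  \<open>resample_avg\<close> integrates along each single fibre.\<close>

definition bmeas :: "((nat \<Rightarrow> real) \<Rightarrow> real) set" where
  "bmeas = {f. f \<in> borel_measurable (cfg N) \<and> (\<exists>K. \<forall>x\<in>space (cfg N). \<bar>f x\<bar> \<le> K)}"

lemma bmeas_I: "f \<in> borel_measurable (cfg N) \<Longrightarrow> (\<And>x. x \<in> space (cfg N) \<Longrightarrow> \<bar>f x\<bar> \<le> K) \<Longrightarrow> f \<in> bmeas"
  by (auto simp: bmeas_def)

lemma bmeas_measurable [measurable_dest]: "f \<in> bmeas \<Longrightarrow> f \<in> borel_measurable (cfg N)"
  by (auto simp: bmeas_def)

lemma bmeas_bound: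
  assumes "f \<in> bmeas"
  obtains K where "K \<ge> 0" "\<And>x. x \<in> space (cfg N) \<Longrightarrow> \<bar>f x\<bar> \<le> K"
proof -
  from assms obtain K where "\<forall>x\<in>space (cfg N). \<bar>f x\<bar> \<le> K" by (auto simp: bmeas_def)
  then have "\<And>x. x \<in> space (cfg N) \<Longrightarrow> \<bar>f x\<bar> \<le> \<bar>K\<bar>" by (meson abs_ge_self order_trans)
  then show ?thesis using that[of "\<bar>K\<bar>"] by auto
qed

lemma bmeas_const [simp, intro]: "(\<lambda>_. c) \<in> bmeas"
  by (rule bmeas_I[where K="\<bar>c\<bar>"]) auto

lemma bmeas_add [simp, intro]:
  assumes "f \<in> bmeas" "g \<in> bmeas" shows "(\<lambda>x. f x + g x) \<in> bmeas"
proof -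
  obtain K where K: "\<And>x. x \<in> space (cfg N) \<Longrightarrow> \<bar>f x\<bar> \<le> K" using bmeas_bound[OF assms(1)] by metis
  obtain L where L: "\<And>x. x \<in> space (cfg N) \<Longrightarrow> \<bar>g x\<bar> \<le> L" using bmeas_bound[OF assms(2)] by metis
  note [measurable] = assms[THEN bmeas_measurable]
  show ?thesis
    by (rule bmeas_I[where K="K + L"], measurable) (use K L in \<open>meson abs_triangle_ineq add_mono order_trans\<close>)
qed

lemma bmeas_mult [simp, intro]:
  assumes "f \<in> bmeas" "g \<in> bmeas" shows "(\<lambda>x. f x * g x) \<in> bmeas"
proof -
  obtain K where K: "K \<ge> 0" "\<And>x. x \<in> space (cfg N) \<Longrightarrow> \<bar>f x\<bar> \<le> K" using bmeas_bound[OF assms(1)] by metis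
  obtain L where L: "L \<ge> 0" "\<And>x. x \<in> space (cfg N) \<Longrightarrow> \<bar>g x\<bar> \<le> L" using bmeas_bound[OF assms(2)] by metis
  note [measurable] = assms[THEN bmeas_measurable]
  show ?thesis
    by (rule bmeas_I[where K="K * L"], measurable) (use K L in \<open>auto simp: abs_mult intro!: mult_mono\<close>)
qed

lemma bmeas_diff [simp, intro]:
  assumes "f \<in> bmeas" "g \<in> bmeas" shows "(\<lambda>x. f x - g x) \<in> bmeas"
  using bmeas_add[OF assms(1) bmeas_mult[OF bmeas_const[of "-1"] assms(2)]] by simp

lemma bmeas_power [simp, intro]: "f \<in> bmeas \<Longrightarrow> (\<lambda>x. (f x) ^ n) \<in> bmeas"
  by (induction n) auto

lemma bmeas_sum [simp, intro]: "(\<And>i. i \<in> I \<Longrightarrow> f i \<in> bmeas) \<Longrightarrow> (\<lambda>x. \<Sum>i\<in>I. f i x) \<in> bmeas"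
  by (induction I rule: infinite_finite_induct) auto

lemma bmeas_divide [simp, intro]: "f \<in> bmeas \<Longrightarrow> (\<lambda>x. f x / c) \<in> bmeas"
  using bmeas_mult[of f "\<lambda>_. 1 / c"] by simp

lemma bmeas_integrable [simp, intro]:
  assumes "f \<in> bmeas" shows "integrable \<nu> f"
proof -
  obtain K where K: "\<And>x. x \<in> space (cfg N) \<Longrightarrow> \<bar>f x\<bar> \<le> K" using bmeas_bound[OF assms] by metis
  note [measurable] = assms[THEN bmeas_measurable]
  show ?thesis by (rule fin.integrable_const_bound[where B=K]) (auto intro!: AE_I2 K)
qed

definition ip :: "((nat \<Rightarrow> real) \<Rightarrow> real) \<Rightarrow> ((nat \<Rightarrow> real) \<Rightarrow> real) \<Rightarrow> real" where
  "ip f g = (\<integral>x. f x * g x \<partial>\<nu>)"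

lemma ip_commute: "ip f g = ip g f"
  by (simp add: ip_def mult.commute)

lemma ip_nonneg [simp]: "0 \<le> ip f f"
  by (auto simp: ip_def intro!: integral_nonneg_AE)

lemma ip_sq_diff:
  assumes "f \<in> bmeas" "g \<in> bmeas"
  shows "(\<integral>x. (f x - g x)\<^sup>2 \<partial>\<nu>) = ip f f - 2 * ip f g + ip g g"
proof -
  have "(\<integral>x. (f x - g x)\<^sup>2 \<partial>\<nu>) = (\<integral>x. f x * f x - 2 * (f x * g x) + g x * g x \<partial>\<nu>)"
    by (intro Bochner_Integration.integral_cong) (auto simp: power2_eq_square algebra_simps)
  then show ?thesis using assms by (simp add: ip_def)
qed

lemma ip_two: "f \<in> bmeas \<Longrightarrow> g \<in> bmeas \<Longrightarrow> 2 * ip f g \<le> ip f f + ip g g"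
proof -
  assume fg: "f \<in> bmeas" "g \<in> bmeas"
  have "0 \<le> (\<integral>x. (f x - g x)\<^sup>2 \<partial>\<nu>)" by (intro integral_nonneg_AE) auto
  then show ?thesis using ip_sq_diff[OF fg] by simp
qed

text \<open>Functions are not identified up to null sets, so \<open>ip\<close> is only semidefinite
  and a null \<open>g\<close> needs its own case: there a suitable multiple of \<open>g\<close>
  would violate \<open>ip_two\<close> if the pairing did not vanish.\<close>

lemma ip_Cauchy:
  assumes f: "f \<in> bmeas" "g \<in> bmeas"
  shows "(ip f g)\<^sup>2 \<le> ip f f * ip g g"
proof (cases "ip g g = 0")
  case True
  have "ip f g = 0"
  proof (rule ccontr)
    assume ne: "ip f g \<noteq> 0"
    define t where "t = (ip f f + 1) / ip f g"
    have "2 * ip f (\<lambda>x. t * g x) \<le> ip f f + ip (\<lambda>x. t * g x) (\<lambda>x. t * g x)"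
      using f by (intro ip_two) auto
    moreover have "ip f (\<lambda>x. t * g x) = t * ip f g"
      unfolding ip_def by (simp add: mult.left_commute[of _ t])
    moreover have "ip (\<lambda>x. t * g x) (\<lambda>x. t * g x) = t * t * ip g g"
    proof -
      have "t * g x * (t * g x) = t * t * (g x * g x)" for x by simp
      then show ?thesis by (simp only: ip_def integral_mult_right_zero)
    qed
    ultimately have "2 * (ip f f + 1) \<le> ip f f" using ne True by (simp add: t_def)
    then show False using ip_nonneg[of f] by simp
  qed
  then show ?thesis by simp
next
  case False
  define t where "t = ip f g / ip g g"
  have "2 * ip f (\<lambda>x. t * g x) \<le> ip f f + ip (\<lambda>x. t * g x) (\<lambda>x. t * g x)"
    using f by (intro ip_two) auto
  moreover have "ip f (\<lambda>x. t * g x) = t * ip f g"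
    unfolding ip_def by (simp add: mult.left_commute[of _ t])
  moreover have "ip (\<lambda>x. t * g x) (\<lambda>x. t * g x) = t * t * ip g g"
  proof -
    have "t * g x * (t * g x) = t * t * (g x * g x)" for x by simp
    then show ?thesis by (simp only: ip_def integral_mult_right_zero)
  qed
  ultimately have "2 * (t * ip f g) \<le> ip f f + t * t * ip g g" by simp
  moreover have "t * t * ip g g = t * ip f g" using False by (simp add: t_def)
  ultimately have "t * ip f g \<le> ip f f" by simp
  moreover have "ip g g > 0" using False ip_nonneg[of g] by linarith
  ultimately show ?thesis by (simp add: t_def power2_eq_square pos_divide_le_eq)
qed

text \<open>By self-adjointness and Cauchy-Schwarz the squared norms of the iterates are log-convex,
  so their successive ratios never decrease. A first ratio above \<open>r\<close> would outgrow
  \<open>C * r ^ n\<close>, whatever \<open>C\<close> is. Finally \<open>ip f (A f)\<close> is at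
  most the product of the norms of \<open>f\<close> and \<open>A f\<close>.\<close>

lemma decay_contraction:
  assumes A: "\<And>f. f \<in> bmeas \<Longrightarrow> A f \<in> bmeas" "\<And>f g. f \<in> bmeas \<Longrightarrow> g \<in> bmeas \<Longrightarrow> ip g (A f) = ip (A g) f"
    and f: "f \<in> bmeas" and r: "r > 0" and decay: "\<And>n. ip ((A ^^ n) f) ((A ^^ n) f) \<le> C * r ^ n"
  shows "ip f (A f) \<le> sqrt r * ip f f"
proof -
  define a where "a n = ip ((A ^^ n) f) ((A ^^ n) f)" for n
  have BMn: "(A ^^ n) f \<in> bmeas" for n by (induction n) (auto simp: f A(1))
  have a0: "a n \<ge> 0" for n by (simp add: a_def)
  have logconv: "(a (Suc n))\<^sup>2 \<le> a n * a (Suc (Suc n))" for n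
  proof -
    have "a (Suc n) = ip ((A ^^ n) f) ((A ^^ Suc (Suc n)) f)"
      using A(2)[OF BMn[of "Suc n"] BMn[of n]] by (simp add: a_def)
    then show ?thesis using ip_Cauchy[OF BMn[of n] BMn[of "Suc (Suc n)"]] by (simp add: a_def)
  qed
  have "a 1 \<le> r * a 0"
  proof (rule ccontr)
    assume neg: "\<not> a 1 \<le> r * a 0"
    have pos0: "a 0 > 0"
    proof (rule ccontr)
      assume "\<not> a 0 > 0"
      then have "a 0 = 0" using a0[of 0] by simp
      then have "(a 1)\<^sup>2 \<le> 0" using logconv[of 0] by simp
      then show False using neg \<open>a 0 = 0\<close> by simp
    qed
    define \<theta> where "\<theta> = a 1 / a 0"
    have \<theta>: "\<theta> > r" using neg pos0 by (simp add: \<theta>_def field_simps)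
    have step: "a n > 0 \<and> \<theta> * a n \<le> a (Suc n)" for n
    proof (induction n)
      case 0 then show ?case using pos0 by (simp add: \<theta>_def)
    next
      case (Suc n)
      have th: "\<theta> > 0" using \<theta> r by linarith
      have p: "a (Suc n) > 0" using Suc th by (meson mult_pos_pos less_le_trans)
      have "a (Suc n) * (\<theta> * a n) \<le> a (Suc n) * a (Suc n)" using Suc p by (intro mult_left_mono) auto
      also have "\<dots> \<le> a n * a (Suc (Suc n))" using logconv[of n] by (simp add: power2_eq_square)
      finally have "a n * (\<theta> * a (Suc n)) \<le> a n * a (Suc (Suc n))" by (simp add: mult_ac)
      then show ?case using Suc p by simp
    qed
    have geo: "\<theta> ^ n * a 0 \<le> a n" for n
    proof (induction n)
      case (Suc n)
      have "\<theta> * (\<theta> ^ n * a 0) \<le> \<theta> * a n" using Suc \<theta> r by (intro mult_left_mono) auto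
      then show ?case using step[of n] by (simp add: mult.assoc)
    qed simp
    have "(\<theta> / r) ^ n \<le> C / a 0" for n
    proof -
      have "\<theta> ^ n * a 0 \<le> C * r ^ n" using geo[of n] decay[of n] unfolding a_def by linarith
      then show ?thesis using pos0 r by (simp add: power_divide field_simps)
    qed
    moreover have "\<theta> / r > 1" using \<theta> r by simp
    ultimately show False using real_arch_pow[of "\<theta> / r" "C / a 0"] by (meson not_less)
  qed
  have "(ip f (A f))\<^sup>2 \<le> a 0 * a 1" using ip_Cauchy[OF f A(1)[OF f]] by (simp add: a_def)
  also have "\<dots> \<le> a 0 * (r * a 0)" using \<open>a 1 \<le> r * a 0\<close> a0 by (intro mult_left_mono) auto
  also have "\<dots> = (sqrt r * a 0)\<^sup>2" using r by (simp add: power2_eq_square)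
  finally have "ip f (A f) \<le> sqrt r * a 0"
    by (rule power2_le_imp_le) (use a0[of 0] r in simp)
  then show ?thesis by (simp add: a_def)
qed

section \<open>Resampling operators as projections\<close>

text \<open>The conditional expectation given the sum of the two sites and all other coordinates, in
  a version that is defined at every configuration.\<close>

definition resample_avg :: "nat \<Rightarrow> nat \<Rightarrow> ((nat \<Rightarrow> real) \<Rightarrow> real) \<Rightarrow> (nat \<Rightarrow> real) \<Rightarrow> real" where
  "resample_avg i j f x = (\<integral>a. f (Tx i j a x) \<partial>\<beta>)"

lemma beta_integrable:
  assumes f: "f \<in> bmeas" and "i < N" "j < N" "x \<in> space (cfg N)"
  shows "integrable \<beta> (\<lambda>a. f (Tx i j a x))"
proof -
  obtain K where K: "\<And>x. x \<in> space (cfg N) \<Longrightarrow> \<bar>f x\<bar> \<le> K" using bmeas_bound[OF f] by metis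
  note [measurable] = Tx_measurable_fixed[OF assms(4,2,3)] bmeas_measurable[OF f]
  show ?thesis
    by (rule beta.integrable_const_bound[where B=K]) (auto intro!: AE_I2 K Tx_space assms)
qed

lemma resample_avg_bmeas [simp, intro]:
  assumes f: "f \<in> bmeas" and ij: "i < N" "j < N"
  shows "resample_avg i j f \<in> bmeas"
proof -
  obtain K where K: "K \<ge> 0" "\<And>x. x \<in> space (cfg N) \<Longrightarrow> \<bar>f x\<bar> \<le> K" using bmeas_bound[OF f] by metis
  note [measurable] = bmeas_measurable[OF f]
  show ?thesis
  proof (rule bmeas_I[where K=K])
    show "resample_avg i j f \<in> borel_measurable (cfg N)" unfolding resample_avg_def[abs_def] using ij by measurable
    fix x assume x: "x \<in> space (cfg N)"
    have "\<bar>resample_avg i j f x\<bar> \<le> (\<integral>a. \<bar>f (Tx i j a x)\<bar> \<partial>\<beta>)" unfolding resample_avg_def by (rule integral_abs_bound)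
    also have "\<dots> \<le> (\<integral>a. K \<partial>\<beta>)"
      using beta_integrable[OF f ij x] K(2)[OF Tx_space[OF ij x]] by (intro integral_mono) auto
    finally show "\<bar>resample_avg i j f x\<bar> \<le> K" by (simp add: beta.prob_space[simplified])
  qed
qed

lemma resample_avg_integral:
  assumes f: "f \<in> bmeas" and ij: "i < N" "j < N" "i \<noteq> j"
  shows "(\<integral>x. resample_avg i j f x \<partial>\<nu>) = (\<integral>x. f x \<partial>\<nu>)"
proof -
  have pos: "(\<integral>x. resample_avg i j g x \<partial>\<nu>) = (\<integral>x. g x \<partial>\<nu>)"
    if g: "g \<in> bmeas" and p: "\<And>x. x \<in> space (cfg N) \<Longrightarrow> 0 \<le> g x" for g
  proof -
    note [measurable] = bmeas_measurable[OF g] bmeas_measurable[OF resample_avg_bmeas[OF g ij(1,2)]]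
    have R: "0 \<le> resample_avg i j g x" if "x \<in> space (cfg N)" for x
      unfolding resample_avg_def using p Tx_space[OF ij(1,2) that] by (intro integral_nonneg_AE AE_I2) auto
    have "ennreal (\<integral>x. resample_avg i j g x \<partial>\<nu>) = (\<integral>\<^sup>+x. ennreal (resample_avg i j g x) \<partial>\<nu>)"
      using R g ij by (intro nn_integral_eq_integral[symmetric] bmeas_integrable) (auto intro!: AE_I2)
    also have "\<dots> = (\<integral>\<^sup>+x. (\<integral>\<^sup>+a. ennreal (g (Tx i j a x)) \<partial>\<beta>) \<partial>\<nu>)"
      unfolding resample_avg_def using p Tx_space[OF ij(1,2)]
      by (intro nn_integral_cong nn_integral_eq_integral[symmetric] beta_integrable g ij) auto
    also have "\<dots> = (\<integral>\<^sup>+x. ennreal (g x) \<partial>\<nu>)" using ij by (intro resample) auto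
    also have "\<dots> = ennreal (\<integral>x. g x \<partial>\<nu>)"
      using p g by (intro nn_integral_eq_integral bmeas_integrable) (auto intro!: AE_I2)
    finally show ?thesis
      using R p by (subst (asm) ennreal_inj) (auto intro!: integral_nonneg_AE AE_I2)
  qed
  \<comment> \<open>Stationarity is known for nonnegative integrals. Adding the bound
    \<open>K\<close> makes the integrand nonnegative, and the average fixes constants.\<close>
  obtain K where K: "K \<ge> 0" "\<And>x. x \<in> space (cfg N) \<Longrightarrow> \<bar>f x\<bar> \<le> K" using bmeas_bound[OF f] by metis
  have "resample_avg i j (\<lambda>x. f x + K) x = resample_avg i j f x + K" if "x \<in> space (cfg N)" for x
    unfolding resample_avg_def using beta_integrable[OF f ij(1,2) that] by (simp add: beta.prob_space[simplified])
  then have "(\<integral>x. resample_avg i j f x + K \<partial>\<nu>) = (\<integral>x. resample_avg i j (\<lambda>x. f x + K) x \<partial>\<nu>)"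
    by (intro Bochner_Integration.integral_cong) auto
  also have "\<dots> = (\<integral>x. f x + K \<partial>\<nu>)"
  proof (rule pos)
    show "0 \<le> f x + K" if "x \<in> space (cfg N)" for x using K(2)[OF that] by linarith
  qed (use f in auto)
  finally show ?thesis using f ij by simp
qed

lemma resample_avg_invariant_mult:
  assumes "\<And>a. g (Tx i j a x) = g x"
  shows "resample_avg i j (\<lambda>x. g x * f x) x = g x * resample_avg i j f x"
  unfolding resample_avg_def using assms by simp

text \<open>An average is constant on fibres and can be taken out of a further integral over the
  fibre. So the operator is an orthogonal projection.\<close>

lemma ip_resample_avg:
  assumes f: "f \<in> bmeas" "g \<in> bmeas" and ij: "i < N" "j < N" "i \<noteq> j"
  shows "ip g (resample_avg i j f) = ip (resample_avg i j g) (resample_avg i j f)"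
proof -
  have "ip g (resample_avg i j f) = (\<integral>x. resample_avg i j (\<lambda>x. g x * resample_avg i j f x) x \<partial>\<nu>)"
    unfolding ip_def using f ij by (subst resample_avg_integral) auto
  also have "\<dots> = (\<integral>x. resample_avg i j g x * resample_avg i j f x \<partial>\<nu>)"
  proof -
    have "resample_avg i j (\<lambda>x. resample_avg i j f x * g x) x = resample_avg i j f x * resample_avg i j g x" for x
      using ij by (intro resample_avg_invariant_mult) (simp add: resample_avg_def)
    then show ?thesis by (simp add: mult.commute)
  qed
  finally show ?thesis by (simp add: ip_def)
qed

text \<open>Expand the square; by stationarity the squares of the new and of the old value have the
  same integral.\<close>

lemma jump_ip:
  assumes f: "f \<in> bmeas" and ij: "i < N" "j < N" "i \<noteq> j"
  shows "jump i j f (\<lambda>_. 1) = ennreal (2 * (ip f f - ip f (resample_avg i j f)))"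
    and "ip f (resample_avg i j f) \<le> ip f f"
proof -
  note [measurable] = bmeas_measurable[OF f]
  let ?h = "\<lambda>x. (\<integral>a. (f (Tx i j a x) - f x)\<^sup>2 \<partial>\<beta>)"
  have sq: "(\<lambda>x. (f x)\<^sup>2) \<in> bmeas" using f by auto
  have h: "?h x = resample_avg i j (\<lambda>x. (f x)\<^sup>2) x - 2 * (f x * resample_avg i j f x) + f x * f x" if x: "x \<in> space (cfg N)" for x
  proof -
    have "?h x = (\<integral>a. (f (Tx i j a x))\<^sup>2 - 2 * f x * f (Tx i j a x) + f x * f x \<partial>\<beta>)"
      by (intro Bochner_Integration.integral_cong) (auto simp: power2_eq_square algebra_simps)
    then show ?thesis
      unfolding resample_avg_def using beta_integrable[OF sq ij(1,2) x] beta_integrable[OF f ij(1,2) x]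
      by (simp add: beta.prob_space[simplified])
  qed
  have hB: "?h \<in> bmeas"
  proof -
    have "(\<lambda>x. resample_avg i j (\<lambda>x. (f x)\<^sup>2) x - 2 * (f x * resample_avg i j f x) + f x * f x) \<in> bmeas" using f sq ij by auto
    from bmeas_bound[OF this] obtain K where K: "\<And>x. x \<in> space (cfg N) \<Longrightarrow> \<bar>resample_avg i j (\<lambda>x. (f x)\<^sup>2) x - 2 * (f x * resample_avg i j f x) + f x * f x\<bar> \<le> K"
      by metis
    show ?thesis
    proof (rule bmeas_I[where K=K])
      show "?h \<in> borel_measurable (cfg N)" using ij by measurable
    qed (simp add: h K)
  qed
  have I: "(\<integral>x. ?h x \<partial>\<nu>) = 2 * (ip f f - ip f (resample_avg i j f))"
  proof -
    have "(\<integral>x. ?h x \<partial>\<nu>) = (\<integral>x. resample_avg i j (\<lambda>x. (f x)\<^sup>2) x - 2 * (f x * resample_avg i j f x) + f x * f x \<partial>\<nu>)"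
      by (intro Bochner_Integration.integral_cong) (auto simp: h)
    also have "\<dots> = (\<integral>x. resample_avg i j (\<lambda>x. (f x)\<^sup>2) x \<partial>\<nu>) - 2 * ip f (resample_avg i j f) + ip f f"
      unfolding ip_def using f sq ij by (simp add: bmeas_integrable)
    also have "(\<integral>x. resample_avg i j (\<lambda>x. (f x)\<^sup>2) x \<partial>\<nu>) = ip f f"
      using resample_avg_integral[OF sq ij] by (simp add: ip_def power2_eq_square)
    finally show ?thesis by simp
  qed
  have hpos: "0 \<le> ?h x" for x by (intro integral_nonneg_AE) auto
  have "jump i j f (\<lambda>_. 1) = (\<integral>\<^sup>+x. ennreal (?h x) \<partial>\<nu>)"
    unfolding jump_def
  proof (rule nn_integral_cong)
    fix x assume "x \<in> space \<nu>"
    then have x: "x \<in> space (cfg N)" by simp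
    have "(\<lambda>y. (f y - f x)\<^sup>2) \<in> bmeas" using f by auto
    from beta_integrable[OF this ij(1,2) x]
    show "1 * (\<integral>\<^sup>+a. ennreal ((f (Tx i j a x) - f x)\<^sup>2) \<partial>\<beta>) = ennreal (?h x)"
      by (simp add: nn_integral_eq_integral)
  qed
  also have "\<dots> = ennreal (\<integral>x. ?h x \<partial>\<nu>)"
    using hB hpos by (intro nn_integral_eq_integral bmeas_integrable) auto
  finally show "jump i j f (\<lambda>_. 1) = ennreal (2 * (ip f f - ip f (resample_avg i j f)))" by (simp add: I)
  have "0 \<le> (\<integral>x. ?h x \<partial>\<nu>)" using hpos by (intro integral_nonneg_AE) auto
  then show "ip f (resample_avg i j f) \<le> ip f f" by (simp add: I)
qed

definition pair_avg :: "nat set \<Rightarrow> ((nat \<Rightarrow> real) \<Rightarrow> real) \<Rightarrow> (nat \<Rightarrow> real) \<Rightarrow> real" where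
  "pair_avg I f x = (\<Sum>i\<in>I. \<Sum>j\<in>I - {i}. resample_avg i j f x) / (real (card I) * (real (card I) - 1))"

lemma pair_avg_bmeas [simp, intro]: "f \<in> bmeas \<Longrightarrow> I \<subseteq> {..<N} \<Longrightarrow> pair_avg I f \<in> bmeas"
  unfolding pair_avg_def[abs_def] by (intro bmeas_divide bmeas_sum resample_avg_bmeas) auto

lemma ip_pair_avg:
  assumes f: "f \<in> bmeas" "g \<in> bmeas" and I: "I \<subseteq> {..<N}"
  shows "ip g (pair_avg I f) = (\<Sum>i\<in>I. \<Sum>j\<in>I - {i}. ip (resample_avg i j g) (resample_avg i j f)) / (real (card I) * (real (card I) - 1))"
proof -
  have "ip g (pair_avg I f) = (\<Sum>i\<in>I. \<Sum>j\<in>I - {i}. ip g (resample_avg i j f)) / (real (card I) * (real (card I) - 1))"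
  proof -
    have B: "(\<lambda>x. g x * resample_avg i j f x) \<in> bmeas" if "i \<in> I" "j \<in> I - {i}" for i j using f I that by auto
    have "ip g (pair_avg I f) = (\<integral>x. (\<Sum>i\<in>I. \<Sum>j\<in>I - {i}. g x * resample_avg i j f x) / (real (card I) * (real (card I) - 1)) \<partial>\<nu>)"
      unfolding ip_def pair_avg_def by (simp add: sum_distrib_left)
    also have "\<dots> = (\<integral>x. (\<Sum>i\<in>I. \<Sum>j\<in>I - {i}. g x * resample_avg i j f x) \<partial>\<nu>) / (real (card I) * (real (card I) - 1))"
      by simp
    also have "(\<integral>x. (\<Sum>i\<in>I. \<Sum>j\<in>I - {i}. g x * resample_avg i j f x) \<partial>\<nu>) = (\<Sum>i\<in>I. \<Sum>j\<in>I - {i}. ip g (resample_avg i j f))"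
    proof -
      have "(\<integral>x. (\<Sum>i\<in>I. \<Sum>j\<in>I - {i}. g x * resample_avg i j f x) \<partial>\<nu>) = (\<Sum>i\<in>I. (\<integral>x. (\<Sum>j\<in>I - {i}. g x * resample_avg i j f x) \<partial>\<nu>))"
        using B by (intro Bochner_Integration.integral_sum bmeas_integrable bmeas_sum) auto
      also have "\<dots> = (\<Sum>i\<in>I. \<Sum>j\<in>I - {i}. (\<integral>x. g x * resample_avg i j f x \<partial>\<nu>))"
        using B by (intro sum.cong refl Bochner_Integration.integral_sum bmeas_integrable) auto
      finally show ?thesis by (simp only: ip_def)
    qed
    finally show ?thesis .
  qed
  also have "(\<Sum>i\<in>I. \<Sum>j\<in>I - {i}. ip g (resample_avg i j f)) = (\<Sum>i\<in>I. \<Sum>j\<in>I - {i}. ip (resample_avg i j g) (resample_avg i j f))"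
    using I by (intro sum.cong refl ip_resample_avg f) auto
  finally show ?thesis .
qed

lemma pair_avg_selfadjoint:
  assumes "f \<in> bmeas" "g \<in> bmeas" "I \<subseteq> {..<N}"
  shows "ip g (pair_avg I f) = ip (pair_avg I g) f"
  using ip_pair_avg[OF assms] ip_pair_avg[OF assms(2,1,3)] by (simp add: ip_commute[of "pair_avg I g"] ip_commute[of "resample_avg _ _ g"])

lemma jump_sum_pair_avg:
  assumes f: "f \<in> bmeas" and I: "I \<subseteq> {..<N}" "card I \<ge> 2"
  shows "(\<Sum>i\<in>I. \<Sum>j\<in>I - {i}. ip f f - ip f (resample_avg i j f)) = real (card I) * (real (card I) - 1) * (ip f f - ip f (pair_avg I f))"
proof -
  have fin: "finite I" using I(1) finite_subset by blast
  have "(\<Sum>i\<in>I. \<Sum>j\<in>I - {i}. ip f (resample_avg i j f)) = (\<Sum>i\<in>I. \<Sum>j\<in>I - {i}. ip (resample_avg i j f) (resample_avg i j f))"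
    using I by (intro sum.cong refl ip_resample_avg f) auto
  also have "\<dots> = real (card I) * (real (card I) - 1) * ip f (pair_avg I f)"
    using I by (simp add: ip_pair_avg[OF f f I(1)])
  finally have 1: "(\<Sum>i\<in>I. \<Sum>j\<in>I - {i}. ip f (resample_avg i j f)) = real (card I) * (real (card I) - 1) * ip f (pair_avg I f)" .
  have "(\<Sum>i\<in>I. \<Sum>j\<in>I - {i}. ip f f) = real (card I) * (real (card I) - 1) * ip f f"
    using fin I(2) by (simp add: card_Diff_singleton of_nat_diff)
  then show ?thesis by (simp add: sum_subtractf 1 right_diff_distrib)
qed

lemma pair_avg_pow_bmeas [simp]: "f \<in> bmeas \<Longrightarrow> I \<subseteq> {..<N} \<Longrightarrow> (pair_avg I ^^ n) f \<in> bmeas"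
  by (induction n) auto

lemma pair_avg_pow_selfadjoint:
  assumes "f \<in> bmeas" "g \<in> bmeas" "I \<subseteq> {..<N}"
  shows "ip g ((pair_avg I ^^ n) f) = ip ((pair_avg I ^^ n) g) f"
  using assms
proof (induction n arbitrary: g)
  case (Suc n)
  have "ip g ((pair_avg I ^^ Suc n) f) = ip (pair_avg I g) ((pair_avg I ^^ n) f)"
    using Suc.prems by (simp add: pair_avg_selfadjoint)
  also have "\<dots> = ip ((pair_avg I ^^ n) (pair_avg I g)) f" using Suc by simp
  finally show ?case by (simp add: funpow_swap1)
qed simp

text \<open>The sequence \<open>n \<mapsto> \<langle>f, A^n f\<rangle>\<close> is convex because \<open>A\<close> is an average of orthogonal projections.\<close>

lemma pair_avg_pow_energy:
  assumes f: "f \<in> bmeas" and I: "I \<subseteq> {..<N}"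
  shows "ip f f - ip f ((pair_avg I ^^ n) f) \<le> real n * (ip f f - ip f (pair_avg I f))"
proof -
  define a where "a n = ip f ((pair_avg I ^^ n) f)" for n
  note B = pair_avg_pow_bmeas[OF f I]
  have conv: "2 * a (Suc n) \<le> a n + a (Suc (Suc n))" for n
  proof -
    \<comment> \<open>With \<open>A\<close> the pair average: for even \<open>n\<close> the three
      terms are pairings of the two functions \<open>g\<close> and \<open>A g\<close>, and convexity
      is \<open>ip_two\<close>. For odd \<open>n\<close> one factor \<open>A\<close> remains between
      them, and its positivity is needed.\<close>
    obtain k where k: "n = 2 * k \<or> n = Suc (2 * k)" by (metis evenE oddE Suc_eq_plus1)
    define g where "g = (pair_avg I ^^ k) f"
    have gB: "g \<in> bmeas" "pair_avg I g \<in> bmeas" using B I by (auto simp: g_def)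
    have shift: "a (k + l) = ip g ((pair_avg I ^^ l) f)" for l
      using pair_avg_pow_selfadjoint[OF B[of l] f I, of k] by (simp add: a_def g_def funpow_add)
    have g': "(pair_avg I ^^ Suc k) f = pair_avg I g" "(pair_avg I ^^ Suc (Suc k)) f = pair_avg I (pair_avg I g)" by (simp_all add: g_def)
    from k show ?thesis
    proof
      assume n: "n = 2 * k"
      have "a n = ip g g" "a (Suc n) = ip g (pair_avg I g)" "a (Suc (Suc n)) = ip (pair_avg I g) (pair_avg I g)"
        using shift[of k] shift[of "Suc k"] shift[of "Suc (Suc k)"] gB I
        unfolding g' by (simp_all add: n mult_2 g_def[symmetric] pair_avg_selfadjoint)
      then show ?thesis using ip_two[OF gB] by simp
    next
      assume n: "n = Suc (2 * k)"
      have sh: "a n = ip g (pair_avg I g)" "a (Suc n) = ip g (pair_avg I (pair_avg I g))" "a (Suc (Suc n)) = ip (pair_avg I g) (pair_avg I (pair_avg I g))"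
        using shift[of "Suc k"] shift[of "Suc (Suc k)"] shift[of "Suc (Suc (Suc k))"] gB I
        unfolding g' by (simp_all add: n mult_2 g_def[symmetric] pair_avg_selfadjoint)
      let ?M = "real (card I) * (real (card I) - 1)"
      have M: "?M \<ge> 0" by (cases "card I") auto
      \<comment> \<open>The positivity of \<open>A\<close>: it is a mean of projections, so
        \<open>ip_two\<close> is applied behind each projection separately.\<close>
      have "2 * ip (resample_avg i j g) (resample_avg i j (pair_avg I g)) \<le> ip (resample_avg i j g) (resample_avg i j g) + ip (resample_avg i j (pair_avg I g)) (resample_avg i j (pair_avg I g))"
        if "i \<in> I" "j \<in> I - {i}" for i j using that I gB by (intro ip_two) auto
      then have "(\<Sum>i\<in>I. \<Sum>j\<in>I - {i}. 2 * ip (resample_avg i j g) (resample_avg i j (pair_avg I g)))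
        \<le> (\<Sum>i\<in>I. \<Sum>j\<in>I - {i}. ip (resample_avg i j g) (resample_avg i j g) + ip (resample_avg i j (pair_avg I g)) (resample_avg i j (pair_avg I g)))"
        by (intro sum_mono)
      then have "(\<Sum>i\<in>I. \<Sum>j\<in>I - {i}. 2 * ip (resample_avg i j g) (resample_avg i j (pair_avg I g))) / ?M
        \<le> (\<Sum>i\<in>I. \<Sum>j\<in>I - {i}. ip (resample_avg i j g) (resample_avg i j g) + ip (resample_avg i j (pair_avg I g)) (resample_avg i j (pair_avg I g))) / ?M"
        using M by (rule divide_right_mono)
      then show ?thesis unfolding sh ip_pair_avg[OF gB(1) gB(1) I] ip_pair_avg[OF gB(2) gB(1) I] ip_pair_avg[OF gB(2) gB(2) I]
        by (simp add: sum.distrib sum_distrib_left add_divide_distrib flip: sum_distrib_left)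
    qed
  qed
  have d: "a n - a (Suc n) \<le> a 0 - a 1" for n
  proof (induction n)
    case (Suc n) then show ?case using conv[of n] by simp
  qed simp
  have "a 0 - a n \<le> real n * (a 0 - a 1)"
  proof (induction n)
    case (Suc n) then show ?case using d[of n] by (simp add: algebra_simps)
  qed simp
  then show ?thesis by (simp add: a_def)
qed

end

section \<open>The mean-field gap\<close>

text \<open>If two configurations are resampled with the same fraction, the squared difference of
  their pair sums returns, on average, with this factor as the sum of the two new squared
  differences. It is below one because the fraction is almost surely strictly between 0 and
  1.\<close>

definition mix :: "real \<Rightarrow> real" where
  "mix g = (\<integral>a. a\<^sup>2 + (1 - a)\<^sup>2 \<partial>sym_beta g)"

lemma mix_props:
  assumes g: "g > 0"
  shows "integrable (sym_beta g) (\<lambda>a. a\<^sup>2 + (1 - a)\<^sup>2)" "1/2 \<le> mix g" "mix g < 1"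
proof -
  interpret prob_space "sym_beta g" by (rule prob_space_sym_beta[OF g])
  have i1: "integrable (sym_beta g) (\<lambda>a. a * (1 - a))"
  proof (rule integrable_const_bound[where B=1])
    show "AE a in sym_beta g. norm (a * (1 - a)) \<le> 1"
      using AE_sym_beta by eventually_elim (auto simp: abs_mult intro!: mult_le_one)
  qed simp
  have eq: "a\<^sup>2 + (1 - a)\<^sup>2 = 1 - 2 * (a * (1 - a))" for a :: real
    by (simp add: power2_eq_square algebra_simps)
  show i2: "integrable (sym_beta g) (\<lambda>a. a\<^sup>2 + (1 - a)\<^sup>2)" unfolding eq using i1 by auto
  have m: "mix g = 1 - 2 * (\<integral>a. a * (1 - a) \<partial>sym_beta g)"
    unfolding mix_def eq using i1 by (simp add: prob_space[simplified])
  have pos: "AE a in sym_beta g. 0 < a * (1 - a)" using AE_sym_beta by eventually_elim auto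
  have "0 \<le> (\<integral>a. a * (1 - a) \<partial>sym_beta g)"
    using pos by (intro integral_nonneg_AE) (auto elim: eventually_mono)
  moreover have "(\<integral>a. a * (1 - a) \<partial>sym_beta g) \<noteq> 0"
  proof
    assume "(\<integral>a. a * (1 - a) \<partial>sym_beta g) = 0"
    then have "AE a in sym_beta g. a * (1 - a) = 0"
      using pos i1 by (subst (asm) integral_nonneg_eq_0_iff_AE) (auto elim: eventually_mono)
    then have "AE a in sym_beta g. False" using pos by eventually_elim auto
    then show False by simp
  qed
  ultimately show "mix g < 1" by (simp add: m)
  have "(1/2::real) = (\<integral>a. 1/2 \<partial>sym_beta g)" by (simp add: prob_space[simplified])
  also have "\<dots> \<le> mix g" unfolding mix_def
  proof (rule integral_mono[OF _ i2])
    fix a :: real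
    have "0 \<le> (2 * a - 1)\<^sup>2" by simp
    then show "1/2 \<le> a\<^sup>2 + (1 - a)\<^sup>2" by (simp add: power2_eq_square algebra_simps)
  qed simp
  finally show "1/2 \<le> mix g" .
qed

text \<open>Every index occurs in 2 (n - 1) ordered pairs, and the cross products 2 d_i d_j over all
  ordered pairs add up to 2 (D^2 - v).\<close>

lemma sum_pairs:
  fixes d :: "nat \<Rightarrow> real"
  assumes I: "finite I"
  defines "n \<equiv> real (card I)" and "v \<equiv> (\<Sum>i\<in>I. (d i)\<^sup>2)" and "D \<equiv> (\<Sum>i\<in>I. d i)"
  shows "(\<Sum>i\<in>I. \<Sum>j\<in>I - {i}. v - (d i)\<^sup>2 - (d j)\<^sup>2 + q * (d i + d j)\<^sup>2)
     = (n * (n - 1) - 2 * (n - 1) + 2 * q * (n - 2)) * v + 2 * q * D\<^sup>2"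
proof -
  let ?g = "\<lambda>i j. v - (d i)\<^sup>2 - (d j)\<^sup>2 + q * (d i + d j)\<^sup>2"
  have row: "(\<Sum>j\<in>I. ?g i j) = n * v - n * (d i)\<^sup>2 - v + q * (n * (d i)\<^sup>2 + 2 * d i * D + v)" for i
  proof -
    have "(\<Sum>j\<in>I. ?g i j) = (\<Sum>j\<in>I. (v - (d i)\<^sup>2 + q * (d i)\<^sup>2) + (q - 1) * (d j)\<^sup>2 + 2 * q * d i * d j)"
      by (intro sum.cong) (auto simp: power2_eq_square algebra_simps)
    also have "\<dots> = n * (v - (d i)\<^sup>2 + q * (d i)\<^sup>2) + (q - 1) * v + 2 * q * d i * D"
      by (simp add: sum.distrib sum_distrib_left[symmetric] n_def v_def D_def)
    finally show ?thesis by (simp add: algebra_simps)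
  qed
  have "(\<Sum>i\<in>I. \<Sum>j\<in>I - {i}. ?g i j) = (\<Sum>i\<in>I. (\<Sum>j\<in>I. ?g i j) - ?g i i)"
    using I by (intro sum.cong refl) (simp add: sum_diff1)
  also have "\<dots> = (\<Sum>i\<in>I. (n * v - v + q * v - v) + ((q - 1) * n + 2 - 4 * q) * (d i)\<^sup>2 + 2 * q * D * d i)"
    unfolding row by (intro sum.cong refl) (simp add: power2_eq_square algebra_simps)
  also have "\<dots> = n * (n * v - v + q * v - v) + ((q - 1) * n + 2 - 4 * q) * v + 2 * q * D * D"
    by (simp add: sum.distrib sum_distrib_left[symmetric] n_def v_def D_def)
  finally show ?thesis by (simp add: power2_eq_square algebra_simps)
qed

context energy_simplex begin

abbreviation "q \<equiv> mix \<gamma>"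

text \<open>Positivity is not imposed, so that the shell is stable under \<open>Tx\<close> for every
  real fraction and Lipschitz bounds can be integrated pointwise.\<close>

definition shell :: "(nat \<Rightarrow> real) set" where
  "shell = {x \<in> space (cfg N). (\<Sum>i<N. x i) = real N * E}"

lemma Tx_shell: "x \<in> shell \<Longrightarrow> i < N \<Longrightarrow> j < N \<Longrightarrow> i \<noteq> j \<Longrightarrow> Tx i j a x \<in> shell"
  by (auto simp: shell_def Tx_space Tx_sum)

text \<open>A Lipschitz seminorm that keeps track of the discrepancy of the total energy on \<open>I\<close> separately;
  exchanges inside \<open>I\<close> do not contract that part.\<close>

definition quad_lip :: "nat set \<Rightarrow> real \<Rightarrow> real \<Rightarrow> ((nat \<Rightarrow> real) \<Rightarrow> real) \<Rightarrow> bool" where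
  "quad_lip I a b f \<longleftrightarrow> (\<forall>x\<in>shell. \<forall>y\<in>shell.
     (f x - f y)\<^sup>2 \<le> a * (\<Sum>i\<in>I. (x i - y i)\<^sup>2) + b * (\<Sum>i\<in>I. x i - y i)\<^sup>2)"

lemma quad_lip_mono: "quad_lip I a b f \<Longrightarrow> a \<le> a' \<Longrightarrow> b \<le> b' \<Longrightarrow> quad_lip I a' b' f"
  unfolding quad_lip_def
  by (meson add_mono mult_right_mono order_trans sum_nonneg zero_le_power2)

text \<open>Both configurations use the same fraction, so the new differences at \<open>i\<close>
  and \<open>j\<close> are a and 1 - a times the old difference of the pair sums.\<close>

lemma Tx_diff_sq:
  assumes "finite I" "i \<in> I" "j \<in> I" "i \<noteq> j"
  shows "(\<Sum>k\<in>I. (Tx i j a x k - Tx i j a y k)\<^sup>2) =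
    (\<Sum>k\<in>I. (x k - y k)\<^sup>2) - (x i - y i)\<^sup>2 - (x j - y j)\<^sup>2 + (a\<^sup>2 + (1 - a)\<^sup>2) * ((x i - y i) + (x j - y j))\<^sup>2"
proof -
  have I: "I = insert i (insert j (I - {i, j}))" using assms by auto
  have "(\<Sum>k\<in>I - {i, j}. (Tx i j a x k - Tx i j a y k)\<^sup>2) = (\<Sum>k\<in>I - {i, j}. (x k - y k)\<^sup>2)"
    by (intro sum.cong) (auto simp: Tx_def)
  moreover have "Tx i j a x i - Tx i j a y i = a * ((x i - y i) + (x j - y j))"
      "Tx i j a x j - Tx i j a y j = (1 - a) * ((x i - y i) + (x j - y j))"
    using assms by (auto simp: Tx_def algebra_simps)
  moreover have split: "(\<Sum>k\<in>I. g k) = g i + (g j + (\<Sum>k\<in>I - {i, j}. g k))" for g :: "nat \<Rightarrow> real"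
    by (subst I) (use assms in simp)
  ultimately show ?thesis
    by (simp only: split[of "\<lambda>k. (Tx i j a x k - Tx i j a y k)\<^sup>2"] split[of "\<lambda>k. (x k - y k)\<^sup>2"] power_mult_distrib)
       (simp add: distrib_right)
qed

lemma beta_Jensen:
  fixes u :: "real \<Rightarrow> real"
  assumes "integrable \<beta> u" "integrable \<beta> (\<lambda>a. (u a)\<^sup>2)"
  shows "(\<integral>a. u a \<partial>\<beta>)\<^sup>2 \<le> (\<integral>a. (u a)\<^sup>2 \<partial>\<beta>)"
proof -
  let ?c = "\<integral>a. u a \<partial>\<beta>"
  have "0 \<le> (\<integral>a. (u a - ?c)\<^sup>2 \<partial>\<beta>)" by (intro integral_nonneg_AE) auto
  also have "\<dots> = (\<integral>a. (u a)\<^sup>2 - 2 * ?c * u a + ?c\<^sup>2 \<partial>\<beta>)"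
    by (intro Bochner_Integration.integral_cong) (auto simp: power2_eq_square algebra_simps)
  also have "\<dots> = (\<integral>a. (u a)\<^sup>2 \<partial>\<beta>) - 2 * ?c * ?c + ?c\<^sup>2"
    using assms by (simp add: beta.prob_space[simplified])
  finally show ?thesis by (simp add: power2_eq_square)
qed

text \<open>Jensen for the Beta integral and Cauchy-Schwarz for the mean over pairs reduce the claim
  to the coupled exchange of a single pair; \<open>sum_pairs\<close> adds these up. Exchanges inside
  \<open>I\<close> conserve the total on \<open>I\<close>, so the term with \<open>b\<close>
  persists and only gains the cross products.\<close>

lemma quad_lip_pair_avg:
  assumes f: "f \<in> bmeas" and I: "I \<subseteq> {..<N}" "card I \<ge> 2" and Q: "quad_lip I a b f"
  defines "n \<equiv> real (card I)"
  shows "quad_lip I ((n * (n - 1) - 2 * (n - 1) + 2 * q * (n - 2)) / (n * (n - 1)) * a) (b + 2 * q * a / (n * (n - 1))) (pair_avg I f)"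
  unfolding quad_lip_def
proof (intro ballI)
  fix x y assume xy: "x \<in> shell" "y \<in> shell"
  then have sp: "x \<in> space (cfg N)" "y \<in> space (cfg N)" by (auto simp: shell_def)
  have fin: "finite I" using I(1) finite_subset by blast
  let ?M = "n * (n - 1)"
  have n2: "n \<ge> 2" using I(2) by (simp add: n_def)
  then have M: "?M > 0" by simp
  define d where "d k = x k - y k" for k
  define v where "v = (\<Sum>k\<in>I. (d k)\<^sup>2)"
  define D where "D = (\<Sum>k\<in>I. d k)"
  have pair: "(resample_avg i j f x - resample_avg i j f y)\<^sup>2 \<le> a * (v - (d i)\<^sup>2 - (d j)\<^sup>2 + q * (d i + d j)\<^sup>2) + b * D\<^sup>2"
    if ij: "i \<in> I" "j \<in> I - {i}" for i j
  proof -
    have ijN: "i < N" "j < N" "i \<noteq> j" using ij I by auto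
    define u where "u c = f (Tx i j c x) - f (Tx i j c y)" for c
    have fi: "integrable \<beta> (\<lambda>c. f (Tx i j c z))" if "z \<in> space (cfg N)" for z
      by (rule beta_integrable[OF f ijN(1,2) that])
    have ui: "integrable \<beta> u" unfolding u_def using fi sp by auto
    obtain K where K: "\<And>x. x \<in> space (cfg N) \<Longrightarrow> \<bar>f x\<bar> \<le> K" using bmeas_bound[OF f] by metis
    have u2: "integrable \<beta> (\<lambda>c. (u c)\<^sup>2)"
    proof (rule beta.integrable_const_bound[where B="(K + K)\<^sup>2"])
      have "\<bar>u c\<bar> \<le> K + K" for c
        unfolding u_def using K[OF Tx_space[OF ijN(1,2) sp(1)], of c] K[OF Tx_space[OF ijN(1,2) sp(2)], of c] by linarith
      then have "(u c)\<^sup>2 \<le> (K + K)\<^sup>2" for c by (metis abs_le_square_iff abs_ge_self order_trans)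
      then show "AE c in \<beta>. norm ((u c)\<^sup>2) \<le> (K + K)\<^sup>2" by simp
    qed (use ui in measurable)
    have "(resample_avg i j f x - resample_avg i j f y)\<^sup>2 = (\<integral>c. u c \<partial>\<beta>)\<^sup>2"
      unfolding resample_avg_def u_def using fi sp by simp
    also have "\<dots> \<le> (\<integral>c. (u c)\<^sup>2 \<partial>\<beta>)" by (rule beta_Jensen[OF ui u2])
    also have "\<dots> \<le> (\<integral>c. a * (v - (d i)\<^sup>2 - (d j)\<^sup>2 + (c\<^sup>2 + (1 - c)\<^sup>2) * (d i + d j)\<^sup>2) + b * D\<^sup>2 \<partial>\<beta>)"
    proof (rule integral_mono[OF u2])
      show "integrable \<beta> (\<lambda>c. a * (v - (d i)\<^sup>2 - (d j)\<^sup>2 + (c\<^sup>2 + (1 - c)\<^sup>2) * (d i + d j)\<^sup>2) + b * D\<^sup>2)"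
        using mix_props(1)[OF gam] by auto
      fix c
      have "(u c)\<^sup>2 \<le> a * (\<Sum>k\<in>I. (Tx i j c x k - Tx i j c y k)\<^sup>2) + b * (\<Sum>k\<in>I. Tx i j c x k - Tx i j c y k)\<^sup>2"
        using Q[unfolded quad_lip_def, rule_format, OF Tx_shell[OF xy(1) ijN] Tx_shell[OF xy(2) ijN]] by (simp add: u_def)
      also have "(\<Sum>k\<in>I. (Tx i j c x k - Tx i j c y k)\<^sup>2) = v - (d i)\<^sup>2 - (d j)\<^sup>2 + (c\<^sup>2 + (1 - c)\<^sup>2) * (d i + d j)\<^sup>2"
        using ij fin by (subst Tx_diff_sq) (auto simp: v_def d_def)
      also have "(\<Sum>k\<in>I. Tx i j c x k - Tx i j c y k) = D"
        using ij fin by (simp add: sum_subtractf Tx_sum D_def d_def)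
      finally show "(u c)\<^sup>2 \<le> a * (v - (d i)\<^sup>2 - (d j)\<^sup>2 + (c\<^sup>2 + (1 - c)\<^sup>2) * (d i + d j)\<^sup>2) + b * D\<^sup>2" .
    qed
    also have "\<dots> = a * (v - (d i)\<^sup>2 - (d j)\<^sup>2 + q * (d i + d j)\<^sup>2) + b * D\<^sup>2"
      using mix_props(1)[OF gam] by (simp add: mix_def beta.prob_space[simplified])
    finally show ?thesis .
  qed
  define U where "U p = resample_avg (fst p) (snd p) f x - resample_avg (fst p) (snd p) f y" for p
  \<comment> \<open>The ordered pairs as one index set, so that Cauchy-Schwarz is applied only
    once.\<close>
  define Pr where "Pr = Sigma I (\<lambda>i. I - {i})"
  have cardPr: "real (card Pr) = ?M"
    unfolding Pr_def n_def using fin I(2) by (simp add: card_SigmaI card_Diff_singleton of_nat_diff)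
  have sumPr: "(\<Sum>p\<in>Pr. F (fst p) (snd p)) = (\<Sum>i\<in>I. \<Sum>j\<in>I - {i}. F i j)" for F :: "nat \<Rightarrow> nat \<Rightarrow> real"
    unfolding Pr_def using fin by (subst sum.Sigma) (auto simp: case_prod_beta)
  have "pair_avg I f x - pair_avg I f y = (\<Sum>p\<in>Pr. U p) / ?M"
    unfolding pair_avg_def n_def[symmetric] U_def sumPr[of "\<lambda>i j. resample_avg i j f x - resample_avg i j f y"]
    by (simp add: sum_subtractf diff_divide_distrib)
  then have "(pair_avg I f x - pair_avg I f y)\<^sup>2 = (\<Sum>p\<in>Pr. U p)\<^sup>2 / (?M * ?M)"
    by (simp add: power_divide power2_eq_square)
  also have "\<dots> \<le> ((\<Sum>p\<in>Pr. (U p)\<^sup>2) * ?M) / (?M * ?M)"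
    using sum_squared_le_sum_of_squares[of U Pr] M unfolding cardPr by (intro divide_right_mono) auto
  also have "\<dots> = (\<Sum>p\<in>Pr. (U p)\<^sup>2) / ?M" using M by simp
  also have "\<dots> \<le> (\<Sum>i\<in>I. \<Sum>j\<in>I - {i}. a * (v - (d i)\<^sup>2 - (d j)\<^sup>2 + q * (d i + d j)\<^sup>2) + b * D\<^sup>2) / ?M"
    unfolding U_def sumPr[of "\<lambda>i j. (resample_avg i j f x - resample_avg i j f y)\<^sup>2"] using M
    by (intro divide_right_mono sum_mono pair) auto
  also have "(\<Sum>i\<in>I. \<Sum>j\<in>I - {i}. a * (v - (d i)\<^sup>2 - (d j)\<^sup>2 + q * (d i + d j)\<^sup>2) + b * D\<^sup>2)
     = a * ((?M - 2 * (n - 1) + 2 * q * (n - 2)) * v + 2 * q * D\<^sup>2) + ?M * (b * D\<^sup>2)"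
  proof -
    have "(\<Sum>i\<in>I. \<Sum>j\<in>I - {i}. b * D\<^sup>2) = ?M * (b * D\<^sup>2)"
    proof -
      have "(\<Sum>p\<in>Pr. b * D\<^sup>2) = ?M * (b * D\<^sup>2)" using cardPr by simp
      then show ?thesis using sumPr[of "\<lambda>_ _. b * D\<^sup>2"] by (simp only:)
    qed
    then show ?thesis
      using sum_pairs[OF fin, of d q] by (simp add: sum.distrib sum_distrib_left[symmetric] n_def v_def D_def)
  qed
  also have "\<dots> / ?M = (?M - 2 * (n - 1) + 2 * q * (n - 2)) / ?M * a * v + (b + 2 * q * a / ?M) * D\<^sup>2"
    using n2 by (simp add: add_divide_distrib distrib_left distrib_right mult_ac)
  finally show "(pair_avg I f x - pair_avg I f y)\<^sup>2 \<le> (?M - 2 * (n - 1) + 2 * q * (n - 2)) / ?M * a * (\<Sum>i\<in>I. (x i - y i)\<^sup>2)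
       + (b + 2 * q * a / ?M) * (\<Sum>i\<in>I. x i - y i)\<^sup>2"
    unfolding v_def D_def d_def .
qed

text \<open>One step sends (a, b) to (r a, b + 2 q a / M), where r + 2 q / M = 1 - 2 (1 - q) / n.
  Hence \<open>a\<close> decays geometrically while a + b does not increase, which keeps
  \<open>b\<close> below 2 L.\<close>

lemma quad_lip_pair_avg_pow:
  assumes f: "f \<in> bmeas" and I: "I \<subseteq> {..<N}" "card I \<ge> 2" and Q: "quad_lip I L L f" and L: "L \<ge> 0"
  shows "quad_lip I (L * (1 - 2 * (1 - q) / real (card I)) ^ t) (2 * L) ((pair_avg I ^^ t) f)"
proof -
  define n where "n = real (card I)"
  let ?M = "n * (n - 1)"
  define r where "r = (?M - 2 * (n - 1) + 2 * q * (n - 2)) / ?M"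
  define r' where "r' = 1 - 2 * (1 - q) / n"
  have n2: "n \<ge> 2" using I(2) by (simp add: n_def)
  then have M: "?M > 0" by simp
  have q: "1/2 \<le> q" "q < 1" using mix_props[OF gam] by auto
  have r0: "r \<ge> 0"
  proof -
    have "?M - 2 * (n - 1) + 2 * q * (n - 2) = (n - 2) * (n - 1 + 2 * q)" by (simp add: algebra_simps)
    also have "\<dots> \<ge> 0" using n2 q by (intro mult_nonneg_nonneg) auto
    finally show ?thesis unfolding r_def using M by (intro divide_nonneg_pos) auto
  qed
  have rr': "r \<le> r'"
  proof -
    have "r' = (?M - 2 * (1 - q) * (n - 1)) / ?M" using n2 by (simp add: r'_def field_simps)
    moreover have "?M - 2 * (n - 1) + 2 * q * (n - 2) \<le> ?M - 2 * (1 - q) * (n - 1)"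
      using q by (simp add: algebra_simps)
    ultimately show ?thesis unfolding r_def using M by (simp add: divide_right_mono)
  qed
  have rq: "r * a + 2 * q * a / ?M \<le> a" if "a \<ge> 0" for a
  proof -
    have "r + 2 * q / ?M = (?M - 2 * (n - 1) + 2 * q * (n - 2) + 2 * q) / ?M" by (simp add: r_def add_divide_distrib)
    also have "\<dots> = (?M - 2 * ((1 - q) * (n - 1))) / ?M" by (simp add: algebra_simps)
    also have "\<dots> \<le> 1" using M q n2 by (simp add: pos_divide_le_eq)
    finally have "(r + 2 * q / ?M) * a \<le> 1 * a" using that by (rule mult_right_mono)
    moreover have "(r + 2 * q / ?M) * a = r * a + 2 * q * a / ?M" by (simp add: distrib_right)
    ultimately show ?thesis by linarith
  qed
  have "\<exists>a b. quad_lip I a b ((pair_avg I ^^ t) f) \<and> 0 \<le> a \<and> a \<le> L * r' ^ t \<and> 0 \<le> b \<and> a + b \<le> 2 * L" for t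
  proof (induction t)
    case 0 then show ?case using Q L by (intro exI[of _ L]) auto
  next
    case (Suc t)
    then obtain a b where ab: "quad_lip I a b ((pair_avg I ^^ t) f)" "0 \<le> a" "a \<le> L * r' ^ t" "0 \<le> b" "a + b \<le> 2 * L" by auto
    have "quad_lip I (r * a) (b + 2 * q * a / ?M) ((pair_avg I ^^ Suc t) f)"
      using quad_lip_pair_avg[OF pair_avg_pow_bmeas[OF f I(1)] I ab(1)] by (simp add: r_def n_def)
    moreover have "r * a \<le> r' * (L * r' ^ t)" using r0 rr' ab by (intro mult_mono) auto
    moreover have "0 \<le> b + 2 * q * a / ?M" using ab q M by (simp add: divide_nonneg_pos)
    ultimately show ?case using r0 ab rq[OF ab(2)]
      by (intro exI[of _ "r * a"] exI[of _ "b + 2 * q * a / ?M"]) (auto simp: mult_ac)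
  qed
  then obtain a b where ab: "quad_lip I a b ((pair_avg I ^^ t) f)" "0 \<le> a" "a \<le> L * r' ^ t" "0 \<le> b" "a + b \<le> 2 * L" by metis
  then show ?thesis unfolding r'_def n_def by (intro quad_lip_mono[OF ab(1)]) auto
qed

section \<open>Spectral gaps from contraction\<close>

text \<open>Since the mean vanishes, \<open>g x\<close> times the mass is the integral of
  \<open>g x - g y\<close> over y, so \<open>g\<close> is bounded by its oscillation. The crude
  diameter comes from all coordinates lying between 0 and N E; its size does not matter for
  \<open>decay_contraction\<close>.\<close>

lemma osc_bound:
  assumes g: "g \<in> bmeas" "(\<integral>x. g x \<partial>\<nu>) = 0" and Q: "quad_lip {..<N} K 0 g" and K: "K \<ge> 0"
  shows "ip g g \<le> K * (real N * (real N * E)\<^sup>2)"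
proof -
  define C where "C = K * (real N * (real N * E)\<^sup>2)"
  have C: "C \<ge> 0" using K by (simp add: C_def)
  define p where "p = measure \<nu> (space \<nu>)"
  have p: "0 \<le> p" "p \<le> 1"
    unfolding p_def using emeasure_nu_le by (auto simp: fin.emeasure_eq_measure)
  define R where "R x \<longleftrightarrow> x \<in> space (cfg N) \<and> (\<forall>i<N. 0 < x i) \<and> (\<Sum>i<N. x i) = real N * E" for x
  have AER: "AE x in \<nu>. R x" using AE_nu AE_space by eventually_elim (auto simp: R_def)
  have diff: "(g x - g y)\<^sup>2 \<le> C" if "R x" "R y" for x y
  proof -
    have lt: "0 < z i \<and> z i \<le> real N * E" if "R z" "i < N" for z i
      using that member_le_sum[of i "{..<N}" z] by (auto simp: R_def less_imp_le)
    have "(g x - g y)\<^sup>2 \<le> K * (\<Sum>i<N. (x i - y i)\<^sup>2)"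
      using Q that by (auto simp: quad_lip_def shell_def R_def)
    also have "\<dots> \<le> K * (\<Sum>i<N. (real N * E)\<^sup>2)"
    proof (intro mult_left_mono sum_mono K)
      fix i assume "i \<in> {..<N}"
      then have "\<bar>x i - y i\<bar> \<le> real N * E" using lt[OF that(1), of i] lt[OF that(2), of i] by auto
      then show "(x i - y i)\<^sup>2 \<le> (real N * E)\<^sup>2" by (metis abs_le_square_iff abs_ge_self order_trans)
    qed
    finally show ?thesis by (simp add: C_def)
  qed
  have pt: "(g x)\<^sup>2 \<le> C" if x: "R x" and p0: "p > 0" for x
  proof -
    have sC: "\<bar>g x - g y\<bar> \<le> sqrt C" if "R y" for y
      using diff[OF x that] by (metis real_sqrt_abs real_sqrt_le_mono)
    have "\<bar>g x * p\<bar> = \<bar>(\<integral>y. g x - g y \<partial>\<nu>)\<bar>"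
      using g by (simp add: p_def mult.commute)
    also have "\<dots> \<le> (\<integral>y. \<bar>g x - g y\<bar> \<partial>\<nu>)" by (rule integral_abs_bound)
    also have "\<dots> \<le> (\<integral>y. sqrt C \<partial>\<nu>)"
      using AER sC g by (intro integral_mono_AE) auto
    also have "\<dots> = sqrt C * p" by (simp add: p_def)
    finally have "\<bar>g x\<bar> \<le> sqrt C" using p0 by (simp add: abs_mult)
    then show ?thesis using C by (metis real_sqrt_abs real_sqrt_le_iff)
  qed
  show ?thesis
  proof (cases "p > 0")
    case True
    have "ip g g \<le> (\<integral>x. C \<partial>\<nu>)" unfolding ip_def
      using AER g pt[OF _ True] by (intro integral_mono_AE) (auto simp: power2_eq_square)
    also have "\<dots> = C * p" by (simp add: p_def)
    also have "\<dots> \<le> C * 1" using p C by (intro mult_left_mono) auto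
    finally show ?thesis by (simp add: C_def)
  next
    case False
    then have "p = 0" using p by simp
    then have "emeasure \<nu> (space \<nu>) = 0" by (simp add: p_def fin.emeasure_eq_measure)
    then have "AE x in \<nu>. False" by (intro AE_I[where N="space \<nu>"]) auto
    then have "AE x in \<nu>. g x * g x = 0" by eventually_elim simp
    then have "ip g g = 0" unfolding ip_def by (rule integral_eq_zero_AE)
    then show ?thesis using C by (simp add: C_def)
  qed
qed

text \<open>A self-adjoint Markov operator that contracts Lipschitz constants has a spectral gap.\<close>

lemma contraction_gap:
  assumes A: "\<And>f. f \<in> bmeas \<Longrightarrow> A f \<in> bmeas" "\<And>f g. f \<in> bmeas \<Longrightarrow> g \<in> bmeas \<Longrightarrow> ip g (A f) = ip (A g) f"
    and mean: "\<And>f. f \<in> bmeas \<Longrightarrow> (\<integral>x. A f x \<partial>\<nu>) = (\<integral>x. f x \<partial>\<nu>)"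
    and contr: "\<And>f L. f \<in> bmeas \<Longrightarrow> L \<ge> 0 \<Longrightarrow> quad_lip {..<N} L 0 f \<Longrightarrow> quad_lip {..<N} (r * L) 0 (A f)"
    and r: "r > 0" and f: "f \<in> bmeas" "(\<integral>x. f x \<partial>\<nu>) = 0" "quad_lip {..<N} L 0 f" "L \<ge> 0"
  shows "ip f (A f) \<le> sqrt r * ip f f"
proof (rule decay_contraction[OF A f(1) r, where C="L * (real N * (real N * E)\<^sup>2)"])
  fix n
  have "(A ^^ n) f \<in> bmeas \<and> (\<integral>x. (A ^^ n) f x \<partial>\<nu>) = 0 \<and> quad_lip {..<N} (r ^ n * L) 0 ((A ^^ n) f)"
  proof (induction n)
    case (Suc n)
    then show ?case using A(1) mean contr[of "(A ^^ n) f" "r ^ n * L"] r f(4) by (simp add: mult.assoc)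
  qed (use f in simp)
  then have "ip ((A ^^ n) f) ((A ^^ n) f) \<le> r ^ n * L * (real N * (real N * E)\<^sup>2)"
    using r f(4) by (intro osc_bound) auto
  then show "ip ((A ^^ n) f) ((A ^^ n) f) \<le> L * (real N * (real N * E)\<^sup>2) * r ^ n" by (simp add: mult_ac)
qed auto

lemma shell_sum_diff: "x \<in> shell \<Longrightarrow> y \<in> shell \<Longrightarrow> (\<Sum>i<N. x i - y i) = 0"
  by (simp add: shell_def sum_subtractf)

lemma pair_avg_integral:
  assumes f: "f \<in> bmeas" and I: "I \<subseteq> {..<N}" "card I \<ge> 2"
  shows "(\<integral>x. pair_avg I f x \<partial>\<nu>) = (\<integral>x. f x \<partial>\<nu>)"
proof -
  have fin: "finite I" using I(1) finite_subset by blast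
  have one: "pair_avg I (\<lambda>_. 1) x = 1" for x
  proof -
    have "I \<noteq> {}" using I(2) by auto
    then show ?thesis
      using fin I(2) by (simp add: pair_avg_def resample_avg_def beta.prob_space[simplified] card_Diff_singleton of_nat_diff)
  qed
  have "ip (\<lambda>_. 1) (pair_avg I f) = ip (pair_avg I (\<lambda>_. 1)) f" using f I by (intro pair_avg_selfadjoint) auto
  then show ?thesis unfolding ip_def one by simp
qed

text \<open>On the shell the differences of all sites add up to zero, so only the contracting
  coefficient 1 - 2 (1 - q) / N is left. The square root from \<open>contraction_gap\<close> turns
  it into at most 1 - (1 - q) / N.\<close>

lemma mean_field_gap:
  assumes f: "f \<in> bmeas" "(\<integral>x. f x \<partial>\<nu>) = 0" "quad_lip {..<N} L 0 f" "L \<ge> 0"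
  shows "(1 - q) * ip f f \<le> real N * (ip f f - ip f (pair_avg {..<N} f))"
proof -
  define r where "r = 1 - 2 * (1 - q) / real N"
  have q: "1/2 \<le> q" "q < 1" using mix_props[OF gam] by auto
  have N: "real N \<ge> 2" using N2 by simp
  have r: "r > 0"
  proof -
    have "2 * (1 - q) / real N < 1" using q N by (simp add: pos_divide_less_eq)
    then show ?thesis by (simp add: r_def)
  qed
  have "ip f (pair_avg {..<N} f) \<le> sqrt r * ip f f"
  proof (rule contraction_gap[OF _ _ _ _ r f])
    fix g L assume g: "g \<in> bmeas" "(L::real) \<ge> 0" "quad_lip {..<N} L 0 g"
    have "quad_lip {..<N} L L g" using g by (intro quad_lip_mono[OF g(3)]) auto
    then have "quad_lip {..<N} (L * r) (2 * L) (pair_avg {..<N} g)"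
      using quad_lip_pair_avg_pow[OF g(1), of "{..<N}" L 1] N2 g(2) by (simp add: r_def)
    then show "quad_lip {..<N} (r * L) 0 (pair_avg {..<N} g)"
      unfolding quad_lip_def by (auto simp: shell_sum_diff mult_ac)
  qed (use N2 in \<open>auto simp: pair_avg_selfadjoint pair_avg_integral\<close>)
  moreover have "sqrt r \<le> 1 - (1 - q) / real N"
  proof (rule real_le_lsqrt)
    have "0 \<le> ((1 - q) / real N)\<^sup>2" by simp
    then show "r \<le> (1 - (1 - q) / real N)\<^sup>2" by (simp add: r_def power2_eq_square algebra_simps)
    have "(1 - q) / real N \<le> 1" using q N by (simp add: pos_divide_le_eq)
    then show "0 \<le> 1 - (1 - q) / real N" by simp
  qed
  ultimately have "ip f (pair_avg {..<N} f) \<le> (1 - (1 - q) / real N) * ip f f"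
    by (meson ip_nonneg mult_right_mono order_trans)
  then have "(1 - q) / real N * ip f f \<le> ip f f - ip f (pair_avg {..<N} f)" by (simp add: algebra_simps)
  then show ?thesis using N by (simp add: field_simps)
qed

text \<open>Averages that leave out one site: the left-out site serves as catalyst for all other pairs.\<close>

definition left_out_avg :: "nat \<Rightarrow> ((nat \<Rightarrow> real) \<Rightarrow> real) \<Rightarrow> (nat \<Rightarrow> real) \<Rightarrow> real" where
  "left_out_avg t f x = (\<Sum>k<N. (pair_avg ({..<N} - {k}) ^^ t) f x) / real N"

lemma ip_left_out_avg:
  assumes "f \<in> bmeas" "g \<in> bmeas"
  shows "ip g (left_out_avg t f) = (\<Sum>k<N. ip g ((pair_avg ({..<N} - {k}) ^^ t) f)) / real N"
proof -
  have B: "(\<lambda>x. g x * (pair_avg ({..<N} - {k}) ^^ t) f x) \<in> bmeas" for k using assms by auto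
  have "ip g (left_out_avg t f) = (\<integral>x. (\<Sum>k<N. g x * (pair_avg ({..<N} - {k}) ^^ t) f x) / real N \<partial>\<nu>)"
    unfolding ip_def left_out_avg_def by (simp add: sum_distrib_left)
  also have "\<dots> = (\<Sum>k<N. (\<integral>x. g x * (pair_avg ({..<N} - {k}) ^^ t) f x \<partial>\<nu>)) / real N"
    using B by (simp add: Bochner_Integration.integral_sum bmeas_integrable)
  finally show ?thesis by (simp add: ip_def)
qed

text \<open>Without site \<open>k\<close> the total discrepancy is - d_k; it does not contract and
  contributes 2 L d_k^2. The mean over \<open>k\<close> turns this into the small term 2 / N, which
  is why all sites are left out in turn.\<close>

lemma left_out_avg_gap:
  assumes f: "f \<in> bmeas" "(\<integral>x. f x \<partial>\<nu>) = 0" "quad_lip {..<N} L 0 f" "L \<ge> 0" and N3: "N \<ge> 3"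
  shows "ip f (left_out_avg t f) \<le> sqrt ((1 - 2 * (1 - q) / (real N - 1)) ^ t + 2 / real N) * ip f f"
proof (rule contraction_gap[OF _ _ _ _ _ f])
  let ?I = "\<lambda>k. {..<N} - {k}"
  let ?r = "1 - 2 * (1 - q) / (real N - 1)"
  have q: "1/2 \<le> q" "q < 1" using mix_props[OF gam] by auto
  have I: "?I k \<subseteq> {..<N}" "card (?I k) = N - 1" if "k < N" for k using that by (auto simp: card_Diff_singleton)
  have r: "?r \<ge> 0" using q N3 by (simp add: pos_divide_le_eq)
  then show "0 < ?r ^ t + 2 / real N" using N3 by (intro add_nonneg_pos) auto
  show B: "left_out_avg t f \<in> bmeas" if "f \<in> bmeas" for f
    unfolding left_out_avg_def[abs_def] using that by (intro bmeas_divide bmeas_sum pair_avg_pow_bmeas) auto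
  show sa: "ip g (left_out_avg t f) = ip (left_out_avg t g) f" if "f \<in> bmeas" "g \<in> bmeas" for f g
    using ip_left_out_avg[OF that] ip_left_out_avg[OF that(2,1)] that
    by (simp add: ip_commute[of "left_out_avg t g"] ip_commute[of f] pair_avg_pow_selfadjoint)
  show "(\<integral>x. left_out_avg t f x \<partial>\<nu>) = (\<integral>x. f x \<partial>\<nu>)" if f: "f \<in> bmeas" for f
  proof -
    have "(\<integral>x. (pair_avg (?I k) ^^ s) f x \<partial>\<nu>) = (\<integral>x. f x \<partial>\<nu>)" if "k < N" for k s
    proof (induction s)
      case (Suc s)
      have "(\<integral>x. pair_avg (?I k) ((pair_avg (?I k) ^^ s) f) x \<partial>\<nu>) = (\<integral>x. (pair_avg (?I k) ^^ s) f x \<partial>\<nu>)"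
        using f I[OF that] N3 by (intro pair_avg_integral pair_avg_pow_bmeas) auto
      then show ?case using Suc by simp
    qed simp
    moreover have "ip (\<lambda>_. 1) (left_out_avg t f) = (\<Sum>k<N. ip (\<lambda>_. 1) ((pair_avg (?I k) ^^ t) f)) / real N"
      using f by (intro ip_left_out_avg) auto
    ultimately show ?thesis using N3 by (simp add: ip_def)
  qed
  fix g L assume g: "g \<in> bmeas" "(L::real) \<ge> 0" "quad_lip {..<N} L 0 g"
  show "quad_lip {..<N} ((?r ^ t + 2 / real N) * L) 0 (left_out_avg t g)"
    unfolding quad_lip_def
  proof (intro ballI)
    fix x y assume xy: "x \<in> shell" "y \<in> shell"
    define d where "d k = x k - y k" for k
    have D: "(\<Sum>i\<in>?I k. d i) = - d k" if "k < N" for k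
      using shell_sum_diff[OF xy] that by (simp add: sum_diff1 d_def)
    have V: "(\<Sum>i\<in>?I k. (d i)\<^sup>2) = (\<Sum>i<N. (d i)\<^sup>2) - (d k)\<^sup>2" if "k < N" for k
      using that by (simp add: sum_diff1)
    have one: "((pair_avg (?I k) ^^ t) g x - (pair_avg (?I k) ^^ t) g y)\<^sup>2 \<le> L * ?r ^ t * (\<Sum>i<N. (d i)\<^sup>2) + 2 * L * (d k)\<^sup>2"
      if k: "k < N" for k
    proof -
      \<comment> \<open>On the shell d_k is minus the total difference on \<open>?I k\<close>, so
        the full sum of squares is exactly the sum over \<open>?I k\<close> plus the square of that
        total.\<close>
      have "quad_lip (?I k) L L g"
        unfolding quad_lip_def
      proof (intro ballI)
        fix x y assume xy: "x \<in> shell" "y \<in> shell"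
        have D': "(\<Sum>i\<in>?I k. x i - y i) = - (x k - y k)"
          using shell_sum_diff[OF xy] k by (simp add: sum_diff1)
        have V': "(\<Sum>i\<in>?I k. (x i - y i)\<^sup>2) = (\<Sum>i<N. (x i - y i)\<^sup>2) - (x k - y k)\<^sup>2"
          using k by (simp add: sum_diff1)
        show "(g x - g y)\<^sup>2 \<le> L * (\<Sum>i\<in>?I k. (x i - y i)\<^sup>2) + L * (\<Sum>i\<in>?I k. x i - y i)\<^sup>2"
          unfolding D' V' power2_minus using g(3)[unfolded quad_lip_def, rule_format, OF xy] by (simp add: algebra_simps)
      qed
      then have "quad_lip (?I k) (L * ?r ^ t) (2 * L) ((pair_avg (?I k) ^^ t) g)"
        using quad_lip_pair_avg_pow[OF g(1) I(1)[OF k], of L t] I[OF k] N3 g(2) by (simp add: of_nat_diff)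
      then have "((pair_avg (?I k) ^^ t) g x - (pair_avg (?I k) ^^ t) g y)\<^sup>2 \<le> L * ?r ^ t * (\<Sum>i\<in>?I k. (d i)\<^sup>2) + 2 * L * (\<Sum>i\<in>?I k. d i)\<^sup>2"
        using xy unfolding quad_lip_def d_def by blast
      then have "((pair_avg (?I k) ^^ t) g x - (pair_avg (?I k) ^^ t) g y)\<^sup>2 \<le> L * ?r ^ t * (\<Sum>i\<in>?I k. (d i)\<^sup>2) + 2 * L * (d k)\<^sup>2"
        unfolding D[OF k] power2_minus .
      also have "\<dots> \<le> L * ?r ^ t * (\<Sum>i<N. (d i)\<^sup>2) + 2 * L * (d k)\<^sup>2"
        unfolding V[OF k] using g(2) r by (intro add_right_mono mult_left_mono) auto
      finally show ?thesis .
    qed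
    let ?u = "\<lambda>k. (pair_avg (?I k) ^^ t) g x - (pair_avg (?I k) ^^ t) g y"
    have "(left_out_avg t g x - left_out_avg t g y)\<^sup>2 = (\<Sum>k<N. ?u k)\<^sup>2 / (real N * real N)"
      unfolding left_out_avg_def by (simp add: sum_subtractf diff_divide_distrib[symmetric] power_divide power2_eq_square)
    also have "\<dots> \<le> ((\<Sum>k<N. (?u k)\<^sup>2) * real N) / (real N * real N)"
      using sum_squared_le_sum_of_squares[of ?u "{..<N}"] by (intro divide_right_mono) auto
    also have "\<dots> = (\<Sum>k<N. (?u k)\<^sup>2) / real N" using N3 by simp
    also have "\<dots> \<le> (\<Sum>k<N. L * ?r ^ t * (\<Sum>i<N. (d i)\<^sup>2) + 2 * L * (d k)\<^sup>2) / real N"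
      by (intro divide_right_mono sum_mono one) auto
    also have "\<dots> = (?r ^ t + 2 / real N) * L * (\<Sum>i<N. (d i)\<^sup>2)"
    proof -
      have "(real N * (L * \<rho> * S) + 2 * L * S) / real N = (\<rho> + 2 / real N) * L * S" for \<rho> S
        using N3 by (simp add: field_simps)
      then show ?thesis by (simp add: sum.distrib sum_distrib_left[symmetric])
    qed
    finally show "(left_out_avg t g x - left_out_avg t g y)\<^sup>2 \<le> (?r ^ t + 2 / real N) * L * (\<Sum>i<N. (x i - y i)\<^sup>2) + 0 * (\<Sum>i<N. x i - y i)\<^sup>2"
      by (simp add: d_def)
  qed
qed

end

section \<open>Inserting the weights\<close>

lemma sum_off_diag_le:
  fixes F :: "nat \<Rightarrow> nat \<Rightarrow> ennreal"
  shows "(\<Sum>i<N. \<Sum>j\<in>{..<N} - {i}. \<Sum>k\<in>{..<N} - {i, j}. F i k) \<le> of_nat N * (\<Sum>i<N. \<Sum>k\<in>{..<N} - {i}. F i k)"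
    and "(\<Sum>i<N. \<Sum>j\<in>{..<N} - {i}. \<Sum>k\<in>{..<N} - {i, j}. F j k) \<le> of_nat N * (\<Sum>i<N. \<Sum>k\<in>{..<N} - {i}. F i k)"
proof -
  have "(\<Sum>i<N. \<Sum>j\<in>{..<N} - {i}. \<Sum>k\<in>{..<N} - {i, j}. F i k) \<le> (\<Sum>i<N. \<Sum>j<N. \<Sum>k\<in>{..<N} - {i}. F i k)"
  proof (rule sum_mono)
    fix i
    have "(\<Sum>j\<in>{..<N} - {i}. \<Sum>k\<in>{..<N} - {i, j}. F i k) \<le> (\<Sum>j\<in>{..<N} - {i}. \<Sum>k\<in>{..<N} - {i}. F i k)"
      by (intro sum_mono sum_mono2) auto
    also have "\<dots> \<le> (\<Sum>j<N. \<Sum>k\<in>{..<N} - {i}. F i k)" by (intro sum_mono2) auto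
    finally show "(\<Sum>j\<in>{..<N} - {i}. \<Sum>k\<in>{..<N} - {i, j}. F i k) \<le> (\<Sum>j<N. \<Sum>k\<in>{..<N} - {i}. F i k)" .
  qed
  then show "(\<Sum>i<N. \<Sum>j\<in>{..<N} - {i}. \<Sum>k\<in>{..<N} - {i, j}. F i k) \<le> of_nat N * (\<Sum>i<N. \<Sum>k\<in>{..<N} - {i}. F i k)"
    by (simp add: sum_distrib_left)
  have "(\<Sum>i<N. \<Sum>j\<in>{..<N} - {i}. \<Sum>k\<in>{..<N} - {i, j}. F j k) \<le> (\<Sum>i<N. \<Sum>j<N. \<Sum>k\<in>{..<N} - {j}. F j k)"
  proof (rule sum_mono)
    fix i
    have "(\<Sum>j\<in>{..<N} - {i}. \<Sum>k\<in>{..<N} - {i, j}. F j k) \<le> (\<Sum>j\<in>{..<N} - {i}. \<Sum>k\<in>{..<N} - {j}. F j k)"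
      by (intro sum_mono sum_mono2) auto
    also have "\<dots> \<le> (\<Sum>j<N. \<Sum>k\<in>{..<N} - {j}. F j k)" by (intro sum_mono2) auto
    finally show "(\<Sum>j\<in>{..<N} - {i}. \<Sum>k\<in>{..<N} - {i, j}. F j k) \<le> (\<Sum>j<N. \<Sum>k\<in>{..<N} - {j}. F j k)" .
  qed
  then show "(\<Sum>i<N. \<Sum>j\<in>{..<N} - {i}. \<Sum>k\<in>{..<N} - {i, j}. F j k) \<le> of_nat N * (\<Sum>i<N. \<Sum>k\<in>{..<N} - {i}. F i k)"
    by simp
qed

context energy_simplex begin

definition mean_field_energy :: "real \<Rightarrow> ((nat \<Rightarrow> real) \<Rightarrow> real) \<Rightarrow> ennreal" where
  "mean_field_energy m f = (\<Sum>i<N. \<Sum>j\<in>{..<N} - {i}. pair_energy m f i j)"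

definition chain_energy :: "real \<Rightarrow> ((nat \<Rightarrow> real) \<Rightarrow> real) \<Rightarrow> ennreal" where
  "chain_energy m f = (\<Sum>k<N-1. pair_energy m f k (Suc k))"

text \<open>For \<open>k\<close> equal to \<open>i\<close> or \<open>j\<close> the weight is below
  the rate of the pair itself. In the remaining terms every pair energy occurs for at most N third
  sites, hence the factor \<open>of_nat N\<close>.\<close>

lemma catalyst_sum:
  assumes m: "m \<ge> 0" and \<kappa>: "unif_dom \<gamma> \<kappa>" "\<kappa> > 0" and f: "f \<in> borel_measurable (cfg N)"
  shows "(\<Sum>i<N. \<Sum>j\<in>{..<N} - {i}. \<Sum>k<N. jump i j f (\<lambda>x. ennreal (x k powr m)))
    \<le> ennreal (2 + 8 * \<kappa> + 8 * \<kappa>\<^sup>2 * 2 powr m) * of_nat N * mean_field_energy m f"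
proof -
  let ?A = "ennreal (8 * \<kappa>)" and ?B = "ennreal (8 * \<kappa>\<^sup>2 * 2 powr m)"
  have own: "jump i j f (\<lambda>x. ennreal (x k powr m)) \<le> pair_energy m f i j"
    if "i < N" "j < N" "k = i \<or> k = j" for i j k
    unfolding pair_energy_def
  proof (rule jump_mono, use AE_nu in eventually_elim)
    case (elim x)
    then have "0 < x i" "0 < x j" using that by auto
    then show ?case using m that(3) by (auto intro!: ennreal_leI powr_mono2)
  qed
  have row: "(\<Sum>k<N. jump i j f (\<lambda>x. ennreal (x k powr m)))
     \<le> (\<Sum>k\<in>{..<N} - {i, j}. ?A * pair_energy m f i k + ?B * pair_energy m f j k) + of_nat N * pair_energy m f i j"
    if ij: "i < N" "j \<in> {..<N} - {i}" for i j
  proof -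
    have "(\<Sum>k<N. jump i j f (\<lambda>x. ennreal (x k powr m)))
      \<le> (\<Sum>k<N. pair_energy m f i j + (if k \<in> {i, j} then 0 else ?A * pair_energy m f i k + ?B * pair_energy m f j k))"
    proof (rule sum_mono)
      fix k assume "k \<in> {..<N}"
      then show "jump i j f (\<lambda>x. ennreal (x k powr m)) \<le> pair_energy m f i j + (if k \<in> {i, j} then 0 else ?A * pair_energy m f i k + ?B * pair_energy m f j k)"
        using own[of i j k] catalyst[OF m \<kappa> f, of i j k] ij by (auto simp: add.assoc)
    qed
    also have "\<dots> = (\<Sum>k<N. if k \<in> {i, j} then 0 else ?A * pair_energy m f i k + ?B * pair_energy m f j k) + of_nat N * pair_energy m f i j"
      by (simp add: sum.distrib add.commute)
    also have "(\<Sum>k<N. if k \<in> {i, j} then 0 else ?A * pair_energy m f i k + ?B * pair_energy m f j k)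
       = (\<Sum>k\<in>{..<N} - {i, j}. ?A * pair_energy m f i k + ?B * pair_energy m f j k)"
      by (intro sum.mono_neutral_cong_right) auto
    finally show ?thesis .
  qed
  have "(\<Sum>i<N. \<Sum>j\<in>{..<N} - {i}. \<Sum>k<N. jump i j f (\<lambda>x. ennreal (x k powr m)))
     \<le> (\<Sum>i<N. \<Sum>j\<in>{..<N} - {i}. (\<Sum>k\<in>{..<N} - {i, j}. ?A * pair_energy m f i k + ?B * pair_energy m f j k) + of_nat N * pair_energy m f i j)"
    by (intro sum_mono row) auto
  also have "\<dots> = ?A * (\<Sum>i<N. \<Sum>j\<in>{..<N} - {i}. \<Sum>k\<in>{..<N} - {i, j}. pair_energy m f i k)
      + ?B * (\<Sum>i<N. \<Sum>j\<in>{..<N} - {i}. \<Sum>k\<in>{..<N} - {i, j}. pair_energy m f j k) + of_nat N * mean_field_energy m f"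
    by (simp add: sum.distrib sum_distrib_left mean_field_energy_def)
  also have "\<dots> \<le> ?A * (of_nat N * mean_field_energy m f) + ?B * (of_nat N * mean_field_energy m f) + of_nat N * mean_field_energy m f"
    unfolding mean_field_energy_def by (intro add_mono mult_left_mono sum_off_diag_le) auto
  also have "\<dots> = (?A + ?B + 1) * (of_nat N * mean_field_energy m f)"
    by (simp add: distrib_right)
  also have "\<dots> \<le> ennreal (2 + 8 * \<kappa> + 8 * \<kappa>\<^sup>2 * 2 powr m) * (of_nat N * mean_field_energy m f)"
  proof (rule mult_right_mono)
    have "?A + ?B + 1 = ennreal (8 * \<kappa> + 8 * \<kappa>\<^sup>2 * 2 powr m + 1)"
      using \<kappa>(2) by (simp add: ennreal_plus)
    then show "?A + ?B + 1 \<le> ennreal (2 + 8 * \<kappa> + 8 * \<kappa>\<^sup>2 * 2 powr m)" by (simp add: ennreal_leI)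
  qed simp
  finally show ?thesis by (simp add: mult.assoc)
qed

text \<open>At most N^2 ordered pairs, each path of length at most N and each path sum at most the
  whole chain: this is the cubic factor.\<close>

lemma mean_field_energy_path:
  assumes m: "m \<ge> 0" and f: "f \<in> borel_measurable (cfg N)"
  shows "emeasure \<beta> {1/4..3/4} * mean_field_energy m f \<le> ennreal (192 * 4 powr m) * of_nat (N ^ 3) * chain_energy m f"
proof -
  let ?C = "ennreal (192 * 4 powr m)"
  have up: "emeasure \<beta> {1/4..3/4} * pair_energy m f i j \<le> ?C * of_nat N * chain_energy m f" if "i < j" "j < N" for i j
  proof -
    have "emeasure \<beta> {1/4..3/4} * pair_energy m f i j \<le> ?C * of_nat (j - i) * (\<Sum>k\<in>{i..<j}. pair_energy m f k (Suc k))"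
      by (rule pair_energy_path[OF m f that])
    also have "\<dots> \<le> ?C * of_nat N * chain_energy m f"
      unfolding chain_energy_def using that by (intro mult_mono mult_left_mono sum_mono2) auto
    finally show ?thesis .
  qed
  have pair: "emeasure \<beta> {1/4..3/4} * pair_energy m f i j \<le> ?C * of_nat N * chain_energy m f" if "i < N" "j \<in> {..<N} - {i}" for i j
    using that up[of i j] up[of j i] pair_energy_sym[OF f, of j i m] by (cases "i < j") auto
  have "emeasure \<beta> {1/4..3/4} * mean_field_energy m f = (\<Sum>i<N. \<Sum>j\<in>{..<N} - {i}. emeasure \<beta> {1/4..3/4} * pair_energy m f i j)"
    by (simp add: mean_field_energy_def sum_distrib_left)
  also have "\<dots> \<le> (\<Sum>i<N. \<Sum>j\<in>{..<N} - {i}. ?C * of_nat N * chain_energy m f)" by (intro sum_mono pair) auto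
  also have "\<dots> \<le> (\<Sum>i<N. \<Sum>j<N. ?C * of_nat N * chain_energy m f)" by (intro sum_mono sum_mono2) auto
  also have "\<dots> = ?C * of_nat (N ^ 3) * chain_energy m f" by (simp add: power3_eq_cube mult_ac)
  finally show ?thesis .
qed

lemma jump_sum_ennreal:
  assumes f: "f \<in> bmeas" and I: "I \<subseteq> {..<N}" "card I \<ge> 2"
  shows "(\<Sum>i\<in>I. \<Sum>j\<in>I - {i}. jump i j f (\<lambda>_. 1)) = ennreal (2 * (real (card I) * (real (card I) - 1)) * (ip f f - ip f (pair_avg I f)))"
proof -
  have "(\<Sum>i\<in>I. \<Sum>j\<in>I - {i}. jump i j f (\<lambda>_. 1)) = (\<Sum>i\<in>I. \<Sum>j\<in>I - {i}. ennreal (2 * (ip f f - ip f (resample_avg i j f))))"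
    using I by (intro sum.cong refl jump_ip(1) f) auto
  also have "\<dots> = (\<Sum>i\<in>I. ennreal (\<Sum>j\<in>I - {i}. 2 * (ip f f - ip f (resample_avg i j f))))"
  proof (intro sum.cong refl sum_ennreal)
    fix i j assume "i \<in> I" "j \<in> I - {i}"
    then show "0 \<le> 2 * (ip f f - ip f (resample_avg i j f))" using jump_ip(2)[OF f, of i j] I by auto
  qed
  also have "\<dots> = ennreal (\<Sum>i\<in>I. \<Sum>j\<in>I - {i}. 2 * (ip f f - ip f (resample_avg i j f)))"
  proof (intro sum_ennreal sum_nonneg)
    fix i j assume "i \<in> I" "j \<in> I - {i}"
    then show "0 \<le> 2 * (ip f f - ip f (resample_avg i j f))" using jump_ip(2)[OF f, of i j] I by auto
  qed
  also have "(\<Sum>i\<in>I. \<Sum>j\<in>I - {i}. 2 * (ip f f - ip f (resample_avg i j f))) = 2 * (real (card I) * (real (card I) - 1) * (ip f f - ip f (pair_avg I f)))"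
    by (simp only: sum_distrib_left[symmetric] jump_sum_pair_avg[OF f I])
  finally show ?thesis by (simp only: mult_ac)
qed

section \<open>Catalyst weights with a sum of order N\<close>

text \<open>The hypothesis on \<open>c\<close> replaces the unit weight of the mean-field form by
  the sum of the catalyst weights. A factor N then appears on both sides, from the number of pairs
  and from \<open>catalyst_sum\<close>, and is cancelled at the end.\<close>

lemma weighted_gap_convex:
  assumes m: "m \<ge> 0" and \<kappa>: "unif_dom \<gamma> \<kappa>" "\<kappa> > 0"
    and c: "c \<ge> 0" "AE x in \<nu>. c * real N \<le> (\<Sum>k<N. x k powr m)"
    and f: "f \<in> bmeas" "(\<integral>x. f x \<partial>\<nu>) = 0" "quad_lip {..<N} L 0 f" "L \<ge> 0"
  shows "ennreal (c * (1 - q) * real N * ip f f) \<le> ennreal (2 + 8 * \<kappa> + 8 * \<kappa>\<^sup>2 * 2 powr m) * mean_field_energy m f"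
proof -
  note fm [measurable] = bmeas_measurable[OF f(1)]
  have q: "q < 1" using mix_props[OF gam] by auto
  have N: "real N \<ge> 2" using N2 by simp
  have one: "ennreal (c * real N) * jump i j f (\<lambda>_. 1) \<le> (\<Sum>k<N. jump i j f (\<lambda>x. ennreal (x k powr m)))"
    if "i < N" "j < N" for i j
  proof -
    have "ennreal (c * real N) * jump i j f (\<lambda>_. 1) = jump i j f (\<lambda>x. ennreal (c * real N) * 1)"
      using that fm by (intro jump_cmult[symmetric]) auto
    also have "\<dots> \<le> jump i j f (\<lambda>x. \<Sum>k<N. ennreal (x k powr m))"
    proof (rule jump_mono, use c(2) in eventually_elim)
      case (elim x)
      then have "ennreal (c * real N) \<le> ennreal (\<Sum>k<N. x k powr m)" by (rule ennreal_leI)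
      then show ?case by (simp add: sum_ennreal)
    qed
    also have "\<dots> = (\<Sum>k<N. jump i j f (\<lambda>x. ennreal (x k powr m)))"
      unfolding jump_def sum_distrib_right using that fm by (intro nn_integral_sum) measurable
    finally show ?thesis .
  qed
  have gap: "(1 - q) * ip f f \<le> 2 * (real N - 1) * (ip f f - ip f (pair_avg {..<N} f))"
  proof -
    have "(1 - q) * ip f f \<le> real N * (ip f f - ip f (pair_avg {..<N} f))" by (rule mean_field_gap[OF f])
    moreover have "0 \<le> ip f f - ip f (pair_avg {..<N} f)"
    proof -
      have "0 \<le> real N * (ip f f - ip f (pair_avg {..<N} f))"
        using mean_field_gap[OF f] q ip_nonneg[of f] by (meson less_imp_le diff_ge_0_iff_ge mult_nonneg_nonneg order_trans)
      then show ?thesis using N by (simp add: zero_le_mult_iff)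
    qed
    ultimately show ?thesis using N mult_right_mono[of "real N" "2 * (real N - 1)" "ip f f - ip f (pair_avg {..<N} f)"] by simp
  qed
  have "ennreal (c * (1 - q) * real N * ip f f) * of_nat N \<le> ennreal (c * real N) * (\<Sum>i<N. \<Sum>j\<in>{..<N} - {i}. jump i j f (\<lambda>_. 1))"
  proof -
    have "ennreal (c * (1 - q) * real N * ip f f) * of_nat N = ennreal ((c * real N) * (real N * ((1 - q) * ip f f)))"
      using c q N by (simp add: ennreal_of_nat_eq_real_of_nat ennreal_mult''[symmetric] mult_ac)
    also have "\<dots> \<le> ennreal ((c * real N) * (real N * (2 * (real N - 1) * (ip f f - ip f (pair_avg {..<N} f)))))"
      using gap c N by (intro ennreal_leI mult_left_mono) auto
    also have "\<dots> = ennreal (c * real N) * ennreal (2 * (real N * (real N - 1)) * (ip f f - ip f (pair_avg {..<N} f)))"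
      using c by (subst ennreal_mult'[symmetric]) (auto simp: mult_ac)
    finally show ?thesis using jump_sum_ennreal[OF f(1), of "{..<N}"] N2 by simp
  qed
  also have "\<dots> \<le> (\<Sum>i<N. \<Sum>j\<in>{..<N} - {i}. \<Sum>k<N. jump i j f (\<lambda>x. ennreal (x k powr m)))"
    unfolding sum_distrib_left by (intro sum_mono one) auto
  also have "\<dots> \<le> ennreal (2 + 8 * \<kappa> + 8 * \<kappa>\<^sup>2 * 2 powr m) * of_nat N * mean_field_energy m f"
    by (rule catalyst_sum[OF m \<kappa> fm])
  finally have "of_nat N * ennreal (c * (1 - q) * real N * ip f f) \<le> of_nat N * (ennreal (2 + 8 * \<kappa> + 8 * \<kappa>\<^sup>2 * 2 powr m) * mean_field_energy m f)"
    by (simp add: mult_ac)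
  then show ?thesis
    using N2 by (subst (asm) ennreal_mult_le_mult_iff) (auto simp: of_nat_less_top)
qed

end

section \<open>Exponents between 0 and 1: the gain from spreading energy\<close>

definition beta_moment :: "real \<Rightarrow> real \<Rightarrow> real" where
  "beta_moment g p = (\<integral>a. a powr p + (1 - a) powr p \<partial>sym_beta g)"

text \<open>Strict because \<open>a powr p\<close> exceeds a for 0 < a < 1. So a resampled pair has,
  on average, a larger sum of p-th powers than a pair with all its energy on one site.\<close>

lemma beta_moment_props:
  assumes g: "g > 0" and p: "0 < p" "p < 1"
  shows "integrable (sym_beta g) (\<lambda>a. a powr p + (1 - a) powr p)" "1 < beta_moment g p"
proof -
  interpret prob_space "sym_beta g" by (rule prob_space_sym_beta[OF g])
  let ?h = "\<lambda>a::real. a powr p + (1 - a) powr p - 1"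
  show i: "integrable (sym_beta g) (\<lambda>a. a powr p + (1 - a) powr p)"
  proof (rule integrable_const_bound[where B=2])
    show "AE a in sym_beta g. norm (a powr p + (1 - a) powr p) \<le> 2"
      using AE_sym_beta
    proof eventually_elim
      case (elim a)
      then have "a powr p \<le> 1" "(1 - a) powr p \<le> 1" using p by (auto simp: powr_le1)
      then show ?case by simp
    qed
  qed simp
  have pos: "AE a in sym_beta g. 0 < ?h a"
    using AE_sym_beta
  proof eventually_elim
    case (elim a)
    have "a powr 1 < a powr p" "(1 - a) powr 1 < (1 - a) powr p"
      using elim p powr_less_mono'[of a p 1] powr_less_mono'[of "1 - a" p 1] by auto
    then show ?case using elim by simp
  qed
  have ih: "integrable (sym_beta g) ?h" using i by auto
  have "(\<integral>a. ?h a \<partial>sym_beta g) \<noteq> 0"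
  proof
    assume "(\<integral>a. ?h a \<partial>sym_beta g) = 0"
    then have "AE a in sym_beta g. ?h a = 0"
      using pos ih by (subst (asm) integral_nonneg_eq_0_iff_AE) (auto elim: eventually_mono)
    then have "AE a in sym_beta g. False" using pos by eventually_elim auto
    then show False by simp
  qed
  moreover have "0 \<le> (\<integral>a. ?h a \<partial>sym_beta g)"
    using pos by (intro integral_nonneg_AE) (auto elim: eventually_mono)
  moreover have "(\<integral>a. ?h a \<partial>sym_beta g) = beta_moment g p - 1"
    unfolding beta_moment_def using i by (simp add: prob_space[simplified])
  ultimately show "1 < beta_moment g p" by simp
qed

text \<open>The right-hand side is homogeneous of degree one. If one energy is much smaller than the
  other it is at least a positive multiple of a + b. For comparable energies it may be negative;
  then the term with \<open>C\<close> pays for the deficit, except when both energies are small,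
  where \<open>c / 2\<close> pays. Energies are meant in units of their mean.\<close>

lemma spread_gain:
  fixes m M :: real
  assumes m: "0 < m" "m < 1" and M: "1 < M"
  shows "\<exists>c>0. \<exists>C\<ge>0. \<forall>a>0. \<forall>b>0. c * (a + b) - c / 2 - C * (a * min 1 b + b * min 1 a)
     \<le> (a + b) powr m * (M * (a + b) powr (1 - m) - a powr (1 - m) - b powr (1 - m))"
proof -
  define \<delta> where "\<delta> = M - 1"
  have \<delta>: "\<delta> > 0" using M by (simp add: \<delta>_def)
  \<comment> \<open>Determines which ratios t = b / a count as very unequal: as t tends to 0 the
    subtracted part, relative to a, tends to 1, which is below \<open>M\<close>.\<close>
  have "((\<lambda>t::real. (1 + t) powr m * (1 + t powr (1 - m))) \<longlongrightarrow> (1 + 0) powr m * (1 + 0)) (at_right 0)"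
    by (intro tendsto_intros tendsto_zero_powrI[where b="1 - m"]) (use m in \<open>auto intro!: eventually_at_rightI[of 0 1]\<close>)
  then have "eventually (\<lambda>t::real. (1 + t) powr m * (1 + t powr (1 - m)) < 1 + \<delta> / 2) (at_right 0)"
    using \<delta> by (intro order_tendstoD(2)) auto
  then obtain \<tau>0 where \<tau>0: "\<tau>0 > 0" "\<And>t. 0 < t \<Longrightarrow> t < \<tau>0 \<Longrightarrow> (1 + t) powr m * (1 + t powr (1 - m)) < 1 + \<delta> / 2"
    unfolding eventually_at_right_field by auto
  define \<tau> where "\<tau> = \<tau>0 / 2"
  have \<tau>: "\<tau> > 0" "(1 + \<tau>) powr m * (1 + \<tau> powr (1 - m)) < 1 + \<delta> / 2"
    using \<tau>0(1) \<tau>0(2)[of \<tau>] by (auto simp: \<tau>_def)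
  define c where "c = \<delta> / 4"
  have c: "c > 0" using \<delta> by (simp add: c_def)
  \<comment> \<open>Chosen such that (4 + 2 c) \<epsilon> = c / 2: for a up to \<epsilon> the
    constant term covers the deficit. For larger a, a comparable b is at least \<tau> \<epsilon>, so
    \<open>min 1 b\<close> is at least \<open>\<mu>\<close>, and \<open>C\<close> is scaled
    accordingly.\<close>
  define \<epsilon> where "\<epsilon> = c / (2 * (4 + 2 * c))"
  have \<epsilon>: "\<epsilon> > 0" using c by (simp add: \<epsilon>_def)
  define \<mu> where "\<mu> = min 1 (\<tau> * \<epsilon>)"
  have \<mu>: "\<mu> > 0" using \<tau>(1) \<epsilon> by (simp add: \<mu>_def)
  define C where "C = (4 + 2 * c) / \<mu>"
  have C: "C > 0" using c \<mu> by (simp add: C_def)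
  let ?g = "\<lambda>a b. (a + b) powr m * (M * (a + b) powr (1 - m) - a powr (1 - m) - b powr (1 - m))"
  have gexp: "?g a b = M * (a + b) - (a + b) powr m * (a powr (1 - m) + b powr (1 - m))" if "a > 0" "b > 0" for a b
  proof -
    have "(a + b) powr m * (a + b) powr (1 - m) = a + b"
      using that by (simp add: powr_add[symmetric])
    then show ?thesis by (simp add: algebra_simps)
  qed
  have main: "c * (a + b) - c / 2 - C * (a * min 1 b + b * min 1 a) \<le> ?g a b"
    if ab: "a > 0" "b > 0" "b \<le> a" for a b
  proof (cases "b \<le> \<tau> * a")
    case True
    have "(a + b) powr m \<le> ((1 + \<tau>) * a) powr m"
      using ab m True by (intro powr_mono2) (auto simp: algebra_simps)
    also have "\<dots> = (1 + \<tau>) powr m * a powr m" using ab \<tau>(1) by (simp add: powr_mult)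
    finally have 1: "(a + b) powr m \<le> (1 + \<tau>) powr m * a powr m" .
    have "b powr (1 - m) \<le> (\<tau> * a) powr (1 - m)" using ab m True by (intro powr_mono2) auto
    also have "\<dots> = \<tau> powr (1 - m) * a powr (1 - m)" using ab \<tau>(1) by (simp add: powr_mult)
    finally have 2: "a powr (1 - m) + b powr (1 - m) \<le> (1 + \<tau> powr (1 - m)) * a powr (1 - m)" by (simp add: algebra_simps)
    have "(a + b) powr m * (a powr (1 - m) + b powr (1 - m)) \<le> ((1 + \<tau>) powr m * a powr m) * ((1 + \<tau> powr (1 - m)) * a powr (1 - m))"
      using 1 2 by (intro mult_mono) auto
    also have "\<dots> = ((1 + \<tau>) powr m * (1 + \<tau> powr (1 - m))) * (a powr m * a powr (1 - m))" by (simp only: mult_ac)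
    also have "a powr m * a powr (1 - m) = a" using ab by (simp add: powr_add[symmetric])
    also have "((1 + \<tau>) powr m * (1 + \<tau> powr (1 - m))) * a \<le> (1 + \<delta> / 2) * a"
      using \<tau>(2) ab by (intro mult_right_mono) auto
    also have "\<dots> \<le> (1 + \<delta> / 2) * (a + b)" using \<delta> ab by (intro mult_left_mono) auto
    finally have "(a + b) powr m * (a powr (1 - m) + b powr (1 - m)) \<le> (1 + \<delta> / 2) * (a + b)" .
    moreover have "M * (a + b) - (1 + \<delta> / 2) * (a + b) = 2 * (c * (a + b))" by (simp add: \<delta>_def c_def field_simps)
    moreover have "0 \<le> c * (a + b)" using c ab by simp
    moreover have "0 \<le> C * (a * min 1 b + b * min 1 a)" using C ab by simp
    moreover have "0 \<le> c / 2" using c by simp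
    ultimately show ?thesis unfolding gexp[OF ab(1,2)] by linarith
  next
    case False
    have "(a + b) powr m * (a powr (1 - m) + b powr (1 - m)) \<le> (2 * a) powr m * (2 * a powr (1 - m))"
    proof (intro mult_mono)
      show "(a + b) powr m \<le> (2 * a) powr m" using ab m by (intro powr_mono2) auto
      have "b powr (1 - m) \<le> a powr (1 - m)" using ab m by (intro powr_mono2) auto
      then show "a powr (1 - m) + b powr (1 - m) \<le> 2 * a powr (1 - m)" by simp
    qed auto
    also have "\<dots> = 2 powr m * 2 * (a powr m * a powr (1 - m))" using ab by (simp add: powr_mult)
    also have "a powr m * a powr (1 - m) = a" using ab by (simp add: powr_add[symmetric])
    also have "2 powr m * 2 * a \<le> 2 powr 1 * 2 * a" using m ab by (intro mult_right_mono powr_mono) auto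
    finally have g4: "(a + b) powr m * (a powr (1 - m) + b powr (1 - m)) \<le> 2 powr 1 * 2 * a" .
    have "0 \<le> M * (a + b)" using M ab by simp
    then have g: "- (4 * a) \<le> ?g a b"
      unfolding gexp[OF ab(1,2)] using g4 by simp
    have "(4 + 2 * c) * a \<le> c / 2 + C * (a * min 1 b)"
    proof (cases "a \<le> \<epsilon>")
      case True
      have "(4 + 2 * c) * a \<le> (4 + 2 * c) * \<epsilon>" using True c by (intro mult_left_mono) auto
      also have "\<dots> = c / 2" using c by (simp add: \<epsilon>_def field_simps)
      finally show ?thesis using C ab by (simp add: add_increasing2)
    next
      case False
      have "\<tau> * \<epsilon> \<le> \<tau> * a" using False \<tau>(1) by (intro mult_left_mono) auto
      then have "\<tau> * \<epsilon> \<le> b" using \<open>\<not> b \<le> \<tau> * a\<close> by simp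
      then have "\<mu> \<le> min 1 b" by (auto simp: \<mu>_def)
      then have "C * (a * \<mu>) \<le> C * (a * min 1 b)" using C ab by (intro mult_left_mono) auto
      moreover have "C * (a * \<mu>) = (4 + 2 * c) * a" using \<mu> by (simp add: C_def)
      ultimately show ?thesis using c by simp
    qed
    moreover have "c * (a + b) \<le> c * (2 * a)" using c ab by (intro mult_left_mono) auto
    moreover have "C * (a * min 1 b + b * min 1 a) = C * (a * min 1 b) + C * (b * min 1 a)" by (simp add: distrib_left)
    moreover have "0 \<le> C * (b * min 1 a)" using C ab by simp
    ultimately show ?thesis using g by (simp add: algebra_simps)
  qed
  have "c * (a + b) - c / 2 - C * (a * min 1 b + b * min 1 a) \<le> ?g a b" if ab: "a > 0" "b > 0" for a b
  proof (cases "b \<le> a")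
    case True then show ?thesis using main ab by blast
  next
    case False
    have "?g b a = ?g a b" by (simp add: add.commute algebra_simps)
    moreover have "c * (b + a) - c / 2 - C * (b * min 1 a + a * min 1 b) \<le> ?g b a"
      using main[of b a] ab False by simp
    moreover have "c * (b + a) - c / 2 - C * (b * min 1 a + a * min 1 b) = c * (a + b) - c / 2 - C * (a * min 1 b + b * min 1 a)"
      by (simp add: add.commute)
    ultimately show ?thesis by linarith
  qed
  then show ?thesis using c C by (intro exI[of _ c] conjI exI[of _ C]) auto
qed

context energy_simplex begin

lemma nn_integral_bmeas:
  assumes "f \<in> bmeas" "AE x in \<nu>. 0 \<le> f x"
  shows "(\<integral>\<^sup>+x. ennreal (f x) \<partial>\<nu>) = ennreal (\<integral>x. f x \<partial>\<nu>)"
  using assms by (intro nn_integral_eq_integral bmeas_integrable) auto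

text \<open>For a symmetric jump kernel, \<open>f\<^sup>2 (1 - V'/V)\<close> integrates to at most half of \<open>(f - f')\<^sup>2\<close>:
  this is \<open>2 f f' \<le> f\<^sup>2 V'/V + f'\<^sup>2 V/V'\<close>.\<close>

lemma Lyapunov_pair:
  assumes f: "f \<in> bmeas" and V: "V \<in> bmeas" "\<And>x. x \<in> space (cfg N) \<Longrightarrow> 1 \<le> V x" and iV: "(\<lambda>x. 1 / V x) \<in> bmeas"
    and W: "W \<in> bmeas" "\<And>x. x \<in> space (cfg N) \<Longrightarrow> 0 \<le> W x" "\<And>x a. W (Tx i j a x) = W x"
    and ij: "i < N" "j < N" "i \<noteq> j"
  shows "ennreal (2 * (\<integral>x. W x * (f x)\<^sup>2 \<partial>\<nu>)) \<le> ennreal (2 * (\<integral>x. W x * (f x)\<^sup>2 * resample_avg i j V x * (1 / V x) \<partial>\<nu>)) + jump i j f (\<lambda>x. ennreal (W x))"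
proof -
  note [measurable] = bmeas_measurable[OF f] bmeas_measurable[OF V(1)] bmeas_measurable[OF W(1)]
  define H where "H x y = ennreal (W x * (f x)\<^sup>2 * (V y / V x))" for x y
  have H: "(\<lambda>(x, y). H x y) \<in> borel_measurable (cfg N \<Otimes>\<^sub>M cfg N)"
    unfolding H_def by measurable
  have Vp: "0 < V x" if "x \<in> space (cfg N)" for x using V(2)[OF that] by linarith
  have pt: "ennreal (W x) * ennreal ((f x)\<^sup>2) + ennreal (W (Tx i j a x)) * ennreal ((f (Tx i j a x))\<^sup>2)
     \<le> H x (Tx i j a x) + H (Tx i j a x) x + ennreal (W x) * ennreal ((f (Tx i j a x) - f x)\<^sup>2)"
    if x: "x \<in> space (cfg N)" for a x
  proof -
    define y where "y = Tx i j a x"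
    have y: "y \<in> space (cfg N)" unfolding y_def by (rule Tx_space[OF ij(1,2) x])
    have Wy: "W y = W x" by (simp add: y_def W(3))
    have p: "0 < V x" "0 < V y" "0 \<le> W x" using Vp x y W(2) by auto
    have "0 \<le> (f x * V y - f y * V x)\<^sup>2 / (V x * V y)" using p by (intro divide_nonneg_pos) auto
    also have "\<dots> = (f x)\<^sup>2 * (V y / V x) + (f y)\<^sup>2 * (V x / V y) - 2 * (f x * f y)"
      using p by (simp add: field_simps power2_eq_square)
    finally have "(f x)\<^sup>2 + (f y)\<^sup>2 \<le> (f x)\<^sup>2 * (V y / V x) + (f y)\<^sup>2 * (V x / V y) + (f y - f x)\<^sup>2"
      by (simp add: power2_eq_square algebra_simps)
    then have "W x * ((f x)\<^sup>2 + (f y)\<^sup>2) \<le> W x * ((f x)\<^sup>2 * (V y / V x) + (f y)\<^sup>2 * (V x / V y) + (f y - f x)\<^sup>2)"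
      using p by (intro mult_left_mono) auto
    then have "ennreal (W x * (f x)\<^sup>2 + W y * (f y)\<^sup>2) \<le> ennreal (W x * (f x)\<^sup>2 * (V y / V x) + W y * (f y)\<^sup>2 * (V x / V y) + W x * (f y - f x)\<^sup>2)"
      unfolding Wy by (intro ennreal_leI) (simp add: distrib_left mult.assoc)
    also have "\<dots> = H x y + H y x + ennreal (W x) * ennreal ((f y - f x)\<^sup>2)"
      unfolding H_def using p Wy by (simp add: ennreal_plus ennreal_mult)
    also have "ennreal (W x * (f x)\<^sup>2 + W y * (f y)\<^sup>2) = ennreal (W x) * ennreal ((f x)\<^sup>2) + ennreal (W y) * ennreal ((f y)\<^sup>2)"
      using p Wy by (simp add: ennreal_plus ennreal_mult)
    finally show ?thesis unfolding y_def .
  qed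
  define A where "A x = ennreal (W x) * ennreal ((f x)\<^sup>2)" for x
  have [measurable]: "A \<in> borel_measurable (cfg N)" unfolding A_def[abs_def] by measurable
  have "(\<integral>\<^sup>+x. (\<integral>\<^sup>+a. A x + A (Tx i j a x) \<partial>\<beta>) \<partial>\<nu>) \<le>
      (\<integral>\<^sup>+x. (\<integral>\<^sup>+a. H x (Tx i j a x) + H (Tx i j a x) x + ennreal (W x) * ennreal ((f (Tx i j a x) - f x)\<^sup>2) \<partial>\<beta>) \<partial>\<nu>)"
    unfolding A_def by (intro nn_integral_mono pt) simp
  moreover have "(\<integral>\<^sup>+x. (\<integral>\<^sup>+a. A x + A (Tx i j a x) \<partial>\<beta>) \<partial>\<nu>) = 2 * (\<integral>\<^sup>+x. A x \<partial>\<nu>)"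
  proof -
    have "(\<integral>\<^sup>+x. (\<integral>\<^sup>+a. A x + A (Tx i j a x) \<partial>\<beta>) \<partial>\<nu>) = (\<integral>\<^sup>+x. A x + (\<integral>\<^sup>+a. A (Tx i j a x) \<partial>\<beta>) \<partial>\<nu>)"
    proof (rule nn_integral_cong)
      fix x assume "x \<in> space \<nu>"
      then have x: "x \<in> space (cfg N)" by simp
      note [measurable] = Tx_measurable_fixed[OF x ij(1,2)]
      show "(\<integral>\<^sup>+a. A x + A (Tx i j a x) \<partial>\<beta>) = A x + (\<integral>\<^sup>+a. A (Tx i j a x) \<partial>\<beta>)"
        by (simp add: nn_integral_add beta.emeasure_space_1[simplified])
    qed
    also have "\<dots> = (\<integral>\<^sup>+x. A x \<partial>\<nu>) + (\<integral>\<^sup>+x. (\<integral>\<^sup>+a. A (Tx i j a x) \<partial>\<beta>) \<partial>\<nu>)"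
      using ij by (intro nn_integral_add) measurable
    also have "\<dots> = 2 * (\<integral>\<^sup>+x. A x \<partial>\<nu>)" using ij by (subst resample) (auto simp: mult_2)
    finally show ?thesis .
  qed
  moreover have "(\<integral>\<^sup>+x. (\<integral>\<^sup>+a. H x (Tx i j a x) + H (Tx i j a x) x + ennreal (W x) * ennreal ((f (Tx i j a x) - f x)\<^sup>2) \<partial>\<beta>) \<partial>\<nu>)
    = 2 * (\<integral>\<^sup>+x. (\<integral>\<^sup>+a. H x (Tx i j a x) \<partial>\<beta>) \<partial>\<nu>) + jump i j f (\<lambda>x. ennreal (W x))"
  proof -
    have H': "(\<lambda>(x, y). H y x) \<in> borel_measurable (cfg N \<Otimes>\<^sub>M cfg N)" using H by measurable
    have [measurable]: "(\<lambda>(x, a). H x (Tx i j a x)) \<in> borel_measurable (cfg N \<Otimes>\<^sub>M borel)"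
      "(\<lambda>(x, a). H (Tx i j a x) x) \<in> borel_measurable (cfg N \<Otimes>\<^sub>M borel)"
      unfolding H_def using ij by measurable
    have "(\<integral>\<^sup>+x. (\<integral>\<^sup>+a. H x (Tx i j a x) + H (Tx i j a x) x + ennreal (W x) * ennreal ((f (Tx i j a x) - f x)\<^sup>2) \<partial>\<beta>) \<partial>\<nu>)
      = (\<integral>\<^sup>+x. (\<integral>\<^sup>+a. H x (Tx i j a x) \<partial>\<beta>) \<partial>\<nu>) + (\<integral>\<^sup>+x. (\<integral>\<^sup>+a. H (Tx i j a x) x \<partial>\<beta>) \<partial>\<nu>) + (\<integral>\<^sup>+x. (\<integral>\<^sup>+a. ennreal (W x) * ennreal ((f (Tx i j a x) - f x)\<^sup>2) \<partial>\<beta>) \<partial>\<nu>)"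
    proof -
      have "(\<integral>\<^sup>+a. H x (Tx i j a x) + H (Tx i j a x) x + ennreal (W x) * ennreal ((f (Tx i j a x) - f x)\<^sup>2) \<partial>\<beta>)
        = (\<integral>\<^sup>+a. H x (Tx i j a x) \<partial>\<beta>) + (\<integral>\<^sup>+a. H (Tx i j a x) x \<partial>\<beta>) + (\<integral>\<^sup>+a. ennreal (W x) * ennreal ((f (Tx i j a x) - f x)\<^sup>2) \<partial>\<beta>)"
        if x: "x \<in> space (cfg N)" for x
      proof -
        note [measurable] = Tx_measurable_fixed[OF x ij(1,2)]
        have [measurable]: "(\<lambda>a. H x (Tx i j a x)) \<in> borel_measurable borel" "(\<lambda>a. H (Tx i j a x) x) \<in> borel_measurable borel"
          unfolding H_def by measurable
        show ?thesis by (simp add: nn_integral_add)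
      qed
      then have "(\<integral>\<^sup>+x. (\<integral>\<^sup>+a. H x (Tx i j a x) + H (Tx i j a x) x + ennreal (W x) * ennreal ((f (Tx i j a x) - f x)\<^sup>2) \<partial>\<beta>) \<partial>\<nu>)
        = (\<integral>\<^sup>+x. ((\<integral>\<^sup>+a. H x (Tx i j a x) \<partial>\<beta>) + (\<integral>\<^sup>+a. H (Tx i j a x) x \<partial>\<beta>)) + (\<integral>\<^sup>+a. ennreal (W x) * ennreal ((f (Tx i j a x) - f x)\<^sup>2) \<partial>\<beta>) \<partial>\<nu>)"
        by (intro nn_integral_cong) simp
      moreover have m3: "(\<lambda>x. \<integral>\<^sup>+a. H x (Tx i j a x) \<partial>\<beta>) \<in> borel_measurable \<nu>" "(\<lambda>x. \<integral>\<^sup>+a. H (Tx i j a x) x \<partial>\<beta>) \<in> borel_measurable \<nu>"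
        "(\<lambda>x. \<integral>\<^sup>+a. ennreal (W x) * ennreal ((f (Tx i j a x) - f x)\<^sup>2) \<partial>\<beta>) \<in> borel_measurable \<nu>"
        using ij by measurable
      ultimately show ?thesis by (simp add: nn_integral_add)
    qed
    then show ?thesis using reversible_pair[OF H ij] ij by (subst jump_eq) (auto simp: mult_2)
  qed
  ultimately have "2 * (\<integral>\<^sup>+x. A x \<partial>\<nu>) \<le> 2 * (\<integral>\<^sup>+x. (\<integral>\<^sup>+a. H x (Tx i j a x) \<partial>\<beta>) \<partial>\<nu>) + jump i j f (\<lambda>x. ennreal (W x))"
    by simp
  moreover have "(\<integral>\<^sup>+x. A x \<partial>\<nu>) = ennreal (\<integral>x. W x * (f x)\<^sup>2 \<partial>\<nu>)"
  proof -
    have "(\<integral>\<^sup>+x. A x \<partial>\<nu>) = (\<integral>\<^sup>+x. ennreal (W x * (f x)\<^sup>2) \<partial>\<nu>)"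
      unfolding A_def using W(2) by (intro nn_integral_cong) (simp add: ennreal_mult)
    then show ?thesis using f W(1,2) by (subst (asm) nn_integral_bmeas) auto
  qed
  moreover have "(\<integral>\<^sup>+x. (\<integral>\<^sup>+a. H x (Tx i j a x) \<partial>\<beta>) \<partial>\<nu>) = ennreal (\<integral>x. W x * (f x)\<^sup>2 * resample_avg i j V x * (1 / V x) \<partial>\<nu>)"
  proof -
    have RV: "0 \<le> resample_avg i j V x" if "x \<in> space (cfg N)" for x
      unfolding resample_avg_def using Vp[OF Tx_space[OF ij(1,2) that]] by (intro integral_nonneg_AE AE_I2) (simp add: less_imp_le)
    have "(\<integral>\<^sup>+a. H x (Tx i j a x) \<partial>\<beta>) = ennreal (W x * (f x)\<^sup>2 * resample_avg i j V x * (1 / V x))" if x: "x \<in> space (cfg N)" for x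
    proof -
      have "(\<integral>\<^sup>+a. H x (Tx i j a x) \<partial>\<beta>) = ennreal (\<integral>a. W x * (f x)\<^sup>2 * (V (Tx i j a x) / V x) \<partial>\<beta>)"
        unfolding H_def using beta_integrable[OF V(1) ij(1,2) x] W(2)[OF x] Vp[OF x] Vp[OF Tx_space[OF ij(1,2) x]]
        by (intro nn_integral_eq_integral) (auto intro!: AE_I2 mult_nonneg_nonneg simp: less_imp_le)
      then show ?thesis by (simp add: resample_avg_def)
    qed
    then have "(\<integral>\<^sup>+x. (\<integral>\<^sup>+a. H x (Tx i j a x) \<partial>\<beta>) \<partial>\<nu>) = (\<integral>\<^sup>+x. ennreal (W x * (f x)\<^sup>2 * resample_avg i j V x * (1 / V x)) \<partial>\<nu>)"
      by (intro nn_integral_cong) simp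
    also have "\<dots> = ennreal (\<integral>x. W x * (f x)\<^sup>2 * resample_avg i j V x * (1 / V x) \<partial>\<nu>)"
    proof (rule nn_integral_bmeas)
      show "(\<lambda>x. W x * (f x)\<^sup>2 * resample_avg i j V x * (1 / V x)) \<in> bmeas"
        by (intro bmeas_mult bmeas_power resample_avg_bmeas f W V iV ij)
      show "AE x in \<nu>. 0 \<le> W x * (f x)\<^sup>2 * resample_avg i j V x * (1 / V x)"
        using W(2) RV Vp by (intro AE_I2) (auto intro!: mult_nonneg_nonneg simp: less_imp_le)
    qed
    finally show ?thesis .
  qed
  ultimately show ?thesis by (simp add: ennreal_mult')
qed

end

section \<open>Capped energies as catalyst weights\<close>

lemma min_one_le_powr:
  fixes v m :: real
  assumes "0 < v" "0 < m" "m < 1"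
  shows "min 1 v \<le> v powr m"
proof (cases "v \<le> 1")
  case True
  have "v powr 1 \<le> v powr m" using True assms by (intro powr_mono') auto
  then show ?thesis using True assms by simp
next
  case False
  then have "1 \<le> v powr m" using assms by (intro ge_one_powr_ge_zero) auto
  then show ?thesis by simp
qed

context energy_simplex begin

definition good :: "(nat \<Rightarrow> real) \<Rightarrow> bool" where
  "good x \<longleftrightarrow> x \<in> space (cfg N) \<and> (\<forall>i<N. 0 < x i) \<and> (\<Sum>i<N. x i) = real N * E"

lemma AE_good: "AE x in \<nu>. good x"
  using AE_nu AE_space by eventually_elim (auto simp: good_def)

lemma good_le: "good x \<Longrightarrow> i < N \<Longrightarrow> 0 < x i \<and> x i \<le> real N * E"
  using member_le_sum[of i "{..<N}" x] by (auto simp: good_def less_imp_le)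

lemma good_Tx:
  assumes x: "good x" and ij: "i < N" "j < N" "i \<noteq> j" and a: "0 < a" "a < 1"
  shows "good (Tx i j a x)"
  using x ij a Tx_space[OF ij(1,2), of x a] Tx_sum[of i "{..<N}" j a x]
  by (auto simp: good_def Tx_def add_pos_pos)

text \<open>Clipped so as to be bounded on the whole configuration space, as \<open>bmeas\<close>
  demands of its powers; on good configurations the clipping has no effect. \<open>bondw\<close> is
  clipped for the same reason.\<close>

definition share :: "nat \<Rightarrow> (nat \<Rightarrow> real) \<Rightarrow> real" where
  "share k x = max 0 (min (x k / E) (real N))"

lemma share_good: "good x \<Longrightarrow> k < N \<Longrightarrow> share k x = x k / E"
  using good_le[of x k] Epos by (auto simp: share_def min_def pos_divide_le_eq)

text \<open>For 0 < m < 1 and positive energies this weight is at most (x_k / E)^m, so the catalyst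
  \<open>k\<close> can pay for it; being at most one, it never enlarges a norm.\<close>

definition capped :: "nat \<Rightarrow> (nat \<Rightarrow> real) \<Rightarrow> real" where
  "capped k x = max 0 (min 1 (x k / E))"

lemma capped_bmeas [simp, intro]: "k < N \<Longrightarrow> capped k \<in> bmeas"
  unfolding capped_def[abs_def] by (rule bmeas_I[where K=1]) auto

lemma capped_range: "0 \<le> capped k x" "capped k x \<le> 1"
  by (auto simp: capped_def)

lemma bmeas_powr_share:
  assumes "k < N" "p > 0"
  shows "(\<lambda>x. share k x powr p) \<in> bmeas"
proof (rule bmeas_I[where K="real N powr p"])
  show "(\<lambda>x. share k x powr p) \<in> borel_measurable (cfg N)"
    unfolding share_def using assms by measurable
  show "\<bar>share k x powr p\<bar> \<le> real N powr p" for x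
    using assms by (auto simp: share_def intro!: powr_mono2)
qed

definition bondw :: "real \<Rightarrow> nat \<Rightarrow> nat \<Rightarrow> (nat \<Rightarrow> real) \<Rightarrow> real" where
  "bondw m i j x = (max 0 (min (x i + x j) (real N * E))) powr m"

lemma bondw_bmeas: "i < N \<Longrightarrow> j < N \<Longrightarrow> m > 0 \<Longrightarrow> bondw m i j \<in> bmeas"
proof (rule bmeas_I[where K="(real N * E) powr m"])
  assume "i < N" "j < N" "m > 0"
  then show "bondw m i j \<in> borel_measurable (cfg N)" unfolding bondw_def[abs_def] by measurable
  show "\<bar>bondw m i j x\<bar> \<le> (real N * E) powr m" for x
    using \<open>m > 0\<close> Epos by (auto simp: bondw_def intro!: powr_mono2)
qed

lemma bondw_good:
  assumes x: "good x" and ij: "i < N" "j < N" "i \<noteq> j"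
  shows "bondw m i j x = (x i + x j) powr m"
proof -
  have "x i + x j = (\<Sum>k\<in>{i, j}. x k)" using ij by simp
  also have "\<dots> \<le> (\<Sum>k<N. x k)" using x ij by (intro sum_mono2) (auto simp: good_def less_imp_le)
  finally have "x i + x j \<le> real N * E" using x by (simp add: good_def)
  moreover have "0 < x i + x j" using good_le[OF x] ij by (auto intro: add_pos_pos)
  ultimately show ?thesis by (simp add: bondw_def)
qed

text \<open>The weight \<open>capped k\<close> is invariant under all exchanges that leave out
  \<open>k\<close>, so its square root can be pulled through the average over those pairs. By
  \<open>pair_avg_pow_energy\<close> the weighted norm is at most the number of steps times the
  weighted energy, plus an iterated form; the mean of the latter over \<open>k\<close> is handled by
  \<open>left_out_avg_gap\<close>. Of order N steps are needed because each contracts only by 1 -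
  O(1 / N).\<close>

lemma capped_energy:
  assumes m: "0 < m" "m < 1" and \<kappa>: "unif_dom \<gamma> \<kappa>" "\<kappa> > 0"
    and f: "f \<in> bmeas" "(\<integral>x. f x \<partial>\<nu>) = 0" "quad_lip {..<N} L 0 f" "L \<ge> 0"
    and N4: "N \<ge> 4" and t: "mean_field_energy m f = ennreal t" "t \<ge> 0"
    and \<epsilon>: "sqrt ((1 - 2 * (1 - q) / (real N - 1)) ^ (2 * (K * N)) + 2 / real N) \<le> \<epsilon>"
  shows "(\<Sum>k<N. (\<integral>x. capped k x * (f x)\<^sup>2 \<partial>\<nu>)) \<le>
    4 * real K * (2 + 8 * \<kappa> + 8 * \<kappa>\<^sup>2 * 2 powr m) * E powr (- m) * t + real N * \<epsilon> * ip f f"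
proof -
  let ?I = "\<lambda>k. {..<N} - {k}"
  let ?Kc = "2 + 8 * \<kappa> + 8 * \<kappa>\<^sup>2 * 2 powr m"
  let ?n = "real N - 1"
  note fm [measurable] = bmeas_measurable[OF f(1)]
  have Kc: "?Kc > 0" using \<kappa>(2) by (simp add: add_pos_nonneg)
  have I: "?I k \<subseteq> {..<N}" "card (?I k) = N - 1" if "k < N" for k using that by (auto simp: card_Diff_singleton)
  \<comment> \<open>Compares the number of ordered pairs without \<open>k\<close> with N^2. This is
    false for N = 3 and accounts for the bound on \<open>N\<close>.\<close>
  have nn: "?n * (?n - 1) \<ge> (real N)\<^sup>2 / 4" 
  proof -
    have "0 \<le> (real N - 4) * (3 * real N)" using N4 by simp
    then show ?thesis by (simp add: power2_eq_square algebra_simps)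
  qed
  define s where "s = K * N"
  define g where "g k x = sqrt (capped k x) * f x" for k x
  define e where "e k = ip (g k) (g k) - ip (g k) (pair_avg (?I k) (g k))" for k
  have gB: "g k \<in> bmeas" if "k < N" for k
  proof -
    have "(\<lambda>x. sqrt (capped k x)) \<in> bmeas"
    proof (rule bmeas_I[where K=1])
      show "(\<lambda>x. sqrt (capped k x)) \<in> borel_measurable (cfg N)"
        using bmeas_measurable[OF capped_bmeas[OF that]] by measurable
      show "\<bar>sqrt (capped k x)\<bar> \<le> 1" for x using capped_range[of k x] by simp
    qed
    then show ?thesis unfolding g_def[abs_def] using f by auto
  qed
  have cT: "capped k (Tx i j a x) = capped k x" if "i \<noteq> k" "j \<noteq> k" for i j k a x
    using that by (simp add: capped_def Tx_def)
  have Avg: "pair_avg (?I k) (\<lambda>x. sqrt (capped k x) * h x) = (\<lambda>x. sqrt (capped k x) * pair_avg (?I k) h x)" for k h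
  proof
    fix x
    have "resample_avg i j (\<lambda>x. sqrt (capped k x) * h x) x = sqrt (capped k x) * resample_avg i j h x" if "i \<in> ?I k" "j \<in> ?I k - {i}" for i j
      using that by (intro resample_avg_invariant_mult) (simp add: cT)
    then show "pair_avg (?I k) (\<lambda>x. sqrt (capped k x) * h x) x = sqrt (capped k x) * pair_avg (?I k) h x"
      unfolding pair_avg_def by (simp add: sum_distrib_left)
  qed
  have Avpow: "(pair_avg (?I k) ^^ r) (g k) = (\<lambda>x. sqrt (capped k x) * (pair_avg (?I k) ^^ r) f x)" for k r
    by (induction r) (simp_all add: g_def[abs_def] Avg)
  have sqc: "sqrt (capped k x) * u * (sqrt (capped k x) * v) = capped k x * (u * v)" for k x u v
  proof -
    have "sqrt (capped k x) * u * (sqrt (capped k x) * v) = (sqrt (capped k x) * sqrt (capped k x)) * (u * v)" by (simp only: mult_ac)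
    then show ?thesis using capped_range(1)[of k x] by simp
  qed
  have gg: "ip (g k) (g k) = (\<integral>x. capped k x * (f x)\<^sup>2 \<partial>\<nu>)" for k
    unfolding ip_def g_def
    by (intro Bochner_Integration.integral_cong refl) (simp add: power2_eq_square sqc)
  have one: "(\<integral>x. capped k x * (f x)\<^sup>2 \<partial>\<nu>) \<le> real (2 * s) * e k + ip f ((pair_avg (?I k) ^^ (2 * s)) f)" if k: "k < N" for k
  proof -
    have "ip (g k) (g k) - ip (g k) ((pair_avg (?I k) ^^ (2 * s)) (g k)) \<le> real (2 * s) * e k"
      unfolding e_def by (rule pair_avg_pow_energy[OF gB[OF k] I(1)[OF k]])
    \<comment> \<open>An even power turns the pairing into a squared norm, in which the factor
      \<open>capped k\<close> can be bounded by one.\<close>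
    moreover have "ip (g k) ((pair_avg (?I k) ^^ (2 * s)) (g k)) \<le> ip f ((pair_avg (?I k) ^^ (2 * s)) f)"
    proof -
      have half: "ip h ((pair_avg (?I k) ^^ (2 * s)) h) = ip ((pair_avg (?I k) ^^ s) h) ((pair_avg (?I k) ^^ s) h)" if h: "h \<in> bmeas" for h
      proof -
        have "(pair_avg (?I k) ^^ (2 * s)) h = (pair_avg (?I k) ^^ s) ((pair_avg (?I k) ^^ s) h)" by (simp add: mult_2 funpow_add)
        then show ?thesis using pair_avg_pow_selfadjoint[OF pair_avg_pow_bmeas[OF h I(1)[OF k]] h I(1)[OF k]] by simp
      qed
      define A where "A = (pair_avg (?I k) ^^ s) f"
      have AB: "A \<in> bmeas" unfolding A_def by (rule pair_avg_pow_bmeas[OF f(1) I(1)[OF k]])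
      have "ip ((pair_avg (?I k) ^^ s) (g k)) ((pair_avg (?I k) ^^ s) (g k)) = (\<integral>x. capped k x * (A x * A x) \<partial>\<nu>)"
        unfolding Avpow A_def[symmetric] ip_def
        by (intro Bochner_Integration.integral_cong refl) (simp add: sqc)
      also have "\<dots> \<le> (\<integral>x. A x * A x \<partial>\<nu>)"
        using AB k capped_range[of k] by (intro integral_mono bmeas_integrable bmeas_mult capped_bmeas) (auto intro: mult_left_le_one_le)
      finally show ?thesis unfolding half[OF gB[OF k]] half[OF f(1)] A_def[symmetric] by (simp add: ip_def)
    qed
    ultimately show ?thesis unfolding gg by simp
  qed
  have ek: "ennreal (2 * (?n * (?n - 1)) * e k) \<le> ennreal (E powr (- m)) * (\<Sum>i<N. \<Sum>j\<in>{..<N} - {i}. jump i j f (\<lambda>x. ennreal (x k powr m)))"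
    if k: "k < N" for k
  proof -
    have "ennreal (2 * (?n * (?n - 1)) * e k) = (\<Sum>i\<in>?I k. \<Sum>j\<in>?I k - {i}. jump i j (g k) (\<lambda>_. 1))"
      using jump_sum_ennreal[OF gB[OF k] I(1)[OF k]] I[OF k] N4 by (simp add: e_def of_nat_diff)
    also have "\<dots> \<le> (\<Sum>i\<in>?I k. \<Sum>j\<in>?I k - {i}. ennreal (E powr (- m)) * jump i j f (\<lambda>x. ennreal (x k powr m)))"
    proof (intro sum_mono)
      fix i j assume ij: "i \<in> ?I k" "j \<in> ?I k - {i}"
      \<comment> \<open>The invariant weight comes out of the squared difference: unweighted energy
        of \<open>g k\<close> is energy of \<open>f\<close> with weight
        \<open>capped k\<close>.\<close>
      have "jump i j (g k) (\<lambda>_. 1) = jump i j f (\<lambda>x. ennreal (capped k x))"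
        unfolding jump_def
      proof (rule nn_integral_cong)
        fix x assume "x \<in> space \<nu>"
        then have x: "x \<in> space (cfg N)" by simp
        note [measurable] = Tx_measurable_fixed[OF x, of i j]
        have "ennreal ((g k (Tx i j a x) - g k x)\<^sup>2) = ennreal (capped k x) * ennreal ((f (Tx i j a x) - f x)\<^sup>2)" for a
        proof -
          have "(g k (Tx i j a x) - g k x)\<^sup>2 = capped k x * (f (Tx i j a x) - f x)\<^sup>2"
            using ij capped_range(1)[of k x] by (simp add: g_def cT right_diff_distrib[symmetric] power_mult_distrib)
          then show ?thesis using capped_range(1)[of k x] by (simp add: ennreal_mult)
        qed
        then show "1 * (\<integral>\<^sup>+a. ennreal ((g k (Tx i j a x) - g k x)\<^sup>2) \<partial>\<beta>) = ennreal (capped k x) * (\<integral>\<^sup>+a. ennreal ((f (Tx i j a x) - f x)\<^sup>2) \<partial>\<beta>)"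
          using ij by (simp add: nn_integral_cmult)
      qed
      also have "\<dots> \<le> jump i j f (\<lambda>x. ennreal (E powr (- m)) * ennreal (x k powr m))"
      proof (rule jump_mono, use AE_good in eventually_elim)
        case (elim x)
        have p: "0 < x k / E" using good_le[OF elim k] Epos by simp
        have "min 1 (x k / E) \<le> (x k / E) powr m"
          by (rule min_one_le_powr[OF p m])
        also have "(x k / E) powr m = E powr (- m) * x k powr m"
          using good_le[OF elim k] Epos by (simp add: powr_divide powr_minus_divide)
        finally have "capped k x \<le> E powr (- m) * x k powr m" using p by (simp add: capped_def)
        then show ?case by (simp add: ennreal_mult[symmetric] ennreal_leI)
      qed
      also have "\<dots> = ennreal (E powr (- m)) * jump i j f (\<lambda>x. ennreal (x k powr m))"
        using ij k by (intro jump_cmult) auto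
      finally show "jump i j (g k) (\<lambda>_. 1) \<le> ennreal (E powr (- m)) * jump i j f (\<lambda>x. ennreal (x k powr m))" .
    qed
    also have "\<dots> = ennreal (E powr (- m)) * (\<Sum>i\<in>?I k. \<Sum>j\<in>?I k - {i}. jump i j f (\<lambda>x. ennreal (x k powr m)))"
      by (simp add: sum_distrib_left)
    also have "\<dots> \<le> ennreal (E powr (- m)) * (\<Sum>i<N. \<Sum>j\<in>{..<N} - {i}. jump i j f (\<lambda>x. ennreal (x k powr m)))"
    proof (rule mult_left_mono)
      have "(\<Sum>i\<in>?I k. \<Sum>j\<in>?I k - {i}. jump i j f (\<lambda>x. ennreal (x k powr m))) \<le> (\<Sum>i\<in>?I k. \<Sum>j\<in>{..<N} - {i}. jump i j f (\<lambda>x. ennreal (x k powr m)))"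
        by (intro sum_mono sum_mono2) auto
      also have "\<dots> \<le> (\<Sum>i<N. \<Sum>j\<in>{..<N} - {i}. jump i j f (\<lambda>x. ennreal (x k powr m)))"
        by (intro sum_mono2) auto
      finally show "(\<Sum>i\<in>?I k. \<Sum>j\<in>?I k - {i}. jump i j f (\<lambda>x. ennreal (x k powr m))) \<le> (\<Sum>i<N. \<Sum>j\<in>{..<N} - {i}. jump i j f (\<lambda>x. ennreal (x k powr m)))" .
    qed simp
    finally show ?thesis .
  qed
  have e0: "0 \<le> e k" if k: "k < N" for k
  proof -
    have "0 \<le> (\<Sum>i\<in>?I k. \<Sum>j\<in>?I k - {i}. ip (g k) (g k) - ip (g k) (resample_avg i j (g k)))"
      using jump_ip(2)[OF gB[OF k]] by (intro sum_nonneg) auto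
    then have "0 \<le> real (card (?I k)) * (real (card (?I k)) - 1) * e k"
      using jump_sum_pair_avg[OF gB[OF k] I(1)[OF k]] I[OF k] N4 unfolding e_def by simp
    moreover have "real (card (?I k)) * (real (card (?I k)) - 1) > 0" using I[OF k] N4 by (simp add: of_nat_diff)
    ultimately show ?thesis by (simp add: zero_le_mult_iff)
  qed
  have sume: "2 * (?n * (?n - 1)) * (\<Sum>k<N. e k) \<le> E powr (- m) * ?Kc * real N * t"
  proof -
    have n0: "0 \<le> 2 * (?n * (?n - 1))" using N4 by simp
    have "ennreal (2 * (?n * (?n - 1)) * (\<Sum>k<N. e k)) = (\<Sum>k<N. ennreal (2 * (?n * (?n - 1)) * e k))"
      unfolding sum_distrib_left using e0 by (intro sum_ennreal[symmetric] mult_nonneg_nonneg[OF n0]) auto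
    also have "\<dots> \<le> (\<Sum>k<N. ennreal (E powr (- m)) * (\<Sum>i<N. \<Sum>j\<in>{..<N} - {i}. jump i j f (\<lambda>x. ennreal (x k powr m))))"
      by (intro sum_mono ek) auto
    also have "\<dots> = ennreal (E powr (- m)) * (\<Sum>i<N. \<Sum>j\<in>{..<N} - {i}. \<Sum>k<N. jump i j f (\<lambda>x. ennreal (x k powr m)))"
    proof -
      have "(\<Sum>k<N. \<Sum>i<N. \<Sum>j\<in>{..<N} - {i}. jump i j f (\<lambda>x. ennreal (x k powr m)))
         = (\<Sum>i<N. \<Sum>k<N. \<Sum>j\<in>{..<N} - {i}. jump i j f (\<lambda>x. ennreal (x k powr m)))" by (rule sum.swap)
      also have "\<dots> = (\<Sum>i<N. \<Sum>j\<in>{..<N} - {i}. \<Sum>k<N. jump i j f (\<lambda>x. ennreal (x k powr m)))"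
        by (intro sum.cong refl sum.swap)
      finally show ?thesis by (simp add: sum_distrib_left[symmetric])
    qed
    also have "\<dots> \<le> ennreal (E powr (- m)) * (ennreal ?Kc * of_nat N * mean_field_energy m f)"
      using m by (intro mult_left_mono catalyst_sum \<kappa> fm) auto
    also have "\<dots> = ennreal (E powr (- m) * ?Kc * real N * t)"
      unfolding t(1) using Kc t(2) by (simp add: ennreal_mult ennreal_of_nat_eq_real_of_nat mult.assoc)
    finally show ?thesis
      using Kc t(2) by (subst (asm) ennreal_le_iff) auto
  qed
  have "(\<Sum>k<N. (\<integral>x. capped k x * (f x)\<^sup>2 \<partial>\<nu>)) \<le> (\<Sum>k<N. real (2 * s) * e k + ip f ((pair_avg (?I k) ^^ (2 * s)) f))"
    by (intro sum_mono one) auto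
  also have "\<dots> = real (2 * s) * (\<Sum>k<N. e k) + real N * ip f (left_out_avg (2 * s) f)"
    using ip_left_out_avg[OF f(1) f(1), of "2 * s"] N4 by (simp add: sum.distrib sum_distrib_left[symmetric])
  also have "\<dots> \<le> 4 * real K * ?Kc * E powr (- m) * t + real N * (\<epsilon> * ip f f)"
  proof (intro add_mono mult_left_mono)
    have "real (2 * s) * (\<Sum>k<N. e k) * ((real N)\<^sup>2 / 4) \<le> real (2 * s) * (\<Sum>k<N. e k) * (?n * (?n - 1))"
      using nn e0 by (intro mult_left_mono mult_nonneg_nonneg sum_nonneg) auto
    also have "\<dots> = real s * (2 * (?n * (?n - 1)) * (\<Sum>k<N. e k))" by simp
    also have "\<dots> \<le> real s * (E powr (- m) * ?Kc * real N * t)" by (intro mult_left_mono sume) auto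
    also have "\<dots> = (4 * real K * ?Kc * E powr (- m) * t) * ((real N)\<^sup>2 / 4)"
      by (simp add: s_def power2_eq_square)
    finally show "real (2 * s) * (\<Sum>k<N. e k) \<le> 4 * real K * ?Kc * E powr (- m) * t"
      using N4 by (subst (asm) mult_le_cancel_right) auto
    have "ip f (left_out_avg (2 * s) f) \<le> sqrt ((1 - 2 * (1 - q) / (real N - 1)) ^ (2 * s) + 2 / real N) * ip f f"
      using N4 by (intro left_out_avg_gap[OF f]) auto
    also have "\<dots> \<le> \<epsilon> * ip f f" using \<epsilon> unfolding s_def by (intro mult_right_mono) auto
    finally show "ip f (left_out_avg (2 * s) f) \<le> \<epsilon> * ip f f" .
  qed auto
  finally show ?thesis by (simp add: mult.assoc)
qed

end

section \<open>Drift of the Lyapunov function\<close>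

lemma sum_off_diag:
  fixes a :: "nat \<Rightarrow> real"
  assumes "N \<ge> 1"
  shows "(\<Sum>i<N. \<Sum>j\<in>{..<N} - {i}. a i + a j) = 2 * (real N - 1) * (\<Sum>i<N. a i)"
    and "(\<Sum>i<N. \<Sum>j\<in>{..<N} - {i}. c) = real N * (real N - 1) * c"
proof -
  have "(\<Sum>i<N. \<Sum>j\<in>{..<N} - {i}. a i + a j) = (\<Sum>i<N. (\<Sum>j<N. a i + a j) - (a i + a i))"
    by (intro sum.cong refl) (simp add: sum_diff1)
  also have "\<dots> = 2 * (real N - 1) * (\<Sum>i<N. a i)"
    by (simp add: sum_subtractf sum.distrib flip: sum_distrib_left) (simp add: algebra_simps)
  finally show "(\<Sum>i<N. \<Sum>j\<in>{..<N} - {i}. a i + a j) = 2 * (real N - 1) * (\<Sum>i<N. a i)" .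
  show "(\<Sum>i<N. \<Sum>j\<in>{..<N} - {i}. c) = real N * (real N - 1) * c"
    using assms by (simp add: card_Diff_singleton of_nat_diff)
qed

lemma sum_off_diag_cross:
  fixes a b :: "nat \<Rightarrow> real"
  assumes "\<And>i. i < N \<Longrightarrow> 0 \<le> a i" "\<And>i. i < N \<Longrightarrow> 0 \<le> b i"
  shows "(\<Sum>i<N. \<Sum>j\<in>{..<N} - {i}. a i * b j + a j * b i) \<le> 2 * ((\<Sum>i<N. a i) * (\<Sum>i<N. b i))"
proof -
  have "(\<Sum>i<N. \<Sum>j\<in>{..<N} - {i}. a i * b j + a j * b i) \<le> (\<Sum>i<N. \<Sum>j<N. a i * b j + a j * b i)"
    using assms by (intro sum_mono sum_mono2) auto
  also have "\<dots> = (\<Sum>i<N. \<Sum>j<N. a i * b j) + (\<Sum>i<N. \<Sum>j<N. a j * b i)" by (simp add: sum.distrib)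
  also have "(\<Sum>i<N. \<Sum>j<N. a j * b i) = (\<Sum>i<N. \<Sum>j<N. a i * b j)" by (rule sum.swap)
  finally show ?thesis by (simp add: sum_product)
qed

lemma sum_off_diag_ennreal:
  assumes "\<And>i j. i < N \<Longrightarrow> j < N \<Longrightarrow> 0 \<le> F i j"
  shows "(\<Sum>i<N. \<Sum>j\<in>{..<N} - {i}. ennreal (F i j)) = ennreal (\<Sum>i<N. \<Sum>j\<in>{..<N} - {i}. F i j)"
proof -
  have "(\<Sum>i<N. \<Sum>j\<in>{..<N} - {i}. ennreal (F i j)) = (\<Sum>i<N. ennreal (\<Sum>j\<in>{..<N} - {i}. F i j))"
    using assms by (intro sum.cong refl sum_ennreal) auto
  also have "\<dots> = ennreal (\<Sum>i<N. \<Sum>j\<in>{..<N} - {i}. F i j)"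
    using assms by (intro sum_ennreal sum_nonneg) auto
  finally show ?thesis .
qed

context energy_simplex begin

text \<open>In units of the mean energy, the rate of a bond times the expected decrease of
  \<open>V\<close> is \<open>E powr m / real N\<close> times the right-hand side of
  \<open>gain\<close>. Over all pairs the linear terms sum to a multiple of the conserved total, and
  the cross terms to at most 2 N times the sum of the capped weights. \<open>Lyapunov_pair\<close>
  converts this decrease into energy.\<close>

lemma Lyapunov_bound:
  assumes m: "0 < m" "m < 1"
    and c: "c > 0" "C \<ge> 0"
    and gain: "\<forall>a>0. \<forall>b>0. c * (a + b) - c / 2 - C * (a * min 1 b + b * min 1 a)
     \<le> (a + b) powr m * (beta_moment \<gamma> (1 - m) * (a + b) powr (1 - m) - a powr (1 - m) - b powr (1 - m))"
    and f: "f \<in> bmeas" and t: "mean_field_energy m f = ennreal t" "t \<ge> 0"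
  shows "E powr m * (c * real N / 6 * ip f f - 2 * C * (\<Sum>k<N. (\<integral>x. capped k x * (f x)\<^sup>2 \<partial>\<nu>))) \<le> t / 2"
proof -
  let ?p = "1 - m"
  have p: "0 < ?p" "?p < 1" using m by auto
  have Np: "real N > 0" using N2 by simp
  note [measurable] = bmeas_measurable[OF f]
  define hs where "hs x = (\<Sum>k<N. share k x powr ?p) / real N" for x
  \<comment> \<open>As u^(1-m) is at most 1 + u and the u_k have mean one, \<open>hs\<close> is at
    most 2 on good configurations. There 3 - hs lies between 1 and 3, and the maximum with 1 acts
    only elsewhere.\<close>
  define V where "V x = max 1 (3 - hs x)" for x
  have hs0: "0 \<le> hs x" for x unfolding hs_def by (intro divide_nonneg_nonneg sum_nonneg) auto
  have V: "1 \<le> V x" "V x \<le> 3" for x using hs0[of x] by (auto simp: V_def)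
  have hsB: "hs \<in> bmeas" unfolding hs_def[abs_def] using p by (intro bmeas_divide bmeas_sum bmeas_powr_share) auto
  note [measurable] = bmeas_measurable[OF hsB]
  have VB: "V \<in> bmeas"
  proof (rule bmeas_I[where K=3])
    show "V \<in> borel_measurable (cfg N)" unfolding V_def[abs_def] by measurable
    show "\<bar>V x\<bar> \<le> 3" for x using V[of x] by linarith
  qed
  note [measurable] = bmeas_measurable[OF VB]
  have iVB: "(\<lambda>x. 1 / V x) \<in> bmeas"
  proof (rule bmeas_I[where K=1])
    show "\<bar>1 / V x\<bar> \<le> 1" for x using V(1)[of x] by (simp add: divide_le_eq_1)
  qed simp
  have Vgood: "V x = 3 - hs x" if x: "good x" for x
  proof -
    have "(\<Sum>k<N. share k x powr ?p) \<le> (\<Sum>k<N. 1 + x k / E)"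
    proof (rule sum_mono)
      fix k assume "k \<in> {..<N}"
      then have k: "k < N" by simp
      define u where "u = x k / E"
      have u: "0 < u" using good_le[OF x k] Epos by (simp add: u_def)
      have "u powr ?p \<le> 1 + u"
      proof (cases "u \<le> 1")
        case True
        have "u powr ?p \<le> 1" using True u p by (intro powr_le1) auto
        then show ?thesis using u by simp
      next
        case False
        then have "u powr ?p \<le> u powr 1" using p by (intro powr_mono) auto
        then show ?thesis using u by simp
      qed
      then show "share k x powr ?p \<le> 1 + x k / E" using share_good[OF x k] by (simp add: u_def)
    qed
    also have "\<dots> = 2 * real N"
      using x Epos by (simp add: sum.distrib sum_divide_distrib[symmetric] good_def)
    finally have "hs x \<le> 2" using Np by (simp add: hs_def pos_divide_le_eq)
    then show ?thesis by (simp add: V_def)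
  qed
  define R where "R i j x = bondw m i j x * (f x)\<^sup>2 * (V x - resample_avg i j V x) * (1 / V x)" for i j x
  have RB: "R i j \<in> bmeas" if "i < N" "j < N" for i j
    unfolding R_def[abs_def] using that m by (intro bmeas_mult bmeas_diff bmeas_power bondw_bmeas resample_avg_bmeas f VB iVB) auto
  \<comment> \<open>Only two terms of \<open>hs\<close> change, and their sum after resampling has
    mean \<open>beta_moment \<gamma> ?p\<close> times the power of the energy of the pair.\<close>
  have diff: "V x - resample_avg i j V x = (beta_moment \<gamma> ?p * (x i / E + x j / E) powr ?p - (x i / E) powr ?p - (x j / E) powr ?p) / real N"
    if x: "good x" and ij: "i < N" "j < N" "i \<noteq> j" for x i j
  proof -
    have sp: "x \<in> space (cfg N)" using x by (simp add: good_def)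
    note [measurable] = Tx_measurable_fixed[OF sp ij(1,2)]
    let ?w = "x i / E + x j / E"
    have w: "0 < ?w" using good_le[OF x] ij Epos by (auto intro!: add_pos_pos divide_pos_pos)
    have pt: "V (Tx i j a x) = V x + ((x i / E) powr ?p + (x j / E) powr ?p) / real N - (a powr ?p + (1 - a) powr ?p) * (?w powr ?p / real N)"
      if a: "0 < a" "a < 1" for a
    proof -
      have gT: "good (Tx i j a x)" by (rule good_Tx[OF x ij a])
      have split: "(\<Sum>k<N. g k) = g i + (g j + (\<Sum>k\<in>{..<N} - {i, j}. g k))" for g :: "nat \<Rightarrow> real"
      proof -
        have "{..<N} = insert i (insert j ({..<N} - {i, j}))" using ij by auto
        then show ?thesis using ij by (metis (no_types, lifting) DiffD2 finite_Diff finite_insert finite_lessThan insertCI insertE sum.insert)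
      qed
      have rest: "(\<Sum>k\<in>{..<N} - {i, j}. share k (Tx i j a x) powr ?p) = (\<Sum>k\<in>{..<N} - {i, j}. share k x powr ?p)"
        by (intro sum.cong) (auto simp: share_def Tx_def)
      have Ti: "share i (Tx i j a x) powr ?p = a powr ?p * ?w powr ?p"
      proof -
        have "share i (Tx i j a x) = a * ?w"
          using share_good[OF gT ij(1)] ij by (simp add: Tx_def add_divide_distrib distrib_left)
        then show ?thesis using a w by (simp add: powr_mult)
      qed
      have Tj: "share j (Tx i j a x) powr ?p = (1 - a) powr ?p * ?w powr ?p"
      proof -
        have "share j (Tx i j a x) = (1 - a) * ?w"
          using share_good[OF gT ij(2)] ij by (simp add: Tx_def add_divide_distrib[symmetric])
        then show ?thesis using a w by (simp add: powr_mult)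
      qed
      have "hs (Tx i j a x) = hs x + ((a powr ?p + (1 - a) powr ?p) * ?w powr ?p - (x i / E) powr ?p - (x j / E) powr ?p) / real N"
        unfolding hs_def split[of "\<lambda>k. share k (Tx i j a x) powr ?p"] split[of "\<lambda>k. share k x powr ?p"] rest Ti Tj
        by (simp add: share_good[OF x] ij add_divide_distrib diff_divide_distrib distrib_right)
      then show ?thesis unfolding Vgood[OF x] Vgood[OF gT]
        by (simp add: add_divide_distrib diff_divide_distrib)
    qed
    have "resample_avg i j V x = (\<integral>a. V x + ((x i / E) powr ?p + (x j / E) powr ?p) / real N - (a powr ?p + (1 - a) powr ?p) * (?w powr ?p / real N) \<partial>\<beta>)"
      unfolding resample_avg_def
    proof (rule integral_cong_AE)
      show "AE a in \<beta>. V (Tx i j a x) = V x + ((x i / E) powr ?p + (x j / E) powr ?p) / real N - (a powr ?p + (1 - a) powr ?p) * (?w powr ?p / real N)"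
        using AE_sym_beta by eventually_elim (rule pt; simp)
    qed measurable
    also have "\<dots> = V x + ((x i / E) powr ?p + (x j / E) powr ?p) / real N - beta_moment \<gamma> ?p * (?w powr ?p / real N)"
      using beta_moment_props(1)[OF gam p] unfolding beta_moment_def by (simp add: beta.prob_space[simplified])
    finally show ?thesis by (simp add: add_divide_distrib diff_divide_distrib)
  qed
  have point: "E powr m * (c * real N / 6 * (f x)\<^sup>2 - 2 * C * (\<Sum>k<N. capped k x * (f x)\<^sup>2)) \<le> (\<Sum>i<N. \<Sum>j\<in>{..<N} - {i}. R i j x)"
    if x: "good x" for x
  proof -
    define u where "u k = x k / E" for k
    have u: "0 < u k" if "k < N" for k using good_le[OF x that] Epos by (simp add: u_def)
    have capu: "capped k x = min 1 (u k)" if "k < N" for k using u[OF that] by (simp add: capped_def u_def)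
    have sumu: "(\<Sum>k<N. u k) = real N"
      using x Epos by (simp add: u_def sum_divide_distrib[symmetric] good_def)
    define \<Phi> where "\<Phi> = (\<Sum>k<N. capped k x)"
    have \<Phi>0: "\<Phi> \<ge> 0" unfolding \<Phi>_def by (intro sum_nonneg) (auto simp: capped_range)
    have bond: "bondw m i j x * (V x - resample_avg i j V x) \<ge> E powr m / real N * (c * (u i + u j) - c / 2 - C * (u i * capped j x + u j * capped i x))"
      if ij: "i < N" "j \<in> {..<N} - {i}" for i j
    proof -
      have ij': "i < N" "j < N" "i \<noteq> j" using ij by auto
      have "x i + x j = E * (u i + u j)" using Epos by (simp add: u_def distrib_left)
      then have "bondw m i j x = E powr m * (u i + u j) powr m"
        using bondw_good[OF x ij'] u[OF ij'(1)] u[OF ij'(2)] Epos by (simp add: powr_mult)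
      then have "bondw m i j x * (V x - resample_avg i j V x) = E powr m / real N * ((u i + u j) powr m * (beta_moment \<gamma> ?p * (u i + u j) powr ?p - u i powr ?p - u j powr ?p))"
        unfolding diff[OF x ij'] u_def by simp
      moreover have gg: "c * (u i + u j) - c / 2 - C * (u i * capped j x + u j * capped i x)
         \<le> (u i + u j) powr m * (beta_moment \<gamma> ?p * (u i + u j) powr ?p - u i powr ?p - u j powr ?p)"
        using gain u[OF ij'(1)] u[OF ij'(2)] ij' by (simp add: capu)
      moreover have "0 \<le> E powr m / real N" by simp
      ultimately show ?thesis using mult_left_mono[OF gg, of "E powr m / real N"] by linarith
    qed
    \<comment> \<open>The linear and the constant term together give 3/2 c N (N - 1), which is at
      least c N^2 / 2 for N at least 2.\<close>
    have "E powr m * (c * real N / 2 - 2 * C * \<Phi>) \<le> E powr m / real N * (c * (2 * (real N - 1) * real N) - real N * (real N - 1) * (c / 2) - C * (2 * (real N * \<Phi>)))"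
    proof -
      have "E powr m * (c * real N / 2 - 2 * C * \<Phi>) = E powr m / real N * (c * (real N * real N) / 2 - C * (2 * (real N * \<Phi>)))"
        using Np by (simp add: field_simps)
      also have "\<dots> \<le> E powr m / real N * (c * (2 * (real N - 1) * real N) - real N * (real N - 1) * (c / 2) - C * (2 * (real N * \<Phi>)))"
      proof (rule mult_left_mono)
        have "0 \<le> c * real N * (2 * real N - 3)" using c N2 by simp
        then show "c * (real N * real N) / 2 - C * (2 * (real N * \<Phi>)) \<le> c * (2 * (real N - 1) * real N) - real N * (real N - 1) * (c / 2) - C * (2 * (real N * \<Phi>))"
          by (simp add: algebra_simps)
      qed simp
      finally show ?thesis .
    qed
    also have "\<dots> \<le> E powr m / real N * (\<Sum>i<N. \<Sum>j\<in>{..<N} - {i}. c * (u i + u j) - c / 2 - C * (u i * capped j x + u j * capped i x))"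
    proof (rule mult_left_mono)
      have "(\<Sum>i<N. \<Sum>j\<in>{..<N} - {i}. u i * capped j x + u j * capped i x) \<le> 2 * ((\<Sum>i<N. u i) * (\<Sum>i<N. capped i x))"
        using u by (intro sum_off_diag_cross) (auto simp: capped_range less_imp_le)
      then have "C * (\<Sum>i<N. \<Sum>j\<in>{..<N} - {i}. u i * capped j x + u j * capped i x) \<le> C * (2 * (real N * \<Phi>))"
        using c by (intro mult_left_mono) (auto simp: sumu \<Phi>_def)
      moreover have "(\<Sum>i<N. \<Sum>j\<in>{..<N} - {i}. c * (u i + u j) - c / 2 - C * (u i * capped j x + u j * capped i x))
        = c * (2 * (real N - 1) * real N) - real N * (real N - 1) * (c / 2) - C * (\<Sum>i<N. \<Sum>j\<in>{..<N} - {i}. u i * capped j x + u j * capped i x)"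
      proof -
        have "(\<Sum>i<N. \<Sum>j\<in>{..<N} - {i}. c * (u i + u j)) = c * (2 * (real N - 1) * real N)"
          using sum_off_diag(1)[of N u] N2 by (simp only: sum_distrib_left[symmetric] sumu)
        moreover have "(\<Sum>i<N. \<Sum>j\<in>{..<N} - {i}. c / 2) = real N * (real N - 1) * (c / 2)"
          using sum_off_diag(2)[of N "c / 2"] N2 by simp
        moreover have "(\<Sum>i<N. \<Sum>j\<in>{..<N} - {i}. C * (u i * capped j x + u j * capped i x)) = C * (\<Sum>i<N. \<Sum>j\<in>{..<N} - {i}. u i * capped j x + u j * capped i x)"
          by (simp only: sum_distrib_left[symmetric])
        ultimately show ?thesis by (simp only: sum_subtractf)
      qed
      ultimately show "c * (2 * (real N - 1) * real N) - real N * (real N - 1) * (c / 2) - C * (2 * (real N * \<Phi>))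
        \<le> (\<Sum>i<N. \<Sum>j\<in>{..<N} - {i}. c * (u i + u j) - c / 2 - C * (u i * capped j x + u j * capped i x))"
        by linarith
    qed simp
    also have "\<dots> \<le> (\<Sum>i<N. \<Sum>j\<in>{..<N} - {i}. bondw m i j x * (V x - resample_avg i j V x))"
      unfolding sum_distrib_left by (intro sum_mono bond) auto
    finally have tot: "E powr m * (c * real N / 2 - 2 * C * \<Phi>) \<le> (\<Sum>i<N. \<Sum>j\<in>{..<N} - {i}. bondw m i j x * (V x - resample_avg i j V x))" .
    \<comment> \<open>\<open>V x\<close> lies in [1, 3]: dividing by it costs a factor 3 in the
      positive term and does not enlarge the negative one.\<close>
    have "c * real N / 6 - 2 * C * \<Phi> \<le> (c * real N / 2 - 2 * C * \<Phi>) * (1 / V x)"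
    proof -
      have Vx: "1 \<le> V x" "V x \<le> 3" using V by auto
      have "c * real N / 6 = (c * real N / 2) * (1 / 3)" by simp
      also have "\<dots> \<le> (c * real N / 2) * (1 / V x)" using c Np Vx by (intro mult_left_mono) (auto simp: field_simps)
      finally have 1: "c * real N / 6 \<le> (c * real N / 2) * (1 / V x)" .
      have 2: "2 * C * \<Phi> * (1 / V x) \<le> 2 * C * \<Phi> * 1" using c \<Phi>0 Vx by (intro mult_left_mono) auto
      have "(c * real N / 2 - 2 * C * \<Phi>) * (1 / V x) = (c * real N / 2) * (1 / V x) - 2 * C * \<Phi> * (1 / V x)"
        by (rule left_diff_distrib)
      then show ?thesis using 1 2 by linarith
    qed
    then have "E powr m * (c * real N / 6 - 2 * C * \<Phi>) \<le> E powr m * ((c * real N / 2 - 2 * C * \<Phi>) * (1 / V x))"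
      by (rule mult_left_mono) simp
    also have "\<dots> = (E powr m * (c * real N / 2 - 2 * C * \<Phi>)) * (1 / V x)" by simp
    also have "\<dots> \<le> (\<Sum>i<N. \<Sum>j\<in>{..<N} - {i}. bondw m i j x * (V x - resample_avg i j V x)) * (1 / V x)"
      using V(1)[of x] by (intro mult_right_mono tot) auto
    finally have "E powr m * (c * real N / 6 - 2 * C * \<Phi>) * (f x)\<^sup>2 \<le> (\<Sum>i<N. \<Sum>j\<in>{..<N} - {i}. bondw m i j x * (V x - resample_avg i j V x)) * (1 / V x) * (f x)\<^sup>2"
      by (rule mult_right_mono) simp
    also have "\<dots> = (\<Sum>i<N. \<Sum>j\<in>{..<N} - {i}. R i j x)"
      unfolding R_def sum_distrib_right by (intro sum.cong refl) (simp only: mult_ac)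
    finally show ?thesis
      by (simp add: \<Phi>_def sum_distrib_right[symmetric] algebra_simps)
  qed
  have total: "E powr m * (c * real N / 6 * ip f f - 2 * C * (\<Sum>k<N. (\<integral>x. capped k x * (f x)\<^sup>2 \<partial>\<nu>))) \<le> (\<Sum>i<N. \<Sum>j\<in>{..<N} - {i}. (\<integral>x. R i j x \<partial>\<nu>))"
  proof -
    have cB: "(\<lambda>x. capped k x * (f x)\<^sup>2) \<in> bmeas" if "k < N" for k using f that by auto
    have fB: "(\<lambda>x. (f x)\<^sup>2) \<in> bmeas" using f by auto
    have "E powr m * (c * real N / 6 * ip f f - 2 * C * (\<Sum>k<N. (\<integral>x. capped k x * (f x)\<^sup>2 \<partial>\<nu>)))
       = (\<integral>x. E powr m * (c * real N / 6 * (f x)\<^sup>2 - 2 * C * (\<Sum>k<N. capped k x * (f x)\<^sup>2)) \<partial>\<nu>)"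
    proof -
      have "(\<integral>x. (\<Sum>k<N. capped k x * (f x)\<^sup>2) \<partial>\<nu>) = (\<Sum>k<N. (\<integral>x. capped k x * (f x)\<^sup>2 \<partial>\<nu>))"
        using cB by (intro Bochner_Integration.integral_sum bmeas_integrable) auto
      moreover have "integrable \<nu> (\<lambda>x. \<Sum>k<N. capped k x * (f x)\<^sup>2)" using cB by (intro bmeas_integrable bmeas_sum) auto
      moreover have "integrable \<nu> (\<lambda>x. (f x)\<^sup>2)" using fB by (rule bmeas_integrable)
      ultimately show ?thesis by (simp add: ip_def power2_eq_square)
    qed
    also have "\<dots> \<le> (\<integral>x. (\<Sum>i<N. \<Sum>j\<in>{..<N} - {i}. R i j x) \<partial>\<nu>)"
    proof (rule integral_mono_AE)
      show "integrable \<nu> (\<lambda>x. E powr m * (c * real N / 6 * (f x)\<^sup>2 - 2 * C * (\<Sum>k<N. capped k x * (f x)\<^sup>2)))"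
        using fB cB by (intro bmeas_integrable bmeas_mult bmeas_const bmeas_diff bmeas_sum) auto
      show "integrable \<nu> (\<lambda>x. \<Sum>i<N. \<Sum>j\<in>{..<N} - {i}. R i j x)"
        using RB by (intro bmeas_integrable bmeas_sum) auto
      show "AE x in \<nu>. E powr m * (c * real N / 6 * (f x)\<^sup>2 - 2 * C * (\<Sum>k<N. capped k x * (f x)\<^sup>2)) \<le> (\<Sum>i<N. \<Sum>j\<in>{..<N} - {i}. R i j x)"
        using AE_good by eventually_elim (rule point)
    qed
    also have "\<dots> = (\<Sum>i<N. (\<integral>x. (\<Sum>j\<in>{..<N} - {i}. R i j x) \<partial>\<nu>))"
      using RB by (intro Bochner_Integration.integral_sum bmeas_integrable bmeas_sum) auto
    also have "\<dots> = (\<Sum>i<N. \<Sum>j\<in>{..<N} - {i}. (\<integral>x. R i j x \<partial>\<nu>))"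
      using RB by (intro sum.cong refl Bochner_Integration.integral_sum bmeas_integrable) auto
    finally show ?thesis .
  qed
  define A where "A i j = (\<integral>x. bondw m i j x * (f x)\<^sup>2 \<partial>\<nu>)" for i j
  define B where "B i j = (\<integral>x. bondw m i j x * (f x)\<^sup>2 * resample_avg i j V x * (1 / V x) \<partial>\<nu>)" for i j
  have bw0: "0 \<le> bondw m i j x" for i j x by (simp add: bondw_def)
  have RA: "(\<integral>x. R i j x \<partial>\<nu>) = A i j - B i j" if ij: "i < N" "j < N" for i j
  proof -
    have "(\<integral>x. R i j x \<partial>\<nu>) = (\<integral>x. bondw m i j x * (f x)\<^sup>2 - bondw m i j x * (f x)\<^sup>2 * resample_avg i j V x * (1 / V x) \<partial>\<nu>)"
    proof (intro Bochner_Integration.integral_cong refl)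
      fix x
      have "V x \<noteq> 0" using V(1)[of x] by linarith
      then show "R i j x = bondw m i j x * (f x)\<^sup>2 - bondw m i j x * (f x)\<^sup>2 * resample_avg i j V x * (1 / V x)"
        by (simp add: R_def field_simps)
    qed
    also have "\<dots> = A i j - B i j"
      unfolding A_def B_def using ij m
      by (intro Bochner_Integration.integral_diff bmeas_integrable bmeas_mult bmeas_power bondw_bmeas resample_avg_bmeas f VB iVB) auto
    finally show ?thesis .
  qed
  have lyap: "ennreal (2 * A i j) \<le> ennreal (2 * B i j) + pair_energy m f i j" if ij: "i < N" "j \<in> {..<N} - {i}" for i j
  proof -
    have ij': "i < N" "j < N" "i \<noteq> j" using ij by auto
    have "ennreal (2 * A i j) \<le> ennreal (2 * B i j) + jump i j f (\<lambda>x. ennreal (bondw m i j x))"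
      unfolding A_def B_def using ij' m bw0 V(1)
      by (intro Lyapunov_pair f VB iVB bondw_bmeas) (auto simp: bondw_def Tx_pair_sum)
    also have "jump i j f (\<lambda>x. ennreal (bondw m i j x)) \<le> pair_energy m f i j"
      unfolding pair_energy_def by (rule jump_mono, use AE_good in eventually_elim) (simp add: bondw_good ij')
    finally show ?thesis by (simp add: add_left_mono)
  qed
  have A0: "0 \<le> A i j" for i j unfolding A_def using bw0 by (intro integral_nonneg_AE AE_I2) auto
  have B0: "0 \<le> B i j" if "i < N" "j < N" for i j
  proof -
    have V0: "0 \<le> V x" for x using V(1)[of x] by linarith
    have "0 \<le> resample_avg i j V x" for x
      unfolding resample_avg_def using V0 by (intro integral_nonneg_AE) auto
    then show ?thesis unfolding B_def using bw0 V0 by (intro integral_nonneg_AE AE_I2) auto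
  qed
  have "ennreal (\<Sum>i<N. \<Sum>j\<in>{..<N} - {i}. 2 * A i j) \<le> ennreal ((\<Sum>i<N. \<Sum>j\<in>{..<N} - {i}. 2 * B i j) + t)"
  proof -
    have "ennreal (\<Sum>i<N. \<Sum>j\<in>{..<N} - {i}. 2 * A i j) = (\<Sum>i<N. \<Sum>j\<in>{..<N} - {i}. ennreal (2 * A i j))"
      using A0 by (intro sum_off_diag_ennreal[symmetric]) auto
    also have "\<dots> \<le> (\<Sum>i<N. \<Sum>j\<in>{..<N} - {i}. ennreal (2 * B i j) + pair_energy m f i j)"
      by (intro sum_mono lyap) auto
    also have "\<dots> = (\<Sum>i<N. \<Sum>j\<in>{..<N} - {i}. ennreal (2 * B i j)) + mean_field_energy m f"
      by (simp add: sum.distrib mean_field_energy_def)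
    also have "(\<Sum>i<N. \<Sum>j\<in>{..<N} - {i}. ennreal (2 * B i j)) = ennreal (\<Sum>i<N. \<Sum>j\<in>{..<N} - {i}. 2 * B i j)"
      using B0 by (intro sum_off_diag_ennreal) auto
    also have "\<dots> + mean_field_energy m f = ennreal ((\<Sum>i<N. \<Sum>j\<in>{..<N} - {i}. 2 * B i j) + t)"
      unfolding t(1) using B0 t(2) by (intro ennreal_plus[symmetric] sum_nonneg) auto
    finally show ?thesis .
  qed
  then have "(\<Sum>i<N. \<Sum>j\<in>{..<N} - {i}. 2 * A i j) \<le> (\<Sum>i<N. \<Sum>j\<in>{..<N} - {i}. 2 * B i j) + t"
    using B0 t(2) by (subst (asm) ennreal_le_iff) (auto intro!: add_nonneg_nonneg sum_nonneg)
  moreover have "(\<Sum>i<N. \<Sum>j\<in>{..<N} - {i}. (\<integral>x. R i j x \<partial>\<nu>)) = (\<Sum>i<N. \<Sum>j\<in>{..<N} - {i}. A i j) - (\<Sum>i<N. \<Sum>j\<in>{..<N} - {i}. B i j)"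
    unfolding sum_subtractf[symmetric] by (intro sum.cong refl RA) auto
  ultimately show ?thesis using total by (simp add: sum_distrib_left[symmetric])
qed

text \<open>\<open>capped_energy\<close> controls the error term of \<open>Lyapunov_bound\<close> up
  to a multiple of \<epsilon> of the norm. By the condition on \<epsilon> this is at most c / 12,
  half of the main coefficient c / 6, and is absorbed. For infinite energy nothing is
  claimed.\<close>

lemma weighted_gap_concave:
  assumes m: "0 < m" "m < 1" and \<kappa>: "unif_dom \<gamma> \<kappa>" "\<kappa> > 0"
    and c: "c > 0" "C \<ge> 0"
    and gain: "\<forall>a>0. \<forall>b>0. c * (a + b) - c / 2 - C * (a * min 1 b + b * min 1 a)
     \<le> (a + b) powr m * (beta_moment \<gamma> (1 - m) * (a + b) powr (1 - m) - a powr (1 - m) - b powr (1 - m))"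
    and f: "f \<in> bmeas" "(\<integral>x. f x \<partial>\<nu>) = 0" "quad_lip {..<N} L 0 f" "L \<ge> 0"
    and N4: "N \<ge> 4"
    and \<epsilon>: "sqrt ((1 - 2 * (1 - q) / (real N - 1)) ^ (2 * (K * N)) + 2 / real N) \<le> \<epsilon>" "2 * C * \<epsilon> \<le> c / 12"
  shows "ennreal (c / 12 * E powr m * real N * ip f f) \<le> ennreal (1 / 2 + 8 * C * real K * (2 + 8 * \<kappa> + 8 * \<kappa>\<^sup>2 * 2 powr m)) * mean_field_energy m f"
proof -
  let ?Kc = "2 + 8 * \<kappa> + 8 * \<kappa>\<^sup>2 * 2 powr m"
  have Kc: "?Kc > 0" using \<kappa>(2) by (simp add: add_pos_nonneg)
  have coef: "0 < 1 / 2 + 8 * C * real K * ?Kc" using Kc c by (simp add: add_pos_nonneg)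
  show ?thesis
  proof (cases "mean_field_energy m f")
    case (real t)
    let ?S = "\<Sum>k<N. (\<integral>x. capped k x * (f x)\<^sup>2 \<partial>\<nu>)"
    have 1: "E powr m * (c * real N / 6 * ip f f - 2 * C * ?S) \<le> t / 2"
      by (rule Lyapunov_bound[OF m c gain f(1) real(2,1)])
    have 2: "?S \<le> 4 * real K * ?Kc * E powr (- m) * t + real N * \<epsilon> * ip f f"
      by (rule capped_energy[OF m \<kappa> f N4 real(2,1) \<epsilon>(1)])
    have EE: "E powr m * E powr (- m) = 1" using Epos by (simp add: powr_minus)
    have "E powr m * (2 * C * ?S) \<le> E powr m * (2 * C * (4 * real K * ?Kc * E powr (- m) * t + real N * \<epsilon> * ip f f))"
      using 2 c by (intro mult_left_mono) auto
    also have "\<dots> = (E powr m * E powr (- m)) * (8 * C * real K * ?Kc * t) + E powr m * (real N * ip f f) * (2 * C * \<epsilon>)"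
      by (simp only: distrib_left mult_ac)
    also have "\<dots> \<le> 8 * C * real K * ?Kc * t + E powr m * (real N * ip f f) * (c / 12)"
      unfolding EE using mult_left_mono[OF \<epsilon>(2), of "E powr m * (real N * ip f f)"] by simp
    finally have 3: "E powr m * (2 * C * ?S) \<le> 8 * C * real K * ?Kc * t + E powr m * (real N * ip f f) * (c / 12)" .
    define X where "X = E powr m * (real N * ip f f)"
    define Y where "Y = E powr m * (2 * C * ?S)"
    have eq: "E powr m * (c * real N / 6 * ip f f - 2 * C * ?S) = c / 6 * X - Y"
      unfolding X_def Y_def by (simp only: right_diff_distrib) simp
    have "c / 6 * X - Y \<le> t / 2" using 1 unfolding eq .
    moreover have "Y \<le> 8 * C * real K * ?Kc * t + X * (c / 12)" using 3 unfolding X_def Y_def .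
    moreover have "c / 6 * X = 2 * (c / 12 * X)" "X * (c / 12) = c / 12 * X" by simp_all
    ultimately have "c / 12 * X \<le> t / 2 + 8 * C * real K * ?Kc * t" by linarith
    moreover have "c / 12 * E powr m * real N * ip f f = c / 12 * X" by (simp add: X_def)
    moreover have "(1 / 2 + 8 * C * real K * ?Kc) * t = t / 2 + 8 * C * real K * ?Kc * t" by (simp add: distrib_right)
    ultimately have "c / 12 * E powr m * real N * ip f f \<le> (1 / 2 + 8 * C * real K * ?Kc) * t" by linarith
    then show ?thesis unfolding real(2) using coef real(1)
      by (subst ennreal_mult[symmetric]) (auto intro: ennreal_leI)
  next
    case top
    then show ?thesis using coef by (simp add: ennreal_mult_top)
  qed
qed

end

section \<open>Density of the bounded Lipschitz functions\<close>

lemma ennreal_quarters: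
  assumes "(e::real) > 0"
  shows "2 * ennreal (e / 4) + 2 * ennreal (e / 4) = ennreal e"
proof -
  have "2 * ennreal (e / 4) = ennreal (e / 2)" using ennreal_mult'[of 2 "e / 4"] by simp
  then show ?thesis using assms by (simp add: ennreal_plus[symmetric] del: ennreal_plus)
qed

context energy_simplex begin

text \<open>The class on which the gap is first proved, as \<open>contraction_gap\<close> starts
  from a Lipschitz bound. Closure under sums, multiples and minima is what the approximation of
  indicators needs.\<close>

definition blip :: "((nat \<Rightarrow> real) \<Rightarrow> real) set" where
  "blip = {g \<in> bmeas. \<exists>L\<ge>0. quad_lip {..<N} L 0 g}"

lemma blip_I: "g \<in> bmeas \<Longrightarrow> L \<ge> 0 \<Longrightarrow> (\<And>x y. (g x - g y)\<^sup>2 \<le> L * (\<Sum>i<N. (x i - y i)\<^sup>2)) \<Longrightarrow> g \<in> blip"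
  by (auto simp: blip_def quad_lip_def)

lemma blip_const: "(\<lambda>_. c) \<in> blip"
  by (rule blip_I[where L=0]) auto

lemma blip_add:
  assumes "f \<in> blip" "g \<in> blip"
  shows "(\<lambda>x. f x + g x) \<in> blip"
proof -
  from assms obtain K L where K: "K \<ge> 0" "quad_lip {..<N} K 0 f" and L: "L \<ge> 0" "quad_lip {..<N} L 0 g" by (auto simp: blip_def)
  have "quad_lip {..<N} (2 * K + 2 * L) 0 (\<lambda>x. f x + g x)"
    unfolding quad_lip_def
  proof (intro ballI)
    fix x y assume xy: "x \<in> shell" "y \<in> shell"
    have "(f x + g x - (f y + g y))\<^sup>2 \<le> 2 * (f x - f y)\<^sup>2 + 2 * (g x - g y)\<^sup>2"
      using sum_squares_ge_zero[of "(f x - f y) - (g x - g y)" 0] by (simp add: power2_eq_square algebra_simps)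
    also have "\<dots> \<le> 2 * (K * (\<Sum>i<N. (x i - y i)\<^sup>2)) + 2 * (L * (\<Sum>i<N. (x i - y i)\<^sup>2))"
      using K(2) L(2) xy by (auto simp: quad_lip_def intro!: add_mono)
    finally show "(f x + g x - (f y + g y))\<^sup>2 \<le> (2 * K + 2 * L) * (\<Sum>i<N. (x i - y i)\<^sup>2) + 0 * (\<Sum>i<N. x i - y i)\<^sup>2"
      by (simp add: algebra_simps)
  qed
  then show ?thesis using assms K L by (auto simp: blip_def intro!: exI[of _ "2 * K + 2 * L"])
qed

lemma blip_cmult:
  assumes "f \<in> blip"
  shows "(\<lambda>x. c * f x) \<in> blip"
proof -
  from assms obtain K where K: "K \<ge> 0" "quad_lip {..<N} K 0 f" by (auto simp: blip_def)
  have "quad_lip {..<N} (c\<^sup>2 * K) 0 (\<lambda>x. c * f x)"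
    unfolding quad_lip_def
  proof (intro ballI)
    fix x y assume xy: "x \<in> shell" "y \<in> shell"
    have "(c * f x - c * f y)\<^sup>2 = c\<^sup>2 * (f x - f y)\<^sup>2" by (simp add: power_mult_distrib right_diff_distrib[symmetric])
    also have "\<dots> \<le> c\<^sup>2 * (K * (\<Sum>i<N. (x i - y i)\<^sup>2))"
      using K(2) xy by (intro mult_left_mono) (auto simp: quad_lip_def)
    finally show "(c * f x - c * f y)\<^sup>2 \<le> c\<^sup>2 * K * (\<Sum>i<N. (x i - y i)\<^sup>2) + 0 * (\<Sum>i<N. x i - y i)\<^sup>2"
      by (simp add: mult.assoc)
  qed
  then show ?thesis using assms K by (auto simp: blip_def intro!: exI[of _ "c\<^sup>2 * K"])
qed

lemma min_diff_sq: "(min a b - min c d)\<^sup>2 \<le> (a - c)\<^sup>2 + (b - d)\<^sup>2" for a b c d :: real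
proof -
  have "\<bar>min a b - min c d\<bar> \<le> max \<bar>a - c\<bar> \<bar>b - d\<bar>" by (auto simp: min_def max_def)
  then have "(min a b - min c d)\<^sup>2 \<le> (max \<bar>a - c\<bar> \<bar>b - d\<bar>)\<^sup>2" by (metis abs_le_square_iff abs_ge_self order_trans)
  also have "\<dots> \<le> (a - c)\<^sup>2 + (b - d)\<^sup>2" by (auto simp: max_def)
  finally show ?thesis .
qed

lemma blip_min:
  assumes "f \<in> blip" "g \<in> blip"
  shows "(\<lambda>x. min (f x) (g x)) \<in> blip"
proof -
  from assms obtain K L where K: "K \<ge> 0" "quad_lip {..<N} K 0 f" and L: "L \<ge> 0" "quad_lip {..<N} L 0 g" by (auto simp: blip_def)
  from assms have B: "f \<in> bmeas" "g \<in> bmeas" by (auto simp: blip_def)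
  note [measurable] = B[THEN bmeas_measurable]
  obtain P where P: "\<And>x. x \<in> space (cfg N) \<Longrightarrow> \<bar>f x\<bar> \<le> P" using bmeas_bound[OF B(1)] by metis
  obtain Q where Q: "\<And>x. x \<in> space (cfg N) \<Longrightarrow> \<bar>g x\<bar> \<le> Q" using bmeas_bound[OF B(2)] by metis
  have "(\<lambda>x. min (f x) (g x)) \<in> bmeas"
  proof (rule bmeas_I[where K="max P Q"])
    show "\<bar>min (f x) (g x)\<bar> \<le> max P Q" if "x \<in> space (cfg N)" for x
      using P[OF that] Q[OF that] by (auto simp: min_def max_def)
  qed simp
  moreover have "quad_lip {..<N} (K + L) 0 (\<lambda>x. min (f x) (g x))"
    unfolding quad_lip_def
  proof (intro ballI)
    fix x y assume xy: "x \<in> shell" "y \<in> shell"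
    have "(f x - f y)\<^sup>2 \<le> K * (\<Sum>i<N. (x i - y i)\<^sup>2)" "(g x - g y)\<^sup>2 \<le> L * (\<Sum>i<N. (x i - y i)\<^sup>2)"
      using K(2) L(2) xy by (auto simp: quad_lip_def)
    then show "(min (f x) (g x) - min (f y) (g y))\<^sup>2 \<le> (K + L) * (\<Sum>i<N. (x i - y i)\<^sup>2) + 0 * (\<Sum>i<N. x i - y i)\<^sup>2"
      using min_diff_sq[of "f x" "g x" "f y" "g y"] by (simp add: distrib_right)
  qed
  ultimately show ?thesis using K L by (auto simp: blip_def intro!: exI[of _ "K + L"])
qed

definition approximable :: "((nat \<Rightarrow> real) \<Rightarrow> real) \<Rightarrow> bool" where
  "approximable f \<longleftrightarrow> f \<in> borel_measurable (cfg N) \<and>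
     (\<forall>e>0. \<exists>g\<in>blip. (\<integral>\<^sup>+x. ennreal ((f x - g x)\<^sup>2) \<partial>\<nu>) \<le> ennreal e)"

lemma approximableD:
  assumes "approximable f" "e > 0"
  obtains g where "g \<in> blip" "(\<integral>\<^sup>+x. ennreal ((f x - g x)\<^sup>2) \<partial>\<nu>) \<le> ennreal e"
  using assms by (auto simp: approximable_def)

lemma blip_measurable: "g \<in> blip \<Longrightarrow> g \<in> borel_measurable (cfg N)"
  by (auto simp: blip_def intro: bmeas_measurable)

lemma approximable_blip:
  assumes "g \<in> blip" shows "approximable g"
  unfolding approximable_def using assms blip_measurable[OF assms] by (auto intro!: bexI[of _ g])

lemma approximable_add:
  assumes f: "approximable f" and g: "approximable g"
  shows "approximable (\<lambda>x. f x + g x)"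
  unfolding approximable_def
proof (intro conjI allI impI)
  have m [measurable]: "f \<in> borel_measurable (cfg N)" "g \<in> borel_measurable (cfg N)" using f g by (auto simp: approximable_def)
  show "(\<lambda>x. f x + g x) \<in> borel_measurable (cfg N)" by measurable
  fix e :: real assume e: "e > 0"
  obtain f' where f': "f' \<in> blip" "(\<integral>\<^sup>+x. ennreal ((f x - f' x)\<^sup>2) \<partial>\<nu>) \<le> ennreal (e / 4)" using approximableD[OF f, of "e / 4"] e by auto
  obtain g' where g': "g' \<in> blip" "(\<integral>\<^sup>+x. ennreal ((g x - g' x)\<^sup>2) \<partial>\<nu>) \<le> ennreal (e / 4)" using approximableD[OF g, of "e / 4"] e by auto
  note [measurable] = blip_measurable[OF f'(1)] blip_measurable[OF g'(1)]
  have "(\<integral>\<^sup>+x. ennreal ((f x + g x - (f' x + g' x))\<^sup>2) \<partial>\<nu>) \<le> (\<integral>\<^sup>+x. 2 * ennreal ((f x - f' x)\<^sup>2) + 2 * ennreal ((g x - g' x)\<^sup>2) \<partial>\<nu>)"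
  proof (rule nn_integral_mono)
    fix x
    show "ennreal ((f x + g x - (f' x + g' x))\<^sup>2) \<le> 2 * ennreal ((f x - f' x)\<^sup>2) + 2 * ennreal ((g x - g' x)\<^sup>2)"
      using ennreal_sq2[of "f x + g x" "f' x + g' x" "f' x + g x"] by simp
  qed
  also have "\<dots> = 2 * (\<integral>\<^sup>+x. ennreal ((f x - f' x)\<^sup>2) \<partial>\<nu>) + 2 * (\<integral>\<^sup>+x. ennreal ((g x - g' x)\<^sup>2) \<partial>\<nu>)"
    by (simp add: nn_integral_add nn_integral_cmult)
  also have "\<dots> \<le> 2 * ennreal (e / 4) + 2 * ennreal (e / 4)" by (intro add_mono mult_left_mono f' g') auto
  also have "\<dots> = ennreal e" by (rule ennreal_quarters[OF e])
  finally show "\<exists>h\<in>blip. (\<integral>\<^sup>+x. ennreal ((f x + g x - h x)\<^sup>2) \<partial>\<nu>) \<le> ennreal e"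
    using f' g' by (intro bexI[of _ "\<lambda>x. f' x + g' x"] blip_add) auto
qed

lemma approximable_cmult:
  assumes f: "approximable f"
  shows "approximable (\<lambda>x. c * f x)"
  unfolding approximable_def
proof (intro conjI allI impI)
  have m [measurable]: "f \<in> borel_measurable (cfg N)" using f by (auto simp: approximable_def)
  show "(\<lambda>x. c * f x) \<in> borel_measurable (cfg N)" by measurable
  fix e :: real assume e: "e > 0"
  have c: "c\<^sup>2 + 1 > 0" by (simp add: add_nonneg_pos)
  obtain f' where f': "f' \<in> blip" "(\<integral>\<^sup>+x. ennreal ((f x - f' x)\<^sup>2) \<partial>\<nu>) \<le> ennreal (e / (c\<^sup>2 + 1))"
    using approximableD[OF f, of "e / (c\<^sup>2 + 1)"] e c by auto
  note [measurable] = blip_measurable[OF f'(1)]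
  have "(\<integral>\<^sup>+x. ennreal ((c * f x - c * f' x)\<^sup>2) \<partial>\<nu>) = (\<integral>\<^sup>+x. ennreal (c\<^sup>2) * ennreal ((f x - f' x)\<^sup>2) \<partial>\<nu>)"
    by (intro nn_integral_cong) (simp add: ennreal_mult[symmetric] power_mult_distrib right_diff_distrib[symmetric])
  also have "\<dots> = ennreal (c\<^sup>2) * (\<integral>\<^sup>+x. ennreal ((f x - f' x)\<^sup>2) \<partial>\<nu>)" by (simp add: nn_integral_cmult)
  also have "\<dots> \<le> ennreal (c\<^sup>2) * ennreal (e / (c\<^sup>2 + 1))" by (intro mult_left_mono f') auto
  also have "\<dots> = ennreal (c\<^sup>2 * (e / (c\<^sup>2 + 1)))" 
    by (rule ennreal_mult[symmetric]) (use e c in auto)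
  also have "\<dots> \<le> ennreal e" using e c by (intro ennreal_leI) (simp add: field_simps)
  finally show "\<exists>h\<in>blip. (\<integral>\<^sup>+x. ennreal ((c * f x - h x)\<^sup>2) \<partial>\<nu>) \<le> ennreal e"
    using f' by (intro bexI[of _ "\<lambda>x. c * f' x"] blip_cmult) auto
qed

lemma approximable_min:
  assumes f: "approximable f" and g: "approximable g"
  shows "approximable (\<lambda>x. min (f x) (g x))"
  unfolding approximable_def
proof (intro conjI allI impI)
  have m [measurable]: "f \<in> borel_measurable (cfg N)" "g \<in> borel_measurable (cfg N)" using f g by (auto simp: approximable_def)
  show "(\<lambda>x. min (f x) (g x)) \<in> borel_measurable (cfg N)" by measurable
  fix e :: real assume e: "e > 0"
  obtain f' where f': "f' \<in> blip" "(\<integral>\<^sup>+x. ennreal ((f x - f' x)\<^sup>2) \<partial>\<nu>) \<le> ennreal (e / 2)" using approximableD[OF f, of "e / 2"] e by auto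
  obtain g' where g': "g' \<in> blip" "(\<integral>\<^sup>+x. ennreal ((g x - g' x)\<^sup>2) \<partial>\<nu>) \<le> ennreal (e / 2)" using approximableD[OF g, of "e / 2"] e by auto
  note [measurable] = blip_measurable[OF f'(1)] blip_measurable[OF g'(1)]
  have "(\<integral>\<^sup>+x. ennreal ((min (f x) (g x) - min (f' x) (g' x))\<^sup>2) \<partial>\<nu>) \<le> (\<integral>\<^sup>+x. ennreal ((f x - f' x)\<^sup>2) + ennreal ((g x - g' x)\<^sup>2) \<partial>\<nu>)"
    using min_diff_sq by (intro nn_integral_mono) (simp add: ennreal_plus[symmetric] ennreal_leI del: ennreal_plus)
  also have "\<dots> = (\<integral>\<^sup>+x. ennreal ((f x - f' x)\<^sup>2) \<partial>\<nu>) + (\<integral>\<^sup>+x. ennreal ((g x - g' x)\<^sup>2) \<partial>\<nu>)"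
    by (simp add: nn_integral_add)
  also have "\<dots> \<le> ennreal (e / 2) + ennreal (e / 2)" by (intro add_mono f' g')
  also have "\<dots> = ennreal e" using e by (simp add: ennreal_plus[symmetric] del: ennreal_plus)
  finally show "\<exists>h\<in>blip. (\<integral>\<^sup>+x. ennreal ((min (f x) (g x) - h x)\<^sup>2) \<partial>\<nu>) \<le> ennreal e"
    using f' g' by (intro bexI[of _ "\<lambda>x. min (f' x) (g' x)"] blip_min) auto
qed

text \<open>Dominated convergence, with \<open>w\<close> bounding the squared errors, brings some
  \<open>F n\<close> close to \<open>f\<close>, and \<open>F n\<close> is itself close to a member
  of \<open>blip\<close>.\<close>

lemma approximable_limit:
  assumes F: "\<And>n. approximable (F n)" and f: "f \<in> borel_measurable (cfg N)"
    and lim: "\<And>x. x \<in> space (cfg N) \<Longrightarrow> (\<lambda>n. F n x) \<longlonglongrightarrow> f x"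
    and w: "integrable \<nu> w" "\<And>n x. x \<in> space (cfg N) \<Longrightarrow> (f x - F n x)\<^sup>2 \<le> w x"
  shows "approximable f"
  unfolding approximable_def
proof (intro conjI allI impI f)
  fix e :: real assume e: "e > 0"
  have [measurable]: "F n \<in> borel_measurable (cfg N)" for n using F by (auto simp: approximable_def)
  note [measurable] = f
  have "(\<lambda>n. \<integral>\<^sup>+x. ennreal ((f x - F n x)\<^sup>2) \<partial>\<nu>) \<longlonglongrightarrow> (\<integral>\<^sup>+x. 0 \<partial>\<nu>)"
  proof (rule nn_integral_dominated_convergence[where w="\<lambda>x. ennreal (w x)"])
    show "(\<lambda>x. ennreal (w x)) \<in> borel_measurable \<nu>" using w(1) by measurable
    show "(\<integral>\<^sup>+x. ennreal (w x) \<partial>\<nu>) < \<infinity>"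
    proof -
      have "(\<integral>\<^sup>+x. ennreal (w x) \<partial>\<nu>) \<le> (\<integral>\<^sup>+x. ennreal (norm (w x)) \<partial>\<nu>)"
        by (intro nn_integral_mono ennreal_leI) simp
      also have "\<dots> < \<infinity>" using w(1) by (simp add: integrable_iff_bounded)
      finally show ?thesis .
    qed
    show "AE x in \<nu>. ennreal ((f x - F n x)\<^sup>2) \<le> ennreal (w x)" for n
      using w(2) by (intro AE_I2 ennreal_leI) auto
    show "AE x in \<nu>. (\<lambda>n. ennreal ((f x - F n x)\<^sup>2)) \<longlonglongrightarrow> 0"
    proof (rule AE_I2)
      fix x assume "x \<in> space \<nu>"
      then have "(\<lambda>n. (f x - F n x)\<^sup>2) \<longlonglongrightarrow> (f x - f x)\<^sup>2" by (intro tendsto_intros lim) simp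
      then have "(\<lambda>n. ennreal ((f x - F n x)\<^sup>2)) \<longlonglongrightarrow> ennreal ((f x - f x)\<^sup>2)" by (rule tendsto_ennrealI)
      then show "(\<lambda>n. ennreal ((f x - F n x)\<^sup>2)) \<longlonglongrightarrow> 0" by simp
    qed
  qed measurable
  then have "eventually (\<lambda>n. (\<integral>\<^sup>+x. ennreal ((f x - F n x)\<^sup>2) \<partial>\<nu>) < ennreal (e / 4)) sequentially"
    using e by (intro order_tendstoD(2)) auto
  then obtain n where n: "(\<integral>\<^sup>+x. ennreal ((f x - F n x)\<^sup>2) \<partial>\<nu>) < ennreal (e / 4)" by (auto simp: eventually_sequentially)
  obtain g where g: "g \<in> blip" "(\<integral>\<^sup>+x. ennreal ((F n x - g x)\<^sup>2) \<partial>\<nu>) \<le> ennreal (e / 4)"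
    using approximableD[OF F[of n], of "e / 4"] e by auto
  note [measurable] = blip_measurable[OF g(1)]
  have "(\<integral>\<^sup>+x. ennreal ((f x - g x)\<^sup>2) \<partial>\<nu>) \<le> (\<integral>\<^sup>+x. 2 * ennreal ((f x - F n x)\<^sup>2) + 2 * ennreal ((F n x - g x)\<^sup>2) \<partial>\<nu>)"
    by (intro nn_integral_mono ennreal_sq2)
  also have "\<dots> = 2 * (\<integral>\<^sup>+x. ennreal ((f x - F n x)\<^sup>2) \<partial>\<nu>) + 2 * (\<integral>\<^sup>+x. ennreal ((F n x - g x)\<^sup>2) \<partial>\<nu>)"
    by (simp add: nn_integral_add nn_integral_cmult)
  also have "\<dots> \<le> 2 * ennreal (e / 4) + 2 * ennreal (e / 4)" using n g by (intro add_mono mult_left_mono) auto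
  also have "\<dots> = ennreal e" by (rule ennreal_quarters[OF e])
  finally show "\<exists>g\<in>blip. (\<integral>\<^sup>+x. ennreal ((f x - g x)\<^sup>2) \<partial>\<nu>) \<le> ennreal e"
    using g(1) by auto
qed

text \<open>The indicator is the limit of ramps that equal 1 up to \<open>a\<close> and then fall to
  0 with slope \<open>n\<close>.\<close>

lemma approximable_halfspace:
  assumes i: "i < N"
  shows "approximable (indicator {x \<in> space (cfg N). x i \<le> a})"
proof (rule approximable_limit[where F="\<lambda>n x. max 0 (min 1 (1 - real n * (x i - a)))" and w="\<lambda>_. 1"])
  show "approximable (\<lambda>x. max 0 (min 1 (1 - real n * (x i - a))))" for n
  proof (intro approximable_blip blip_I[where L="(real n)\<^sup>2"])
    show "(\<lambda>x. max 0 (min 1 (1 - real n * (x i - a)))) \<in> bmeas"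
      using i by (intro bmeas_I[where K=1]) auto
    fix x y :: "nat \<Rightarrow> real"
    have "\<bar>max 0 (min 1 (1 - real n * (x i - a))) - max 0 (min 1 (1 - real n * (y i - a)))\<bar> \<le> \<bar>real n * (x i - y i)\<bar>"
      by (simp add: right_diff_distrib)
    then have "(max 0 (min 1 (1 - real n * (x i - a))) - max 0 (min 1 (1 - real n * (y i - a))))\<^sup>2 \<le> (real n * (x i - y i))\<^sup>2"
      by (simp add: abs_le_square_iff)
    also have "\<dots> = (real n)\<^sup>2 * (x i - y i)\<^sup>2" by (rule power_mult_distrib)
    also have "\<dots> \<le> (real n)\<^sup>2 * (\<Sum>i<N. (x i - y i)\<^sup>2)"
      using i member_le_sum[of i "{..<N}" "\<lambda>i. (x i - y i)\<^sup>2"] by (intro mult_left_mono) auto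
    finally show "(max 0 (min 1 (1 - real n * (x i - a))) - max 0 (min 1 (1 - real n * (y i - a))))\<^sup>2 \<le> (real n)\<^sup>2 * (\<Sum>i<N. (x i - y i)\<^sup>2)" .
  qed simp
  have "{x \<in> space (cfg N). x i \<le> a} \<in> sets (cfg N)" using i by measurable
  then show "indicator {x \<in> space (cfg N). x i \<le> a} \<in> borel_measurable (cfg N)" by simp
  show "integrable \<nu> (\<lambda>_. 1::real)" by simp
  fix x assume x: "x \<in> space (cfg N)"
  show "(indicator {x \<in> space (cfg N). x i \<le> a} x - max 0 (min 1 (1 - real n * (x i - a))))\<^sup>2 \<le> 1" for n
  proof -
    have "\<bar>indicator {x \<in> space (cfg N). x i \<le> a} x - max 0 (min 1 (1 - real n * (x i - a)))\<bar> \<le> (1::real)"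
      by (auto simp: indicator_def)
    then show ?thesis by (simp add: abs_square_le_1)
  qed
  show "(\<lambda>n. max 0 (min 1 (1 - real n * (x i - a)))) \<longlonglongrightarrow> indicator {x \<in> space (cfg N). x i \<le> a} x"
  proof (cases "x i \<le> a")
    case True
    then have "max 0 (min 1 (1 - real n * (x i - a))) = 1" for n
      by (simp add: mult_nonneg_nonpos)
    then show ?thesis using True x by simp
  next
    case False
    then obtain n0 where n0: "real n0 * (x i - a) > 1" using reals_Archimedean3[of "x i - a"] by auto
    have "max 0 (min 1 (1 - real n * (x i - a))) = 0" if "n \<ge> n0" for n
    proof -
      have "real n0 * (x i - a) \<le> real n * (x i - a)" using that False by (intro mult_right_mono) auto
      then show ?thesis using n0 by simp
    qed
    then have "eventually (\<lambda>n. max 0 (min 1 (1 - real n * (x i - a))) = 0) sequentially"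
      by (auto simp: eventually_sequentially)
    then show ?thesis using False by (simp add: tendsto_eventually)
  qed
qed

text \<open>Sets with approximable indicator are closed under complements (1 minus the indicator),
  finite unions (by the minimum of the complements) and countable unions (as limits of finite
  ones).\<close>

lemma approximable_indicator_sigma:
  fixes G :: "(nat \<Rightarrow> real) set set"
  assumes A: "A \<in> sigma_sets (space (cfg N)) G"
    and G: "\<And>B. B \<in> G \<Longrightarrow> B \<in> sets (cfg N) \<and> approximable (indicator B)"
  shows "A \<in> sets (cfg N) \<and> approximable (indicator A)"
  using A
proof induction
  case (Basic a) then show ?case by (rule G)
next
  case Empty
  then show ?case using approximable_blip[OF blip_const[of 0]] by (simp add: indicator_def)
next
  case (Compl a)
  have "approximable (\<lambda>x. 1 + (-1) * indicator a x)"
    using Compl by (intro approximable_add approximable_cmult approximable_blip[OF blip_const]) auto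
  then have "approximable (indicator (space (cfg N) - a))"
  proof (rule approximable_limit[where F="\<lambda>_ x. 1 + (-1) * indicator a x" and w="\<lambda>_. 0"])
    show "indicator (space (cfg N) - a) \<in> borel_measurable (cfg N)"
      using Compl.IH by (intro borel_measurable_indicator sets.compl_sets) auto
  qed (auto simp: indicator_def)
  then show ?case using Compl by auto
next
  case (Union a)
  define U where "U n = (\<Union>i<n. a i)" for n
  have U: "U n \<in> sets (cfg N) \<and> approximable (indicator (U n))" for n
  proof (induction n)
    case 0 then show ?case using approximable_blip[OF blip_const[of 0]] by (simp add: U_def indicator_def)
  next
    case (Suc n)
    have eq: "indicator (U (Suc n)) x = 1 + (-1) * min (1 + (-1) * indicator (U n) x) (1 + (-1) * indicator (a n) x :: real)" for x
      by (auto simp: U_def indicator_def lessThan_Suc)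
    have "approximable (\<lambda>x. 1 + (-1) * min (1 + (-1) * indicator (U n) x) (1 + (-1) * indicator (a n) x))"
      using Suc Union by (intro approximable_add approximable_cmult approximable_min approximable_blip[OF blip_const]) auto
    then have "approximable (indicator (U (Suc n)))" unfolding eq[symmetric] .
    then show ?case using Suc Union by (auto simp: U_def lessThan_Suc)
  qed
  have un: "(\<Union>i. a i) \<in> sets (cfg N)" using Union by auto
  have "approximable (indicator (\<Union>i. a i))"
  proof (rule approximable_limit[where F="\<lambda>n. indicator (U n)" and w="\<lambda>_. 1"])
    fix x
    show "(\<lambda>n. indicator (U n) x) \<longlonglongrightarrow> (indicator (\<Union>i. a i) x :: real)"
    proof (cases "x \<in> (\<Union>i. a i)")
      case True
      then obtain i where "x \<in> a i" by auto
      then have "x \<in> U n" if "n \<ge> Suc i" for n using that by (auto simp: U_def)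
      then have "eventually (\<lambda>n. indicator (U n) x = (1::real)) sequentially"
        unfolding eventually_sequentially by (intro exI[of _ "Suc i"]) auto
      then show ?thesis using True by (simp add: tendsto_eventually)
    next
      case False
      then have "x \<notin> U n" for n by (auto simp: U_def)
      then show ?thesis using False by simp
    qed
    show "(indicator (\<Union>i. a i) x - indicator (U n) x)\<^sup>2 \<le> (1::real)" for n by (auto simp: indicator_def)
  qed (use U un in auto)
  then show ?case using un by simp
qed

lemma approximable_indicator:
  assumes A: "A \<in> sets (cfg N)"
  shows "approximable (indicator A)"
proof -
  have sp: "space (cfg N) = (\<Pi>\<^sub>E i\<in>{..<N}. space borel)" by (simp add: space_cfg PiE_def)
  let ?G = "{{f \<in> \<Pi>\<^sub>E i\<in>{..<N}. space borel. f i \<in> B} |i B. i \<in> {..<N} \<and> B \<in> sets (borel :: real measure)}"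
  have "A \<in> sigma_sets (space (cfg N)) ?G"
    using A unfolding sets_cfg sp by (simp add: sets_PiM_single)
  moreover have "C \<in> sets (cfg N) \<and> approximable (indicator C)" if "C \<in> ?G" for C
  proof -
    obtain i B where C: "C = {f \<in> space (cfg N). f i \<in> B}" and i: "i < N" and B: "B \<in> sets (borel :: real measure)"
      using \<open>C \<in> ?G\<close> unfolding sp[symmetric] by auto
    let ?H = "range (\<lambda>a. {x \<in> space (cfg N). x i \<le> a})"
    have "B \<in> sigma_sets UNIV (range atMost)"
      using B by (simp add: borel_eq_atMost)
    then have "{f \<in> space (cfg N). f i \<in> B} \<in> sigma_sets (space (cfg N)) ?H"
    proof induction
      case (Basic b) then show ?case by (auto intro!: sigma_sets.Basic)
    next
      case Empty then show ?case by (simp add: sigma_sets.Empty)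
    next
      case (Compl b)
      have "{f \<in> space (cfg N). f i \<in> UNIV - b} = space (cfg N) - {f \<in> space (cfg N). f i \<in> b}" by auto
      then show ?case using sigma_sets.Compl[OF Compl.IH] by simp
    next
      case (Union b)
      have "{f \<in> space (cfg N). f i \<in> (\<Union>n. b n)} = (\<Union>n. {f \<in> space (cfg N). f i \<in> b n})" by auto
      then show ?case using sigma_sets.Union[OF Union.IH] by simp
    qed
    then show ?thesis unfolding C
    proof (rule approximable_indicator_sigma)
      fix D assume "D \<in> ?H"
      then obtain a where D: "D = {x \<in> space (cfg N). x i \<le> a}" by auto
      then show "D \<in> sets (cfg N) \<and> approximable (indicator D)"
        using approximable_halfspace[OF i, of a] i by (auto simp: D)
    qed
  qed
  ultimately show ?thesis using approximable_indicator_sigma[of A ?G] by blast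
qed

lemma approximable_L2:
  assumes f: "f \<in> borel_measurable (cfg N)" "integrable \<nu> (\<lambda>x. (f x)\<^sup>2)"
  shows "approximable f"
proof -
  obtain F where F: "\<And>i. simple_function (cfg N) (F i)" "\<And>x. x \<in> space (cfg N) \<Longrightarrow> (\<lambda>i. F i x) \<longlonglongrightarrow> f x"
     "\<And>i x. x \<in> space (cfg N) \<Longrightarrow> dist (F i x) 0 \<le> 2 * dist (f x) 0"
    using borel_measurable_implies_sequence_metric[OF f(1), of 0] by metis
  show ?thesis
  \<comment> \<open>The simple functions are bounded by 2 |f|, so the error is at most 3 |f| and its
    square at most 9 f^2.\<close>
  proof (rule approximable_limit[where F=F and w="\<lambda>x. 9 * (f x)\<^sup>2"])
    fix n
    let ?S = "F n ` space (cfg N)"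
    have fin: "finite ?S" using F(1)[of n] by (simp add: simple_function_def)
    have "approximable (\<lambda>x. \<Sum>y\<in>S. y * indicator (F n -` {y} \<inter> space (cfg N)) x)" if "finite S" "S \<subseteq> ?S" for S
      using that
    proof (induction S)
      case empty then show ?case using approximable_blip[OF blip_const[of 0]] by simp
    next
      case (insert y S)
      have "F n -` {y} \<inter> space (cfg N) \<in> sets (cfg N)" using F(1)[of n] insert by (auto simp: simple_function_def)
      then show ?case unfolding sum.insert[OF insert.hyps] using insert.prems
        by (intro approximable_add approximable_cmult approximable_indicator insert.IH) auto
    qed
    from this[OF fin subset_refl]
    show "approximable (F n)"
    proof (rule approximable_limit[where w="\<lambda>_. 0"])
      show "F n \<in> borel_measurable (cfg N)" using F(1) by (rule borel_measurable_simple_function)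
      have eq: "(\<Sum>y\<in>?S. y * indicator (F n -` {y} \<inter> space (cfg N)) x) = F n x" if x: "x \<in> space (cfg N)" for x
      proof -
        have "(\<Sum>y\<in>?S. y * indicator (F n -` {y} \<inter> space (cfg N)) x) = (\<Sum>y\<in>{F n x}. y)"
          using fin x by (intro sum.mono_neutral_cong_right) (auto simp: indicator_def)
        then show ?thesis by simp
      qed
      show "(\<lambda>_. \<Sum>y\<in>?S. y * indicator (F n -` {y} \<inter> space (cfg N)) x) \<longlonglongrightarrow> F n x" if "x \<in> space (cfg N)" for x
        unfolding eq[OF that] by simp
      show "(F n x - (\<Sum>y\<in>?S. y * indicator (F n -` {y} \<inter> space (cfg N)) x))\<^sup>2 \<le> 0" if "x \<in> space (cfg N)" for x
        unfolding eq[OF that] by simp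
    qed simp
  next
    show "integrable \<nu> (\<lambda>x. 9 * (f x)\<^sup>2)" using f(2) by simp
    fix n x assume x: "x \<in> space (cfg N)"
    have "\<bar>F n x\<bar> \<le> 2 * \<bar>f x\<bar>" using F(3)[OF x, of n] by (simp add: dist_real_def)
    then have "\<bar>f x - F n x\<bar> \<le> \<bar>3 * f x\<bar>" by linarith
    then have "(f x - F n x)\<^sup>2 \<le> (3 * f x)\<^sup>2" by (simp add: abs_le_square_iff)
    then show "(f x - F n x)\<^sup>2 \<le> 9 * (f x)\<^sup>2" by (simp add: power_mult_distrib)
  qed (use f F in auto)
qed

end

section \<open>The weighted gap\<close>

lemma ennreal_divide_le:
  assumes "ennreal a \<le> ennreal K * T" "K > 0"
  shows "ennreal (a / K) \<le> T"
proof -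
  have "ennreal (1 / K) * ennreal a \<le> ennreal (1 / K) * (ennreal K * T)"
    using assms(1) by (rule mult_left_mono) simp
  moreover have "ennreal (1 / K) * (ennreal K * T) = T"
    using assms(2) by (simp add: mult.assoc[symmetric] ennreal_mult'[symmetric])
  moreover have "ennreal (1 / K) * ennreal a = ennreal (a / K)"
    using assms(2) by (simp add: ennreal_mult'[symmetric])
  ultimately show ?thesis by simp
qed

context energy_simplex begin

text \<open>Scaling accounts for \<open>E powr m\<close> and the mean-field form for the factor N,
  so that a single \<open>c\<close> can serve all E and N.\<close>

definition weak_gap :: "real \<Rightarrow> real \<Rightarrow> bool" where
  "weak_gap m c \<longleftrightarrow> (\<forall>f\<in>blip. (\<integral>x. f x \<partial>\<nu>) = 0 \<longrightarrow> ennreal (c * E powr m * real N * ip f f) \<le> mean_field_energy m f)"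

lemma weak_gap_mono:
  assumes "weak_gap m c" "c' \<le> c"
  shows "weak_gap m c'"
  unfolding weak_gap_def
proof (intro ballI impI)
  fix f assume f: "f \<in> blip" "(\<integral>x. f x \<partial>\<nu>) = 0"
  have "ennreal (c' * E powr m * real N * ip f f) \<le> ennreal (c * E powr m * real N * ip f f)"
    using assms(2) by (intro ennreal_leI mult_right_mono) auto
  then show "ennreal (c' * E powr m * real N * ip f f) \<le> mean_field_energy m f"
    using assms(1) f by (auto simp: weak_gap_def intro: order_trans)
qed

lemma weak_gap_convex:
  assumes m: "m \<ge> 0" and \<kappa>: "unif_dom \<gamma> \<kappa>" "\<kappa> > 0" and c: "c \<ge> 0"
    and le: "\<And>x. good x \<Longrightarrow> c * real N \<le> (\<Sum>k<N. (x k / E) powr m)"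
  shows "weak_gap m (c * (1 - q) / (2 + 8 * \<kappa> + 8 * \<kappa>\<^sup>2 * 2 powr m))"
  unfolding weak_gap_def
proof (intro ballI impI)
  let ?K = "2 + 8 * \<kappa> + 8 * \<kappa>\<^sup>2 * 2 powr m"
  have K: "?K > 0" using \<kappa>(2) by (simp add: add_pos_nonneg)
  fix f assume f: "f \<in> blip" "(\<integral>x. f x \<partial>\<nu>) = 0"
  then obtain L where L: "f \<in> bmeas" "L \<ge> 0" "quad_lip {..<N} L 0 f" by (auto simp: blip_def)
  have "ennreal (c * E powr m * (1 - q) * real N * ip f f) \<le> ennreal ?K * mean_field_energy m f"
  proof (rule weighted_gap_convex[OF m \<kappa> _ _ L(1) f(2) L(3,2)])
    show "0 \<le> c * E powr m" using c by simp
    show "AE x in \<nu>. c * E powr m * real N \<le> (\<Sum>k<N. x k powr m)"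
      using AE_good
    proof eventually_elim
      case (elim x)
      have "E powr m * (c * real N) \<le> E powr m * (\<Sum>k<N. (x k / E) powr m)"
        by (intro mult_left_mono le elim) simp
      also have "\<dots> = (\<Sum>k<N. x k powr m)"
        unfolding sum_distrib_left
      proof (intro sum.cong refl)
        fix k assume "k \<in> {..<N}"
        then show "E powr m * (x k / E) powr m = x k powr m"
          using good_le[OF elim, of k] Epos by (simp add: powr_divide)
      qed
      finally show ?case by (simp add: mult_ac)
    qed
  qed
  from ennreal_divide_le[OF this K]
  show "ennreal (c * (1 - q) / ?K * E powr m * real N * ip f f) \<le> mean_field_energy m f" by (simp add: mult_ac)
qed

text \<open>The last two conditions on \<epsilon> make both terms under the square root at most
  \<epsilon>^2 / 2: the power is at most exp (- 4 (1 - q) K), which is estimated by exp y being at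
  least y, and 2 / N is small for large N.\<close>

lemma weak_gap_concave:
  assumes m: "0 < m" "m < 1" and \<kappa>: "unif_dom \<gamma> \<kappa>" "\<kappa> > 0"
    and c: "c > 0" "C \<ge> 0"
    and gain: "\<forall>a>0. \<forall>b>0. c * (a + b) - c / 2 - C * (a * min 1 b + b * min 1 a)
     \<le> (a + b) powr m * (beta_moment \<gamma> (1 - m) * (a + b) powr (1 - m) - a powr (1 - m) - b powr (1 - m))"
    and N4: "N \<ge> 4"
    and \<epsilon>: "\<epsilon> > 0" "2 * C * \<epsilon> \<le> c / 12" "2 / \<epsilon>\<^sup>2 \<le> 4 * (1 - q) * real K" "4 / \<epsilon>\<^sup>2 \<le> real N"
  shows "weak_gap m (c / 12 / (1 / 2 + 8 * C * real K * (2 + 8 * \<kappa> + 8 * \<kappa>\<^sup>2 * 2 powr m)))"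
  unfolding weak_gap_def
proof (intro ballI impI)
  let ?K = "1 / 2 + 8 * C * real K * (2 + 8 * \<kappa> + 8 * \<kappa>\<^sup>2 * 2 powr m)"
  have K: "?K > 0" using \<kappa>(2) c by (simp add: add_pos_nonneg)
  have q: "1/2 \<le> q" "q < 1" using mix_props[OF gam] by auto
  fix f assume f: "f \<in> blip" "(\<integral>x. f x \<partial>\<nu>) = 0"
  then obtain L where L: "f \<in> bmeas" "L \<ge> 0" "quad_lip {..<N} L 0 f" by (auto simp: blip_def)
  have "sqrt ((1 - 2 * (1 - q) / (real N - 1)) ^ (2 * (K * N)) + 2 / real N) \<le> \<epsilon>"
  proof (rule real_le_lsqrt)
    let ?y = "2 * (1 - q) / (real N - 1)"
    have y: "0 \<le> 1 - ?y" using q N4 by (simp add: pos_divide_le_eq)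
    have "(1 - ?y) ^ (2 * (K * N)) \<le> exp (- ?y) ^ (2 * (K * N))"
      using exp_ge_add_one_self[of "- ?y"] y by (intro power_mono) auto
    also have "\<dots> = exp (- (real (2 * (K * N)) * ?y))" by (simp add: exp_of_nat_mult[symmetric])
    also have "\<dots> \<le> \<epsilon>\<^sup>2 / 2"
    proof -
      have "4 * (1 - q) * real K \<le> real (2 * (K * N)) * ?y"
      proof -
        have "4 * (1 - q) * real K * 1 \<le> 4 * (1 - q) * real K * (real N / (real N - 1))"
        proof (rule mult_left_mono)
          show "1 \<le> real N / (real N - 1)" using N4 by (simp add: pos_le_divide_eq)
        qed (use q in simp)
        then show ?thesis by (simp add: mult_ac)
      qed
      then have "2 / \<epsilon>\<^sup>2 \<le> real (2 * (K * N)) * ?y" using \<epsilon>(3) by linarith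
      also have "\<dots> \<le> exp (real (2 * (K * N)) * ?y)"
        using exp_ge_add_one_self[of "real (2 * (K * N)) * ?y"] by linarith
      finally have "inverse (exp (real (2 * (K * N)) * ?y)) \<le> inverse (2 / \<epsilon>\<^sup>2)"
        using \<epsilon>(1) by (intro le_imp_inverse_le) auto
      then show ?thesis using \<epsilon>(1) by (simp add: exp_minus)
    qed
    finally have 1: "(1 - ?y) ^ (2 * (K * N)) \<le> \<epsilon>\<^sup>2 / 2" .
    have "4 \<le> real N * \<epsilon>\<^sup>2" using \<epsilon>(1,4) by (simp add: pos_divide_le_eq)
    then have 2: "2 / real N \<le> \<epsilon>\<^sup>2 / 2" using N4 by (simp add: field_simps)
    show "(1 - ?y) ^ (2 * (K * N)) + 2 / real N \<le> \<epsilon>\<^sup>2" using 1 2 by linarith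
  qed (use \<epsilon> in auto)
  from weighted_gap_concave[OF m \<kappa> c gain L(1) f(2) L(3,2) N4 this \<epsilon>(2)]
  have "ennreal (c / 12 * E powr m * real N * ip f f) \<le> ennreal ?K * mean_field_energy m f" .
  from ennreal_divide_le[OF this K]
  show "ennreal (c / 12 / ?K * E powr m * real N * ip f f) \<le> mean_field_energy m f" by (simp add: mult_ac)
qed

lemma pair_energy_triangle:
  assumes [measurable]: "f \<in> borel_measurable (cfg N)" "g \<in> borel_measurable (cfg N)" and ij: "i < N" "j < N"
  shows "pair_energy m g i j \<le> 2 * pair_energy m f i j + 2 * pair_energy m (\<lambda>x. f x - g x) i j"
proof -
  let ?W = "\<lambda>x::nat\<Rightarrow>real. ennreal ((x i + x j) powr m)"
  let ?e = "\<lambda>h x. (\<integral>\<^sup>+a. ennreal ((h (Tx i j a x) - h x)\<^sup>2) \<partial>\<beta>)"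
  have "?e g x \<le> 2 * ?e f x + 2 * ?e (\<lambda>x. f x - g x) x" if x: "x \<in> space (cfg N)" for x
  proof -
    note [measurable] = Tx_measurable_fixed[OF x ij]
    have "?e g x \<le> (\<integral>\<^sup>+a. 2 * ennreal ((f (Tx i j a x) - f x)\<^sup>2) + 2 * ennreal ((f (Tx i j a x) - g (Tx i j a x) - (f x - g x))\<^sup>2) \<partial>\<beta>)"
    proof (rule nn_integral_mono)
      fix a
      let ?u = "f (Tx i j a x) - f x" and ?v = "f (Tx i j a x) - g (Tx i j a x) - (f x - g x)"
      show "ennreal ((g (Tx i j a x) - g x)\<^sup>2) \<le> 2 * ennreal (?u\<^sup>2) + 2 * ennreal (?v\<^sup>2)"
      proof -
        have "?u - ?v = g (Tx i j a x) - g x" "(0 - ?v)\<^sup>2 = ?v\<^sup>2" "(?u - 0)\<^sup>2 = ?u\<^sup>2"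
          by (simp_all only: power2_minus diff_0 diff_0_right)
        then show ?thesis using ennreal_sq2[of ?u ?v 0] by (simp only:)
      qed
    qed
    also have "\<dots> = 2 * ?e f x + 2 * ?e (\<lambda>x. f x - g x) x" by (simp add: nn_integral_add nn_integral_cmult)
    finally show ?thesis .
  qed
  then have "pair_energy m g i j \<le> (\<integral>\<^sup>+x. 2 * (?W x * ?e f x) + 2 * (?W x * ?e (\<lambda>x. f x - g x) x) \<partial>\<nu>)"
    unfolding pair_energy_def jump_def
  proof (intro nn_integral_mono)
    fix x assume "x \<in> space \<nu>"
    then have "?e g x \<le> 2 * ?e f x + 2 * ?e (\<lambda>x. f x - g x) x" using \<open>\<And>x. x \<in> space (cfg N) \<Longrightarrow> _ x\<close> by simp
    then have "?W x * ?e g x \<le> ?W x * (2 * ?e f x + 2 * ?e (\<lambda>x. f x - g x) x)" by (rule mult_left_mono) simp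
    then show "?W x * ?e g x \<le> 2 * (?W x * ?e f x) + 2 * (?W x * ?e (\<lambda>x. f x - g x) x)"
      by (simp add: distrib_left mult_ac)
  qed
  also have "\<dots> = 2 * pair_energy m f i j + 2 * pair_energy m (\<lambda>x. f x - g x) i j"
    unfolding pair_energy_def jump_def using ij
    by (subst nn_integral_add, measurable, subst (1 2) nn_integral_cmult, measurable)
  finally show ?thesis .
qed

text \<open>On the simplex the rates are at most (N E)^m, so the form is continuous on L2. The
  constant depends on N and E, but it only enters a limit.\<close>

lemma pair_energy_le_L2:
  assumes m: "m \<ge> 0" and [measurable]: "h \<in> borel_measurable (cfg N)" and ij: "i < N" "j < N" "i \<noteq> j"
  shows "pair_energy m h i j \<le> ennreal (4 * (real N * E) powr m) * (\<integral>\<^sup>+x. ennreal ((h x)\<^sup>2) \<partial>\<nu>)"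
proof -
  let ?B = "(real N * E) powr m"
  have "pair_energy m h i j \<le> jump i j h (\<lambda>x. ennreal ?B * 1)"
    unfolding pair_energy_def
  proof (rule jump_mono, use AE_good in eventually_elim)
    case (elim x)
    have "x i + x j = (\<Sum>k\<in>{i, j}. x k)" using ij by simp
    also have "\<dots> \<le> (\<Sum>k<N. x k)" using elim ij by (intro sum_mono2) (auto simp: good_def less_imp_le)
    finally have "x i + x j \<le> real N * E" using elim by (simp add: good_def)
    moreover have "0 < x i + x j" using good_le[OF elim] ij by (auto intro: add_pos_pos)
    ultimately show ?case using m by (auto intro!: ennreal_leI powr_mono2)
  qed
  also have "\<dots> = ennreal ?B * jump i j h (\<lambda>_. 1)" using ij by (intro jump_cmult) auto
  also have "jump i j h (\<lambda>_. 1) \<le> 4 * (\<integral>\<^sup>+x. ennreal ((h x)\<^sup>2) \<partial>\<nu>)"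
  proof -
    have "jump i j h (\<lambda>_. 1) \<le> (\<integral>\<^sup>+x. 2 * (\<integral>\<^sup>+a. ennreal ((h (Tx i j a x))\<^sup>2) \<partial>\<beta>) + 2 * ennreal ((h x)\<^sup>2) \<partial>\<nu>)"
      unfolding jump_def
    proof (rule nn_integral_mono)
      fix x assume "x \<in> space \<nu>"
      then have x: "x \<in> space (cfg N)" by simp
      note [measurable] = Tx_measurable_fixed[OF x ij(1,2)]
      have "(\<integral>\<^sup>+a. ennreal ((h (Tx i j a x) - h x)\<^sup>2) \<partial>\<beta>) \<le> (\<integral>\<^sup>+a. 2 * ennreal ((h (Tx i j a x))\<^sup>2) + 2 * ennreal ((h x)\<^sup>2) \<partial>\<beta>)"
      proof (rule nn_integral_mono)
        fix a show "ennreal ((h (Tx i j a x) - h x)\<^sup>2) \<le> 2 * ennreal ((h (Tx i j a x))\<^sup>2) + 2 * ennreal ((h x)\<^sup>2)"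
          using ennreal_sq2[of "h (Tx i j a x)" "h x" 0] by simp
      qed
      then show "1 * (\<integral>\<^sup>+a. ennreal ((h (Tx i j a x) - h x)\<^sup>2) \<partial>\<beta>) \<le> 2 * (\<integral>\<^sup>+a. ennreal ((h (Tx i j a x))\<^sup>2) \<partial>\<beta>) + 2 * ennreal ((h x)\<^sup>2)"
        by (simp add: nn_integral_add nn_integral_cmult beta.emeasure_space_1[simplified])
    qed
    also have "\<dots> = 2 * (\<integral>\<^sup>+x. (\<integral>\<^sup>+a. ennreal ((h (Tx i j a x))\<^sup>2) \<partial>\<beta>) \<partial>\<nu>) + 2 * (\<integral>\<^sup>+x. ennreal ((h x)\<^sup>2) \<partial>\<nu>)"
      using ij by (subst nn_integral_add, measurable, subst (1 2) nn_integral_cmult, measurable)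
    also have "(\<integral>\<^sup>+x. (\<integral>\<^sup>+a. ennreal ((h (Tx i j a x))\<^sup>2) \<partial>\<beta>) \<partial>\<nu>) = (\<integral>\<^sup>+x. ennreal ((h x)\<^sup>2) \<partial>\<nu>)"
      using ij by (intro resample) auto
    also have "2 * (\<integral>\<^sup>+x. ennreal ((h x)\<^sup>2) \<partial>\<nu>) + 2 * (\<integral>\<^sup>+x. ennreal ((h x)\<^sup>2) \<partial>\<nu>) = 4 * (\<integral>\<^sup>+x. ennreal ((h x)\<^sup>2) \<partial>\<nu>)"
      by (simp flip: distrib_right)
    finally show ?thesis .
  qed
  finally have "pair_energy m h i j \<le> ennreal ?B * (4 * (\<integral>\<^sup>+x. ennreal ((h x)\<^sup>2) \<partial>\<nu>))" by (simp add: mult_left_mono)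
  also have "\<dots> = ennreal (4 * ?B) * (\<integral>\<^sup>+x. ennreal ((h x)\<^sup>2) \<partial>\<nu>)" by (simp add: ennreal_mult' mult_ac)
  finally show ?thesis .
qed

text \<open>Approximate \<open>f\<close> by centred Lipschitz functions and let the error tend to 0.
  One factor 2 is lost in the norm and one in the energy; hence the 4.\<close>

lemma L2_gap:
  assumes m: "m \<ge> 0" and wg: "weak_gap m c" "c > 0"
    and f: "f \<in> borel_measurable (cfg N)" "integrable \<nu> (\<lambda>x. (f x)\<^sup>2)" "(\<integral>x. f x \<partial>\<nu>) = 0"
  shows "ennreal (measure \<beta> {1/4..3/4} * c * E powr m * real N * (\<integral>x. (f x)\<^sup>2 \<partial>\<nu>))
     \<le> ennreal (4 * (192 * 4 powr m * real (N ^ 3))) * chain_energy m f"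
proof -
  define p where "p = measure \<beta> {1/4..3/4}"
  have p: "p \<ge> 0" by (simp add: p_def)
  define A where "A = p * c * E powr m * real N"
  define B where "B = 192 * 4 powr m * real (N ^ 3)"
  have A: "A \<ge> 0" using p wg(2) by (simp add: A_def)
  have B: "B > 0" using N2 by (simp add: B_def)
  note [measurable] = f(1)
  have fint: "integrable \<nu> f" by (rule fin.square_integrable_imp_integrable[OF _ f(2)]) simp
  show ?thesis
  proof (cases "chain_energy m f")
    case top
    then show ?thesis using B by (simp add: ennreal_mult_top B_def)
  next
    case (real s)
    define D where "D = 2 * (real N * (4 * (real N * E) powr m * 4))"
    define P where "P = measure \<nu> (space \<nu>)"
    have "A * (\<integral>x. (f x)\<^sup>2 \<partial>\<nu>) \<le> 4 * B * s"
    proof (cases "P = 0")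
      case True
      then have "emeasure \<nu> (space \<nu>) = 0" by (simp add: P_def fin.emeasure_eq_measure)
      then have "AE x in \<nu>. False" by (intro AE_I[where N="space \<nu>"]) auto
      then have "AE x in \<nu>. (f x)\<^sup>2 = 0" by eventually_elim simp
      then have "(\<integral>x. (f x)\<^sup>2 \<partial>\<nu>) = 0" by (rule integral_eq_zero_AE)
      then show ?thesis using B real by simp
    next
      case False
      then have P: "P > 0" by (simp add: P_def less_le)
      have main: "A * (\<integral>x. (f x)\<^sup>2 \<partial>\<nu>) \<le> 4 * B * s + (8 * A + 2 * B * D) * e" if e: "e > 0" for e
      proof -
        obtain g where g: "g \<in> blip" "(\<integral>\<^sup>+x. ennreal ((f x - g x)\<^sup>2) \<partial>\<nu>) \<le> ennreal e"
          using approximableD[OF approximable_L2[OF f(1,2)] e] by metis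
        have gB: "g \<in> bmeas" using g(1) by (simp add: blip_def)
        note [measurable] = bmeas_measurable[OF gB]
        define h where "h x = f x - g x" for x
        have [measurable]: "h \<in> borel_measurable (cfg N)" unfolding h_def[abs_def] by measurable
        have h2: "integrable \<nu> (\<lambda>x. (h x)\<^sup>2)"
        proof (rule integrableI_bounded)
          have "(\<integral>\<^sup>+x. ennreal (norm ((h x)\<^sup>2)) \<partial>\<nu>) \<le> ennreal e" using g(2) by (simp add: h_def)
          then show "(\<integral>\<^sup>+x. ennreal (norm ((h x)\<^sup>2)) \<partial>\<nu>) < \<infinity>" by (simp add: le_less_trans)
        qed measurable
        have hint: "integrable \<nu> h" by (rule fin.square_integrable_imp_integrable[OF _ h2]) simp
        have h2e: "(\<integral>x. (h x)\<^sup>2 \<partial>\<nu>) \<le> e"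
        proof -
          have "ennreal (\<integral>x. (h x)\<^sup>2 \<partial>\<nu>) \<le> ennreal e"
            using g(2) by (subst nn_integral_eq_integral[symmetric, OF h2]) (auto simp: h_def)
          then show ?thesis using e by simp
        qed
        \<comment> \<open>Centring \<open>g\<close> does not enlarge the error: as \<open>f\<close>
          has mean zero, h + \<mu> is \<open>h\<close> minus its own mean.\<close>
        define \<mu> where "\<mu> = (\<integral>x. g x \<partial>\<nu>) / P"
        have "(\<integral>x. h x \<partial>\<nu>) = - (\<mu> * P)"
          using fint gB f(3) P by (simp add: h_def[abs_def] \<mu>_def)
        moreover have "0 \<le> (\<integral>x. (h x + \<mu>)\<^sup>2 \<partial>\<nu>)" by (intro integral_nonneg_AE) auto
        moreover have "(\<integral>x. (h x + \<mu>)\<^sup>2 \<partial>\<nu>) = (\<integral>x. (h x)\<^sup>2 \<partial>\<nu>) + 2 * \<mu> * (\<integral>x. h x \<partial>\<nu>) + \<mu>\<^sup>2 * P"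
        proof -
          have "(\<integral>x. (h x + \<mu>)\<^sup>2 \<partial>\<nu>) = (\<integral>x. (h x)\<^sup>2 + 2 * \<mu> * h x + \<mu>\<^sup>2 \<partial>\<nu>)"
            by (intro Bochner_Integration.integral_cong) (auto simp: power2_eq_square algebra_simps)
          then show ?thesis using hint h2 by (simp add: P_def)
        qed
        ultimately have e2: "(\<integral>x. (h x + \<mu>)\<^sup>2 \<partial>\<nu>) \<le> e"
          using h2e by (simp add: power2_eq_square mult_ac) (smt (verit) P mult_nonneg_nonneg zero_le_square mult.assoc)
        define g' where "g' x = g x + (- \<mu>)" for x
        have g': "g' \<in> blip" unfolding g'_def[abs_def] by (intro blip_add g(1) blip_const)
        have g'B: "g' \<in> bmeas" using g' by (simp add: blip_def)
        note [measurable] = bmeas_measurable[OF g'B]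
        have g'0: "(\<integral>x. g' x \<partial>\<nu>) = 0"
          using gB P by (simp add: g'_def[abs_def] \<mu>_def P_def)
        have fg': "f x - g' x = h x + \<mu>" for x by (simp add: g'_def h_def)
        have i2: "integrable \<nu> (\<lambda>x. (f x - g' x)\<^sup>2)"
        proof -
          have "integrable \<nu> (\<lambda>x. (h x)\<^sup>2 + 2 * \<mu> * h x + \<mu>\<^sup>2)" using hint h2 by simp
          then show ?thesis unfolding fg' by (simp add: power2_eq_square algebra_simps)
        qed
        have nn: "(\<integral>\<^sup>+x. ennreal ((f x - g' x)\<^sup>2) \<partial>\<nu>) \<le> ennreal e"
          using e2 by (subst nn_integral_eq_integral[OF i2]) (auto simp: fg' ennreal_leI)
        have SSg: "chain_energy m g' \<le> ennreal (2 * s + D * e)"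
        proof -
          have "chain_energy m g' \<le> (\<Sum>k<N-1. 2 * pair_energy m f k (Suc k) + 2 * (ennreal (4 * (real N * E) powr m) * ennreal e))"
            unfolding chain_energy_def
          proof (rule sum_mono)
            fix k assume "k \<in> {..<N-1}"
            then have k: "k < N" "Suc k < N" "k \<noteq> Suc k" by auto
            have "pair_energy m (\<lambda>x. f x - g' x) k (Suc k) \<le> ennreal (4 * (real N * E) powr m) * ennreal e"
              using k by (intro order_trans[OF pair_energy_le_L2[OF m]] mult_left_mono nn) auto
            then show "pair_energy m g' k (Suc k) \<le> 2 * pair_energy m f k (Suc k) + 2 * (ennreal (4 * (real N * E) powr m) * ennreal e)"
              using k by (intro order_trans[OF pair_energy_triangle[of f g' k "Suc k" m]] add_left_mono mult_left_mono) auto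
          qed
          also have "\<dots> = 2 * chain_energy m f + of_nat (N - 1) * (2 * (ennreal (4 * (real N * E) powr m) * ennreal e))"
            by (simp add: sum.distrib chain_energy_def sum_distrib_left)
          also have "\<dots> = ennreal (2 * s + real (N - 1) * (2 * (4 * (real N * E) powr m * e)))"
          proof -
            define w where "w = 4 * (real N * E) powr m"
            have w: "w \<ge> 0" by (simp add: w_def)
            have 1: "2 * (ennreal w * ennreal e) = ennreal (2 * (w * e))"
              using w e by (simp only: ennreal_mult'[of 2] ennreal_mult[of w e]) simp
            have 2: "of_nat (N - 1) * ennreal (2 * (w * e)) = ennreal (real (N - 1) * (2 * (w * e)))"
              unfolding ennreal_of_nat_eq_real_of_nat by (rule ennreal_mult[symmetric]) (use w e in auto)
            have 3: "2 * ennreal s = ennreal (2 * s)" using ennreal_mult'[of 2 s] by simp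
            show ?thesis unfolding real(2) w_def[symmetric] 1 2 3
              using real(1) w e by (intro ennreal_plus[symmetric]) auto
          qed
          also have "\<dots> \<le> ennreal (2 * s + D * e)"
          proof (rule ennreal_leI)
            have "real (N - 1) * (2 * (4 * (real N * E) powr m * e)) \<le> real N * (2 * (4 * (real N * E) powr m * (4 * e)))"
              using e by (intro mult_mono mult_left_mono) auto
            then show "2 * s + real (N - 1) * (2 * (4 * (real N * E) powr m * e)) \<le> 2 * s + D * e"
              by (simp add: D_def mult_ac)
          qed
          finally show ?thesis .
        qed
        have De: "0 \<le> 2 * s + D * e" using real(1) e by (simp add: D_def)
        have "ennreal (A * ip g' g') = emeasure \<beta> {1/4..3/4} * ennreal (c * E powr m * real N * ip g' g')"
          using p wg(2) by (simp add: A_def p_def beta.emeasure_eq_measure ennreal_mult'[symmetric] mult_ac)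
        also have "\<dots> \<le> emeasure \<beta> {1/4..3/4} * mean_field_energy m g'"
          using wg(1) g' g'0 by (intro mult_left_mono) (auto simp: weak_gap_def)
        also have "\<dots> \<le> ennreal (192 * 4 powr m) * of_nat (N ^ 3) * chain_energy m g'"
          by (intro mean_field_energy_path m) simp
        also have "\<dots> = ennreal B * chain_energy m g'"
        proof -
          have "ennreal (192 * 4 powr m) * of_nat (N ^ 3) = ennreal B"
            unfolding B_def ennreal_of_nat_eq_real_of_nat by (rule ennreal_mult[symmetric]) auto
          then show ?thesis by simp
        qed
        also have "\<dots> \<le> ennreal B * ennreal (2 * s + D * e)" by (intro mult_left_mono SSg) simp
        also have "\<dots> = ennreal (B * (2 * s + D * e))" using B De by (intro ennreal_mult[symmetric]) auto
        finally have Ag: "A * ip g' g' \<le> B * (2 * s + D * e)"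
          using B De by (subst (asm) ennreal_le_iff) auto
        have "(\<integral>x. (f x)\<^sup>2 \<partial>\<nu>) \<le> (\<integral>x. 2 * (f x - g' x)\<^sup>2 + 2 * (g' x * g' x) \<partial>\<nu>)"
        proof (rule integral_mono[OF f(2)])
          show "integrable \<nu> (\<lambda>x. 2 * (f x - g' x)\<^sup>2 + 2 * (g' x * g' x))" using i2 g'B by auto
          fix x
          have "0 \<le> (f x - g' x - g' x)\<^sup>2" by simp
          then show "(f x)\<^sup>2 \<le> 2 * (f x - g' x)\<^sup>2 + 2 * (g' x * g' x)" by (simp add: power2_eq_square algebra_simps)
        qed
        also have "\<dots> = 2 * (\<integral>x. (h x + \<mu>)\<^sup>2 \<partial>\<nu>) + 2 * ip g' g'"
          using i2 g'B by (simp add: ip_def fg')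
        also have "\<dots> \<le> 2 * e + 2 * ip g' g'" using e2 by simp
        finally have "A * (\<integral>x. (f x)\<^sup>2 \<partial>\<nu>) \<le> A * (2 * e + 2 * ip g' g')" using A by (intro mult_left_mono) auto
        also have "\<dots> = 2 * A * e + 2 * (A * ip g' g')" by (simp add: algebra_simps)
        also have "\<dots> \<le> 2 * A * e + 2 * (B * (2 * s + D * e))" using Ag by simp
        also have "\<dots> = 4 * B * s + (2 * A + 2 * B * D) * e" by (simp add: algebra_simps)
        also have "\<dots> \<le> 4 * B * s + (8 * A + 2 * B * D) * e"
          using A e by (intro add_left_mono mult_right_mono) auto
        finally show ?thesis .
      qed
      have cc: "8 * A + 2 * B * D + 1 > 0" using A B by (simp add: D_def add_nonneg_pos)
      show ?thesis
      proof (rule field_le_epsilon)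
        fix e :: real assume e: "0 < e"
        define d where "d = e / (8 * A + 2 * B * D + 1)"
        have d: "d > 0" using e cc by (simp add: d_def)
        have "(8 * A + 2 * B * D) * d \<le> (8 * A + 2 * B * D + 1) * d" using d by (intro mult_right_mono) auto
        also have "\<dots> = e" using cc by (simp add: d_def)
        finally show "A * (\<integral>x. (f x)\<^sup>2 \<partial>\<nu>) \<le> 4 * B * s + e" using main[OF d] by linarith
      qed
    qed
    then have "ennreal (A * (\<integral>x. (f x)\<^sup>2 \<partial>\<nu>)) \<le> ennreal (4 * B * s)" by (rule ennreal_leI)
    also have "\<dots> = ennreal (4 * B) * chain_energy m f" unfolding real(2) using B real(1) by (intro ennreal_mult) auto
    finally show ?thesis by (simp add: A_def B_def p_def)
  qed
qed

end

text \<open>Doubled fractions from \<open>unif\<close> lie in [1/4, 1/2], so \<open>unif_dom\<close>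
  with l = 2 bounds the mass of the middle range below by 1 / \<kappa>.\<close>

lemma beta_middle_pos:
  assumes g: "g > 0"
  shows "measure (sym_beta g) {1/4..3/4} > 0"
proof -
  interpret b: prob_space "sym_beta g" by (rule prob_space_sym_beta[OF g])
  interpret u: prob_space unif by (rule prob_space_unif)
  obtain \<kappa> where \<kappa>: "\<kappa> > 0" "unif_dom g \<kappa>" using unif_dom_exists[OF g] by auto
  have "1 = (\<integral>\<^sup>+a. 1 \<partial>unif)" using u.emeasure_space_1 by simp
  also have "\<dots> = (\<integral>\<^sup>+a. indicator {1/4..3/4} (a * 2) \<partial>unif)"
    by (rule nn_integral_cong_AE, use AE_unif in eventually_elim) auto
  also have "\<dots> \<le> ennreal \<kappa> * (\<integral>\<^sup>+a. indicator {1/4..3/4} a \<partial>sym_beta g)"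
    by (rule unif_domD[OF \<kappa>(2)]) auto
  also have "\<dots> = ennreal (\<kappa> * measure (sym_beta g) {1/4..3/4})"
    using \<kappa>(1) by (simp add: b.emeasure_eq_measure ennreal_mult)
  finally have "\<kappa> * measure (sym_beta g) {1/4..3/4} \<ge> 1" by simp
  then have "measure (sym_beta g) {1/4..3/4} \<noteq> 0" by auto
  then show ?thesis by (simp add: less_le)
qed

section \<open>Constants uniform in E and N\<close>

lemma uniform_weak_gap:
  assumes g: "\<gamma> > 0" and m: "m \<ge> 0"
  shows "\<exists>c>0. \<forall>E>0. \<forall>N\<ge>2. energy_simplex.weak_gap \<gamma> E N m c"
proof -
  obtain \<kappa> where \<kappa>: "\<kappa> > 0" "unif_dom \<gamma> \<kappa>" using unif_dom_exists[OF g] by auto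
  let ?K = "2 + 8 * \<kappa> + 8 * \<kappa>\<^sup>2 * 2 powr m"
  have K: "?K > 0" using \<kappa>(1) by (simp add: add_pos_nonneg)
  have q: "mix \<gamma> < 1" using mix_props[OF g] by auto
  show ?thesis
  proof (cases "0 < m \<and> m < 1")
    case False
    show ?thesis
    \<comment> \<open>For m at least 1, u is at most 1/2 + 2^(m-1) u^m. As the u_k sum to N, the sum
      of the u_k^m is at least 2^(-m) N. For m = 0 that sum is N itself.\<close>
    proof (intro exI[of _ "2 powr (- m) * (1 - mix \<gamma>) / ?K"] conjI allI impI)
      show "0 < 2 powr (- m) * (1 - mix \<gamma>) / ?K" using K q by simp
      fix E :: real and N :: nat assume EN: "E > 0" "N \<ge> 2"
      interpret energy_simplex \<gamma> E N using g EN by unfold_locales auto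
      show "weak_gap m (2 powr (- m) * (1 - mix \<gamma>) / ?K)"
      proof (rule weak_gap_convex[OF m \<kappa>(2,1)])
        fix x assume x: "good x"
        define u where "u k = x k / E" for k
        have u: "0 < u k" if "k < N" for k using good_le[OF x that] EN by (simp add: u_def)
        have su: "(\<Sum>k<N. u k) = real N" using x EN by (simp add: u_def sum_divide_distrib[symmetric] good_def)
        have "2 powr (- m) * real N \<le> (\<Sum>k<N. u k powr m)"
        proof (cases "m = 0")
          case True
          then show ?thesis using u by (simp add: less_imp_neq[symmetric])
        next
          case m0: False
          then have m1: "m \<ge> 1" using False m by auto
          have "u k \<le> 1/2 + 2 powr (m - 1) * u k powr m" if k: "k < N" for k
          proof (cases "u k \<le> 1/2")
            case True then show ?thesis by (simp add: add_increasing2)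
          next
            case False
            then have uk: "1/2 < u k" by simp
            have "(1/2) powr (m - 1) \<le> u k powr (m - 1)" using uk m1 by (intro powr_mono2) auto
            then have "2 powr (m - 1) * (1/2) powr (m - 1) \<le> 2 powr (m - 1) * u k powr (m - 1)" by (intro mult_left_mono) auto
            moreover have "2 powr (m - 1) * (1/2) powr (m - 1) = 1" by (simp add: powr_mult[symmetric])
            ultimately have "1 * u k \<le> 2 powr (m - 1) * u k powr (m - 1) * u k" using u[OF k] by (intro mult_right_mono) auto
            also have "\<dots> = 2 powr (m - 1) * u k powr m"
              using u[OF k] powr_add[of "u k" "m - 1" 1] by simp
            finally show ?thesis by simp
          qed
          then have "(\<Sum>k<N. u k) \<le> (\<Sum>k<N. 1/2 + 2 powr (m - 1) * u k powr m)" by (intro sum_mono) auto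
          then have "real N \<le> real N / 2 + 2 powr (m - 1) * (\<Sum>k<N. u k powr m)"
            by (simp add: su sum.distrib sum_distrib_left)
          then have "real N \<le> 2 powr m * (\<Sum>k<N. u k powr m)" by (simp add: powr_diff)
          then have "2 powr (- m) * real N \<le> 2 powr (- m) * (2 powr m * (\<Sum>k<N. u k powr m))" by (intro mult_left_mono) auto
          also have "\<dots> = (\<Sum>k<N. u k powr m)" by (simp add: mult.assoc[symmetric] powr_add[symmetric])
          finally show ?thesis .
        qed
        then show "2 powr (- m) * real N \<le> (\<Sum>k<N. (x k / E) powr m)" by (simp add: u_def)
      qed simp
    qed
  next
    case True
    then have m01: "0 < m" "m < 1" by auto
    have p01: "0 < 1 - m" "1 - m < 1" using m01 by auto
    obtain c C where c: "c > 0" "C \<ge> 0" and gain: "\<forall>a>0. \<forall>b>0. c * (a + b) - c / 2 - C * (a * min 1 b + b * min 1 a)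
     \<le> (a + b) powr m * (beta_moment \<gamma> (1 - m) * (a + b) powr (1 - m) - a powr (1 - m) - b powr (1 - m))"
      using spread_gain[OF m01 beta_moment_props(2)[OF g p01]] by blast
    \<comment> \<open>Solves 2 (C + 1) \<epsilon> = c / 12; the 1 is added because \<open>C\<close>
      may vanish.\<close>
    define \<epsilon> where "\<epsilon> = c / (24 * (C + 1))"
    have \<epsilon>: "\<epsilon> > 0" using c by (simp add: \<epsilon>_def)
    have C\<epsilon>: "2 * C * \<epsilon> \<le> c / 12"
    proof -
      have "2 * C * \<epsilon> \<le> 2 * (C + 1) * \<epsilon>" using \<epsilon> by simp
      also have "\<dots> = c / 12" using c by (simp add: \<epsilon>_def field_simps)
      finally show ?thesis .
    qed
    obtain Kn :: nat where Kn: "2 / \<epsilon>\<^sup>2 < real Kn * (4 * (1 - mix \<gamma>))"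
      using reals_Archimedean3[of "4 * (1 - mix \<gamma>)"] q by auto
    obtain N0 :: nat where N0: "4 / \<epsilon>\<^sup>2 < real N0" using reals_Archimedean2 by blast
    \<comment> \<open>From \<open>N1\<close> on the argument with left-out sites applies. Below it,
      some site has at least the mean energy, so the sum of the weights is at least 1 and hence at
      least N / N1.\<close>
    define N1 where "N1 = max 4 N0"
    have N1: "real N1 > 0" by (simp add: N1_def)
    let ?c1 = "1 / real N1 * (1 - mix \<gamma>) / ?K" and ?c2 = "c / 12 / (1 / 2 + 8 * C * real Kn * ?K)"
    have c12: "?c1 > 0" "?c2 > 0"
      using K q N1 c by (auto intro!: divide_pos_pos add_pos_nonneg mult_nonneg_nonneg)
    show ?thesis
    proof (intro exI[of _ "min ?c1 ?c2"] conjI allI impI)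
      show "0 < min ?c1 ?c2" using c12 by simp
      fix E :: real and N :: nat assume EN: "E > 0" "N \<ge> 2"
      interpret energy_simplex \<gamma> E N using g EN by unfold_locales auto
      show "weak_gap m (min ?c1 ?c2)"
      proof (cases "N \<ge> N1")
        case True
        then have N4: "N \<ge> 4" "real N0 \<le> real N" by (auto simp: N1_def)
        have "weak_gap m ?c2"
        proof (rule weak_gap_concave[OF m01 \<kappa>(2,1) c gain N4(1) \<epsilon> C\<epsilon>])
          show "2 / \<epsilon>\<^sup>2 \<le> 4 * (1 - mix \<gamma>) * real Kn" using Kn by (simp add: mult_ac)
          show "4 / \<epsilon>\<^sup>2 \<le> real N" using N0 N4(2) by linarith
        qed
        then show ?thesis by (rule weak_gap_mono) simp
      next
        case False
        have "weak_gap m ?c1"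
        proof (rule weak_gap_convex[OF m \<kappa>(2,1)])
          fix x assume x: "good x"
          define u where "u k = x k / E" for k
          have u: "0 < u k" if "k < N" for k using good_le[OF x that] EN by (simp add: u_def)
          have su: "(\<Sum>k<N. u k) = real N" using x EN by (simp add: u_def sum_divide_distrib[symmetric] good_def)
          have "\<exists>k<N. 1 \<le> u k"
          proof (rule ccontr)
            assume "\<not> (\<exists>k<N. 1 \<le> u k)"
            then have "(\<Sum>k<N. u k) < (\<Sum>k<N. 1)" using EN by (intro sum_strict_mono) (auto simp: not_le lessThan_empty_iff)
            then show False using su by simp
          qed
          then obtain k where k: "k < N" "1 \<le> u k" by auto
          have "1 / real N1 * real N \<le> 1" using False N1 by simp
          also have "1 \<le> u k powr m" using k m by (intro ge_one_powr_ge_zero) auto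
          also have "\<dots> \<le> (\<Sum>k<N. u k powr m)"
            using k by (intro member_le_sum[of k "{..<N}" "\<lambda>k. u k powr m"]) auto
          finally show "1 / real N1 * real N \<le> (\<Sum>k<N. (x k / E) powr m)" by (simp add: u_def)
        qed simp
        then show ?thesis by (rule weak_gap_mono) simp
      qed
    qed
  qed
qed

section \<open>Energy exchange models\<close>

abbreviation quadrant :: "(real \<times> real) set" where
  "quadrant \<equiv> {0<..} \<times> {0<..}"

text \<open>The model constrains \<open>P\<close> only on the positive quadrant. A Dirac law
  elsewhere makes the kernel measurable on the whole plane without changing it on good
  configurations; \<open>rate\<close> is extended by 0 for the same reason.\<close>

definition kern :: "(real \<Rightarrow> real \<Rightarrow> real measure) \<Rightarrow> real \<times> real \<Rightarrow> real measure" where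
  "kern P z = (if z \<in> quadrant then P (fst z) (snd z) else return borel 0)"

lemma quadrant_borel: "quadrant \<in> sets borel"
  by (intro borel_open open_Times) auto

lemma kern_prob:
  assumes "energy_exchange_model \<Lambda> P"
  shows "prob_space (kern P z)" "sets (kern P z) = sets borel"
proof -
  have P: "prob_space (P a b)" "sets (P a b) = sets borel" if "a > 0" "b > 0" for a b
    using assms that unfolding energy_exchange_model_def by blast+
  show "prob_space (kern P z)"
    using P[of "fst z" "snd z"] by (auto simp: kern_def mem_Times_iff intro: prob_space_return)
  show "sets (kern P z) = sets borel"
    using P[of "fst z" "snd z"] by (auto simp: kern_def mem_Times_iff)
qed

lemma borel_measurable_on_quadrant:
  fixes \<phi> :: "real \<times> real \<Rightarrow> real"
  assumes "continuous_on quadrant \<phi>"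
  shows "(\<lambda>z. if z \<in> quadrant then \<phi> z else c) \<in> borel_measurable borel"
proof -
  have "(\<lambda>z. indicator quadrant z *\<^sub>R \<phi> z) \<in> borel_measurable borel"
    by (rule borel_measurable_continuous_on_indicator[OF quadrant_borel assms])
  moreover have "(\<lambda>z. c * indicator (- quadrant) z) \<in> borel_measurable borel"
    using quadrant_borel by (intro borel_measurable_times borel_measurable_indicator) auto
  ultimately have "(\<lambda>z. indicator quadrant z *\<^sub>R \<phi> z + c * indicator (- quadrant) z) \<in> borel_measurable borel"
    by (rule borel_measurable_add)
  moreover have "(\<lambda>z. indicator quadrant z *\<^sub>R \<phi> z + c * indicator (- quadrant) z) = (\<lambda>z. if z \<in> quadrant then \<phi> z else c)"
    by (auto simp: indicator_def fun_eq_iff)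
  ultimately show ?thesis by simp
qed

text \<open>A weakly continuous kernel is measurable: half-line probabilities are limits of integrals of
  continuous functions.\<close>

lemma kern_measurable:
  assumes model: "energy_exchange_model \<Lambda> P"
  shows "kern P \<in> borel \<rightarrow>\<^sub>M subprob_algebra borel"
proof (rule measurable_subprob_algebra_generated[where \<Omega>=UNIV and G="range atMost"])
  show "sets (borel :: real measure) = sigma_sets UNIV (range atMost)" by (simp add: borel_eq_atMost)
  show "Int_stable (range (atMost :: real \<Rightarrow> _))" by (auto simp: Int_stable_def)
  show "subprob_space (kern P z)" for z using kern_prob(1)[OF model] by (rule prob_space_imp_subprob_space)
  show "sets (kern P z) = sets borel" for z by (rule kern_prob(2)[OF model])
  show "(\<lambda>z. emeasure (kern P z) UNIV) \<in> borel_measurable borel"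
  proof -
    have "emeasure (kern P z) UNIV = 1" for z
      using prob_space.emeasure_space_1[OF kern_prob(1)[OF model, of z]] sets_eq_imp_space_eq[OF kern_prob(2)[OF model, of z]] by simp
    then show ?thesis by simp
  qed
  fix A assume "A \<in> range (atMost :: real \<Rightarrow> _)"
  then obtain t where A: "A = {..t}" by auto
  \<comment> \<open>Continuous ramps that decrease to the indicator of \<open>{..t}\<close> as n
    grows.\<close>
  define G where "G n \<alpha> = max 0 (min 1 (1 - real n * (\<alpha> - t)))" for n \<alpha>
  have Gm [measurable]: "G n \<in> borel_measurable borel" for n unfolding G_def by measurable
  have lim: "(\<lambda>n. \<integral>\<alpha>. G n \<alpha> \<partial>(kern P z)) \<longlonglongrightarrow> measure (kern P z) {..t}" for z
  proof -
    interpret K: prob_space "kern P z" by (rule kern_prob(1)[OF model])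
    have s: "sets (kern P z) = sets borel" by (rule kern_prob(2)[OF model])
    have KM: "h \<in> borel_measurable (kern P z)" if "h \<in> borel_measurable borel" for h :: "real \<Rightarrow> real"
      using that by (simp add: measurable_cong_sets[OF s refl])
    have "(\<lambda>n. \<integral>\<alpha>. G n \<alpha> \<partial>(kern P z)) \<longlonglongrightarrow> (\<integral>\<alpha>. indicator {..t} \<alpha> \<partial>(kern P z))"
    proof (rule integral_dominated_convergence[where w="\<lambda>_. 1"])
      show "AE \<alpha> in kern P z. (\<lambda>n. G n \<alpha>) \<longlonglongrightarrow> indicator {..t} \<alpha>"
      proof (rule AE_I2)
        fix \<alpha>
        show "(\<lambda>n. G n \<alpha>) \<longlonglongrightarrow> indicator {..t} \<alpha>"
        proof (cases "\<alpha> \<le> t")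
          case True
          then have "G n \<alpha> = 1" for n by (simp add: G_def mult_nonneg_nonpos)
          then show ?thesis using True by simp
        next
          case False
          then obtain n0 where n0: "real n0 * (\<alpha> - t) > 1" using reals_Archimedean3[of "\<alpha> - t"] by auto
          have "G n \<alpha> = 0" if "n \<ge> n0" for n
          proof -
            have "real n0 * (\<alpha> - t) \<le> real n * (\<alpha> - t)" using that False by (intro mult_right_mono) auto
            then show ?thesis using n0 by (simp add: G_def)
          qed
          then have "eventually (\<lambda>n. G n \<alpha> = 0) sequentially" by (auto simp: eventually_sequentially)
          then show ?thesis using False by (simp add: tendsto_eventually)
        qed
      qed
      show "AE \<alpha> in kern P z. norm (G n \<alpha>) \<le> 1" for n by (auto simp: G_def)
    qed (auto intro: KM)
    then show ?thesis using sets_eq_imp_space_eq[OF s] by simp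
  qed
  have "(\<lambda>z. \<integral>\<alpha>. G n \<alpha> \<partial>(kern P z)) \<in> borel_measurable borel" for n
  proof -
    have "continuous_on UNIV (G n)" unfolding G_def by (intro continuous_intros)
    moreover have "bounded (range (G n))" by (rule boundedI[where B=1]) (auto simp: G_def)
    ultimately have "continuous_on quadrant (\<lambda>(a, b). \<integral>\<alpha>. G n \<alpha> \<partial>(P a b))"
      using model unfolding energy_exchange_model_def by blast
    from borel_measurable_on_quadrant[OF this, of "G n 0"]
    have "(\<lambda>z. if z \<in> quadrant then (case z of (a, b) \<Rightarrow> \<integral>\<alpha>. G n \<alpha> \<partial>(P a b)) else G n 0) \<in> borel_measurable borel" .
    moreover have "(\<lambda>z. if z \<in> quadrant then (case z of (a, b) \<Rightarrow> \<integral>\<alpha>. G n \<alpha> \<partial>(P a b)) else G n 0) = (\<lambda>z. \<integral>\<alpha>. G n \<alpha> \<partial>(kern P z))"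
      by (auto simp: kern_def fun_eq_iff integral_return)
    ultimately show ?thesis by simp
  qed
  then have "(\<lambda>z. measure (kern P z) {..t}) \<in> borel_measurable borel"
    using lim by (rule borel_measurable_LIMSEQ_real[rotated])
  then have "(\<lambda>z. ennreal (measure (kern P z) {..t})) \<in> borel_measurable borel" by measurable
  moreover have "emeasure (kern P z) A = ennreal (measure (kern P z) {..t})" for z
  proof -
    interpret K: prob_space "kern P z" by (rule kern_prob(1)[OF model])
    show ?thesis by (simp add: A K.emeasure_eq_measure)
  qed
  ultimately show "(\<lambda>z. emeasure (kern P z) A) \<in> borel_measurable borel" by simp
qed simp

definition rate :: "(real \<Rightarrow> real \<Rightarrow> real) \<Rightarrow> real \<times> real \<Rightarrow> real" where
  "rate \<Lambda> z = (if z \<in> quadrant then \<Lambda> (fst z) (snd z) else 0)"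

lemma rate_measurable:
  assumes "energy_exchange_model \<Lambda> P"
  shows "rate \<Lambda> \<in> borel_measurable borel"
proof -
  have "continuous_on quadrant (\<lambda>z. \<Lambda> (fst z) (snd z))"
    using assms by (simp add: energy_exchange_model_def case_prod_beta')
  from borel_measurable_on_quadrant[OF this, of 0] show ?thesis by (simp add: rate_def[abs_def])
qed

text \<open>The integrand of the Dirichlet form with rate and kernel extended off the quadrant. It
  is measurable everywhere and agrees with the original one almost surely, all energies being
  positive.\<close>

definition hop :: "(real \<Rightarrow> real \<Rightarrow> real) \<Rightarrow> (real \<Rightarrow> real \<Rightarrow> real measure) \<Rightarrow> nat \<Rightarrow> nat
    \<Rightarrow> ((nat \<Rightarrow> real) \<Rightarrow> real) \<Rightarrow> (nat \<Rightarrow> real) \<Rightarrow> ennreal" where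
  "hop \<Lambda> P i j f x = ennreal (rate \<Lambda> (x i, x j)) * (\<integral>\<^sup>+\<alpha>. ennreal ((f (Tx i j \<alpha> x) - f x)\<^sup>2) \<partial>(kern P (x i, x j)))"

lemma hop_measurable:
  assumes model: "energy_exchange_model \<Lambda> P" and f [measurable]: "f \<in> borel_measurable (cfg N)" and ij: "i < N" "j < N"
  shows "hop \<Lambda> P i j f \<in> borel_measurable (cfg N)"
proof -
  have pm: "(\<lambda>x. (x i, x j)) \<in> cfg N \<rightarrow>\<^sub>M borel"
    using ij unfolding borel_prod[symmetric] by measurable
  have [measurable]: "(\<lambda>x. rate \<Lambda> (x i, x j)) \<in> borel_measurable (cfg N)"
    by (rule measurable_compose[OF pm rate_measurable[OF model]])
  have "(\<lambda>x. \<integral>\<^sup>+\<alpha>. ennreal ((f (Tx i j \<alpha> x) - f x)\<^sup>2) \<partial>(kern P (x i, x j))) \<in> borel_measurable (cfg N)"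
  proof (rule nn_integral_measurable_subprob_algebra2[where N=borel])
    show "(\<lambda>x. kern P (x i, x j)) \<in> cfg N \<rightarrow>\<^sub>M subprob_algebra borel"
      by (rule measurable_compose[OF pm kern_measurable[OF model]])
    show "(\<lambda>(x, \<alpha>). ennreal ((f (Tx i j \<alpha> x) - f x)\<^sup>2)) \<in> borel_measurable (cfg N \<Otimes>\<^sub>M borel)"
      using ij by measurable
  qed
  then show ?thesis unfolding hop_def[abs_def] by measurable
qed

context energy_simplex begin

lemma dirichlet_hop:
  shows "dirichlet \<Lambda> P \<gamma> E N f = (1/2) * (\<Sum>i<N-1. \<integral>\<^sup>+x. hop \<Lambda> P i (Suc i) f x \<partial>\<nu>)"
proof -
  have "(\<integral>\<^sup>+ x. ennreal (\<Lambda> (x i) (x (Suc i))) *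
        (\<integral>\<^sup>+ \<alpha>. ennreal ((f (Tx i (Suc i) \<alpha> x) - f x)\<^sup>2) \<partial>(P (x i) (x (Suc i)))) \<partial>\<nu>) = (\<integral>\<^sup>+x. hop \<Lambda> P i (Suc i) f x \<partial>\<nu>)"
    if "i < N - 1" for i
  proof (rule nn_integral_cong_AE, use AE_good in eventually_elim)
    case (elim x)
    have "0 < x i" "0 < x (Suc i)" using good_le[OF elim] that by auto
    then show ?case by (simp add: hop_def rate_def kern_def)
  qed
  then show ?thesis unfolding dirichlet_def by simp
qed

lemma resample_hop:
  assumes "energy_exchange_model \<Lambda> P" "f \<in> borel_measurable (cfg N)" and ij: "i < N" "j < N" "i \<noteq> j"
  shows "(\<integral>\<^sup>+x. hop \<Lambda> P i j f x \<partial>\<nu>) = (\<integral>\<^sup>+x. (\<integral>\<^sup>+a. hop \<Lambda> P i j f (Tx i j a x) \<partial>\<beta>) \<partial>\<nu>)"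
  using resample[OF hop_measurable[OF assms(1,2) ij(1,2)] ij] by simp

end

section \<open>The two-site law and its gap\<close>

text \<open>The value \<open>undefined\<close> off the two sites puts the configuration into the
  extensional function space of \<open>cfg 2\<close>.\<close>

definition pair_cfg :: "real \<Rightarrow> real \<Rightarrow> nat \<Rightarrow> real" where
  "pair_cfg t a = (\<lambda>_. undefined)(0 := a * t, 1 := (1 - a) * t)"

lemma pair_cfg_measurable: "pair_cfg t \<in> borel \<rightarrow>\<^sub>M cfg 2"
proof -
  have "(\<lambda>_. undefined) \<in> space (cfg 2)" by (simp add: space_cfg extensional_def)
  then show ?thesis unfolding pair_cfg_def[abs_def] by (intro measurable_cfg_upd) auto
qed

lemma Tx_pair_cfg: "Tx 0 (Suc 0) b (pair_cfg t a) = pair_cfg t b"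
  by (auto simp: Tx_def pair_cfg_def fun_eq_iff algebra_simps)

text \<open>An exchange forgets a two-site configuration except for its total energy t, so
  invariance under \<open>resample\<close> determines the law up to its mass. \<open>Z\<close> is
  computed only to see that the mass is one. The mean energy of two sites is t / 2.\<close>

lemma nu_two:
  assumes g: "\<gamma> > 0" and t: "t > 0"
  shows "nu \<gamma> (t / 2) 2 = distr (sym_beta \<gamma>) (cfg 2) (pair_cfg t)"
proof -
  interpret energy_simplex \<gamma> "t / 2" 2 using g t by unfold_locales auto
  interpret product_sigma_finite "\<lambda>_::nat. lborel :: real measure" by standard
  note [measurable] = pair_cfg_measurable
  have Z: "Z = ennreal (exp (- t) * (t powr (2 * \<gamma> - 1) * Beta \<gamma> \<gamma>))"
  proof -
    have dm: "(\<lambda>y. ennreal (cond_dens \<gamma> (t/2) 2 y)) \<in> borel_measurable (PiM (insert 0 {}) (\<lambda>_. lborel))"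
      using measurable_compose[OF measurable_cond_dens[of \<gamma> "t/2" 2] measurable_ennreal] by (simp add: lessThan_Suc)
    have "Z = (\<integral>\<^sup>+ y. ennreal (cond_dens \<gamma> (t/2) 2 y) \<partial>(PiM (insert 0 {}) (\<lambda>_. lborel)))"
      by (simp add: Z_def lessThan_Suc)
    also have "\<dots> = (\<integral>\<^sup>+ x. (\<integral>\<^sup>+ y. ennreal (cond_dens \<gamma> (t/2) 2 (x(0 := y))) \<partial>lborel) \<partial>(PiM {} (\<lambda>_. lborel)))"
      using dm by (intro product_nn_integral_insert) auto
    also have "\<dots> = (\<integral>\<^sup>+ x. ennreal (exp (- t)) * ennreal (t powr (2 * \<gamma> - 1) * Beta \<gamma> \<gamma>) \<partial>(PiM {} (\<lambda>_::nat. lborel :: real measure)))"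
    proof (rule nn_integral_cong)
      fix x :: "nat \<Rightarrow> real"
      have "ennreal (cond_dens \<gamma> (t/2) 2 (x(0 := y))) = ennreal (exp (- t)) * (ennreal (indicator {0<..<t} y * (y powr (\<gamma> - 1) * (t - y) powr (\<gamma> - 1))) * 1)" for y
      proof -
        have "exp (- y) * exp (- (t - y)) = exp (- t)" by (simp add: exp_add[symmetric])
        then have "cond_dens \<gamma> (t/2) 2 (x(0 := y)) = exp (- t) * (indicator {0<..<t} y * (y powr (\<gamma> - 1) * (t - y) powr (\<gamma> - 1)))"
          by (simp add: cond_dens_def lessThan_Suc indicator_def mult_ac)
        then show ?thesis by (simp add: ennreal_mult')
      qed
      then have "(\<integral>\<^sup>+ y. ennreal (cond_dens \<gamma> (t/2) 2 (x(0 := y))) \<partial>lborel)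
         = ennreal (exp (- t)) * (\<integral>\<^sup>+ y. ennreal (indicator {0<..<t} y * (y powr (\<gamma> - 1) * (t - y) powr (\<gamma> - 1))) * 1 \<partial>lborel)"
        by (simp only:) (rule nn_integral_cmult, measurable)
      then show "(\<integral>\<^sup>+ y. ennreal (cond_dens \<gamma> (t/2) 2 (x(0 := y))) \<partial>lborel) = ennreal (exp (- t)) * ennreal (t powr (2 * \<gamma> - 1) * Beta \<gamma> \<gamma>)"
        using nn_integral_slice[OF g t, of "\<lambda>_. 1"] by (simp add: beta.emeasure_space_1[simplified])
    qed
    also have "\<dots> = ennreal (exp (- t)) * ennreal (t powr (2 * \<gamma> - 1) * Beta \<gamma> \<gamma>)"
      by (simp add: PiM_empty)
    finally show ?thesis by (simp add: ennreal_mult')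
  qed
  have mass: "emeasure \<nu> (space \<nu>) = 1"
  proof -
    have meas: "(\<lambda>y. ennreal (cond_dens \<gamma> (t/2) 2 y)) \<in> borel_measurable base"
      by (rule measurable_compose[OF measurable_cond_dens measurable_ennreal])
    have "emeasure \<nu> (space \<nu>) = (\<integral>\<^sup>+x. 1 \<partial>\<nu>)" by simp
    also have "\<dots> = (\<integral>\<^sup>+y. ennreal (cond_dens \<gamma> (t/2) 2 y) / Z \<partial>base)"
      by (subst nn_integral_nu) auto
    also have "\<dots> = Z / Z" unfolding Z_def by (rule nn_integral_divide[OF meas])
    also have "\<dots> = 1"
    proof (rule ennreal_divide_self)
      have "0 < exp (- t) * (t powr (2 * \<gamma> - 1) * Beta \<gamma> \<gamma>)" using t Beta_pos[OF g] by simp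
      then show "Z \<noteq> 0" "Z < \<top>" unfolding Z by auto
    qed
    finally show ?thesis .
  qed
  have nn: "(\<integral>\<^sup>+z. G z \<partial>\<nu>) = (\<integral>\<^sup>+a. G (pair_cfg t a) \<partial>\<beta>)" if [measurable]: "G \<in> borel_measurable (cfg 2)" for G
  proof -
    have "(\<integral>\<^sup>+z. G z \<partial>\<nu>) = (\<integral>\<^sup>+z. (\<integral>\<^sup>+a. G (Tx 0 1 a z) \<partial>\<beta>) \<partial>\<nu>)" by (rule resample[symmetric]) auto
    also have "\<dots> = (\<integral>\<^sup>+z. (\<integral>\<^sup>+a. G (pair_cfg t a) \<partial>\<beta>) \<partial>\<nu>)"
    proof (rule nn_integral_cong_AE, use AE_good in eventually_elim)
      case (elim z)
      have e: "z \<in> extensional {..<2}" using elim by (simp add: good_def space_cfg)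
      have "(\<Sum>k<2. z k) = t" using elim by (simp add: good_def)
      then have s: "z 0 + z 1 = t" by (simp add: numeral_2_eq_2)
      have "Tx 0 1 a z = pair_cfg t a" for a
      proof
        fix k :: nat
        have "k \<noteq> 0 \<Longrightarrow> k \<noteq> 1 \<Longrightarrow> z k = undefined" using e by (auto simp: extensional_def)
        then show "Tx 0 1 a z k = pair_cfg t a k" using s by (auto simp: Tx_def pair_cfg_def)
      qed
      then show ?case by simp
    qed
    also have "\<dots> = (\<integral>\<^sup>+a. G (pair_cfg t a) \<partial>\<beta>)" using mass by simp
    finally show ?thesis .
  qed
  show ?thesis
  proof (rule measure_eqI)
    fix A assume "A \<in> sets (nu \<gamma> (t / 2) 2)"
    then have A: "A \<in> sets (cfg 2)" by simp
    have "emeasure \<nu> A = (\<integral>\<^sup>+z. indicator A z \<partial>\<nu>)" using A by simp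
    also have "\<dots> = (\<integral>\<^sup>+a. indicator A (pair_cfg t a) \<partial>\<beta>)" using A by (intro nn) simp
    also have "\<dots> = (\<integral>\<^sup>+z. indicator A z \<partial>(distr \<beta> (cfg 2) (pair_cfg t)))"
      using A by (intro nn_integral_distr[symmetric]) auto
    also have "\<dots> = emeasure (distr \<beta> (cfg 2) (pair_cfg t)) A" using A by simp
    finally show "emeasure (nu \<gamma> (t / 2) 2) A = emeasure (distr (sym_beta \<gamma>) (cfg 2) (pair_cfg t)) A" .
  qed simp
qed

lemma spectral_gap_two:
  assumes g: "\<gamma> > 0" and t: "t > 0" and model: "energy_exchange_model \<Lambda> P"
    and gap: "ennreal c \<le> spectral_gap \<Lambda> P \<gamma> (t / 2) 2" and c: "c \<ge> 0"
    and F [measurable]: "F \<in> borel_measurable (cfg 2)" and F2: "integrable (sym_beta \<gamma>) (\<lambda>a. (F (pair_cfg t a))\<^sup>2)"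
  shows "ennreal c * (\<integral>\<^sup>+b. (\<integral>\<^sup>+a. ennreal ((F (pair_cfg t a) - F (pair_cfg t b))\<^sup>2) \<partial>sym_beta \<gamma>) \<partial>sym_beta \<gamma>)
    \<le> (\<integral>\<^sup>+a. hop \<Lambda> P 0 (Suc 0) F (pair_cfg t a) \<partial>sym_beta \<gamma>)"
proof -
  interpret energy_simplex \<gamma> "t / 2" 2 using g t by unfold_locales auto
  note [measurable] = pair_cfg_measurable
  define u where "u a = F (pair_cfg t a)" for a
  have um [measurable]: "u \<in> borel_measurable borel" unfolding u_def by measurable
  have u2: "integrable \<beta> (\<lambda>a. (u a)\<^sup>2)" using F2 by (simp add: u_def)
  have ui: "integrable \<beta> u" by (rule beta.square_integrable_imp_integrable[OF _ u2]) simp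
  define \<mu> where "\<mu> = (\<integral>a. u a \<partial>\<beta>)"
  define v where "v = (\<integral>a. (u a - \<mu>)\<^sup>2 \<partial>\<beta>)"
  have v0: "v \<ge> 0" unfolding v_def by (intro integral_nonneg_AE) auto
  have expand: "(\<integral>a. (u a - b)\<^sup>2 \<partial>\<beta>) = (\<integral>a. (u a)\<^sup>2 \<partial>\<beta>) - 2 * b * \<mu> + b\<^sup>2" "integrable \<beta> (\<lambda>a. (u a - b)\<^sup>2)" for b
  proof -
    have eq: "(u a - b)\<^sup>2 = (u a)\<^sup>2 - 2 * b * u a + b\<^sup>2" for a by (simp add: power2_eq_square algebra_simps)
    show "integrable \<beta> (\<lambda>a. (u a - b)\<^sup>2)" unfolding eq using u2 ui by simp
    show "(\<integral>a. (u a - b)\<^sup>2 \<partial>\<beta>) = (\<integral>a. (u a)\<^sup>2 \<partial>\<beta>) - 2 * b * \<mu> + b\<^sup>2"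
      unfolding eq using u2 ui by (simp add: \<mu>_def beta.prob_space[simplified])
  qed
  have double: "(\<integral>\<^sup>+b. (\<integral>\<^sup>+a. ennreal ((u a - u b)\<^sup>2) \<partial>\<beta>) \<partial>\<beta>) = ennreal (2 * v)"
  proof -
    have "(\<integral>\<^sup>+b. (\<integral>\<^sup>+a. ennreal ((u a - u b)\<^sup>2) \<partial>\<beta>) \<partial>\<beta>) = (\<integral>\<^sup>+b. ennreal (v + (u b - \<mu>)\<^sup>2) \<partial>\<beta>)"
    proof (rule nn_integral_cong)
      fix b
      have "(\<integral>\<^sup>+a. ennreal ((u a - u b)\<^sup>2) \<partial>\<beta>) = ennreal (\<integral>a. (u a - u b)\<^sup>2 \<partial>\<beta>)"
        using expand(2) by (intro nn_integral_eq_integral) auto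
      also have "(\<integral>a. (u a - u b)\<^sup>2 \<partial>\<beta>) = v + (u b - \<mu>)\<^sup>2"
        unfolding v_def expand(1) by (simp add: power2_eq_square algebra_simps)
      finally show "(\<integral>\<^sup>+a. ennreal ((u a - u b)\<^sup>2) \<partial>\<beta>) = ennreal (v + (u b - \<mu>)\<^sup>2)" .
    qed
    also have "\<dots> = ennreal (\<integral>b. v + (u b - \<mu>)\<^sup>2 \<partial>\<beta>)"
      using expand(2) v0 by (intro nn_integral_eq_integral) auto
    also have "(\<integral>b. v + (u b - \<mu>)\<^sup>2 \<partial>\<beta>) = 2 * v"
      using expand(2) by (simp add: v_def beta.prob_space[simplified])
    finally show ?thesis .
  qed
  have dir: "dirichlet \<Lambda> P \<gamma> (t / 2) 2 h = (1/2) * (\<integral>\<^sup>+a. hop \<Lambda> P 0 (Suc 0) h (pair_cfg t a) \<partial>\<beta>)"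
    if "h \<in> borel_measurable (cfg 2)" for h
  proof -
    note [measurable] = hop_measurable[OF model that, of 0 "Suc 0"]
    have "dirichlet \<Lambda> P \<gamma> (t / 2) 2 h = (1/2) * (\<integral>\<^sup>+z. hop \<Lambda> P 0 (Suc 0) h z \<partial>(distr \<beta> (cfg 2) (pair_cfg t)))"
      unfolding dirichlet_hop nu_two[OF g t] by (simp add: lessThan_Suc)
    then show ?thesis by (simp add: nn_integral_distr)
  qed
  show ?thesis
  proof (cases "v = 0")
    case True
    then show ?thesis using double by (simp add: u_def)
  next
    case False
    then have v: "v > 0" using v0 by simp
    define h where "h z = F z - \<mu>" for z
    have hm [measurable]: "h \<in> borel_measurable (cfg 2)" unfolding h_def[abs_def] by measurable
    have h2: "(\<integral>z. (h z)\<^sup>2 \<partial>(nu \<gamma> (t / 2) 2)) = v"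
      unfolding nu_two[OF g t] by (subst integral_distr) (auto simp: h_def v_def u_def)
    have "ennreal c \<le> dirichlet \<Lambda> P \<gamma> (t / 2) 2 h / ennreal (\<integral>z. (h z)\<^sup>2 \<partial>(nu \<gamma> (t / 2) 2))"
    proof (rule order_trans[OF gap], unfold spectral_gap_def, rule INF_lower)
      have "integrable (nu \<gamma> (t / 2) 2) (\<lambda>z. (h z)\<^sup>2)"
        unfolding nu_two[OF g t] using expand(2)[of \<mu>]
        by (subst integrable_distr_eq) (auto simp: h_def u_def)
      moreover have "(\<integral>z. h z \<partial>(nu \<gamma> (t / 2) 2)) = 0"
      proof -
        have "(\<integral>z. h z \<partial>(nu \<gamma> (t / 2) 2)) = (\<integral>a. u a - \<mu> \<partial>\<beta>)"
          unfolding nu_two[OF g t] by (subst integral_distr) (auto simp: h_def u_def)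
        also have "\<dots> = 0" using ui by (simp add: \<mu>_def beta.prob_space[simplified])
        finally show ?thesis .
      qed
      ultimately show "h \<in> {f. f \<in> borel_measurable (cfg 2) \<and> integrable (nu \<gamma> (t / 2) 2) (\<lambda>x. (f x)\<^sup>2)
                 \<and> (\<integral>x. f x \<partial>(nu \<gamma> (t / 2) 2)) = 0 \<and> (\<integral>x. (f x)\<^sup>2 \<partial>(nu \<gamma> (t / 2) 2)) > 0}"
        using hm h2 v by simp
    qed
    then have "ennreal c * ennreal v \<le> dirichlet \<Lambda> P \<gamma> (t / 2) 2 h / ennreal v * ennreal v"
      unfolding h2 by (rule mult_right_mono) simp
    also have "\<dots> = dirichlet \<Lambda> P \<gamma> (t / 2) 2 h"
      using v by (simp add: ennreal_divide_times ennreal_divide_self less_top[symmetric] flip: ennreal_times_divide)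
    also have "\<dots> = (1/2) * (\<integral>\<^sup>+a. hop \<Lambda> P 0 (Suc 0) F (pair_cfg t a) \<partial>\<beta>)"
      unfolding dir[OF hm] by (simp add: hop_def h_def)
    finally have "2 * (ennreal c * ennreal v) \<le> 2 * ((1/2) * (\<integral>\<^sup>+a. hop \<Lambda> P 0 (Suc 0) F (pair_cfg t a) \<partial>\<beta>))"
      by (rule mult_left_mono) simp
    also have "\<dots> = (\<integral>\<^sup>+a. hop \<Lambda> P 0 (Suc 0) F (pair_cfg t a) \<partial>\<beta>)"
      by (simp add: mult.assoc[symmetric] ennreal_times_divide)
    also have "2 * (ennreal c * ennreal v) = ennreal c * ennreal (2 * v)"
      using v0 by (simp add: ennreal_mult' mult_ac)
    finally show ?thesis using double by (simp add: u_def)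
  qed
qed

section \<open>From the two-site gap to N sites\<close>

context energy_simplex begin

text \<open>A resampled pair has the stationary two-site law, so that the gap for \<open>N = 2\<close> applies to every
  bond after conditioning on the energy of the bond.\<close>

lemma dirichlet_ge_chain_energy:
  assumes model: "energy_exchange_model \<Lambda> P" and C: "Ct > 0"
    and gap: "\<And>E. E > 0 \<Longrightarrow> ennreal (Ct * E powr m) \<le> spectral_gap \<Lambda> P \<gamma> E 2"
    and f [measurable]: "f \<in> borel_measurable (cfg N)" and f2: "integrable \<nu> (\<lambda>x. (f x)\<^sup>2)"
  shows "ennreal (Ct * 2 powr (- m) / 2) * chain_energy m f \<le> dirichlet \<Lambda> P \<gamma> E N f"
proof -
  have bond: "ennreal (Ct * 2 powr (- m)) * pair_energy m f i j \<le> (\<integral>\<^sup>+x. hop \<Lambda> P i j f x \<partial>\<nu>)"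
    if ij: "i < N" "j < N" "i \<noteq> j" for i j
  proof -
    let ?W = "\<lambda>x::nat\<Rightarrow>real. ennreal ((x i + x j) powr m)"
    \<comment> \<open>On almost every fibre the function is square integrable, as the test functions
      for the two-site gap have to be.\<close>
    have "AE x in \<nu>. (\<integral>\<^sup>+a. ennreal ((f (Tx i j a x))\<^sup>2) \<partial>\<beta>) \<noteq> \<infinity>"
    proof (rule nn_integral_PInf_AE)
      show "(\<lambda>x. \<integral>\<^sup>+a. ennreal ((f (Tx i j a x))\<^sup>2) \<partial>\<beta>) \<in> borel_measurable \<nu>" using ij by measurable
      have "(\<integral>\<^sup>+x. (\<integral>\<^sup>+a. ennreal ((f (Tx i j a x))\<^sup>2) \<partial>\<beta>) \<partial>\<nu>) = (\<integral>\<^sup>+x. ennreal ((f x)\<^sup>2) \<partial>\<nu>)"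
        using ij by (intro resample) auto
      also have "\<dots> \<noteq> \<infinity>" using f2 by (simp add: nn_integral_eq_integral)
      finally show "(\<integral>\<^sup>+x. (\<integral>\<^sup>+a. ennreal ((f (Tx i j a x))\<^sup>2) \<partial>\<beta>) \<partial>\<nu>) \<noteq> \<infinity>" .
    qed
    then have "AE x in \<nu>. ennreal (Ct * 2 powr (- m)) * (\<integral>\<^sup>+b. (\<integral>\<^sup>+a. ?W x * ennreal ((f (Tx i j a x) - f (Tx i j b x))\<^sup>2) \<partial>\<beta>) \<partial>\<beta>)
      \<le> (\<integral>\<^sup>+a. hop \<Lambda> P i j f (Tx i j a x) \<partial>\<beta>)"
      using AE_good
    proof eventually_elim
      case (elim x)
      have sp: "x \<in> space (cfg N)" using elim by (simp add: good_def)
      note [measurable] = Tx_measurable_fixed[OF sp ij(1,2)]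
      define t where "t = x i + x j"
      have t: "t > 0" using good_le[OF elim(2)] ij by (auto simp: t_def intro: add_pos_pos)
      \<comment> \<open>\<open>f\<close> as a function of the pair alone, with all other energies
        frozen at \<open>x\<close>.\<close>
      define F where "F z = f (x(i := z 0, j := z (Suc 0)))" for z :: "nat \<Rightarrow> real"
      have Fm: "F \<in> borel_measurable (cfg 2)"
      proof -
        have "(\<lambda>z. x(i := z 0, j := z (Suc 0))) \<in> cfg 2 \<rightarrow>\<^sub>M cfg N"
          using sp ij by (intro measurable_cfg_upd measurable_cfg_component) auto
        then show ?thesis unfolding F_def[abs_def] by measurable
      qed
      have FT: "F (pair_cfg t a) = f (Tx i j a x)" for a
        by (simp add: F_def pair_cfg_def Tx_def t_def)
      have F2: "integrable \<beta> (\<lambda>a. (F (pair_cfg t a))\<^sup>2)"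
      proof (rule integrableI_bounded)
        show "(\<integral>\<^sup>+a. ennreal (norm ((F (pair_cfg t a))\<^sup>2)) \<partial>\<beta>) < \<infinity>"
          using elim(1) by (simp add: FT less_top[symmetric] infinity_ennreal_def)
      qed (simp add: FT)
      have hopT: "hop \<Lambda> P 0 (Suc 0) F (pair_cfg t a) = hop \<Lambda> P i j f (Tx i j a x)" for a
      proof -
        have "pair_cfg t a 0 = Tx i j a x i" "pair_cfg t a (Suc 0) = Tx i j a x j"
          using ij by (auto simp: pair_cfg_def Tx_def t_def)
        then show ?thesis using ij unfolding hop_def Tx_pair_cfg FT by simp
      qed
      have "ennreal (Ct * (t / 2) powr m) * (\<integral>\<^sup>+b. (\<integral>\<^sup>+a. ennreal ((F (pair_cfg t a) - F (pair_cfg t b))\<^sup>2) \<partial>\<beta>) \<partial>\<beta>)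
        \<le> (\<integral>\<^sup>+a. hop \<Lambda> P 0 (Suc 0) F (pair_cfg t a) \<partial>\<beta>)"
        using t C by (intro spectral_gap_two[OF gam t model _ _ Fm F2] gap) auto
      also have "\<dots> = (\<integral>\<^sup>+a. hop \<Lambda> P i j f (Tx i j a x) \<partial>\<beta>)" by (simp only: hopT)
      \<comment> \<open>The two-site gap is taken at the mean energy t / 2 of the bond, which
        produces \<open>2 powr (- m)\<close>.\<close>
      also have "ennreal (Ct * (t / 2) powr m) = ennreal (Ct * 2 powr (- m)) * ?W x"
        using t C by (simp add: ennreal_mult[symmetric] t_def[symmetric] powr_divide powr_minus_divide)
      finally show ?case
        unfolding FT by (simp add: nn_integral_cmult mult.assoc)
    qed
    then have "(\<integral>\<^sup>+x. ennreal (Ct * 2 powr (- m)) * (\<integral>\<^sup>+b. (\<integral>\<^sup>+a. ?W x * ennreal ((f (Tx i j a x) - f (Tx i j b x))\<^sup>2) \<partial>\<beta>) \<partial>\<beta>) \<partial>\<nu>)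
      \<le> (\<integral>\<^sup>+x. (\<integral>\<^sup>+a. hop \<Lambda> P i j f (Tx i j a x) \<partial>\<beta>) \<partial>\<nu>)"
      by (rule nn_integral_mono_AE)
    also have "\<dots> = (\<integral>\<^sup>+x. hop \<Lambda> P i j f x \<partial>\<nu>)" by (rule resample_hop[OF model f ij, symmetric])
    also have "(\<integral>\<^sup>+x. ennreal (Ct * 2 powr (- m)) * (\<integral>\<^sup>+b. (\<integral>\<^sup>+a. ?W x * ennreal ((f (Tx i j a x) - f (Tx i j b x))\<^sup>2) \<partial>\<beta>) \<partial>\<beta>) \<partial>\<nu>)
      = ennreal (Ct * 2 powr (- m)) * (\<integral>\<^sup>+x. (\<integral>\<^sup>+b. (\<integral>\<^sup>+a. ?W x * ennreal ((f (Tx i j a x) - f (Tx i j b x))\<^sup>2) \<partial>\<beta>) \<partial>\<beta>) \<partial>\<nu>)"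
      using ij by (intro nn_integral_cmult) measurable
    also have "(\<integral>\<^sup>+x. (\<integral>\<^sup>+b. (\<integral>\<^sup>+a. ?W x * ennreal ((f (Tx i j a x) - f (Tx i j b x))\<^sup>2) \<partial>\<beta>) \<partial>\<beta>) \<partial>\<nu>) = pair_energy m f i j"
    proof -
      have "pair_energy m f i j = (\<integral>\<^sup>+x. (\<integral>\<^sup>+a. ?W x * ennreal ((f (Tx i j a x) - f x)\<^sup>2) \<partial>\<beta>) \<partial>\<nu>)"
        unfolding pair_energy_def using ij by (intro jump_eq) auto
      also have "\<dots> = (\<integral>\<^sup>+x. (\<integral>\<^sup>+b. (\<integral>\<^sup>+a. ?W (Tx i j b x) * ennreal ((f (Tx i j a x) - f (Tx i j b x))\<^sup>2) \<partial>\<beta>) \<partial>\<beta>) \<partial>\<nu>)"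
        using ij by (intro resample_pair[where H="\<lambda>x y. ?W x * ennreal ((f y - f x)\<^sup>2)"]) measurable
      finally show ?thesis using ij by (simp add: Tx_pair_sum)
    qed
    finally show ?thesis .
  qed
  have "ennreal (Ct * 2 powr (- m) / 2) * chain_energy m f = (1/2) * (ennreal (Ct * 2 powr (- m)) * chain_energy m f)"
  proof -
    have "ennreal (Ct * 2 powr (- m) / 2) = (1/2) * ennreal (Ct * 2 powr (- m))"
      using C ennreal_mult'[of "1/2" "Ct * 2 powr (- m)"] by (simp add: divide_ennreal_def)
    then show ?thesis by (simp add: mult.assoc)
  qed
  also have "\<dots> = (1/2) * (\<Sum>i<N-1. ennreal (Ct * 2 powr (- m)) * pair_energy m f i (Suc i))"
    by (simp add: chain_energy_def sum_distrib_left)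
  also have "\<dots> \<le> (1/2) * (\<Sum>i<N-1. \<integral>\<^sup>+x. hop \<Lambda> P i (Suc i) f x \<partial>\<nu>)"
    by (intro mult_left_mono sum_mono bond) auto
  finally show ?thesis unfolding dirichlet_hop .
qed

text \<open>\<open>L2_gap\<close> carries N on its left and N^3 on its right side; their quotient is
  the claimed rate.\<close>

lemma spectral_gap_lower:
  assumes m: "m \<ge> 0" and wg: "weak_gap m c" "c > 0"
    and model: "energy_exchange_model \<Lambda> P" and C: "Ct > 0"
    and gap: "\<And>E. E > 0 \<Longrightarrow> ennreal (Ct * E powr m) \<le> spectral_gap \<Lambda> P \<gamma> E 2"
  shows "ennreal (2 powr (- m) / 2 * (measure \<beta> {1/4..3/4} * c / (4 * (192 * 4 powr m))) * Ct * E powr m / (real N)\<^sup>2)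
    \<le> spectral_gap \<Lambda> P \<gamma> E N"
  unfolding spectral_gap_def
proof (rule INF_greatest)
  fix f :: "(nat \<Rightarrow> real) \<Rightarrow> real"
  assume "f \<in> {f. f \<in> borel_measurable (cfg N) \<and> integrable \<nu> (\<lambda>x. (f x)\<^sup>2)
                 \<and> (\<integral>x. f x \<partial>\<nu>) = 0 \<and> (\<integral>x. (f x)\<^sup>2 \<partial>\<nu>) > 0}"
  then have f: "f \<in> borel_measurable (cfg N)" "integrable \<nu> (\<lambda>x. (f x)\<^sup>2)" "(\<integral>x. f x \<partial>\<nu>) = 0"
    and v: "(\<integral>x. (f x)\<^sup>2 \<partial>\<nu>) > 0" by auto
  define v where "v = (\<integral>x. (f x)\<^sup>2 \<partial>\<nu>)"
  define p where "p = measure \<beta> {1/4..3/4}"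
  define K where "K = 2 powr (- m) / 2 * (p * c / (4 * (192 * 4 powr m))) * Ct * E powr m / (real N)\<^sup>2"
  have K: "K \<ge> 0" using C wg(2) by (simp add: K_def p_def)
  define D where "D = 4 * (192 * 4 powr m * real (N ^ 3))"
  have D: "D > 0" using N2 by (simp add: D_def)
  have v0: "v > 0" using v by (simp add: v_def)
  have "ennreal (p * c * E powr m * real N * v) \<le> ennreal D * chain_energy m f"
    unfolding p_def v_def D_def by (rule L2_gap[OF m wg f])
  from ennreal_divide_le[OF this D]
  have "ennreal (Ct * 2 powr (- m) / 2) * ennreal (p * c * E powr m * real N * v / D) \<le> ennreal (Ct * 2 powr (- m) / 2) * chain_energy m f"
    by (rule mult_left_mono) simp
  also have "\<dots> \<le> dirichlet \<Lambda> P \<gamma> E N f" by (rule dirichlet_ge_chain_energy[OF model C gap f(1,2)])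
  also have "ennreal (Ct * 2 powr (- m) / 2) * ennreal (p * c * E powr m * real N * v / D)
     = ennreal (Ct * 2 powr (- m) / 2 * (p * c * E powr m * real N * v / D))"
    using C by (intro ennreal_mult'[symmetric]) auto
  also have "Ct * 2 powr (- m) / 2 * (p * c * E powr m * real N * v / D)
     = K * v"
    using N2 by (simp add: K_def D_def power2_eq_square power3_eq_cube mult_ac)
  finally have "ennreal (K * v) / ennreal v
      \<le> dirichlet \<Lambda> P \<gamma> E N f / ennreal v"
    by (rule divide_right_mono_ennreal)
  moreover have "ennreal (K * v) / ennreal v = ennreal K"
    using v0 K by (subst divide_ennreal) auto
  ultimately show "ennreal (2 powr (- m) / 2 * (measure \<beta> {1/4..3/4} * c / (4 * (192 * 4 powr m))) * Ct * E powr m / (real N)\<^sup>2)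
    \<le> dirichlet \<Lambda> P \<gamma> E N f / ennreal (\<integral>x. (f x)\<^sup>2 \<partial>\<nu>)"
    unfolding v_def[symmetric] p_def[symmetric] K_def[symmetric] by simp
qed

end

theorem theorem1:
  fixes \<gamma> m :: real
  assumes "\<gamma> > 0" and "m \<ge> 0"
  shows "\<exists>C>0. \<forall>(\<Lambda> :: real \<Rightarrow> real \<Rightarrow> real) (P :: real \<Rightarrow> real \<Rightarrow> real measure) (Ct :: real).
           energy_exchange_model \<Lambda> P
           \<and> (\<forall>E>0. \<forall>N\<ge>2. reversible \<Lambda> P \<gamma> E N)
           \<and> Ct > 0
           \<and> (\<forall>E>0. spectral_gap \<Lambda> P \<gamma> E 2 \<ge> ennreal (Ct * E powr m))
           \<longrightarrow> (\<forall>E>0. \<forall>N\<ge>2. spectral_gap \<Lambda> P \<gamma> E N \<ge> ennreal (C * Ct * E powr m / (real N)\<^sup>2))"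
proof -
  obtain c where c: "c > 0" "\<And>E N. E > 0 \<Longrightarrow> N \<ge> 2 \<Longrightarrow> energy_simplex.weak_gap \<gamma> E N m c"
    using uniform_weak_gap[OF assms] by auto
  \<comment> \<open>Origin of the factors: \<open>2 powr (- m) / 2\<close> from the passage to
    bonds, the Beta mass, 192 and \<open>4 powr m\<close> from the transport along the chain, 4 from
    the approximation in L2, and \<open>c\<close> from the mean-field gap. All of them depend on
    \<open>\<gamma>\<close> and \<open>m\<close> only.\<close>
  let ?C = "2 powr (- m) / 2 * (measure (sym_beta \<gamma>) {1/4..3/4} * c / (4 * (192 * 4 powr m)))"
  show ?thesis
  proof (intro exI[of _ ?C] conjI allI impI)
    show "?C > 0" using c(1) beta_middle_pos[OF assms(1)] by simp
    fix \<Lambda> P Ct E and N :: nat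
    assume *: "energy_exchange_model \<Lambda> P \<and> (\<forall>E>0. \<forall>N\<ge>2. reversible \<Lambda> P \<gamma> E N) \<and> Ct > 0
           \<and> (\<forall>E>0. spectral_gap \<Lambda> P \<gamma> E 2 \<ge> ennreal (Ct * E powr m))" and E: "(E::real) > 0" and N: "N \<ge> 2"
    interpret energy_simplex \<gamma> E N using assms E N by unfold_locales auto
    show "ennreal (?C * Ct * E powr m / (real N)\<^sup>2) \<le> spectral_gap \<Lambda> P \<gamma> E N"
      using * by (intro spectral_gap_lower[OF assms(2) c(2)[OF E N] c(1)]) auto
  qed
qed

end
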